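(* Let $R$ be a Dedekind domain and let $\mathcal A$ be a fully additive hom-finite $R$-category satisfying the Max-condition. Let $G:K_0(\mathcal A)\to K_0(G\mathcal A)$ be the homomorphism $[A]\mapsto[G(A)]$. Then $$K_0(\mathcal A)\simeq\ker G\oplus K_0(G\mathcal A).$$
   Context: All categories are small and preadditive; fully additive means additive with all idempotents split; an $R$-category is hom-finite if all its Hom modules are finitely generated over $R$. $K_0(\mathcal A)$ is the free abelian group on $\operatorname{ob}\mathcal A$ modulo the relations $A-B-C$ whenever $A\simeq B\oplus C$; $[A]$ is the class of $A$. Nilradical: $a\in\mathcal A(A,B)$ is essentially nilpotent if for every sequence $b_1,b_2,\dots$ in $\mathcal A(B,A)$ there is $n$ with $ab_1ab_2\cdots ab_na=0$. These morphisms form an ideal $\operatorname{nil}\mathcal A$; $\mathcal A^0=\mathcal A/\operatorname{nil}\mathcal A$ and $A^0$ is $A$ regarded in $\mathcal A^0$. $R$ is a Dedekind domain with field of fractions $K$ and set of maximal ideals $\max R$. For a commutative $R$-algebra $S$, $S\otimes_R\mathcal A$ has the same objects as $\mathcal A$ and morphisms $S\otimes_R\mathcal A(A,B)$; $\operatorname{add}\mathcal C$ is the fully additive category containing $\mathcal C$ as a full subcategory in which every object is a direct summand of a finite direct sum of objects of $\mathcal C$. Put $Q\mathcal A=\operatorname{add}(K\otimes_R\mathcal A)$, $\mathcal A_{\mathfrak p}=\operatorname{add}(R_{\mathfrak p}\otimes_R\mathcal A)$; $QA$, $A_{\mathfrak p}$ denote $A$ regarded in these categories. Genera: $G(A)=\{B\in\operatorname{ob}\mathcal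 A\mid B_{\mathfrak p}\simeq A_{\mathfrak p}\ \forall\mathfrak p\in\max R\}$. $G\mathcal A$ is the set of genera, and $K_0(G\mathcal A)$ is the free abelian group on $G\mathcal A$ modulo the relations $G(A\oplus B)-G(A)-G(B)$; $[G(A)]$ is the class of $G(A)$. Max-condition: for every indecomposable $W\in Q\mathcal A$ there is $S\in\operatorname{ob}\mathcal A$ such that $QS\simeq W$ and $\operatorname{End}_{\mathcal A^0}S^0$ is a maximal $R$-order in the skewfield $\operatorname{End}_{(Q\mathcal A)^0}W^0$ (an $R$-order in a finite dimensional $K$-algebra is a subring that is a finitely generated $R$-module spanning the algebra over $K$). *)

theory Defs
  imports "HOL-Algebra.Algebra"
begin

section \<open>Dedekind domains inside their field of fractions\<close>

definition fraction_field :: "'k ring \<Rightarrow> 'k ring \<Rightarrow> bool" where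
  "fraction_field R K \<longleftrightarrow>
     field K \<and> subring (carrier R) K \<and> R = K\<lparr>carrier := carrier R\<rparr> \<and>
     (\<forall>x\<in>carrier K. \<exists>a\<in>carrier R. \<exists>b\<in>carrier R - {\<zero>\<^bsub>R\<^esub>}. x = a \<otimes>\<^bsub>K\<^esub> inv\<^bsub>K\<^esub> b)"

definition integral_over :: "'k ring \<Rightarrow> 'k ring \<Rightarrow> 'k \<Rightarrow> bool" where
  "integral_over R K x \<longleftrightarrow>
     (\<exists>p\<in>carrier (poly_ring R). p \<noteq> [] \<and> lead_coeff p = \<one>\<^bsub>R\<^esub> \<and> ring.eval K p x = \<zero>\<^bsub>K\<^esub>)"

text \<open>Fields are not excluded; for a field the only maximal ideal is zero.\<close>

definition dedekind_domain :: "'k ring \<Rightarrow> 'k ring \<Rightarrow> bool" where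
  "dedekind_domain R K \<longleftrightarrow>
     noetherian_domain R \<and>
     (\<forall>P. primeideal P R \<and> P \<noteq> {\<zero>\<^bsub>R\<^esub>} \<longrightarrow> maximalideal P R) \<and>
     (\<forall>x\<in>carrier K. integral_over R K x \<longrightarrow> x \<in> carrier R)"

definition localization :: "'k ring \<Rightarrow> 'k ring \<Rightarrow> 'k set \<Rightarrow> 'k ring" where
  "localization R K P =
     K\<lparr>carrier := {a \<otimes>\<^bsub>K\<^esub> inv\<^bsub>K\<^esub> b | a b. a \<in> carrier R \<and> b \<in> carrier R - P}\<rparr>"

definition lincombs :: "'k ring \<Rightarrow> ('k, 'm) module \<Rightarrow> 'm set \<Rightarrow> 'm set" where
  "lincombs R M F = {finsum M (\<lambda>x. c x \<odot>\<^bsub>M\<^esub> x) F | c. c \<in> F \<rightarrow> carrier R}"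

section \<open>Categories enriched in modules\<close>

text \<open>Every Hom set is a module record; its multiplicative fields are irrelevant.
  The preadditive structure underlying an \<open>R\<close>-category is obtained by ignoring scalars.
  \<open>Comp C A B D g f\<close> is the composite of \<open>f\<close> from \<open>A\<close> to \<open>B\<close> followed by \<open>g\<close> from \<open>B\<close> to \<open>D\<close>.
  Since composition is indexed by objects, Hom sets need not be disjoint.\<close>

record ('k, 'o, 'm) rcat =
  Ob :: "'o set"
  Hom :: "'o \<Rightarrow> 'o \<Rightarrow> ('k, 'm) module"
  Comp :: "'o \<Rightarrow> 'o \<Rightarrow> 'o \<Rightarrow> 'm \<Rightarrow> 'm \<Rightarrow> 'm"
  Ident :: "'o \<Rightarrow> 'm"

locale R_category =
  fixes R :: "'k ring" and C :: "('k, 'o, 'm) rcat"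
  assumes scalars: "cring R"
    and Hom_module: "\<lbrakk>A \<in> Ob C; B \<in> Ob C\<rbrakk> \<Longrightarrow> module R (Hom C A B)"
    and Ident_closed: "A \<in> Ob C \<Longrightarrow> Ident C A \<in> carrier (Hom C A A)"
    and Comp_closed:
      "\<lbrakk>A \<in> Ob C; B \<in> Ob C; D \<in> Ob C; g \<in> carrier (Hom C B D); f \<in> carrier (Hom C A B)\<rbrakk>
       \<Longrightarrow> Comp C A B D g f \<in> carrier (Hom C A D)"
    and Comp_assoc:
      "\<lbrakk>A \<in> Ob C; B \<in> Ob C; D \<in> Ob C; E \<in> Ob C;
        h \<in> carrier (Hom C D E); g \<in> carrier (Hom C B D); f \<in> carrier (Hom C A B)\<rbrakk>
       \<Longrightarrow> Comp C A D E h (Comp C A B D g f) = Comp C A B E (Comp C B D E h g) f"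
    and Ident_left:
      "\<lbrakk>A \<in> Ob C; B \<in> Ob C; f \<in> carrier (Hom C A B)\<rbrakk> \<Longrightarrow> Comp C A B B (Ident C B) f = f"
    and Ident_right:
      "\<lbrakk>A \<in> Ob C; B \<in> Ob C; f \<in> carrier (Hom C A B)\<rbrakk> \<Longrightarrow> Comp C A A B f (Ident C A) = f"
    and Comp_add_left:
      "\<lbrakk>A \<in> Ob C; B \<in> Ob C; D \<in> Ob C;
        g \<in> carrier (Hom C B D); g' \<in> carrier (Hom C B D); f \<in> carrier (Hom C A B)\<rbrakk>
       \<Longrightarrow> Comp C A B D (g \<oplus>\<^bsub>Hom C B D\<^esub> g') f
           = Comp C A B D g f \<oplus>\<^bsub>Hom C A D\<^esub> Comp C A B D g' f"
    and Comp_add_right: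
      "\<lbrakk>A \<in> Ob C; B \<in> Ob C; D \<in> Ob C;
        g \<in> carrier (Hom C B D); f \<in> carrier (Hom C A B); f' \<in> carrier (Hom C A B)\<rbrakk>
       \<Longrightarrow> Comp C A B D g (f \<oplus>\<^bsub>Hom C A B\<^esub> f')
           = Comp C A B D g f \<oplus>\<^bsub>Hom C A D\<^esub> Comp C A B D g f'"
    and Comp_smult_left:
      "\<lbrakk>A \<in> Ob C; B \<in> Ob C; D \<in> Ob C; r \<in> carrier R;
        g \<in> carrier (Hom C B D); f \<in> carrier (Hom C A B)\<rbrakk>
       \<Longrightarrow> Comp C A B D (r \<odot>\<^bsub>Hom C B D\<^esub> g) f = r \<odot>\<^bsub>Hom C A D\<^esub> Comp C A B D g f"
    and Comp_smult_right:
      "\<lbrakk>A \<in> Ob C; B \<in> Ob C; D \<in> Ob C; r \<in> carrier R;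
        g \<in> carrier (Hom C B D); f \<in> carrier (Hom C A B)\<rbrakk>
       \<Longrightarrow> Comp C A B D g (r \<odot>\<^bsub>Hom C A B\<^esub> f) = r \<odot>\<^bsub>Hom C A D\<^esub> Comp C A B D g f"

definition hom_finite :: "'k ring \<Rightarrow> ('k, 'o, 'm) rcat \<Rightarrow> bool" where
  "hom_finite R C \<longleftrightarrow>
     (\<forall>A\<in>Ob C. \<forall>B\<in>Ob C. \<exists>F. finite F \<and> F \<subseteq> carrier (Hom C A B) \<and>
        carrier (Hom C A B) = lincombs R (Hom C A B) F)"

definition inverse_pair :: "('k, 'o, 'm) rcat \<Rightarrow> 'o \<Rightarrow> 'o \<Rightarrow> 'm \<Rightarrow> 'm \<Rightarrow> bool" where
  "inverse_pair C A B f g \<longleftrightarrow>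
     f \<in> carrier (Hom C A B) \<and> g \<in> carrier (Hom C B A) \<and>
     Comp C A B A g f = Ident C A \<and> Comp C B A B f g = Ident C B"

definition isomorphic :: "('k, 'o, 'm) rcat \<Rightarrow> 'o \<Rightarrow> 'o \<Rightarrow> bool" where
  "isomorphic C A B \<longleftrightarrow> (\<exists>f g. inverse_pair C A B f g)"

definition zero_object :: "('k, 'o, 'm) rcat \<Rightarrow> 'o \<Rightarrow> bool" where
  "zero_object C Z \<longleftrightarrow> Z \<in> Ob C \<and> Ident C Z = \<zero>\<^bsub>Hom C Z Z\<^esub>"

text \<open>\<open>direct_sum C S A B\<close> says that \<open>S\<close> is isomorphic to the direct sum of \<open>A\<close> and \<open>B\<close>,
  i.e. that it carries a biproduct structure.\<close>

definition direct_sum :: "('k, 'o, 'm) rcat \<Rightarrow> 'o \<Rightarrow> 'o \<Rightarrow> 'o \<Rightarrow> bool" where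
  "direct_sum C S A B \<longleftrightarrow>
     S \<in> Ob C \<and> A \<in> Ob C \<and> B \<in> Ob C \<and>
     (\<exists>i\<in>carrier (Hom C A S). \<exists>j\<in>carrier (Hom C B S).
      \<exists>p\<in>carrier (Hom C S A). \<exists>q\<in>carrier (Hom C S B).
        Comp C A S A p i = Ident C A \<and> Comp C B S B q j = Ident C B \<and>
        Comp C B S A p j = \<zero>\<^bsub>Hom C B A\<^esub> \<and> Comp C A S B q i = \<zero>\<^bsub>Hom C A B\<^esub> \<and>
        Comp C S A S i p \<oplus>\<^bsub>Hom C S S\<^esub> Comp C S B S j q = Ident C S)"

definition additive :: "('k, 'o, 'm) rcat \<Rightarrow> bool" where
  "additive C \<longleftrightarrow> (\<exists>Z. zero_object C Z) \<and> (\<forall>A\<in>Ob C. \<forall>B\<in>Ob C. \<exists>S. direct_sum C S A B)"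

definition idempotents_split :: "('k, 'o, 'm) rcat \<Rightarrow> bool" where
  "idempotents_split C \<longleftrightarrow>
     (\<forall>A\<in>Ob C. \<forall>e\<in>carrier (Hom C A A). Comp C A A A e e = e \<longrightarrow>
        (\<exists>B\<in>Ob C. \<exists>p\<in>carrier (Hom C A B). \<exists>i\<in>carrier (Hom C B A).
           Comp C A B A i p = e \<and> Comp C B A B p i = Ident C B))"

definition fully_additive :: "('k, 'o, 'm) rcat \<Rightarrow> bool" where
  "fully_additive C \<longleftrightarrow> additive C \<and> idempotents_split C"

definition indecomposable :: "('k, 'o, 'm) rcat \<Rightarrow> 'o \<Rightarrow> bool" where
  "indecomposable C W \<longleftrightarrow> W \<in> Ob C \<and> \<not> zero_object C W \<and>
     (\<forall>A B. direct_sum C W A B \<longrightarrow> zero_object C A \<or> zero_object C B)"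

definition End :: "('k, 'o, 'm) rcat \<Rightarrow> 'o \<Rightarrow> ('k, 'm) module" where
  "End C A = (Hom C A A)\<lparr>monoid.mult := Comp C A A A, monoid.one := Ident C A\<rparr>"

section \<open>The nilradical and its quotient category\<close>

fun alternating_composite ::
  "('k, 'o, 'm) rcat \<Rightarrow> 'o \<Rightarrow> 'o \<Rightarrow> 'm \<Rightarrow> (nat \<Rightarrow> 'm) \<Rightarrow> nat \<Rightarrow> 'm" where
  "alternating_composite C A B a b 0 = a"
| "alternating_composite C A B a b (Suc n) =
     Comp C A A B (alternating_composite C A B a b n) (Comp C A B A (b n) a)"

definition nilrad :: "('k, 'o, 'm) rcat \<Rightarrow> 'o \<Rightarrow> 'o \<Rightarrow> 'm set" where
  "nilrad C A B = {a \<in> carrier (Hom C A B).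
     \<forall>b. (\<forall>i. b i \<in> carrier (Hom C B A)) \<longrightarrow>
         (\<exists>n. alternating_composite C A B a b n = \<zero>\<^bsub>Hom C A B\<^esub>)}"

definition quotient_module :: "('k, 'm) module \<Rightarrow> 'm set \<Rightarrow> ('k, 'm set) module" where
  "quotient_module M N =
     \<lparr>carrier = a_rcosets\<^bsub>M\<^esub> N, monoid.mult = undefined, monoid.one = undefined,
      ring.zero = N, ring.add = set_add M, module.smult = (\<lambda>r U. \<Union>x\<in>U. N +>\<^bsub>M\<^esub> (r \<odot>\<^bsub>M\<^esub> x))\<rparr>"

definition nil_quotient :: "('k, 'o, 'm) rcat \<Rightarrow> ('k, 'o, 'm set) rcat" where
  "nil_quotient C =
     \<lparr>Ob = Ob C,
      Hom = (\<lambda>A B. quotient_module (Hom C A B) (nilrad C A B)),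
      Comp = (\<lambda>A B D V U. \<Union>y\<in>V. \<Union>x\<in>U. nilrad C A D +>\<^bsub>Hom C A D\<^esub> Comp C A B D y x),
      Ident = (\<lambda>A. nilrad C A A +>\<^bsub>Hom C A A\<^esub> Ident C A)\<rparr>"

section \<open>Extension of scalars\<close>

text \<open>The tensor product of \<open>S\<close> and \<open>M\<close> over \<open>R\<close>, as a quotient of the free abelian
  group on pairs; \<open>S\<close> is a commutative ring containing \<open>R\<close> as a subring.\<close>

definition tensor_rels :: "'k ring \<Rightarrow> 'k ring \<Rightarrow> ('k, 'm) module \<Rightarrow> ('k \<times> 'm \<Rightarrow>\<^sub>0 int) set" where
  "tensor_rels R S M = generate (free_Abelian_group (carrier S \<times> carrier M))
     ({frag_of (s \<oplus>\<^bsub>S\<^esub> t, m) - frag_of (s, m) - frag_of (t, m) | s t m.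
         s \<in> carrier S \<and> t \<in> carrier S \<and> m \<in> carrier M} \<union>
      {frag_of (s, m \<oplus>\<^bsub>M\<^esub> n) - frag_of (s, m) - frag_of (s, n) | s m n.
         s \<in> carrier S \<and> m \<in> carrier M \<and> n \<in> carrier M} \<union>
      {frag_of (s \<otimes>\<^bsub>S\<^esub> r, m) - frag_of (s, r \<odot>\<^bsub>M\<^esub> m) | s r m.
         s \<in> carrier S \<and> r \<in> carrier R \<and> m \<in> carrier M})"

definition tensor_class ::
  "'k ring \<Rightarrow> 'k ring \<Rightarrow> ('k, 'm) module \<Rightarrow> ('k \<times> 'm \<Rightarrow>\<^sub>0 int) \<Rightarrow> ('k \<times> 'm \<Rightarrow>\<^sub>0 int) set" where
  "tensor_class R S M x = tensor_rels R S M #>\<^bsub>free_Abelian_group (carrier S \<times> carrier M)\<^esub> x"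

definition tensor ::
  "'k ring \<Rightarrow> 'k ring \<Rightarrow> ('k, 'm) module \<Rightarrow> ('k, ('k \<times> 'm \<Rightarrow>\<^sub>0 int) set) module" where
  "tensor R S M =
    (let T = free_Abelian_group (carrier S \<times> carrier M) Mod tensor_rels R S M in
     \<lparr>carrier = carrier T, monoid.mult = undefined, monoid.one = undefined,
      ring.zero = monoid.one T, ring.add = monoid.mult T,
      module.smult = (\<lambda>s U. \<Union>x\<in>U. tensor_class R S M
                 (frag_extend (\<lambda>(t, m). frag_of (s \<otimes>\<^bsub>S\<^esub> t, m)) x))\<rparr>)"

text \<open>Composition is the biadditive extension of sending the pure tensors
  \<open>s \<otimes> g\<close>, \<open>t \<otimes> f\<close> to \<open>st \<otimes> gf\<close>.\<close>

definition scalar_extension ::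
  "'k ring \<Rightarrow> 'k ring \<Rightarrow> ('k, 'o, 'm) rcat \<Rightarrow> ('k, 'o, ('k \<times> 'm \<Rightarrow>\<^sub>0 int) set) rcat" where
  "scalar_extension R S C =
     \<lparr>Ob = Ob C,
      Hom = (\<lambda>A B. tensor R S (Hom C A B)),
      Comp = (\<lambda>A B D V U. \<Union>y\<in>V. \<Union>x\<in>U. tensor_class R S (Hom C A D)
                (frag_extend (\<lambda>(s, g).
                   frag_extend (\<lambda>(t, f). frag_of (s \<otimes>\<^bsub>S\<^esub> t, Comp C A B D g f)) x) y)),
      Ident = (\<lambda>A. tensor_class R S (Hom C A A) (frag_of (\<one>\<^bsub>S\<^esub>, Ident C A)))\<rparr>"

section \<open>The fully additive envelope\<close>

text \<open>A morphism between finite direct sums (lists of objects) is a matrix; row \<open>i\<close> and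
  column \<open>j\<close> hold the component from the \<open>j\<close>-th source to the \<open>i\<close>-th target summand.
  An object of \<open>add C\<close> is an idempotent matrix, standing for its image.\<close>

type_synonym 'm matrix = "nat \<times> nat \<Rightarrow> 'm"

definition index_set :: "'o list \<Rightarrow> 'o list \<Rightarrow> (nat \<times> nat) set" where
  "index_set As Bs = {..<length Bs} \<times> {..<length As}"

definition mats :: "('k, 'o, 'm) rcat \<Rightarrow> 'o list \<Rightarrow> 'o list \<Rightarrow> 'm matrix set" where
  "mats C As Bs = (\<Pi>\<^sub>E (i, j)\<in>index_set As Bs. carrier (Hom C (As ! j) (Bs ! i)))"

definition mat_comp ::
  "('k, 'o, 'm) rcat \<Rightarrow> 'o list \<Rightarrow> 'o list \<Rightarrow> 'o list \<Rightarrow> 'm matrix \<Rightarrow> 'm matrix \<Rightarrow> 'm matrix" where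
  "mat_comp C As Bs Ds y x =
     (\<lambda>(i, k)\<in>index_set As Ds.
        finsum (Hom C (As ! k) (Ds ! i))
          (\<lambda>j. Comp C (As ! k) (Bs ! j) (Ds ! i) (y (i, j)) (x (j, k))) {..<length Bs})"

definition mat_ident :: "('k, 'o, 'm) rcat \<Rightarrow> 'o list \<Rightarrow> 'm matrix" where
  "mat_ident C As =
     (\<lambda>(i, j)\<in>index_set As As. if i = j then Ident C (As ! i) else \<zero>\<^bsub>Hom C (As ! j) (As ! i)\<^esub>)"

definition add_envelope ::
  "('k, 'o, 'm) rcat \<Rightarrow> ('k, 'o list \<times> 'm matrix, 'm matrix) rcat" where
  "add_envelope C =
     \<lparr>Ob = {(As, e). set As \<subseteq> Ob C \<and> e \<in> mats C As As \<and> mat_comp C As As As e e = e},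
      Hom = (\<lambda>(As, e) (Bs, f).
        \<lparr>carrier = {x \<in> mats C As Bs.
           mat_comp C As Bs Bs f x = x \<and> mat_comp C As As Bs x e = x},
         monoid.mult = undefined, monoid.one = undefined,
         ring.zero = (\<lambda>(i, j)\<in>index_set As Bs. \<zero>\<^bsub>Hom C (As ! j) (Bs ! i)\<^esub>),
         ring.add = (\<lambda>x y. \<lambda>(i, j)\<in>index_set As Bs. x (i, j) \<oplus>\<^bsub>Hom C (As ! j) (Bs ! i)\<^esub> y (i, j)),
         module.smult = (\<lambda>r x. \<lambda>(i, j)\<in>index_set As Bs. r \<odot>\<^bsub>Hom C (As ! j) (Bs ! i)\<^esub> x (i, j))\<rparr>),
      Comp = (\<lambda>(As, _) (Bs, _) (Ds, _). mat_comp C As Bs Ds),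
      Ident = snd\<rparr>"

text \<open>The full embedding of \<open>C\<close> into \<open>add C\<close>.\<close>

definition env_ob :: "('k, 'o, 'm) rcat \<Rightarrow> 'o \<Rightarrow> 'o list \<times> 'm matrix" where
  "env_ob C A = ([A], mat_ident C [A])"

definition env_mor :: "'m \<Rightarrow> 'm matrix" where
  "env_mor a = (\<lambda>_\<in>{(0, 0)}. a)"

text \<open>\<open>add (S \<otimes>\<^sub>R C)\<close>: for \<open>S = K\<close> this is the rational category \<open>Q C\<close>, and for \<open>S\<close> the
  localization of \<open>R\<close> at \<open>P\<close> it is the local category of \<open>C\<close> at \<open>P\<close>; \<open>ext_ob R S C A\<close> is \<open>A\<close>
  regarded there.\<close>

definition add_ext ::
  "'k ring \<Rightarrow> 'k ring \<Rightarrow> ('k, 'o, 'm) rcat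
   \<Rightarrow> ('k, 'o list \<times> ('k \<times> 'm \<Rightarrow>\<^sub>0 int) set matrix, ('k \<times> 'm \<Rightarrow>\<^sub>0 int) set matrix) rcat" where
  "add_ext R S C = add_envelope (scalar_extension R S C)"

definition ext_ob ::
  "'k ring \<Rightarrow> 'k ring \<Rightarrow> ('k, 'o, 'm) rcat \<Rightarrow> 'o \<Rightarrow> 'o list \<times> ('k \<times> 'm \<Rightarrow>\<^sub>0 int) set matrix" where
  "ext_ob R S C A = env_ob (scalar_extension R S C) A"

definition ext_mor ::
  "'k ring \<Rightarrow> 'k ring \<Rightarrow> ('k, 'o, 'm) rcat \<Rightarrow> 'o \<Rightarrow> 'o \<Rightarrow> 'm \<Rightarrow> ('k \<times> 'm \<Rightarrow>\<^sub>0 int) set matrix" where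
  "ext_mor R S C A B a = env_mor (tensor_class R S (Hom C A B) (frag_of (\<one>\<^bsub>S\<^esub>, a)))"

section \<open>Maximal orders and the Max-condition\<close>

definition R_order :: "'k ring \<Rightarrow> 'k ring \<Rightarrow> ('k, 'm) module \<Rightarrow> 'm set \<Rightarrow> bool" where
  "R_order R K D U \<longleftrightarrow>
     subring U D \<and>
     (\<exists>F. finite F \<and> F \<subseteq> U \<and> U = lincombs R D F) \<and>
     carrier D = (\<Union>F\<in>{F. finite F \<and> F \<subseteq> U}. lincombs K D F)"

definition maximal_R_order :: "'k ring \<Rightarrow> 'k ring \<Rightarrow> ('k, 'm) module \<Rightarrow> 'm set \<Rightarrow> bool" where
  "maximal_R_order R K D U \<longleftrightarrow>
     R_order R K D U \<and> (\<forall>V. R_order R K D V \<and> U \<subseteq> V \<longrightarrow> V = U)"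

text \<open>Given mutually inverse \<open>f\<close> from \<open>QS\<close> to \<open>W\<close> and \<open>g\<close> back, the canonical ring map from the
  endomorphisms of \<open>S\<^sup>0\<close> to those of \<open>W\<^sup>0\<close>, sending the class of \<open>a\<close> to the class of
  \<open>f (1 \<otimes> a) g\<close>.\<close>

definition end_map ::
  "'k ring \<Rightarrow> 'k ring \<Rightarrow> ('k, 'o, 'm) rcat
   \<Rightarrow> 'o \<Rightarrow> 'o list \<times> ('k \<times> 'm \<Rightarrow>\<^sub>0 int) set matrix
   \<Rightarrow> ('k \<times> 'm \<Rightarrow>\<^sub>0 int) set matrix \<Rightarrow> ('k \<times> 'm \<Rightarrow>\<^sub>0 int) set matrix
   \<Rightarrow> 'm set \<Rightarrow> ('k \<times> 'm \<Rightarrow>\<^sub>0 int) set matrix set" where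
  "end_map R K C S W f g U =
     (let Q = add_ext R K C; QS = ext_ob R K C S in
      \<Union>a\<in>U. nilrad Q W W +>\<^bsub>Hom Q W W\<^esub>
        Comp Q W QS W f (Comp Q W QS QS (ext_mor R K C S S a) g))"

text \<open>That the endomorphism ring of \<open>S\<^sup>0\<close> is a maximal order in that of \<open>W\<^sup>0\<close> means that the
  canonical map is injective with a maximal order as its image.\<close>

definition max_condition :: "'k ring \<Rightarrow> 'k ring \<Rightarrow> ('k, 'o, 'm) rcat \<Rightarrow> bool" where
  "max_condition R K C \<longleftrightarrow>
     (\<forall>W. indecomposable (add_ext R K C) W \<longrightarrow>
        (\<exists>S\<in>Ob C. \<exists>f g. inverse_pair (add_ext R K C) (ext_ob R K C S) W f g \<and>
           inj_on (end_map R K C S W f g) (carrier (End (nil_quotient C) S)) \<and>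
           maximal_R_order R K (End (nil_quotient (add_ext R K C)) W)
             (end_map R K C S W f g ` carrier (End (nil_quotient C) S))))"

section \<open>Genera and Grothendieck groups\<close>

definition genus :: "'k ring \<Rightarrow> 'k ring \<Rightarrow> ('k, 'o, 'm) rcat \<Rightarrow> 'o \<Rightarrow> 'o set" where
  "genus R K C A = {B \<in> Ob C. \<forall>P. maximalideal P R \<longrightarrow>
     isomorphic (add_ext R (localization R K P) C)
       (ext_ob R (localization R K P) C B) (ext_ob R (localization R K P) C A)}"

definition K0_rels :: "('k, 'o, 'm) rcat \<Rightarrow> ('o \<Rightarrow>\<^sub>0 int) set" where
  "K0_rels C = generate (free_Abelian_group (Ob C))
     {frag_of A - frag_of B - frag_of D | A B D. direct_sum C A B D}"

definition K0 :: "('k, 'o, 'm) rcat \<Rightarrow> ('o \<Rightarrow>\<^sub>0 int) set monoid" where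
  "K0 C = free_Abelian_group (Ob C) Mod K0_rels C"

definition K0_class :: "('k, 'o, 'm) rcat \<Rightarrow> 'o \<Rightarrow> ('o \<Rightarrow>\<^sub>0 int) set" where
  "K0_class C A = K0_rels C #>\<^bsub>free_Abelian_group (Ob C)\<^esub> frag_of A"

definition K0G_rels :: "'k ring \<Rightarrow> 'k ring \<Rightarrow> ('k, 'o, 'm) rcat \<Rightarrow> ('o set \<Rightarrow>\<^sub>0 int) set" where
  "K0G_rels R K C = generate (free_Abelian_group (genus R K C ` Ob C))
     {frag_of (genus R K C S) - frag_of (genus R K C A) - frag_of (genus R K C B) | S A B.
        direct_sum C S A B}"

definition K0G :: "'k ring \<Rightarrow> 'k ring \<Rightarrow> ('k, 'o, 'm) rcat \<Rightarrow> ('o set \<Rightarrow>\<^sub>0 int) set monoid" where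
  "K0G R K C = free_Abelian_group (genus R K C ` Ob C) Mod K0G_rels R K C"

definition K0G_class ::
  "'k ring \<Rightarrow> 'k ring \<Rightarrow> ('k, 'o, 'm) rcat \<Rightarrow> 'o set \<Rightarrow> ('o set \<Rightarrow>\<^sub>0 int) set" where
  "K0G_class R K C \<Gamma> = K0G_rels R K C #>\<^bsub>free_Abelian_group (genus R K C ` Ob C)\<^esub> frag_of \<Gamma>"

text \<open>The homomorphism induced on cosets by \<open>A \<mapsto> genus A\<close>; see \<open>genus_hom_class\<close> and
  \<open>genus_hom_hom\<close> below.\<close>

definition genus_hom ::
  "'k ring \<Rightarrow> 'k ring \<Rightarrow> ('k, 'o, 'm) rcat \<Rightarrow> ('o \<Rightarrow>\<^sub>0 int) set \<Rightarrow> ('o set \<Rightarrow>\<^sub>0 int) set" where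
  "genus_hom R K C U = (\<Union>x\<in>U. K0G_rels R K C #>\<^bsub>free_Abelian_group (genus R K C ` Ob C)\<^esub>
      frag_extend (frag_of \<circ> genus R K C) x)"

lemma frag_relator_closed:
  assumes "a \<in> S" "b \<in> S" "d \<in> S"
  shows "frag_of a - frag_of b - frag_of d \<in> carrier (free_Abelian_group S)"
  using assms keys_diff[of "frag_of a - frag_of b" "frag_of d"] keys_diff[of "frag_of a" "frag_of b"]
  by auto

lemma free_Abelian_normal:
  assumes "T \<subseteq> carrier (free_Abelian_group S)"
  shows "generate (free_Abelian_group S) T \<lhd> free_Abelian_group S"
proof -
  interpret F: comm_group "free_Abelian_group S"
    by (rule abelian_free_Abelian_group)
  show ?thesis
    using F.generate_is_subgroup[OF assms] F.subgroup_imp_normal by blast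
qed

lemma K0_rels_normal: "K0_rels C \<lhd> free_Abelian_group (Ob C)"
proof -
  have "frag_of A - frag_of B - frag_of D \<in> carrier (free_Abelian_group (Ob C))"
    if "direct_sum C A B D" for A B D
    using that unfolding direct_sum_def by (intro frag_relator_closed) blast+
  then show ?thesis
    unfolding K0_rels_def by (intro free_Abelian_normal) blast
qed

lemma K0G_rels_normal: "K0G_rels R K C \<lhd> free_Abelian_group (genus R K C ` Ob C)"
proof -
  have "frag_of (genus R K C A) - frag_of (genus R K C B) - frag_of (genus R K C D)
      \<in> carrier (free_Abelian_group (genus R K C ` Ob C))"
    if "direct_sum C A B D" for A B D
    using that unfolding direct_sum_def by (intro frag_relator_closed) blast+
  then show ?thesis
    unfolding K0G_rels_def by (intro free_Abelian_normal) blast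
qed

lemma frag_genus_hom:
  "group_hom (free_Abelian_group (Ob C)) (free_Abelian_group (genus R K C ` Ob C))
     (frag_extend (frag_of \<circ> genus R K C))"
proof -
  have "Poly_Mapping.keys (frag_extend (frag_of \<circ> genus R K C) x) \<subseteq> genus R K C ` Ob C"
    if "Poly_Mapping.keys x \<subseteq> Ob C" for x
    using keys_frag_extend[of "frag_of \<circ> genus R K C" x] that by fastforce
  then show ?thesis
    by (auto simp: group_hom_def group_hom_axioms_def hom_def frag_extend_add)
qed

lemma frag_genus_rels:
  assumes "x \<in> K0_rels C"
  shows "frag_extend (frag_of \<circ> genus R K C) x \<in> K0G_rels R K C"
proof -
  interpret h: group_hom "free_Abelian_group (Ob C)" "free_Abelian_group (genus R K C ` Ob C)"
    "frag_extend (frag_of \<circ> genus R K C)"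
    by (rule frag_genus_hom)
  let ?T = "{frag_of A - frag_of B - frag_of D | A B D. direct_sum C A B D}"
  have T: "?T \<subseteq> carrier (free_Abelian_group (Ob C))"
    using frag_relator_closed[of _ "Ob C"] unfolding direct_sum_def by blast
  have "frag_extend (frag_of \<circ> genus R K C) ` K0_rels C
      = generate (free_Abelian_group (genus R K C ` Ob C)) (frag_extend (frag_of \<circ> genus R K C) ` ?T)"
    unfolding K0_rels_def by (rule h.generate_img[OF T, symmetric])
  also have "\<dots> \<subseteq> K0G_rels R K C"
    unfolding K0G_rels_def
    by (rule h.H.mono_generate) (auto simp: frag_extend_diff, blast)
  finally show ?thesis using assms by blast
qed

lemma genus_hom_coset:
  assumes "c \<in> carrier (free_Abelian_group (Ob C))"
  shows "genus_hom R K C (K0_rels C #>\<^bsub>free_Abelian_group (Ob C)\<^esub> c)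
    = K0G_rels R K C #>\<^bsub>free_Abelian_group (genus R K C ` Ob C)\<^esub>
        frag_extend (frag_of \<circ> genus R K C) c"
proof -
  let ?F = "free_Abelian_group (Ob C)" and ?G = "free_Abelian_group (genus R K C ` Ob C)"
  let ?h = "frag_extend (frag_of \<circ> genus R K C)"
  interpret h: group_hom ?F ?G ?h by (rule frag_genus_hom)
  interpret N: normal "K0_rels C" ?F by (rule K0_rels_normal)
  interpret N': normal "K0G_rels R K C" ?G by (rule K0G_rels_normal)
  have hc: "?h c \<in> carrier ?G" using h.hom_closed[OF assms] .
  have "K0G_rels R K C #>\<^bsub>?G\<^esub> ?h x = K0G_rels R K C #>\<^bsub>?G\<^esub> ?h c"
    if "x \<in> K0_rels C #>\<^bsub>?F\<^esub> c" for x
  proof -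
    from that obtain n where n: "n \<in> K0_rels C" "x = n + c"
      by (auto simp: r_coset_def)
    have "?h x = ?h n \<otimes>\<^bsub>?G\<^esub> ?h c" using n by (simp add: frag_extend_add)
    moreover have "?h n \<in> K0G_rels R K C" by (rule frag_genus_rels[OF n(1)])
    ultimately have "?h x \<in> K0G_rels R K C #>\<^bsub>?G\<^esub> ?h c"
      by (auto simp: r_coset_def)
    then show ?thesis
      using h.H.repr_independence[OF _ hc N'.subgroup_axioms] by metis
  qed
  moreover have "c \<in> K0_rels C #>\<^bsub>?F\<^esub> c"
    using h.G.rcos_self[OF assms N.subgroup_axioms] .
  ultimately show ?thesis unfolding genus_hom_def by blast
qed

lemma genus_hom_class:
  "A \<in> Ob C \<Longrightarrow> genus_hom R K C (K0_class C A) = K0G_class R K C (genus R K C A)"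
  by (simp add: K0_class_def K0G_class_def genus_hom_coset)

lemma genus_hom_hom: "genus_hom R K C \<in> hom (K0 C) (K0G R K C)"
proof -
  let ?F = "free_Abelian_group (Ob C)" and ?G = "free_Abelian_group (genus R K C ` Ob C)"
  let ?h = "frag_extend (frag_of \<circ> genus R K C)"
  interpret h: group_hom ?F ?G ?h by (rule frag_genus_hom)
  interpret N: normal "K0_rels C" ?F by (rule K0_rels_normal)
  interpret N': normal "K0G_rels R K C" ?G by (rule K0G_rels_normal)
  show ?thesis
  proof (rule homI)
    fix U assume "U \<in> carrier (K0 C)"
    then obtain c where c: "c \<in> carrier ?F" "U = K0_rels C #>\<^bsub>?F\<^esub> c"
      by (auto simp: K0_def FactGroup_def RCOSETS_def)
    then show "genus_hom R K C U \<in> carrier (K0G R K C)"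
      using h.hom_closed[OF c(1)] unfolding c(2) genus_hom_coset[OF c(1)]
      by (auto simp: K0G_def FactGroup_def RCOSETS_def)
  next
    fix U V assume "U \<in> carrier (K0 C)" "V \<in> carrier (K0 C)"
    then obtain c d where c: "c \<in> carrier ?F" "U = K0_rels C #>\<^bsub>?F\<^esub> c"
      and d: "d \<in> carrier ?F" "V = K0_rels C #>\<^bsub>?F\<^esub> d"
      by (auto simp: K0_def FactGroup_def RCOSETS_def)
    have cd: "c \<otimes>\<^bsub>?F\<^esub> d \<in> carrier ?F" using c d h.G.m_closed by blast
    have "U \<otimes>\<^bsub>K0 C\<^esub> V = K0_rels C #>\<^bsub>?F\<^esub> (c \<otimes>\<^bsub>?F\<^esub> d)"
      unfolding c(2) d(2) K0_def FactGroup_def using N.rcos_sum[OF c(1) d(1)] by simp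
    then have "genus_hom R K C (U \<otimes>\<^bsub>K0 C\<^esub> V) = K0G_rels R K C #>\<^bsub>?G\<^esub> ?h (c \<otimes>\<^bsub>?F\<^esub> d)"
      by (simp only: genus_hom_coset[OF cd])
    also have "\<dots> = genus_hom R K C U \<otimes>\<^bsub>K0G R K C\<^esub> genus_hom R K C V"
      unfolding h.hom_mult[OF c(1) d(1)] c(2) d(2) genus_hom_coset[OF c(1)] genus_hom_coset[OF d(1)]
        K0G_def FactGroup_def
      using N'.rcos_sum[OF h.hom_closed[OF c(1)] h.hom_closed[OF d(1)]] by simp
    finally show "genus_hom R K C (U \<otimes>\<^bsub>K0 C\<^esub> V)
        = genus_hom R K C U \<otimes>\<^bsub>K0G R K C\<^esub> genus_hom R K C V" .
  qed
qed

end

theory Submission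
  imports Defs
begin

text \<open>The group of genera is free abelian, so the surjection onto it splits. Over a field, a
  hom-finite category with split idempotents is a Krull-Schmidt category, hence the multiplicities
  of indecomposables are additive on direct sums and determine an object up to isomorphism. By
  Nakayama's lemma two objects are isomorphic over the localization at \<open>P\<close> if and only if they
  are so over the residue field of \<open>P\<close>. A genus therefore amounts to the family of its
  multiplicities over all residue fields, and it determines the rational multiplicities.

  This family need not have finite support. The Max-condition lifts every indecomposable of the
  rational category to the category itself, and a rational isomorphism becomes an isomorphism at
  almost all \<open>P\<close>; so an object agrees at almost all \<open>P\<close> with the direct sum of the
  lifts of its rational constituents. Subtracting the local multiplicities of that sum embeds the
  group of genera into a free abelian group, whose subgroups are free.\<close>


section \<open>Splitting over subgroups of free abelian groups\<close>

text \<open>Residue fields replace the localizations because a localization is not complete: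
  idempotents need not lift there, and decompositions over it need not be unique. Nothing is lost,
  since it is the Hom modules and not the objects that are reduced modulo \<open>P\<close>. Every
  morphism over the residue field is therefore the image of a morphism of \<open>C\<close>, and an
  inverse pair lifts to a pair that is inverse modulo \<open>P\<close>, the situation of Nakayama's
  lemma. Objects of the residue category need not come from \<open>C\<close>; they only serve to
  count. Additivity dictates the correction at \<open>P\<close>: it must be a linear function of the
  rational multiplicities, so one lift is fixed once and for all for each rational isomorphism
  class. \<open>K\<close>, the localizations and the residue fields are all realized on the type of
  the scalars. Hence the multiplicities for all \<open>P\<close> have one type, and a single free
  abelian group with an extra index for \<open>P\<close> can receive the invariant.\<close>

lemma diff_closed_int_generator:
  fixes I :: "int set"
  assumes "0 \<in> I" and diff: "\<And>x y. x \<in> I \<Longrightarrow> y \<in> I \<Longrightarrow> x - y \<in> I"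
  shows "\<exists>d\<in>I. \<forall>x\<in>I. d dvd x"
proof (cases "I \<subseteq> {0}")
  case True
  with \<open>0 \<in> I\<close> show ?thesis by auto
next
  case False
  have neg: "- x \<in> I" if "x \<in> I" for x using diff[OF \<open>0 \<in> I\<close> that] by simp
  have add: "x + y \<in> I" if "x \<in> I" "y \<in> I" for x y using diff[OF that(1) neg[OF that(2)]] by simp
  have nmul: "int n * x \<in> I" if "x \<in> I" for n x
    by (induction n) (use \<open>0 \<in> I\<close> add that in \<open>auto simp: algebra_simps\<close>)
  have mul: "k * x \<in> I" if "x \<in> I" for k x
    using nmul[OF that, of "nat k"] neg[OF nmul[OF that, of "nat (- k)"]] by (cases "0 \<le> k") auto
  from False obtain z where z: "z \<in> I" "z \<noteq> 0" by auto
  define n where "n = (LEAST n. 0 < n \<and> int n \<in> I)"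
  have "\<exists>n. 0 < n \<and> int n \<in> I"
    using z neg[OF z(1)] by (intro exI[of _ "nat \<bar>z\<bar>"]) (auto simp: abs_if)
  then have n: "0 < n" "int n \<in> I" unfolding n_def by (metis (mono_tags, lifting) LeastI)+
  have "int n dvd x" if x: "x \<in> I" for x
  proof -
    have "x mod int n = x - (x div int n) * int n" by (simp add: minus_div_mult_eq_mod)
    then have m: "x mod int n \<in> I" using diff[OF x mul[OF n(2)]] by simp
    have lt: "nat (x mod int n) < n" using n(1) by (simp add: nat_less_iff)
    then have "\<not> (0 < nat (x mod int n) \<and> int (nat (x mod int n)) \<in> I)"
      unfolding n_def by (rule not_less_Least)
    then have "x mod int n = 0" using m n(1) pos_mod_sign[of "int n" x] by (auto simp del: pos_mod_sign)
    then show ?thesis by (simp add: dvd_eq_mod_eq_0)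
  qed
  with n(2) show ?thesis by blast
qed

lemma lookup_frag_extend:
  "poly_mapping.lookup (frag_extend b c) i
     = (\<Sum>k\<in>Poly_Mapping.keys c. poly_mapping.lookup c k * poly_mapping.lookup (b k) i)"
  by (simp add: frag_extend_def lookup_sum)

text \<open>A basis is chosen by well-ordering the index set and picking, for every \<open>i\<close>, an element of
  the subgroup supported below \<open>i\<close> whose coefficient at \<open>i\<close> is as divisible as possible.\<close>

lemma subgroup_of_free_basis:
  fixes L :: "('i \<Rightarrow>\<^sub>0 int) set"
  assumes "0 \<in> L" and diff: "\<And>x y. x \<in> L \<Longrightarrow> y \<in> L \<Longrightarrow> x - y \<in> L"
  obtains b :: "'i \<Rightarrow> 'i \<Rightarrow>\<^sub>0 int" and J where "\<And>i. b i \<in> L"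
    and "\<And>x. x \<in> L \<Longrightarrow> \<exists>c. Poly_Mapping.keys c \<subseteq> J \<and> frag_extend b c = x"
    and "\<And>c. Poly_Mapping.keys c \<subseteq> J \<Longrightarrow> frag_extend b c = 0 \<Longrightarrow> c = 0"
proof -
  from well_ordering obtain r :: "'i rel" where r: "Well_order r \<and> Field r = UNIV" ..
  then have wf: "wf (r - Id)" and lin: "linear_order_on UNIV r"
    by (metis well_order_on_def)+
  have "refl r" "trans r" "antisym r" "total r"
    using lin unfolding order_on_defs by simp_all
  then have refl: "(i, i) \<in> r" and trans: "(i, j) \<in> r \<Longrightarrow> (j, k) \<in> r \<Longrightarrow> (i, k) \<in> r"
    and anti: "(i, j) \<in> r \<Longrightarrow> (j, i) \<in> r \<Longrightarrow> i = j" for i j k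
    by (blast dest: refl_onD transD antisymD)+
  with \<open>total r\<close> have tot: "(i, j) \<in> r \<or> (j, i) \<in> r" for i j
    unfolding total_on_def by (metis UNIV_I)
  \<comment> \<open>Supports are finite, so every nonzero element has a largest index; it plays the
    role of a leading term.\<close>
  have top: "\<exists>j\<in>A. \<forall>k\<in>A. (k, j) \<in> r" if "finite A" "A \<noteq> {}" for A
    using that
  proof (induction rule: finite_ne_induct)
    case (singleton x)
    then show ?case using refl by auto
  next
    case (insert x F)
    then obtain j where "j \<in> F" "\<forall>k\<in>F. (k, j) \<in> r" by blast
    then show ?case using tot[of x j] trans refl by (metis insert_iff)
  qed
  \<comment> \<open>\<open>i\<close> itself is allowed: the elements of \<open>L\<close> that are
    \<open>below i\<close> form a filtration of \<open>L\<close> by leading index.\<close>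
  define below where "below i x \<longleftrightarrow> (\<forall>k\<in>Poly_Mapping.keys x. (k, i) \<in> r)" for i and x :: "'i \<Rightarrow>\<^sub>0 int"
  have below_diff: "below i (x - y)" if "below i x" "below i y" for i x y
    using that keys_diff[of x y] unfolding below_def by blast
  have neg: "- x \<in> L" if "x \<in> L" for x using diff[OF assms(1) that] by simp
  have mulL: "frag_cmul q x \<in> L" if "x \<in> L" for q x
    by (rule frag_closure_minus_cmul[of "\<lambda>y. y \<in> L"]) (use that diff assms(1) in auto)
  have "\<exists>b. b \<in> L \<and> below i b \<and>
      (\<forall>x\<in>L. below i x \<longrightarrow> poly_mapping.lookup b i dvd poly_mapping.lookup x i)" for i
  proof -
    let ?I = "{poly_mapping.lookup x i | x. x \<in> L \<and> below i x}"
    have "\<exists>d\<in>?I. \<forall>x\<in>?I. d dvd x"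
    proof (rule diff_closed_int_generator)
      show "0 \<in> ?I" using assms(1) by (auto simp: below_def intro!: exI[of _ 0])
      show "x - y \<in> ?I" if xy: "x \<in> ?I" "y \<in> ?I" for x y
      proof -
        from xy obtain u v where "u \<in> L" "below i u" "v \<in> L" "below i v"
          and "x = poly_mapping.lookup u i" "y = poly_mapping.lookup v i" by auto
        then show ?thesis
          using diff[of u v] below_diff[of i u v] by (auto simp: lookup_minus intro!: exI[of _ "u - v"])
      qed
    qed
    then show ?thesis by blast
  qed
  then obtain b where b: "\<And>i. b i \<in> L" "\<And>i. below i (b i)"
    and bdvd: "\<And>i x. x \<in> L \<Longrightarrow> below i x \<Longrightarrow> poly_mapping.lookup (b i) i dvd poly_mapping.lookup x i"
    by metis
  \<comment> \<open>Outside \<open>J\<close> the generator of the coefficients at \<open>i\<close>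
    is \<open>0\<close>, so every element below \<open>i\<close> already vanishes at
    \<open>i\<close> and no basis element is needed there.\<close>
  define J where "J = {i. poly_mapping.lookup (b i) i \<noteq> 0}"
  have surj: "\<exists>c. Poly_Mapping.keys c \<subseteq> J \<and> frag_extend b c = x" if "x \<in> L" "below i x" for i x
    using wf that
  proof (induction i arbitrary: x rule: wf_induct_rule)
    case (less i)
    obtain q where q: "poly_mapping.lookup x i = poly_mapping.lookup (b i) i * q"
      using bdvd[OF less.prems] by (elim dvdE)
    \<comment> \<open>If \<open>b i\<close> vanishes at \<open>i\<close>, the quotient
      \<open>q\<close> is arbitrary; the value \<open>0\<close> keeps the coordinates supported in
      \<open>J\<close>.\<close>
    define q' where "q' = (if i \<in> J then q else 0)"
    define x' where "x' = x - frag_cmul q' (b i)"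
    have x': "x' \<in> L" unfolding x'_def by (intro diff less.prems mulL b)
    have "below i (frag_cmul q' (b i))" using b(2)[of i] keys_cmul[of q' "b i"] by (auto simp: below_def)
    then have bx': "below i x'" unfolding x'_def by (intro below_diff less.prems)
    have li: "poly_mapping.lookup x' i = 0" using q by (auto simp: x'_def q'_def J_def lookup_minus)
    have "\<exists>c. Poly_Mapping.keys c \<subseteq> J \<and> frag_extend b c = x'"
    proof (cases "x' = 0")
      case True then show ?thesis by (intro exI[of _ 0]) simp
    next
      case False
      then obtain j where j: "j \<in> Poly_Mapping.keys x'" "\<forall>k\<in>Poly_Mapping.keys x'. (k, j) \<in> r"
        using top[of "Poly_Mapping.keys x'"] by auto
      \<comment> \<open>Cancelling at \<open>i\<close> makes the leading index drop strictly, which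
        is what the induction along the well-order needs.\<close>
      then have "(j, i) \<in> r - Id" using bx' li by (auto simp: below_def in_keys_iff)
      then show ?thesis using less.IH[of j x'] x' j(2) by (auto simp: below_def)
    qed
    then obtain c where c: "Poly_Mapping.keys c \<subseteq> J" "frag_extend b c = x'" by blast
    have "Poly_Mapping.keys (frag_cmul q' (frag_of i)) \<subseteq> J" by (auto simp: q'_def keys_frag_of split: if_splits)
    then have "Poly_Mapping.keys (c + frag_cmul q' (frag_of i)) \<subseteq> J"
      using c(1) keys_add[of c "frag_cmul q' (frag_of i)"] by blast
    moreover have "frag_extend b (c + frag_cmul q' (frag_of i)) = x"
      by (simp add: frag_extend_add frag_extend_cmul c(2) x'_def)
    ultimately show ?case by blast
  qed
  show ?thesis
  proof (rule that[of b J])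
    show "b i \<in> L" for i by (rule b)
    show "\<exists>c. Poly_Mapping.keys c \<subseteq> J \<and> frag_extend b c = x" if x: "x \<in> L" for x
    proof (cases "x = 0")
      case True then show ?thesis by (intro exI[of _ 0]) simp
    next
      case False
      then obtain j where "\<forall>k\<in>Poly_Mapping.keys x. (k, j) \<in> r"
        using top[of "Poly_Mapping.keys x"] by auto
      then show ?thesis using surj[OF x, of j] by (simp add: below_def)
    qed
    show "c = 0" if c: "Poly_Mapping.keys c \<subseteq> J" "frag_extend b c = 0" for c
    proof (rule ccontr)
      assume "c \<noteq> 0"
      then obtain j where j: "j \<in> Poly_Mapping.keys c" "\<forall>k\<in>Poly_Mapping.keys c. (k, j) \<in> r"
        using top[of "Poly_Mapping.keys c"] by auto
      \<comment> \<open>Triangularity: for a key \<open>k\<close> of \<open>c\<close> other than the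
        largest one \<open>j\<close>, the support of \<open>b k\<close> stays below \<open>k\<close>
        and misses \<open>j\<close>. Nothing can cancel the contribution of
        \<open>b j\<close>.\<close>
      have z: "poly_mapping.lookup (b k) j = 0" if "k \<in> Poly_Mapping.keys c" "k \<noteq> j" for k
        using b(2)[of k] j(2) that anti unfolding below_def by (metis in_keys_iff)
      have "poly_mapping.lookup (frag_extend b c) j
          = (\<Sum>k\<in>{j}. poly_mapping.lookup c k * poly_mapping.lookup (b k) j)"
        unfolding lookup_frag_extend by (rule sum.mono_neutral_right) (use j z in auto)
      then have "poly_mapping.lookup c j * poly_mapping.lookup (b j) j = 0" using c(2) by simp
      then show False using j(1) c(1) by (auto simp: J_def in_keys_iff)
    qed
  qed
qed

text \<open>\<open>psi\<close> embeds \<open>H\<close> in a free abelian group, so \<open>H\<close>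
  is free on the basis just constructed. Lifting this basis along \<open>p\<close> defines a
  homomorphic section \<open>s\<close>, and \<open>z\<close> splits into the kernel element
  \<open>z s(p z)^(-1)\<close> and the factor \<open>s(p z)\<close>.\<close>

lemma epi_to_free_subgroup_splits:
  fixes G :: "'g monoid" and H :: "'h monoid" and psi :: "'h \<Rightarrow> 'i \<Rightarrow>\<^sub>0 int"
  assumes "comm_group G" "comm_group H"
    and p: "p \<in> hom G H" "p ` carrier G = carrier H"
    and psi: "\<And>x y. x \<in> carrier H \<Longrightarrow> y \<in> carrier H \<Longrightarrow> psi (x \<otimes>\<^bsub>H\<^esub> y) = psi x + psi y"
    and inj: "inj_on psi (carrier H)"
  shows "G \<cong> G\<lparr>carrier := kernel G H p\<rparr> \<times>\<times> H"
proof -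
  interpret G: comm_group G by fact
  interpret H: comm_group H by fact
  interpret p: group_hom G H p using p(1) by unfold_locales
  have psi1: "psi \<one>\<^bsub>H\<^esub> = 0" using psi[of "\<one>\<^bsub>H\<^esub>" "\<one>\<^bsub>H\<^esub>"] by simp
  have psiinv: "psi (inv\<^bsub>H\<^esub> x) = - psi x" if "x \<in> carrier H" for x
  proof -
    have "psi (inv\<^bsub>H\<^esub> x) + psi x = 0" using psi[of "inv\<^bsub>H\<^esub> x" x] psi1 that by simp
    then show ?thesis by (simp add: eq_neg_iff_add_eq_0)
  qed
  let ?L = "psi ` carrier H"
  obtain b :: "'i \<Rightarrow> 'i \<Rightarrow>\<^sub>0 int" and J where b: "\<And>i. b i \<in> ?L"
    and bsurj: "\<And>x. x \<in> ?L \<Longrightarrow> \<exists>c. Poly_Mapping.keys c \<subseteq> J \<and> frag_extend b c = x"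
    and binj: "\<And>c. Poly_Mapping.keys c \<subseteq> J \<Longrightarrow> frag_extend b c = 0 \<Longrightarrow> c = 0"
  proof (rule subgroup_of_free_basis[of ?L])
    show "0 \<in> ?L" using psi1 by force
    show "x - y \<in> ?L" if xy: "x \<in> ?L" "y \<in> ?L" for x y
    proof -
      from xy obtain u v where "u \<in> carrier H" "v \<in> carrier H" "x = psi u" "y = psi v" by auto
      then show ?thesis using psi[of u "inv\<^bsub>H\<^esub> v"] psiinv[of v]
        by (auto intro!: image_eqI[of _ _ "u \<otimes>\<^bsub>H\<^esub> inv\<^bsub>H\<^esub> v"])
    qed
  qed blast
  have "\<exists>g\<in>carrier G. psi (p g) = b i" for i using b[of i] p(2) by (metis imageE)
  then obtain g where g: "\<And>i. g i \<in> carrier G" "\<And>i. psi (p (g i)) = b i" by metis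
  obtain gam where gam: "gam \<in> hom (free_Abelian_group J) G" "\<And>i. i \<in> J \<Longrightarrow> gam (frag_of i) = g i"
    using G.free_Abelian_group_universal[of g J] g by blast
  interpret gam: group_hom "free_Abelian_group J" G gam
    using gam(1) by (simp add: group_hom_def group_hom_axioms_def)
  have pg: "psi (p (gam c)) = frag_extend b c" if "Poly_Mapping.keys c \<subseteq> J" for c
  proof (rule free_Abelian_group_induct[OF that, where P = "\<lambda>c. psi (p (gam c)) = frag_extend b c"])
    show "psi (p (gam 0)) = frag_extend b 0" using gam.hom_one psi1 by simp
  next
    fix x y :: "'i \<Rightarrow>\<^sub>0 int"
    assume xy: "Poly_Mapping.keys x \<subseteq> J" "Poly_Mapping.keys y \<subseteq> J"
      and IH: "psi (p (gam x)) = frag_extend b x" "psi (p (gam y)) = frag_extend b y"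
    have c: "gam x \<in> carrier G" "gam y \<in> carrier G" using xy gam.hom_closed by auto
    have "gam (x - y) = gam x \<otimes>\<^bsub>G\<^esub> inv\<^bsub>G\<^esub> gam y"
      using gam.hom_mult[of x "- y"] gam.hom_inv[of y] xy by simp
    then show "psi (p (gam (x - y))) = frag_extend b (x - y)"
      using IH c by (simp add: psi psiinv frag_extend_diff)
  next
    fix a assume "a \<in> J"
    then show "psi (p (gam (frag_of a))) = frag_extend b (frag_of a)" using gam(2) g(2) by simp
  qed
  define sel where "sel h = (SOME c. Poly_Mapping.keys c \<subseteq> J \<and> frag_extend b c = psi h)" for h
  have sel: "Poly_Mapping.keys (sel h) \<subseteq> J" "frag_extend b (sel h) = psi h" if "h \<in> carrier H" for h
    using someI_ex[OF bsurj[of "psi h"]] that unfolding sel_def by auto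
  \<comment> \<open>Coordinates with respect to a basis are unique; this turns the arbitrary choice
    \<open>sel\<close> into a homomorphism.\<close>
  have sel_mult: "sel (x \<otimes>\<^bsub>H\<^esub> y) = sel x + sel y" if xy: "x \<in> carrier H" "y \<in> carrier H" for x y
  proof -
    have *: "Poly_Mapping.keys (sel (x \<otimes>\<^bsub>H\<^esub> y) - (sel x + sel y)) \<subseteq> J"
      using sel(1)[OF xy(1)] sel(1)[OF xy(2)] sel(1)[OF H.m_closed[OF xy]]
        keys_diff[of "sel (x \<otimes>\<^bsub>H\<^esub> y)" "sel x + sel y"] keys_add[of "sel x" "sel y"] by blast
    have "sel (x \<otimes>\<^bsub>H\<^esub> y) - (sel x + sel y) = 0"
      by (rule binj[OF *]) (use xy in \<open>simp add: frag_extend_diff frag_extend_add sel psi\<close>)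
    then show ?thesis by simp
  qed
  define s where "s h = gam (sel h)" for h
  have s_closed: "s h \<in> carrier G" if "h \<in> carrier H" for h
    using sel(1)[OF that] gam.hom_closed unfolding s_def by simp
  have s_mult: "s (x \<otimes>\<^bsub>H\<^esub> y) = s x \<otimes>\<^bsub>G\<^esub> s y" if "x \<in> carrier H" "y \<in> carrier H" for x y
    using gam.hom_mult[of "sel x" "sel y"] sel(1) that unfolding s_def sel_mult[OF that] by simp
  have ps: "p (s h) = h" if "h \<in> carrier H" for h
    using inj_onD[OF inj, of "p (s h)" h] pg[of "sel h"] sel[OF that] s_closed[OF that] that
    unfolding s_def by simp
  let ?Ker = "kernel G H p"
  have ker: "k \<in> carrier G" "p k = \<one>\<^bsub>H\<^esub>" if "k \<in> ?Ker" for k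
    using that unfolding kernel_def by simp_all
  have iso: "(\<lambda>(k, h). k \<otimes>\<^bsub>G\<^esub> s h) \<in> iso (G\<lparr>carrier := ?Ker\<rparr> \<times>\<times> H) G"
  proof (rule isoI)
    show "(\<lambda>(k, h). k \<otimes>\<^bsub>G\<^esub> s h) \<in> hom (G\<lparr>carrier := ?Ker\<rparr> \<times>\<times> H) G"
    proof (rule homI)
      fix x y assume x: "x \<in> carrier (G\<lparr>carrier := ?Ker\<rparr> \<times>\<times> H)" and y: "y \<in> carrier (G\<lparr>carrier := ?Ker\<rparr> \<times>\<times> H)"
      obtain k h where kh: "x = (k, h)" "k \<in> ?Ker" "h \<in> carrier H" using x by auto
      obtain k' h' where kh': "y = (k', h')" "k' \<in> ?Ker" "h' \<in> carrier H" using y by auto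
      have c: "k \<in> carrier G" "k' \<in> carrier G" "s h \<in> carrier G" "s h' \<in> carrier G"
        using kh kh' ker s_closed by auto
      have "(k \<otimes>\<^bsub>G\<^esub> k') \<otimes>\<^bsub>G\<^esub> (s h \<otimes>\<^bsub>G\<^esub> s h') = (k \<otimes>\<^bsub>G\<^esub> s h) \<otimes>\<^bsub>G\<^esub> (k' \<otimes>\<^bsub>G\<^esub> s h')"
        using c by (simp add: G.m_ac)
      then show "(\<lambda>(k, h). k \<otimes>\<^bsub>G\<^esub> s h) (x \<otimes>\<^bsub>G\<lparr>carrier := ?Ker\<rparr> \<times>\<times> H\<^esub> y)
          = (\<lambda>(k, h). k \<otimes>\<^bsub>G\<^esub> s h) x \<otimes>\<^bsub>G\<^esub> (\<lambda>(k, h). k \<otimes>\<^bsub>G\<^esub> s h) y"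
        using kh kh' s_mult by simp
    qed (auto simp: ker s_closed)
    show "bij_betw (\<lambda>(k, h). k \<otimes>\<^bsub>G\<^esub> s h) (carrier (G\<lparr>carrier := ?Ker\<rparr> \<times>\<times> H)) (carrier G)"
      unfolding bij_betw_def
    proof (intro conjI inj_onI equalityI subsetI)
      fix x y assume x: "x \<in> carrier (G\<lparr>carrier := ?Ker\<rparr> \<times>\<times> H)" and y: "y \<in> carrier (G\<lparr>carrier := ?Ker\<rparr> \<times>\<times> H)"
        and eq: "(\<lambda>(k, h). k \<otimes>\<^bsub>G\<^esub> s h) x = (\<lambda>(k, h). k \<otimes>\<^bsub>G\<^esub> s h) y"
      obtain k h where kh: "x = (k, h)" "k \<in> ?Ker" "h \<in> carrier H" using x by auto
      obtain k' h' where kh': "y = (k', h')" "k' \<in> ?Ker" "h' \<in> carrier H" using y by auto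
      have e: "k \<otimes>\<^bsub>G\<^esub> s h = k' \<otimes>\<^bsub>G\<^esub> s h'" using eq kh kh' by simp
      then have "p (k \<otimes>\<^bsub>G\<^esub> s h) = p (k' \<otimes>\<^bsub>G\<^esub> s h')" by simp
      then have "h = h'" using kh kh' ker s_closed ps by simp
      then show "x = y" using e kh kh' ker s_closed by simp
    next
      fix z assume "z \<in> (\<lambda>(k, h). k \<otimes>\<^bsub>G\<^esub> s h) ` carrier (G\<lparr>carrier := ?Ker\<rparr> \<times>\<times> H)"
      then show "z \<in> carrier G" using ker s_closed by auto
    next
      fix z assume z: "z \<in> carrier G"
      have sz: "s (p z) \<in> carrier G" using s_closed z by simp
      have "z \<otimes>\<^bsub>G\<^esub> inv\<^bsub>G\<^esub> s (p z) \<in> ?Ker"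
        using z sz ps[of "p z"] by (simp add: kernel_def)
      moreover have "z = (z \<otimes>\<^bsub>G\<^esub> inv\<^bsub>G\<^esub> s (p z)) \<otimes>\<^bsub>G\<^esub> s (p z)" using z sz by (simp add: G.m_assoc)
      ultimately show "z \<in> (\<lambda>(k, h). k \<otimes>\<^bsub>G\<^esub> s h) ` carrier (G\<lparr>carrier := ?Ker\<rparr> \<times>\<times> H)"
        using z by (intro image_eqI[of _ _ "(z \<otimes>\<^bsub>G\<^esub> inv\<^bsub>G\<^esub> s (p z), p z)"]) auto
    qed
  qed
  interpret Ker: subgroup ?Ker G by (rule p.subgroup_kernel)
  show ?thesis
    using iso group.iso_sym[of "G\<lparr>carrier := ?Ker\<rparr> \<times>\<times> H" G] is_isoI
      DirProd_group[OF Ker.subgroup_is_group[OF G.group_axioms] H.group_axioms] by blast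
qed

section \<open>Linear dependence and Fitting's lemma\<close>

text \<open>Only \<open>carrier R\<close> enters. Replacing it by an ideal \<open>I\<close>
  therefore gives the product of \<open>I\<close> with the span, which is how multiples by an ideal
  are written in Nakayama's lemma.\<close>

fun span_list :: "('k, 'c) ring_scheme \<Rightarrow> ('k, 'm, 'd) module_scheme \<Rightarrow> 'm list \<Rightarrow> 'm set" where
  "span_list R M [] = {\<zero>\<^bsub>M\<^esub>}"
| "span_list R M (g # gs) =
     {c \<odot>\<^bsub>M\<^esub> g \<oplus>\<^bsub>M\<^esub> z | c z. c \<in> carrier R \<and> z \<in> span_list R M gs}"

text \<open>A substitute for a dimension less than \<open>n\<close> that avoids bases. Families are
  indexed, so repetitions count, and the condition is false for \<open>n = 0\<close>.\<close>

definition all_dependent :: "('k, 'c) ring_scheme \<Rightarrow> ('k, 'm, 'd) module_scheme \<Rightarrow> nat \<Rightarrow> bool" where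
  "all_dependent R M n \<longleftrightarrow> (\<forall>y\<in>{..<n} \<rightarrow> carrier M. \<exists>c\<in>{..<n} \<rightarrow> carrier R.
     (\<exists>i<n. c i \<noteq> \<zero>\<^bsub>R\<^esub>) \<and> finsum M (\<lambda>i. c i \<odot>\<^bsub>M\<^esub> y i) {..<n} = \<zero>\<^bsub>M\<^esub>)"

context module
begin

lemma span_list_ideal_submodule:
  assumes I: "ideal I R" and "set gs \<subseteq> carrier M"
  shows "submodule (span_list (R\<lparr>carrier := I\<rparr>) M gs) R M"
  using assms(2)
proof (induction gs)
  case Nil
  show ?case by (rule submoduleI) auto
next
  case (Cons g gs)
  then have g: "g \<in> carrier M" and sub: "submodule (span_list (R\<lparr>carrier := I\<rparr>) M gs) R M" by auto
  note S = submoduleE[OF sub]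
  have Ic: "c \<in> carrier R" if "c \<in> I" for c by (rule ideal.Icarr[OF I that])
  have I0: "\<zero> \<in> I" and Ia: "c \<in> I \<Longrightarrow> d \<in> I \<Longrightarrow> c \<oplus> d \<in> I" and In: "c \<in> I \<Longrightarrow> \<ominus> c \<in> I" for c d
    using additive_subgroup.zero_closed[OF ideal.axioms(1)[OF I]]
      additive_subgroup.a_closed[OF ideal.axioms(1)[OF I]]
      additive_subgroup.a_inv_closed[OF ideal.axioms(1)[OF I]] by blast+
  have zc: "z \<in> carrier M" if "z \<in> span_list (R\<lparr>carrier := I\<rparr>) M gs" for z using that S(1) by blast
  show ?case
  proof (rule submoduleI)
    show "span_list (R\<lparr>carrier := I\<rparr>) M (g # gs) \<subseteq> carrier M" using g zc Ic by auto
    have "\<zero>\<^bsub>M\<^esub> \<in> span_list (R\<lparr>carrier := I\<rparr>) M gs"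
      using S(2,4) zc by (metis R.zero_closed ex_in_conv smult_l_null)
    then show "\<zero>\<^bsub>M\<^esub> \<in> span_list (R\<lparr>carrier := I\<rparr>) M (g # gs)"
      using g I0 by (auto intro!: exI[of _ "\<zero>\<^bsub>R\<^esub>"] exI[of _ "\<zero>\<^bsub>M\<^esub>"])
    show "\<ominus>\<^bsub>M\<^esub> a \<in> span_list (R\<lparr>carrier := I\<rparr>) M (g # gs)" if "a \<in> span_list (R\<lparr>carrier := I\<rparr>) M (g # gs)" for a
    proof -
      from that obtain c z where cz: "c \<in> I" "z \<in> span_list (R\<lparr>carrier := I\<rparr>) M gs" "a = c \<odot>\<^bsub>M\<^esub> g \<oplus>\<^bsub>M\<^esub> z" by auto
      have "\<ominus>\<^bsub>M\<^esub> a = (\<ominus> c) \<odot>\<^bsub>M\<^esub> g \<oplus>\<^bsub>M\<^esub> (\<ominus>\<^bsub>M\<^esub> z)"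
        using cz g zc Ic by (simp add: M.minus_add smult_l_minus)
      then show ?thesis using cz S(3) In by auto
    qed
    show "a \<oplus>\<^bsub>M\<^esub> b \<in> span_list (R\<lparr>carrier := I\<rparr>) M (g # gs)"
      if "a \<in> span_list (R\<lparr>carrier := I\<rparr>) M (g # gs)" "b \<in> span_list (R\<lparr>carrier := I\<rparr>) M (g # gs)" for a b
    proof -
      from that obtain c z c' z' where cz: "c \<in> I" "z \<in> span_list (R\<lparr>carrier := I\<rparr>) M gs" "a = c \<odot>\<^bsub>M\<^esub> g \<oplus>\<^bsub>M\<^esub> z"
        "c' \<in> I" "z' \<in> span_list (R\<lparr>carrier := I\<rparr>) M gs" "b = c' \<odot>\<^bsub>M\<^esub> g \<oplus>\<^bsub>M\<^esub> z'" by auto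
      have "a \<oplus>\<^bsub>M\<^esub> b = (c \<oplus> c') \<odot>\<^bsub>M\<^esub> g \<oplus>\<^bsub>M\<^esub> (z \<oplus>\<^bsub>M\<^esub> z')"
        using cz g zc Ic by (simp add: smult_l_distr M.a_ac)
      moreover have "c \<oplus> c' \<in> I" "z \<oplus>\<^bsub>M\<^esub> z' \<in> span_list (R\<lparr>carrier := I\<rparr>) M gs"
        using cz S(5) Ia by blast+
      ultimately show ?thesis unfolding span_list.simps by auto
    qed
    show "a \<odot>\<^bsub>M\<^esub> x \<in> span_list (R\<lparr>carrier := I\<rparr>) M (g # gs)"
      if "a \<in> carrier R" "x \<in> span_list (R\<lparr>carrier := I\<rparr>) M (g # gs)" for a x
    proof -
      from that obtain c z where cz: "c \<in> I" "z \<in> span_list (R\<lparr>carrier := I\<rparr>) M gs" "x = c \<odot>\<^bsub>M\<^esub> g \<oplus>\<^bsub>M\<^esub> z" by auto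
      have "a \<odot>\<^bsub>M\<^esub> x = (a \<otimes> c) \<odot>\<^bsub>M\<^esub> g \<oplus>\<^bsub>M\<^esub> (a \<odot>\<^bsub>M\<^esub> z)"
        using cz g zc Ic that(1) by (simp add: smult_r_distr smult_assoc1)
      then show ?thesis using cz S(4) that(1) ideal.I_l_closed[OF I cz(1) that(1)] by auto
    qed
  qed
qed

lemma span_list_submodule: "set gs \<subseteq> carrier M \<Longrightarrow> submodule (span_list R M gs) R M"
  using span_list_ideal_submodule[OF R.oneideal] by simp

lemma span_list_generators:
  assumes "set gs \<subseteq> carrier M" "g \<in> set gs"
  shows "g \<in> span_list R M gs"
  using assms
proof (induction gs)
  case Nil then show ?case by simp
next
  case (Cons h gs)
  then have h: "h \<in> carrier M" and sub: "submodule (span_list R M gs) R M"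
    using span_list_submodule by auto
  note S = submoduleE[OF sub]
  have z: "\<zero>\<^bsub>M\<^esub> \<in> span_list R M gs"
    using S(1,2,4) by (metis R.zero_closed ex_in_conv smult_l_null subsetD)
  show ?case
  proof (cases "g = h")
    case True
    then show ?thesis using h z by (auto intro!: exI[of _ "\<one>\<^bsub>R\<^esub>"] exI[of _ "\<zero>\<^bsub>M\<^esub>"])
  next
    case False
    then have "g \<in> span_list R M gs" "g \<in> carrier M" using Cons by auto
    then show ?thesis using h by (auto intro!: exI[of _ "\<zero>\<^bsub>R\<^esub>"] exI[of _ g])
  qed
qed

text \<open>For the elimination step: a relation between vectors reduced by a pivot \<open>w\<close>
  becomes a relation between the original vectors and \<open>w\<close>.\<close>

lemma finsum_shift:
  assumes "finite J" "d \<in> J \<rightarrow> carrier R" "t \<in> J \<rightarrow> carrier R" "y \<in> J \<rightarrow> carrier M" "w \<in> carrier M"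
  shows "\<exists>s\<in>carrier R. finsum M (\<lambda>i. d i \<odot>\<^bsub>M\<^esub> (y i \<ominus>\<^bsub>M\<^esub> t i \<odot>\<^bsub>M\<^esub> w)) J
    = finsum M (\<lambda>i. d i \<odot>\<^bsub>M\<^esub> y i) J \<oplus>\<^bsub>M\<^esub> s \<odot>\<^bsub>M\<^esub> w"
  using assms
proof (induction J)
  case empty
  then show ?case by (intro bexI[of _ "\<zero>\<^bsub>R\<^esub>"]) auto
next
  case (insert j J)
  then obtain s where s: "s \<in> carrier R" "finsum M (\<lambda>i. d i \<odot>\<^bsub>M\<^esub> (y i \<ominus>\<^bsub>M\<^esub> t i \<odot>\<^bsub>M\<^esub> w)) J
    = finsum M (\<lambda>i. d i \<odot>\<^bsub>M\<^esub> y i) J \<oplus>\<^bsub>M\<^esub> s \<odot>\<^bsub>M\<^esub> w" by (auto simp: Pi_def)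
  have c: "d j \<in> carrier R" "t j \<in> carrier R" "y j \<in> carrier M" "w \<in> carrier M"
    "(\<lambda>i. d i \<odot>\<^bsub>M\<^esub> y i) \<in> J \<rightarrow> carrier M"
    "(\<lambda>i. d i \<odot>\<^bsub>M\<^esub> (y i \<ominus>\<^bsub>M\<^esub> t i \<odot>\<^bsub>M\<^esub> w)) \<in> J \<rightarrow> carrier M"
    using insert.prems by (auto simp: Pi_def)
  then have "d j \<odot>\<^bsub>M\<^esub> (y j \<ominus>\<^bsub>M\<^esub> t j \<odot>\<^bsub>M\<^esub> w)
     = d j \<odot>\<^bsub>M\<^esub> y j \<oplus>\<^bsub>M\<^esub> (\<ominus> (d j \<otimes> t j)) \<odot>\<^bsub>M\<^esub> w"
    by (simp add: a_minus_def smult_r_distr smult_r_minus smult_l_minus smult_assoc1)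
  moreover have "finsum M (\<lambda>i. d i \<odot>\<^bsub>M\<^esub> y i) J \<in> carrier M" using c by (intro M.finsum_closed)
  ultimately show ?case using insert.hyps c s
    by (intro bexI[of _ "\<ominus> (d j \<otimes> t j) \<oplus> s"]) (simp_all add: smult_l_distr M.a_ac)
qed

text \<open>Gaussian elimination: a coefficient at the first generator that does not vanish serves as pivot.\<close>

lemma dependent_in_span:
  assumes "field R" "set gs \<subseteq> carrier M" "finite J" "length gs < card J" "y \<in> J \<rightarrow> span_list R M gs"
  shows "\<exists>c\<in>J \<rightarrow> carrier R. (\<exists>i\<in>J. c i \<noteq> \<zero>) \<and> finsum M (\<lambda>i. c i \<odot>\<^bsub>M\<^esub> y i) J = \<zero>\<^bsub>M\<^esub>"
  using assms(2-)
proof (induction gs arbitrary: J y)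
  case Nil
  interpret F: field R by fact
  have "finsum M (\<lambda>i. \<one> \<odot>\<^bsub>M\<^esub> y i) J = \<zero>\<^bsub>M\<^esub>"
    using Nil by (intro M.add.finprod_one_eqI) (auto dest!: Pi_mem)
  moreover have "J \<noteq> {}" using Nil by auto
  ultimately show ?case by (intro bexI[of _ "\<lambda>_. \<one>"]) auto
next
  case (Cons g gs)
  interpret F: field R by fact
  note S = submoduleE[OF span_list_submodule[of gs]]
  have g: "g \<in> carrier M" and gs: "set gs \<subseteq> carrier M" using Cons.prems by auto
  have "\<exists>a z. a \<in> carrier R \<and> z \<in> span_list R M gs \<and> y i = a \<odot>\<^bsub>M\<^esub> g \<oplus>\<^bsub>M\<^esub> z" if "i \<in> J" for i
    using Cons.prems(4) that by (auto simp: Pi_def)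
  then obtain a z where az: "\<And>i. i \<in> J \<Longrightarrow> a i \<in> carrier R" "\<And>i. i \<in> J \<Longrightarrow> z i \<in> span_list R M gs"
    "\<And>i. i \<in> J \<Longrightarrow> y i = a i \<odot>\<^bsub>M\<^esub> g \<oplus>\<^bsub>M\<^esub> z i" by metis
  have zc: "z i \<in> carrier M" if "i \<in> J" for i using az(2)[OF that] S(1)[OF gs] by blast
  have yc: "y i \<in> carrier M" if "i \<in> J" for i using az zc g that by simp
  show ?case
  proof (cases "\<forall>i\<in>J. a i = \<zero>")
    case True
    then have "y \<in> J \<rightarrow> span_list R M gs" using az zc g by (auto simp: Pi_def)
    then show ?thesis using Cons.IH[OF gs] Cons.prems by auto
  next
    case False
    then obtain j where j: "j \<in> J" "a j \<noteq> \<zero>" by blast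
    then have inv: "inv a j \<in> carrier R" "inv a j \<otimes> a j = \<one>"
      using az(1) F.field_Units by auto
    define t where "t i = a i \<otimes> inv a j" for i
    have tc: "t i \<in> carrier R" if "i \<in> J" for i using that az inv by (simp add: t_def)
    have y': "y i \<ominus>\<^bsub>M\<^esub> t i \<odot>\<^bsub>M\<^esub> y j \<in> span_list R M gs" if i: "i \<in> J" for i
    proof -
      have ta: "t i \<otimes> a j = a i" using i az(1) inv by (simp add: t_def R.m_assoc j)
      have "y i \<ominus>\<^bsub>M\<^esub> t i \<odot>\<^bsub>M\<^esub> y j = a i \<odot>\<^bsub>M\<^esub> g \<oplus>\<^bsub>M\<^esub> z i \<ominus>\<^bsub>M\<^esub> (a i \<odot>\<^bsub>M\<^esub> g \<oplus>\<^bsub>M\<^esub> t i \<odot>\<^bsub>M\<^esub> z j)"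
        using i j az zc g tc ta by (simp add: smult_r_distr flip: smult_assoc1)
      also have "\<dots> = z i \<oplus>\<^bsub>M\<^esub> (\<ominus>\<^bsub>M\<^esub> (t i \<odot>\<^bsub>M\<^esub> z j))"
        using i j az zc g tc
        by (simp add: a_minus_def M.minus_add M.a_ac M.r_neg1 M.r_neg2)
      also have "\<dots> \<in> span_list R M gs" using i j az tc S(3-5)[OF gs] by auto
      finally show ?thesis .
    qed
    let ?J = "J - {j}"
    \<comment> \<open>Dropping the pivot costs one vector and one generator, so the strict
      inequality survives.\<close>
    have "length gs < card ?J" "finite ?J" using Cons.prems j by auto
    then obtain d where d: "d \<in> ?J \<rightarrow> carrier R" "\<exists>i\<in>?J. d i \<noteq> \<zero>"
      "finsum M (\<lambda>i. d i \<odot>\<^bsub>M\<^esub> (y i \<ominus>\<^bsub>M\<^esub> t i \<odot>\<^bsub>M\<^esub> y j)) ?J = \<zero>\<^bsub>M\<^esub>"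
      using Cons.IH[OF gs, of ?J "\<lambda>i. y i \<ominus>\<^bsub>M\<^esub> t i \<odot>\<^bsub>M\<^esub> y j"] y' by (auto simp: Pi_def)
    then obtain s where s: "s \<in> carrier R" "finsum M (\<lambda>i. d i \<odot>\<^bsub>M\<^esub> y i) ?J \<oplus>\<^bsub>M\<^esub> s \<odot>\<^bsub>M\<^esub> y j = \<zero>\<^bsub>M\<^esub>"
      using finsum_shift[OF \<open>finite ?J\<close> d(1), of t y "y j"] tc yc j by (force simp: d(3))
    have dy: "(\<lambda>i. d i \<odot>\<^bsub>M\<^esub> y i) \<in> ?J \<rightarrow> carrier M" using d yc by (auto simp: Pi_def)
    have "finsum M (\<lambda>i. (d(j := s)) i \<odot>\<^bsub>M\<^esub> y i) (insert j ?J)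
        = s \<odot>\<^bsub>M\<^esub> y j \<oplus>\<^bsub>M\<^esub> finsum M (\<lambda>i. (d(j := s)) i \<odot>\<^bsub>M\<^esub> y i) ?J"
      using \<open>finite ?J\<close> s yc j d by (subst M.finsum_insert) (auto simp: Pi_def)
    also have "finsum M (\<lambda>i. (d(j := s)) i \<odot>\<^bsub>M\<^esub> y i) ?J = finsum M (\<lambda>i. d i \<odot>\<^bsub>M\<^esub> y i) ?J"
      using dy by (intro M.finsum_cong') auto
    also have "s \<odot>\<^bsub>M\<^esub> y j \<oplus>\<^bsub>M\<^esub> finsum M (\<lambda>i. d i \<odot>\<^bsub>M\<^esub> y i) ?J = \<zero>\<^bsub>M\<^esub>"
      using s dy yc j by (simp add: M.a_comm)
    finally have "finsum M (\<lambda>i. (d(j := s)) i \<odot>\<^bsub>M\<^esub> y i) J = \<zero>\<^bsub>M\<^esub>"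
      using j by (simp add: insert_absorb)
    moreover have "d(j := s) \<in> J \<rightarrow> carrier R" using d(1) s(1) by (auto simp: Pi_def)
    moreover have "\<exists>i\<in>J. (d(j := s)) i \<noteq> \<zero>" using d(2) by auto
    ultimately show ?thesis by blast
  qed
qed

lemma all_dependent_of_span:
  assumes "field R" "set gs \<subseteq> carrier M" "carrier M \<subseteq> span_list R M gs"
  shows "all_dependent R M (Suc (length gs))"
  unfolding all_dependent_def
proof
  fix y assume "y \<in> {..<Suc (length gs)} \<rightarrow> carrier M"
  then show "\<exists>c\<in>{..<Suc (length gs)} \<rightarrow> carrier R.
     (\<exists>i<Suc (length gs). c i \<noteq> \<zero>) \<and> finsum M (\<lambda>i. c i \<odot>\<^bsub>M\<^esub> y i) {..<Suc (length gs)} = \<zero>\<^bsub>M\<^esub>"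
    using dependent_in_span[OF assms(1,2), of "{..<Suc (length gs)}" y] assms(3) by fastforce
qed

end

text \<open>The inverse is the geometric series: the induction builds
  \<open>1 + a + ... + a^(n-1)\<close> as \<open>z\<close>, for both sides at once, and
  \<open>a^m\<close> vanishes in the end.\<close>

lemma (in ring) one_minus_nilpotent_unit:
  assumes a: "a \<in> carrier R" and nil: "a [^] (m::nat) = \<zero>"
  shows "\<one> \<ominus> a \<in> Units R"
proof -
  have "\<exists>z\<in>carrier R. z \<otimes> (\<one> \<ominus> a) = \<one> \<ominus> a [^] n \<and> (\<one> \<ominus> a) \<otimes> z = \<one> \<ominus> a [^] n" for n :: nat
  proof (induction n)
    case 0
    show ?case using a by (intro bexI[of _ \<zero>]) (auto simp: a_minus_def r_neg)
  next
    case (Suc n)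
    then obtain z where z: "z \<in> carrier R" "z \<otimes> (\<one> \<ominus> a) = \<one> \<ominus> a [^] n" "(\<one> \<ominus> a) \<otimes> z = \<one> \<ominus> a [^] n" by blast
    have c: "a [^] n \<in> carrier R" "a [^] n \<otimes> a = a [^] Suc n" "a \<otimes> a [^] n = a [^] Suc n"
      using a by (simp_all add: nat_pow_Suc2[symmetric])
    have "(z \<oplus> a [^] n) \<otimes> (\<one> \<ominus> a) = (\<one> \<ominus> a [^] n) \<oplus> (a [^] n \<ominus> a [^] Suc n)"
      "(\<one> \<ominus> a) \<otimes> (z \<oplus> a [^] n) = (\<one> \<ominus> a [^] n) \<oplus> (a [^] n \<ominus> a [^] Suc n)"
    proof -
      have "a [^] n \<otimes> (\<one> \<ominus> a) = a [^] n \<ominus> a [^] Suc n" "(\<one> \<ominus> a) \<otimes> a [^] n = a [^] n \<ominus> a [^] Suc n"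
        using a c by (simp_all add: a_minus_def l_distr r_distr r_minus l_minus del: nat_pow_Suc)
      then show "(z \<oplus> a [^] n) \<otimes> (\<one> \<ominus> a) = (\<one> \<ominus> a [^] n) \<oplus> (a [^] n \<ominus> a [^] Suc n)"
        "(\<one> \<ominus> a) \<otimes> (z \<oplus> a [^] n) = (\<one> \<ominus> a [^] n) \<oplus> (a [^] n \<ominus> a [^] Suc n)"
        using l_distr[OF z(1) c(1), of "\<one> \<ominus> a"] r_distr[OF z(1) c(1), of "\<one> \<ominus> a"] a z(2,3) by simp_all
    qed
    moreover have "(\<one> \<ominus> a [^] n) \<oplus> (a [^] n \<ominus> a [^] Suc n) = \<one> \<ominus> a [^] Suc n"
    proof -
      have "a [^] Suc n \<in> carrier R" using a by blast
      then show ?thesis using c(1) by (simp add: a_minus_def a_assoc r_neg1 del: nat_pow_Suc)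
    qed
    ultimately show ?case using z(1) c(1) by (metis a_closed)
  qed
  moreover have "\<one> \<ominus> a [^] m = \<one>" using nil by (simp add: a_minus_def)
  ultimately obtain z where "z \<in> carrier R" "z \<otimes> (\<one> \<ominus> a) = \<one>" "(\<one> \<ominus> a) \<otimes> z = \<one>"
    by metis
  then show ?thesis using a unfolding Units_def by blast
qed

text \<open>A linear relation between powers of \<open>a\<close> yields \<open>a\<^sup>m = a\<^sup>m\<^sup>+\<^sup>1 b\<close> with \<open>b\<close> commuting with
  \<open>a\<close>; then \<open>(a b)\<^sup>m\<close> is idempotent.\<close>

lemma fitting_alternative:
  fixes R :: "('k, 'c) ring_scheme" and E :: "('k, 'm) module" (structure)
  assumes "module R E" "ring E" "field R"
    and sl: "\<And>c x y. c \<in> carrier R \<Longrightarrow> x \<in> carrier E \<Longrightarrow> y \<in> carrier E \<Longrightarrow>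
      (c \<odot> x) \<otimes> y = c \<odot> (x \<otimes> y)"
    and sr: "\<And>c x y. c \<in> carrier R \<Longrightarrow> x \<in> carrier E \<Longrightarrow> y \<in> carrier E \<Longrightarrow>
      x \<otimes> (c \<odot> y) = c \<odot> (x \<otimes> y)"
    and dep: "all_dependent R E n"
    and idem: "\<And>e. e \<in> carrier E \<Longrightarrow> e \<otimes> e = e \<Longrightarrow> e = \<zero> \<or> e = \<one>"
    and a: "a \<in> carrier E"
  shows "a \<in> Units E \<or> \<one> \<ominus> a \<in> Units E"
proof -
  interpret M: module R E by fact
  interpret E: ring E by fact
  interpret F: field R by fact
  have pc: "a [^] (i::nat) \<in> carrier E" for i using a by blast
  obtain c where c: "\<And>i. i < n \<Longrightarrow> c i \<in> carrier R" "\<exists>i<n. c i \<noteq> \<zero>\<^bsub>R\<^esub>"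
    "finsum E (\<lambda>i. c i \<odot> a [^] i) {..<n} = \<zero>"
    using dep[unfolded all_dependent_def, rule_format, of "\<lambda>i. a [^] i"] pc by (auto simp: Pi_def)
  \<comment> \<open>The lowest exponent of the relation: dividing by \<open>c m\<close> will express
    \<open>a [^] m\<close> through higher powers.\<close>
  define m where "m = (LEAST i. i < n \<and> c i \<noteq> \<zero>\<^bsub>R\<^esub>)"
  have m: "m < n" "c m \<noteq> \<zero>\<^bsub>R\<^esub>" using c(2) unfolding m_def by (metis (mono_tags, lifting) LeastI)+
  have low: "c i = \<zero>\<^bsub>R\<^esub>" if "i < m" for i
    using not_less_Least[OF that[unfolded m_def]] that m by auto
  \<comment> \<open>All terms beyond \<open>m\<close> share the factor \<open>a [^] Suc m\<close>;
    the cofactor \<open>b\<close> is built from powers of \<open>a\<close> and so commutes with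
    \<open>a\<close>.\<close>
  have "\<exists>b\<in>carrier E. a \<otimes> b = b \<otimes> a \<and> finsum E (\<lambda>i. c i \<odot> a [^] i) {..<Suc (m + k)}
      = c m \<odot> a [^] m \<oplus> a [^] Suc m \<otimes> b" if "m + k < n" for k
    using that
  proof (induction k)
    case 0
    have "finsum E (\<lambda>i. c i \<odot> a [^] i) {..<m} = \<zero>"
      using low pc by (intro M.add.finprod_one_eqI) auto
    moreover have "(\<lambda>i. c i \<odot> a [^] i) \<in> {..<m} \<rightarrow> carrier E" using c(1) pc m by auto
    ultimately have "finsum E (\<lambda>i. c i \<odot> a [^] i) {..<Suc m} = c m \<odot> a [^] m"
      using c(1)[OF m(1)] pc[of m] unfolding lessThan_Suc by (subst M.finsum_insert) auto
    then show ?case using a pc[of m] pc[of "Suc m"] c(1)[OF m(1)] by (intro bexI[of _ "\<zero>"]) (auto simp del: E.nat_pow_Suc)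
  next
    case (Suc k)
    then obtain b where b: "b \<in> carrier E" "a \<otimes> b = b \<otimes> a"
      "finsum E (\<lambda>i. c i \<odot> a [^] i) {..<Suc (m + k)}
      = c m \<odot> a [^] m \<oplus> a [^] Suc m \<otimes> b" by auto
    let ?c = "c (Suc (m + k))"
    have cc: "?c \<in> carrier R" "c m \<in> carrier R" using c(1) Suc.prems m by auto
    have "(\<lambda>i. c i \<odot> a [^] i) \<in> {..<Suc (m + k)} \<rightarrow> carrier E" using c(1) pc Suc.prems by auto
    then have "finsum E (\<lambda>i. c i \<odot> a [^] i) {..<Suc (Suc (m + k))}
        = ?c \<odot> a [^] Suc (m + k) \<oplus> (c m \<odot> a [^] m \<oplus> a [^] Suc m \<otimes> b)"
      using cc pc[of "Suc (m + k)"] unfolding lessThan_Suc[of "Suc (m + k)"]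
      by (subst M.finsum_insert) (auto simp: b(3) simp del: E.nat_pow_Suc)
    also have "?c \<odot> a [^] Suc (m + k) = a [^] Suc m \<otimes> (?c \<odot> a [^] k)"
      using cc pc[of k] pc[of "Suc m"] a E.nat_pow_mult[OF a, of "Suc m" k] by (simp add: sr del: E.nat_pow_Suc)
    also have "a [^] Suc m \<otimes> (?c \<odot> a [^] k) \<oplus> (c m \<odot> a [^] m \<oplus> a [^] Suc m \<otimes> b)
        = c m \<odot> a [^] m \<oplus> a [^] Suc m \<otimes> (?c \<odot> a [^] k \<oplus> b)"
      using cc pc[of k] pc[of m] pc[of "Suc m"] b(1) by (simp add: E.r_distr M.a_ac del: E.nat_pow_Suc)
    finally have "finsum E (\<lambda>i. c i \<odot> a [^] i) {..<Suc (m + Suc k)}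
        = c m \<odot> a [^] m \<oplus> a [^] Suc m \<otimes> (?c \<odot> a [^] k \<oplus> b)" by simp
    moreover have "a \<otimes> (?c \<odot> a [^] k \<oplus> b) = (?c \<odot> a [^] k \<oplus> b) \<otimes> a"
      using cc pc[of k] a b by (simp add: E.r_distr E.l_distr sl sr E.nat_pow_Suc2[symmetric])
    moreover have "?c \<odot> a [^] k \<oplus> b \<in> carrier E" using cc pc[of k] b by simp
    ultimately show ?case by blast
  qed
  from this[of "n - Suc m"] m(1) c(3)
  obtain b where b: "b \<in> carrier E" "a \<otimes> b = b \<otimes> a"
    "c m \<odot> a [^] m \<oplus> a [^] Suc m \<otimes> b = \<zero>" by auto
  have cm: "c m \<in> carrier R" "inv\<^bsub>R\<^esub> c m \<in> carrier R" "inv\<^bsub>R\<^esub> c m \<otimes>\<^bsub>R\<^esub> c m = \<one>\<^bsub>R\<^esub>"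
    using c(1)[OF m(1)] m(2) F.field_Units by auto
  define b' where "b' = \<ominus> (inv\<^bsub>R\<^esub> c m \<odot> b)"
  have b'c: "b' \<in> carrier E" unfolding b'_def using cm b by simp
  have b'a: "a \<otimes> b' = b' \<otimes> a"
    unfolding b'_def using cm a b by (simp add: E.r_minus E.l_minus sl sr)
  \<comment> \<open>Multiplication by \<open>t\<close> fixes \<open>a [^] m\<close>, and
    \<open>t [^] m\<close> is a left multiple of \<open>a [^] m\<close>. Hence
    \<open>t [^] m\<close> is idempotent, and \<open>idem\<close> leaves \<open>0\<close> and
    \<open>1\<close>.\<close>
  define t where "t = a \<otimes> b'"
  have tc: "t \<in> carrier E" using a b'c by (simp add: t_def)
  have ta: "t \<otimes> a = a \<otimes> t" "t \<otimes> b' = b' \<otimes> t"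
    using a b'c b'a by (simp_all add: t_def E.m_assoc) (metis E.m_assoc)+
  have am: "a [^] m \<otimes> t = a [^] m"
  proof -
    have "c m \<odot> a [^] m = \<ominus> (a [^] Suc m \<otimes> b)"
      using b cm pc[of m] pc[of "Suc m"] by (intro M.minus_equality[symmetric]) (auto simp: M.a_comm simp del: E.nat_pow_Suc)
    then have "a [^] m = inv\<^bsub>R\<^esub> c m \<odot> (\<ominus> (a [^] Suc m \<otimes> b))"
      using cm pc[of m] by (metis M.smult_assoc1 M.smult_one)
    also have "\<dots> = a [^] Suc m \<otimes> b'"
      unfolding b'_def using cm b pc[of "Suc m"] by (simp add: E.r_minus M.smult_r_minus sr del: E.nat_pow_Suc)
    finally show ?thesis using pc[of m] a b'c by (simp add: t_def E.m_assoc)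
  qed
  have tp: "t [^] (k::nat) \<in> carrier E" for k using tc by blast
  have amk: "a [^] m \<otimes> t [^] k = a [^] m" for k :: nat
  proof (induction k)
    case (Suc k)
    have "a [^] m \<otimes> t [^] Suc k = (a [^] m \<otimes> t [^] k) \<otimes> t"
      using pc[of m] tp[of k] tc by (simp add: E.m_assoc)
    then show ?case using Suc am by simp
  qed (use pc[of m] in simp)
  have eab: "t [^] m = b' [^] m \<otimes> a [^] m"
    unfolding t_def b'a using a b'c b'a by (intro E.pow_mult_distrib) auto
  have "t [^] m \<otimes> t [^] m = t [^] m"
  proof -
    have "t [^] m \<otimes> t [^] m = b' [^] m \<otimes> (a [^] m \<otimes> t [^] m)"
      using pc[of m] tp[of m] b'c by (subst eab) (simp add: E.m_assoc)
    then show ?thesis using amk[of m] eab by metis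
  qed
  then consider "t [^] m = \<zero>" | "t [^] m = \<one>" using idem tp by blast
  then show ?thesis
  proof cases
    case 1
    then have "a [^] m = \<zero>" using amk[of m] pc[of m] by simp
    then show ?thesis using E.one_minus_nilpotent_unit a by blast
  next
    case 2
    \<comment> \<open>A positive exponent is needed to read off an inverse of \<open>a\<close>. For
      \<open>m = 0\<close> the equation \<open>t [^] m = 1\<close> carries no information, but
      \<open>a [^] m \<otimes> t = a [^] m\<close> then says \<open>t = 1\<close>.\<close>
    have "\<exists>k. t [^] Suc k = \<one>"
    proof (cases m)
      case 0
      then have "t [^] Suc 0 = \<one>" using am tc by simp
      then show ?thesis by blast
    qed (use 2 in blast)
    then obtain k where k: "t [^] Suc k = \<one>" ..
    then have k': "t \<otimes> t [^] k = \<one>" "t [^] k \<otimes> t = \<one>"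
      using tc E.nat_pow_Suc2 by simp_all
    have l: "a \<otimes> (b' \<otimes> t [^] k) = \<one>"
      using k'(1) a b'c tp[of k] by (simp add: t_def E.m_assoc)
    have r: "(t [^] k \<otimes> b') \<otimes> a = \<one>"
      using k'(2) a b'c tp[of k] b'a by (simp add: t_def E.m_assoc)
    have "a \<in> Units E"
      using E.inv_unique[OF r l] l r a b'c tp[of k] unfolding Units_def by auto
    then show ?thesis ..
  qed
qed

section \<open>Biproducts in a category enriched in modules\<close>

text \<open>\<open>direct_sum\<close> with named structure maps: complements and exchange depend on
  the maps and not only on the objects.\<close>

definition biproduct ::
  "('k, 'o, 'm) rcat \<Rightarrow> 'o \<Rightarrow> 'o \<Rightarrow> 'o \<Rightarrow> 'm \<Rightarrow> 'm \<Rightarrow> 'm \<Rightarrow> 'm \<Rightarrow> bool" where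
  "biproduct C S A B i j p q \<longleftrightarrow>
     S \<in> Ob C \<and> A \<in> Ob C \<and> B \<in> Ob C \<and>
     i \<in> carrier (Hom C A S) \<and> j \<in> carrier (Hom C B S) \<and>
     p \<in> carrier (Hom C S A) \<and> q \<in> carrier (Hom C S B) \<and>
     Comp C A S A p i = Ident C A \<and> Comp C B S B q j = Ident C B \<and>
     Comp C B S A p j = \<zero>\<^bsub>Hom C B A\<^esub> \<and> Comp C A S B q i = \<zero>\<^bsub>Hom C A B\<^esub> \<and>
     Comp C S A S i p \<oplus>\<^bsub>Hom C S S\<^esub> Comp C S B S j q = Ident C S"

lemma direct_sum_iff_biproduct: "direct_sum C S A B \<longleftrightarrow> (\<exists>i j p q. biproduct C S A B i j p q)"
  unfolding direct_sum_def biproduct_def by blast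

context R_category
begin

abbreviation mor where
  "mor A B \<equiv> carrier (Hom C A B)"

lemma Hom_abelian: "A \<in> Ob C \<Longrightarrow> B \<in> Ob C \<Longrightarrow> abelian_group (Hom C A B)"
  using Hom_module module.axioms by blast

context
  fixes A B
  assumes A: "A \<in> Ob C" and B: "B \<in> Ob C"
begin

interpretation M: module R "Hom C A B" by (rule Hom_module[OF A B])

lemma
  shows mor_zero: "\<zero>\<^bsub>Hom C A B\<^esub> \<in> mor A B"
    and mor_add: "x \<in> mor A B \<Longrightarrow> y \<in> mor A B \<Longrightarrow> x \<oplus>\<^bsub>Hom C A B\<^esub> y \<in> mor A B"
    and mor_neg: "x \<in> mor A B \<Longrightarrow> \<ominus>\<^bsub>Hom C A B\<^esub> x \<in> mor A B"
    and mor_smult: "x \<in> mor A B \<Longrightarrow> r \<in> carrier R \<Longrightarrow> r \<odot>\<^bsub>Hom C A B\<^esub> x \<in> mor A B"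
    and mor_a_assoc: "x \<in> mor A B \<Longrightarrow> y \<in> mor A B \<Longrightarrow> z \<in> mor A B \<Longrightarrow>
      (x \<oplus>\<^bsub>Hom C A B\<^esub> y) \<oplus>\<^bsub>Hom C A B\<^esub> z = x \<oplus>\<^bsub>Hom C A B\<^esub> (y \<oplus>\<^bsub>Hom C A B\<^esub> z)"
    and mor_a_comm: "x \<in> mor A B \<Longrightarrow> y \<in> mor A B \<Longrightarrow> x \<oplus>\<^bsub>Hom C A B\<^esub> y = y \<oplus>\<^bsub>Hom C A B\<^esub> x"
    and mor_a_lcomm: "x \<in> mor A B \<Longrightarrow> y \<in> mor A B \<Longrightarrow> z \<in> mor A B \<Longrightarrow>
      x \<oplus>\<^bsub>Hom C A B\<^esub> (y \<oplus>\<^bsub>Hom C A B\<^esub> z) = y \<oplus>\<^bsub>Hom C A B\<^esub> (x \<oplus>\<^bsub>Hom C A B\<^esub> z)"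
    and mor_l_zero: "x \<in> mor A B \<Longrightarrow> \<zero>\<^bsub>Hom C A B\<^esub> \<oplus>\<^bsub>Hom C A B\<^esub> x = x"
    and mor_r_zero: "x \<in> mor A B \<Longrightarrow> x \<oplus>\<^bsub>Hom C A B\<^esub> \<zero>\<^bsub>Hom C A B\<^esub> = x"
    and mor_minus_zero: "\<ominus>\<^bsub>Hom C A B\<^esub> \<zero>\<^bsub>Hom C A B\<^esub> = \<zero>\<^bsub>Hom C A B\<^esub>"
    and mor_minus_minus: "x \<in> mor A B \<Longrightarrow> \<ominus>\<^bsub>Hom C A B\<^esub> (\<ominus>\<^bsub>Hom C A B\<^esub> x) = x"
    and mor_minus_add: "x \<in> mor A B \<Longrightarrow> y \<in> mor A B \<Longrightarrow>
      \<ominus>\<^bsub>Hom C A B\<^esub> (x \<oplus>\<^bsub>Hom C A B\<^esub> y) = \<ominus>\<^bsub>Hom C A B\<^esub> x \<oplus>\<^bsub>Hom C A B\<^esub> \<ominus>\<^bsub>Hom C A B\<^esub> y"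
    and mor_r_neg: "x \<in> mor A B \<Longrightarrow> x \<oplus>\<^bsub>Hom C A B\<^esub> \<ominus>\<^bsub>Hom C A B\<^esub> x = \<zero>\<^bsub>Hom C A B\<^esub>"
    and mor_l_neg: "x \<in> mor A B \<Longrightarrow> \<ominus>\<^bsub>Hom C A B\<^esub> x \<oplus>\<^bsub>Hom C A B\<^esub> x = \<zero>\<^bsub>Hom C A B\<^esub>"
    and mor_r_neg1: "x \<in> mor A B \<Longrightarrow> y \<in> mor A B \<Longrightarrow>
      \<ominus>\<^bsub>Hom C A B\<^esub> x \<oplus>\<^bsub>Hom C A B\<^esub> (x \<oplus>\<^bsub>Hom C A B\<^esub> y) = y"
    and mor_r_neg2: "x \<in> mor A B \<Longrightarrow> y \<in> mor A B \<Longrightarrow>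
      x \<oplus>\<^bsub>Hom C A B\<^esub> (\<ominus>\<^bsub>Hom C A B\<^esub> x \<oplus>\<^bsub>Hom C A B\<^esub> y) = y"
  by (auto simp: M.a_assoc M.minus_add M.r_neg M.l_neg M.r_neg1 M.r_neg2 intro: M.a_comm M.a_lcomm)

lemma mor_eq_diff: "x \<in> mor A B \<Longrightarrow> y \<in> mor A B \<Longrightarrow> x \<oplus>\<^bsub>Hom C A B\<^esub> y = z \<Longrightarrow>
      y = z \<oplus>\<^bsub>Hom C A B\<^esub> \<ominus>\<^bsub>Hom C A B\<^esub> x"
  by (auto simp: M.a_comm[of x y] M.a_assoc M.r_neg)

end

lemma Comp_zero_left:
  assumes "A \<in> Ob C" "B \<in> Ob C" "D \<in> Ob C" "f \<in> mor A B"
  shows "Comp C A B D \<zero>\<^bsub>Hom C B D\<^esub> f = \<zero>\<^bsub>Hom C A D\<^esub>"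
proof -
  interpret M: module R "Hom C A D" using assms by (intro Hom_module)
  let ?x = "Comp C A B D \<zero>\<^bsub>Hom C B D\<^esub> f"
  have "?x \<oplus>\<^bsub>Hom C A D\<^esub> ?x = ?x" "?x \<in> mor A D"
    using assms Comp_add_left[of A B D "\<zero>\<^bsub>Hom C B D\<^esub>" "\<zero>\<^bsub>Hom C B D\<^esub>" f]
    by (simp_all add: mor_zero mor_l_zero Comp_closed)
  then show ?thesis by (metis M.add.r_cancel_one')
qed

lemma Comp_zero_right:
  assumes "A \<in> Ob C" "B \<in> Ob C" "D \<in> Ob C" "g \<in> mor B D"
  shows "Comp C A B D g \<zero>\<^bsub>Hom C A B\<^esub> = \<zero>\<^bsub>Hom C A D\<^esub>"
proof -
  interpret M: module R "Hom C A D" using assms by (intro Hom_module)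
  let ?x = "Comp C A B D g \<zero>\<^bsub>Hom C A B\<^esub>"
  have "?x \<oplus>\<^bsub>Hom C A D\<^esub> ?x = ?x" "?x \<in> mor A D"
    using assms Comp_add_right[of A B D g "\<zero>\<^bsub>Hom C A B\<^esub>" "\<zero>\<^bsub>Hom C A B\<^esub>"]
    by (simp_all add: mor_zero mor_l_zero Comp_closed)
  then show ?thesis by (metis M.add.r_cancel_one')
qed

lemma Comp_neg_left:
  assumes "A \<in> Ob C" "B \<in> Ob C" "D \<in> Ob C" "g \<in> mor B D" "f \<in> mor A B"
  shows "Comp C A B D (\<ominus>\<^bsub>Hom C B D\<^esub> g) f = \<ominus>\<^bsub>Hom C A D\<^esub> Comp C A B D g f"
proof -
  interpret M: module R "Hom C A D" using assms by (intro Hom_module)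
  have "Comp C A B D (\<ominus>\<^bsub>Hom C B D\<^esub> g) f \<oplus>\<^bsub>Hom C A D\<^esub> Comp C A B D g f = \<zero>\<^bsub>Hom C A D\<^esub>"
    using assms by (simp add: Comp_add_left[symmetric] mor_neg mor_l_neg Comp_zero_left)
  then show ?thesis using assms by (intro M.minus_equality[symmetric]) (auto simp: Comp_closed mor_neg)
qed

lemma Comp_neg_right:
  assumes "A \<in> Ob C" "B \<in> Ob C" "D \<in> Ob C" "g \<in> mor B D" "f \<in> mor A B"
  shows "Comp C A B D g (\<ominus>\<^bsub>Hom C A B\<^esub> f) = \<ominus>\<^bsub>Hom C A D\<^esub> Comp C A B D g f"
proof -
  interpret M: module R "Hom C A D" using assms by (intro Hom_module)
  have "Comp C A B D g (\<ominus>\<^bsub>Hom C A B\<^esub> f) \<oplus>\<^bsub>Hom C A D\<^esub> Comp C A B D g f = \<zero>\<^bsub>Hom C A D\<^esub>"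
    using assms by (simp add: Comp_add_right[symmetric] mor_neg mor_l_neg Comp_zero_right)
  then show ?thesis using assms by (intro M.minus_equality[symmetric]) (auto simp: Comp_closed mor_neg)
qed

lemma Comp_assoc_right:
  "\<lbrakk>A \<in> Ob C; B \<in> Ob C; D \<in> Ob C; E \<in> Ob C; h \<in> mor D E; g \<in> mor B D; f \<in> mor A B\<rbrakk>
   \<Longrightarrow> Comp C A B E (Comp C B D E h g) f = Comp C A D E h (Comp C A B D g f)"
  by (simp add: Comp_assoc)

text \<open>In composites nested to the right, an equation for \<open>p i\<close> can only be met in
  the shape \<open>p (i x)\<close>; this lemma puts it into that shape.\<close>

lemma Comp_Comp_eq:
  assumes "Comp C A S D p i = r" "A \<in> Ob C" "S \<in> Ob C" "D \<in> Ob C" "Z \<in> Ob C"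
    "p \<in> mor S D" "i \<in> mor A S" "x \<in> mor Z A"
  shows "Comp C Z S D p (Comp C Z A S i x) = Comp C Z A D r x"
  using assms by (simp add: Comp_assoc)

text \<open>A normal form: composites are nested to the right and expanded over sums, signs and
  scalars. Most block computations below are equalities of such normal forms up to
  \<open>mor_a_ac\<close>.\<close>

lemmas Comp_simps = Comp_closed Ident_closed Ident_left Ident_right Comp_assoc_right
  Comp_add_left Comp_add_right Comp_zero_left Comp_zero_right Comp_neg_left Comp_neg_right
  Comp_smult_left Comp_smult_right mor_zero mor_add mor_neg mor_smult
  mor_l_zero mor_r_zero mor_minus_zero mor_minus_minus mor_minus_add mor_r_neg mor_l_neg
  mor_r_neg1 mor_r_neg2

lemmas mor_a_ac = mor_a_assoc mor_a_comm mor_a_lcomm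

lemma Comp_finsum_right:
  assumes "A \<in> Ob C" "B \<in> Ob C" "D \<in> Ob C" "g \<in> mor B D" "f \<in> I \<rightarrow> mor A B"
  shows "Comp C A B D g (finsum (Hom C A B) f I) = finsum (Hom C A D) (\<lambda>i. Comp C A B D g (f i)) I"
proof -
  interpret M: module R "Hom C A B" using assms by (intro Hom_module)
  interpret N: module R "Hom C A D" using assms by (intro Hom_module)
  show ?thesis
    using assms(5)
  proof (induction I rule: infinite_finite_induct)
    case (insert x F)
    then have "f x \<in> mor A B" "f \<in> F \<rightarrow> mor A B" by auto
    then show ?case using insert assms(1-4)
      by (simp add: M.finsum_insert Pi_def Comp_closed Comp_add_right M.finsum_closed)
  qed (use assms in \<open>auto simp: Comp_zero_right\<close>)
qed

lemma Comp_finsum_left: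
  assumes "A \<in> Ob C" "B \<in> Ob C" "D \<in> Ob C" "f \<in> mor A B" "g \<in> I \<rightarrow> mor B D"
  shows "Comp C A B D (finsum (Hom C B D) g I) f = finsum (Hom C A D) (\<lambda>i. Comp C A B D (g i) f) I"
proof -
  interpret M: module R "Hom C B D" using assms by (intro Hom_module)
  interpret N: module R "Hom C A D" using assms by (intro Hom_module)
  show ?thesis
    using assms(5)
  proof (induction I rule: infinite_finite_induct)
    case (insert x F)
    then have "g x \<in> mor B D" "g \<in> F \<rightarrow> mor B D" by auto
    then show ?case using insert assms(1-4)
      by (simp add: M.finsum_insert Pi_def Comp_closed Comp_add_left M.finsum_closed)
  qed (use assms in \<open>auto simp: Comp_zero_left\<close>)
qed

lemma End_module: "A \<in> Ob C \<Longrightarrow> module R (End C A)"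
  using Hom_module[of A A] unfolding End_def module_def module_axioms_def
    abelian_group_def abelian_group_axioms_def abelian_monoid_def by simp

lemma End_ring:
  assumes A: "A \<in> Ob C"
  shows "ring (End C A)"
proof (rule ringI)
  interpret M: module R "End C A" by (rule End_module[OF A])
  show "abelian_group (End C A)" ..
  show "Group.monoid (End C A)"
    by (rule monoidI) (auto simp: End_def Comp_simps A)
qed (auto simp: End_def Comp_simps A)

lemma isomorphic_refl: "A \<in> Ob C \<Longrightarrow> isomorphic C A A"
  unfolding isomorphic_def inverse_pair_def by (intro exI[of _ "Ident C A"]) (simp add: Comp_simps)

lemma isomorphic_sym: "isomorphic C A B \<Longrightarrow> isomorphic C B A"
  unfolding isomorphic_def inverse_pair_def by blast

lemma isomorphic_trans:
  assumes "isomorphic C A B" "isomorphic C B D" and [simp]: "A \<in> Ob C" "B \<in> Ob C" "D \<in> Ob C"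
  shows "isomorphic C A D"
proof -
  obtain f g h k where [simp]: "f \<in> mor A B" "g \<in> mor B A" "h \<in> mor B D" "k \<in> mor D B"
    and e: "Comp C A B A g f = Ident C A" "Comp C B A B f g = Ident C B"
      "Comp C B D B k h = Ident C B" "Comp C D B D h k = Ident C D"
    using assms unfolding isomorphic_def inverse_pair_def by blast
  have "inverse_pair C A D (Comp C A B D h f) (Comp C D B A g k)"
    unfolding inverse_pair_def
    using Comp_Comp_eq[OF e(3), of A f] Comp_Comp_eq[OF e(2), of D k]
    by (simp add: Comp_simps e)
  then show ?thesis unfolding isomorphic_def by blast
qed

text \<open>The equation for the identity of \<open>S\<close> is solved for \<open>j q\<close>, so
  that rewriting removes \<open>j q\<close> in favour of \<open>i p\<close> and does not loop. The
  last five facts are the same equations with a further morphism composed on the right.\<close>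

lemma biproductD:
  assumes "biproduct C S A B i j p q"
  shows "S \<in> Ob C" "A \<in> Ob C" "B \<in> Ob C"
    "i \<in> mor A S" "j \<in> mor B S" "p \<in> mor S A" "q \<in> mor S B"
    "Comp C A S A p i = Ident C A" "Comp C B S B q j = Ident C B"
    "Comp C B S A p j = \<zero>\<^bsub>Hom C B A\<^esub>" "Comp C A S B q i = \<zero>\<^bsub>Hom C A B\<^esub>"
    "Comp C S B S j q = Ident C S \<oplus>\<^bsub>Hom C S S\<^esub> \<ominus>\<^bsub>Hom C S S\<^esub> Comp C S A S i p"
    "\<And>Z x. Z \<in> Ob C \<Longrightarrow> x \<in> mor Z A \<Longrightarrow> Comp C Z S A p (Comp C Z A S i x) = x"
    "\<And>Z x. Z \<in> Ob C \<Longrightarrow> x \<in> mor Z B \<Longrightarrow> Comp C Z S B q (Comp C Z B S j x) = x"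
    "\<And>Z x. Z \<in> Ob C \<Longrightarrow> x \<in> mor Z B \<Longrightarrow> Comp C Z S A p (Comp C Z B S j x) = \<zero>\<^bsub>Hom C Z A\<^esub>"
    "\<And>Z x. Z \<in> Ob C \<Longrightarrow> x \<in> mor Z A \<Longrightarrow> Comp C Z S B q (Comp C Z A S i x) = \<zero>\<^bsub>Hom C Z B\<^esub>"
    "\<And>Z x. Z \<in> Ob C \<Longrightarrow> x \<in> mor Z S \<Longrightarrow> Comp C Z B S j (Comp C Z S B q x)
       = x \<oplus>\<^bsub>Hom C Z S\<^esub> \<ominus>\<^bsub>Hom C Z S\<^esub> Comp C Z A S i (Comp C Z S A p x)"
proof -
  show c: "S \<in> Ob C" "A \<in> Ob C" "B \<in> Ob C"
    "i \<in> mor A S" "j \<in> mor B S" "p \<in> mor S A" "q \<in> mor S B"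
    and e: "Comp C A S A p i = Ident C A" "Comp C B S B q j = Ident C B"
    "Comp C B S A p j = \<zero>\<^bsub>Hom C B A\<^esub>" "Comp C A S B q i = \<zero>\<^bsub>Hom C A B\<^esub>"
    using assms unfolding biproduct_def by blast+
  show s: "Comp C S B S j q = Ident C S \<oplus>\<^bsub>Hom C S S\<^esub> \<ominus>\<^bsub>Hom C S S\<^esub> Comp C S A S i p"
    using assms c unfolding biproduct_def by (intro mor_eq_diff) (auto simp: Comp_closed)
  show "\<And>Z x. Z \<in> Ob C \<Longrightarrow> x \<in> mor Z A \<Longrightarrow> Comp C Z S A p (Comp C Z A S i x) = x"
    "\<And>Z x. Z \<in> Ob C \<Longrightarrow> x \<in> mor Z B \<Longrightarrow> Comp C Z S B q (Comp C Z B S j x) = x"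
    "\<And>Z x. Z \<in> Ob C \<Longrightarrow> x \<in> mor Z B \<Longrightarrow> Comp C Z S A p (Comp C Z B S j x) = \<zero>\<^bsub>Hom C Z A\<^esub>"
    "\<And>Z x. Z \<in> Ob C \<Longrightarrow> x \<in> mor Z A \<Longrightarrow> Comp C Z S B q (Comp C Z A S i x) = \<zero>\<^bsub>Hom C Z B\<^esub>"
    using c by (simp_all add: Comp_Comp_eq[OF e(1)] Comp_Comp_eq[OF e(2)] Comp_Comp_eq[OF e(3)]
        Comp_Comp_eq[OF e(4)] Comp_simps)
  show "\<And>Z x. Z \<in> Ob C \<Longrightarrow> x \<in> mor Z S \<Longrightarrow> Comp C Z B S j (Comp C Z S B q x)
       = x \<oplus>\<^bsub>Hom C Z S\<^esub> \<ominus>\<^bsub>Hom C Z S\<^esub> Comp C Z A S i (Comp C Z S A p x)"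
    using c by (simp add: Comp_Comp_eq[OF s] Comp_simps)
qed

lemma biproductI:
  assumes [simp]: "S \<in> Ob C" "A \<in> Ob C" "B \<in> Ob C"
    "i \<in> mor A S" "j \<in> mor B S" "p \<in> mor S A" "q \<in> mor S B"
    and "Comp C A S A p i = Ident C A" "Comp C B S B q j = Ident C B"
    "Comp C B S A p j = \<zero>\<^bsub>Hom C B A\<^esub>" "Comp C A S B q i = \<zero>\<^bsub>Hom C A B\<^esub>"
    and s: "Comp C S B S j q = Ident C S \<oplus>\<^bsub>Hom C S S\<^esub> \<ominus>\<^bsub>Hom C S S\<^esub> Comp C S A S i p"
  shows "biproduct C S A B i j p q"
  using assms unfolding biproduct_def by (simp add: s Comp_simps mor_a_ac)

lemma biproduct_sym: "biproduct C S A B i j p q \<Longrightarrow> biproduct C S B A j i q p"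
  unfolding biproduct_def by (auto simp: mor_a_comm Comp_closed)

lemma direct_sum_sym: "direct_sum C S A B \<Longrightarrow> direct_sum C S B A"
  unfolding direct_sum_iff_biproduct using biproduct_sym by blast

text \<open>The Schur complement: two complements agree up to isomorphism as soon as one summand maps
  isomorphically onto the other.\<close>

lemma complements_isomorphic:
  assumes b: "biproduct C A W Z i j p q" and b': "biproduct C A V Y i' j' p' q'"
    and u[simp]: "u \<in> mor W V" and u1: "Comp C V W V u (Comp C V A W p i') = Ident C V"
    and u2: "Comp C W V W (Comp C V A W p i') u = Ident C W"
  shows "isomorphic C Z Y"
proof -
  note D [simp] = biproductD(1-7)[OF b] biproductD(1-7)[OF b']
  note E [simp] = biproductD(8-)[OF b] biproductD(8-)[OF b']
  have u1' [simp]: "Comp C E W V u (Comp C E A W p (Comp C E V A i' x)) = x"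
    if "E \<in> Ob C" "x \<in> mor E V" for E x
    using Comp_Comp_eq[OF u1, of E x] that by (simp add: Comp_simps)
  have u2' [simp]: "Comp C E A W p (Comp C E V A i' (Comp C E W V u x)) = x"
    if "E \<in> Ob C" "x \<in> mor E W" for E x
    using Comp_Comp_eq[OF u2, of E x] that by (simp add: Comp_simps)
  \<comment> \<open>As \<open>u\<close> inverts \<open>p i'\<close>, the endomorphism
    \<open>i' u p\<close> of \<open>A\<close> is idempotent with image \<open>V\<close> and kernel
    \<open>Z\<close>. Its complement therefore carries \<open>Y\<close> onto \<open>Z\<close>,
    inverse to the component \<open>g\<close> from \<open>Z\<close> to \<open>Y\<close>.\<close>
  define f where "f = Comp C Y A Z q (j' \<oplus>\<^bsub>Hom C Y A\<^esub> \<ominus>\<^bsub>Hom C Y A\<^esub>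
    Comp C Y V A i' (Comp C Y W V u (Comp C Y A W p j')))"
  define g where "g = Comp C Z A Y q' j"
  have fc [simp]: "f \<in> mor Y Z" and gc [simp]: "g \<in> mor Z Y"
    unfolding f_def g_def by (simp_all add: Comp_simps)
  have "Comp C Z Y Z f g = Ident C Z" unfolding f_def g_def
    by (simp add: Comp_simps mor_a_ac)
  moreover have "Comp C Y Z Y g f = Ident C Y" unfolding f_def g_def
    by (simp add: Comp_simps mor_a_ac)
  ultimately show ?thesis unfolding isomorphic_def inverse_pair_def using fc gc by blast
qed

text \<open>The complement is the image of the idempotent \<open>1 - i p\<close>. Both
  \<open>j\<close> and \<open>q\<close> absorb this idempotent, while \<open>p\<close> and
  \<open>i\<close> kill it, which gives the mixed equations.\<close>

lemma biproduct_of_retract: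
  assumes "idempotents_split C" and [simp]: "A \<in> Ob C" "W \<in> Ob C" "i \<in> mor W A" "p \<in> mor A W"
    and pi [simp]: "Comp C W A W p i = Ident C W"
  shows "\<exists>Z j q. biproduct C A W Z i j p q"
proof -
  have pi' [simp]: "Comp C E A W p (Comp C E W A i x) = x" if "E \<in> Ob C" "x \<in> mor E W" for E x
    using Comp_Comp_eq[OF pi, of E x] that by (simp add: Comp_simps)
  define e where "e = Ident C A \<oplus>\<^bsub>Hom C A A\<^esub> \<ominus>\<^bsub>Hom C A A\<^esub> Comp C A W A i p"
  have "e \<in> mor A A" "Comp C A A A e e = e" unfolding e_def by (simp_all add: Comp_simps)
  then obtain Z q j where [simp]: "Z \<in> Ob C" "q \<in> mor A Z" "j \<in> mor Z A"
    and jq: "Comp C A Z A j q = e" and qj [simp]: "Comp C Z A Z q j = Ident C Z"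
    using assms(1) unfolding idempotents_split_def by (metis assms(2))
  have qj' [simp]: "Comp C E A Z q (Comp C E Z A j x) = x" if "E \<in> Ob C" "x \<in> mor E Z" for E x
    using Comp_Comp_eq[OF qj, of E x] that by (simp add: Comp_simps)
  have j: "j = Comp C Z A A e j" and q: "q = Comp C A A Z q e"
    unfolding jq[symmetric] by (simp_all add: Comp_simps)
  have "Comp C Z A W p j = \<zero>\<^bsub>Hom C Z W\<^esub>"
    by (subst j) (simp add: e_def Comp_simps)
  moreover have "Comp C W A Z q i = \<zero>\<^bsub>Hom C W Z\<^esub>"
    by (subst q) (simp add: e_def Comp_simps)
  ultimately have "biproduct C A W Z i j p q"
    by (intro biproductI) (simp_all add: jq e_def)
  then show ?thesis by blast
qed

text \<open>Associativity read inside \<open>S\<close>: the complement \<open>Z\<close> of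
  \<open>V\<close> comes from splitting an idempotent and is only afterwards recognized as a sum of
  \<open>A'\<close> and \<open>B\<close>. The embedding and projection of \<open>V\<close> are kept
  explicit because the exchange argument compares them with others.\<close>

lemma biproduct_assoc:
  assumes sp: "idempotents_split C" and b: "biproduct C S A B i j p q"
    and b': "biproduct C A V A' i' j' p' q'"
  shows "\<exists>Z k r. biproduct C S V Z (Comp C V A S i i') k (Comp C S A V p' p) r \<and> direct_sum C Z A' B"
proof -
  note D [simp] = biproductD(1-7)[OF b] biproductD(1-7)[OF b']
  note E [simp] = biproductD(8-)[OF b] biproductD(8-)[OF b']
  obtain Z k r where z: "biproduct C S V Z (Comp C V A S i i') k (Comp C S A V p' p) r"
    using biproduct_of_retract[OF sp, of S V "Comp C V A S i i'" "Comp C S A V p' p"]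
    by (auto simp: Comp_simps)
  note DZ [simp] = biproductD(1-3,5,7)[OF z]
  note EZ = biproductD(8-)[OF z]
  have kr: "Comp C E Z S k (Comp C E S Z r x) = x \<oplus>\<^bsub>Hom C E S\<^esub> \<ominus>\<^bsub>Hom C E S\<^esub>
      Comp C E A S i (Comp C E V A i' (Comp C E A V p' (Comp C E S A p x)))"
    if "E \<in> Ob C" "x \<in> mor E S" for E x
    using EZ(10)[of E x] that by (simp add: Comp_simps)
  have rk: "Comp C E S Z r (Comp C E Z S k x) = x" if "E \<in> Ob C" "x \<in> mor E Z" for E x
    using EZ(7) that by simp
  have pk0: "Comp C Z A V p' (Comp C Z S A p k) = \<zero>\<^bsub>Hom C Z V\<^esub>"
    using EZ(3) by (simp add: Comp_simps)
  have "biproduct C Z A' B (Comp C A' S Z r (Comp C A' A S i j')) (Comp C B S Z r j)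
     (Comp C Z A A' q' (Comp C Z S A p k)) (Comp C Z S B q k)"
  proof (rule biproductI)
    have "Comp C Z B Z (Comp C B S Z r j) (Comp C Z S B q k)
      = Comp C Z S Z r (Comp C Z B S j (Comp C Z S B q k))" by (simp add: Comp_simps)
    also have "\<dots> = Ident C Z \<oplus>\<^bsub>Hom C Z Z\<^esub> \<ominus>\<^bsub>Hom C Z Z\<^esub>
        Comp C Z S Z r (Comp C Z A S i (Comp C Z S A p k))"
      using EZ(2) by (simp add: Comp_simps)
    also have "Comp C Z S Z r (Comp C Z A S i (Comp C Z S A p k))
      = Comp C Z A' Z (Comp C A' S Z r (Comp C A' A S i j')) (Comp C Z A A' q' (Comp C Z S A p k))"
      using pk0 by (simp add: Comp_simps)
    finally show "Comp C Z B Z (Comp C B S Z r j) (Comp C Z S B q k) = Ident C Z \<oplus>\<^bsub>Hom C Z Z\<^esub> \<ominus>\<^bsub>Hom C Z Z\<^esub>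
      Comp C Z A' Z (Comp C A' S Z r (Comp C A' A S i j')) (Comp C Z A A' q' (Comp C Z S A p k))" .
  qed (simp_all add: Comp_simps kr)
  then show ?thesis using z unfolding direct_sum_iff_biproduct by blast
qed

end

section \<open>Krull-Schmidt decompositions\<close>

text \<open>Each tail decomposes a complement inside the given object, and the empty list stands for
  any zero object; objects are thus taken apart without forming new direct sums.\<close>

fun summands :: "('k, 'o, 'm) rcat \<Rightarrow> 'o \<Rightarrow> 'o list \<Rightarrow> bool" where
  "summands C A [] \<longleftrightarrow> zero_object C A"
| "summands C A (W # Ws) \<longleftrightarrow> (\<exists>B. direct_sum C A W B \<and> summands C B Ws)"

definition iso_rep :: "('k, 'o, 'm) rcat \<Rightarrow> 'o \<Rightarrow> 'o" where
  "iso_rep C A = (SOME B. B \<in> Ob C \<and> isomorphic C A B)"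

context R_category
begin

lemma iso_rep:
  assumes "A \<in> Ob C"
  shows "iso_rep C A \<in> Ob C" "isomorphic C A (iso_rep C A)"
proof -
  have "\<exists>B. B \<in> Ob C \<and> isomorphic C A B" using assms isomorphic_refl by blast
  then show "iso_rep C A \<in> Ob C" "isomorphic C A (iso_rep C A)"
    unfolding iso_rep_def by (metis (mono_tags, lifting) someI_ex)+
qed

lemma iso_rep_eq_iff:
  assumes "A \<in> Ob C" "B \<in> Ob C"
  shows "iso_rep C A = iso_rep C B \<longleftrightarrow> isomorphic C A B"
proof
  assume "iso_rep C A = iso_rep C B"
  then show "isomorphic C A B"
    using iso_rep[OF assms(1)] iso_rep[OF assms(2)] assms isomorphic_trans isomorphic_sym by metis
next
  assume "isomorphic C A B"
  then have "(E \<in> Ob C \<and> isomorphic C A E) = (E \<in> Ob C \<and> isomorphic C B E)" for E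
    using assms isomorphic_trans isomorphic_sym by blast
  then show "iso_rep C A = iso_rep C B" unfolding iso_rep_def by simp
qed

lemma direct_sum_Ob: "direct_sum C S A B \<Longrightarrow> S \<in> Ob C \<and> A \<in> Ob C \<and> B \<in> Ob C"
  unfolding direct_sum_def by blast

lemma mor_to_zero: "zero_object C Z \<Longrightarrow> A \<in> Ob C \<Longrightarrow> f \<in> mor A Z \<Longrightarrow> f = \<zero>\<^bsub>Hom C A Z\<^esub>"
  unfolding zero_object_def using Ident_left[of A Z f] Comp_zero_left[of A Z Z f] by simp

lemma mor_from_zero: "zero_object C Z \<Longrightarrow> A \<in> Ob C \<Longrightarrow> f \<in> mor Z A \<Longrightarrow> f = \<zero>\<^bsub>Hom C Z A\<^esub>"
  unfolding zero_object_def using Ident_right[of Z A f] Comp_zero_right[of Z Z A f] by simp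

lemma zero_objects_isomorphic:
  assumes "zero_object C Y" "zero_object C Z"
  shows "isomorphic C Y Z"
  using assms unfolding isomorphic_def inverse_pair_def zero_object_def
  by (intro exI[of _ "\<zero>\<^bsub>Hom C Y Z\<^esub>"] exI[of _ "\<zero>\<^bsub>Hom C Z Y\<^esub>"]) (simp add: Comp_simps)

lemma direct_sum_zero:
  assumes "direct_sum C S A B" "zero_object C A"
  shows "isomorphic C S B"
proof -
  obtain i j p q where b: "biproduct C S A B i j p q" using assms direct_sum_iff_biproduct by metis
  note D [simp] = biproductD(1-7)[OF b]
  note E = biproductD(8-)[OF b]
  have "p = \<zero>\<^bsub>Hom C S A\<^esub>" using mor_to_zero[OF assms(2)] by simp
  then have "Comp C S B S j q = Ident C S" using E(5) by (simp add: Comp_simps)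
  then show ?thesis unfolding isomorphic_def inverse_pair_def using E(2) by (intro exI[of _ q] exI[of _ j]) simp
qed

lemma direct_sum_iso:
  assumes "direct_sum C S A B" "direct_sum C S' A' B'" "isomorphic C A A'" "isomorphic C B B'"
  shows "isomorphic C S S'"
proof -
  obtain i j p q where b: "biproduct C S A B i j p q" using assms direct_sum_iff_biproduct by metis
  obtain i' j' p' q' where b': "biproduct C S' A' B' i' j' p' q'" using assms direct_sum_iff_biproduct by metis
  obtain f g where fg: "inverse_pair C A A' f g" using assms(3) isomorphic_def by metis
  obtain h k where hk: "inverse_pair C B B' h k" using assms(4) isomorphic_def by metis
  note D [simp] = biproductD(1-7)[OF b] biproductD(1-7)[OF b']
  note E [simp] = biproductD(8-)[OF b] biproductD(8-)[OF b']
  have [simp]: "f \<in> mor A A'" "g \<in> mor A' A" "h \<in> mor B B'" "k \<in> mor B' B"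
    and e: "Comp C A A' A g f = Ident C A" "Comp C A' A A' f g = Ident C A'"
      "Comp C B B' B k h = Ident C B" "Comp C B' B B' h k = Ident C B'"
    using fg hk unfolding inverse_pair_def by auto
  have [simp]: "Comp C E A' A g (Comp C E A A' f x) = x" if "E \<in> Ob C" "x \<in> mor E A" for E x
    using Comp_Comp_eq[OF e(1), of E x] that by (simp add: Comp_simps)
  have [simp]: "Comp C E A A' f (Comp C E A' A g x) = x" if "E \<in> Ob C" "x \<in> mor E A'" for E x
    using Comp_Comp_eq[OF e(2), of E x] that by (simp add: Comp_simps)
  have [simp]: "Comp C E B' B k (Comp C E B B' h x) = x" if "E \<in> Ob C" "x \<in> mor E B" for E x
    using Comp_Comp_eq[OF e(3), of E x] that by (simp add: Comp_simps)
  have [simp]: "Comp C E B B' h (Comp C E B' B k x) = x" if "E \<in> Ob C" "x \<in> mor E B'" for E x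
    using Comp_Comp_eq[OF e(4), of E x] that by (simp add: Comp_simps)
  define F where "F = Comp C S A S' (Comp C A A' S' i' f) p \<oplus>\<^bsub>Hom C S S'\<^esub> Comp C S B S' (Comp C B B' S' j' h) q"
  define G where "G = Comp C S' A' S (Comp C A' A S i g) p' \<oplus>\<^bsub>Hom C S' S\<^esub> Comp C S' B' S (Comp C B' B S j k) q'"
  have [simp]: "F \<in> mor S S'" "G \<in> mor S' S" unfolding F_def G_def by (simp_all add: Comp_simps)
  have "Comp C S S' S G F = Ident C S" "Comp C S' S S' F G = Ident C S'"
    unfolding F_def G_def by (simp_all add: Comp_simps mor_a_ac)
  then show ?thesis unfolding isomorphic_def inverse_pair_def by (intro exI[of _ F] exI[of _ G]) simp
qed

lemma direct_sum_iso_sum: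
  assumes "direct_sum C S A B" "isomorphic C S S'" "S' \<in> Ob C"
  shows "direct_sum C S' A B"
proof -
  obtain i j p q where b: "biproduct C S A B i j p q" using assms direct_sum_iff_biproduct by metis
  obtain f g where fg: "inverse_pair C S S' f g" using assms(2) isomorphic_def by metis
  note D [simp] = biproductD(1-7)[OF b] assms(3)
  note E [simp] = biproductD(8-)[OF b]
  have [simp]: "f \<in> mor S S'" "g \<in> mor S' S"
    and e: "Comp C S S' S g f = Ident C S" "Comp C S' S S' f g = Ident C S'"
    using fg unfolding inverse_pair_def by auto
  have [simp]: "Comp C E S' S g (Comp C E S S' f x) = x" if "E \<in> Ob C" "x \<in> mor E S" for E x
    using Comp_Comp_eq[OF e(1), of E x] that by (simp add: Comp_simps)
  have "biproduct C S' A B (Comp C A S S' f i) (Comp C B S S' f j) (Comp C S' S A p g) (Comp C S' S B q g)"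
    by (rule biproductI) (simp_all add: Comp_simps e)
  then show ?thesis unfolding direct_sum_iff_biproduct by blast
qed

lemma summands_Ob: "summands C A Ws \<Longrightarrow> A \<in> Ob C \<and> set Ws \<subseteq> Ob C"
proof (induction Ws arbitrary: A)
  case Nil
  then show ?case by (simp add: zero_object_def)
next
  case (Cons W Ws)
  then show ?case using direct_sum_Ob by auto
qed

lemma summands_iso:
  assumes "summands C A Ws" "isomorphic C A B" "B \<in> Ob C"
  shows "summands C B Ws"
proof (cases Ws)
  case Nil
  then have z: "zero_object C A" using assms by simp
  obtain f g where fg: "f \<in> mor A B" "g \<in> mor B A" "Comp C B A B f g = Ident C B"
    using assms(2) unfolding isomorphic_def inverse_pair_def by blast
  have "A \<in> Ob C" using z unfolding zero_object_def by blast
  moreover have "f = \<zero>\<^bsub>Hom C A B\<^esub>" using mor_from_zero[OF z] fg assms by blast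
  ultimately have "Ident C B = \<zero>\<^bsub>Hom C B B\<^esub>" using fg assms Comp_zero_left by metis
  then show ?thesis using assms(3) Nil by (simp add: zero_object_def)
next
  case (Cons W Vs)
  then show ?thesis using assms direct_sum_iso_sum unfolding Cons summands.simps by blast
qed

end

text \<open>Finite dimension of the endomorphism rings is used twice: the dimension decreases along
  proper summands, which yields existence, and Fitting's alternative makes endomorphism rings of
  indecomposables local, which yields uniqueness.\<close>

locale krull_schmidt = R_category +
  assumes scalar_field: "field R"
    and split: "idempotents_split C"
    and fin: "A \<in> Ob C \<Longrightarrow> \<exists>n. all_dependent R (End C A) n"
begin

lemma direct_sum_assoc:
  assumes "direct_sum C S A B" "direct_sum C A V A'"
  shows "\<exists>Z. direct_sum C S V Z \<and> direct_sum C Z A' B"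
  using assms biproduct_assoc[OF split] unfolding direct_sum_iff_biproduct by meson

lemma summands_append:
  assumes "direct_sum C S A B" "summands C A Vs" "summands C B Us"
  shows "summands C S (Vs @ Us)"
  using assms
proof (induction Vs arbitrary: S A)
  case Nil
  then have "isomorphic C B S" using direct_sum_zero isomorphic_sym by (metis summands.simps(1))
  then show ?case using summands_iso[OF Nil(3)] direct_sum_Ob Nil(1) by simp
next
  case (Cons V Vs)
  then obtain A' where A': "direct_sum C A V A'" "summands C A' Vs" by auto
  obtain Z where Z: "direct_sum C S V Z" "direct_sum C Z A' B"
    using direct_sum_assoc[OF Cons(2) A'(1)] by blast
  then show ?case using Cons.IH[OF Z(2) A'(2) Cons(4)] by auto
qed

lemma summands_extract:
  assumes "summands C A (Us @ V # Vs)"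
  shows "\<exists>Y. direct_sum C A V Y \<and> summands C Y (Us @ Vs)"
  using assms
proof (induction Us arbitrary: A)
  case Nil
  then show ?case by simp
next
  case (Cons U Us)
  then obtain B where B: "direct_sum C A U B" "summands C B (Us @ V # Vs)" by auto
  then obtain Y where Y: "direct_sum C B V Y" "summands C Y (Us @ Vs)" using Cons.IH by blast
  obtain Z where Z: "direct_sum C A V Z" "direct_sum C Z Y U"
    using direct_sum_assoc[OF direct_sum_sym[OF B(1)] Y(1)] by blast
  then show ?case using Y(2) direct_sum_sym[OF Z(2)] by auto
qed

text \<open>One more than the dimension of the endomorphism ring.\<close>

definition rank :: "'b \<Rightarrow> nat" where
  "rank A = (LEAST n. all_dependent R (End C A) n)"

lemma finsum_End: "finsum (End C A) = finsum (Hom C A A)"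
  unfolding finsum_def End_def by simp

text \<open>If a family \<open>y\<close> is independent in the endomorphisms of \<open>B\<close>,
  then the \<open>i y p\<close> together with the idempotent \<open>j q\<close> are independent for
  \<open>A\<close>: compressing a relation to \<open>B'\<close> kills the coefficient of
  \<open>j q\<close>, and compressing it to \<open>B\<close> leaves a relation between the
  \<open>y\<close>. The proof runs contrapositively.\<close>

lemma rank_less:
  assumes b: "direct_sum C A B B'" and nz: "\<not> zero_object C B'"
  shows "rank B < rank A"
proof -
  interpret F: field R by (rule scalar_field)
  obtain i j p q where b: "biproduct C A B B' i j p q" using b direct_sum_iff_biproduct by metis
  note D [simp] = biproductD(1-7)[OF b]
  note E [simp] = biproductD(8-)[OF b]
  interpret MA: module R "Hom C A A" by (rule Hom_module) simp_all
  interpret MB: module R "Hom C B B" by (rule Hom_module) simp_all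
  interpret MB': module R "Hom C B' B'" by (rule Hom_module) simp_all
  have dep: "all_dependent R (End C A) (rank A)"
    unfolding rank_def using fin[of A] by (metis (mono_tags, lifting) D(1) LeastI_ex)
  have "rank A \<noteq> 0"
  proof
    assume "rank A = 0"
    then show False using dep by (simp add: all_dependent_def)
  qed
  then obtain m where m: "rank A = Suc m" using not0_implies_Suc by blast
  have "all_dependent R (End C B) m"
    unfolding all_dependent_def
  proof
    fix y assume "y \<in> {..<m} \<rightarrow> carrier (End C B)"
    then have y [simp]: "y k \<in> mor B B" if "k < m" for k using that by (auto simp: End_def)
    \<comment> \<open>The last slot \<open>m\<close> holds the idempotent of \<open>B'\<close>, the
      extra vector responsible for the drop of the rank.\<close>
    define y' where "y' k = (if k < m then Comp C A B A i (Comp C A B B (y k) p) else Comp C A B' A j q)" for k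
    have y'c: "y' k \<in> mor A A" for k unfolding y'_def by (simp add: Comp_closed del: E)
    obtain c where c: "\<And>k. k < Suc m \<Longrightarrow> c k \<in> carrier R" "\<exists>k<Suc m. c k \<noteq> \<zero>\<^bsub>R\<^esub>"
      and sum: "finsum (End C A) (\<lambda>k. c k \<odot>\<^bsub>End C A\<^esub> y' k) {..<Suc m} = \<zero>\<^bsub>End C A\<^esub>"
      using dep[unfolded m all_dependent_def, rule_format, of y'] y'c by (auto simp: End_def Pi_def)
    define s where "s = finsum (Hom C B B) (\<lambda>k. c k \<odot>\<^bsub>Hom C B B\<^esub> y k) {..<m}"
    have cy: "(\<lambda>k. c k \<odot>\<^bsub>Hom C B B\<^esub> y k) \<in> {..<m} \<rightarrow> mor B B" using c(1) by (auto simp: mor_smult)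
    have sc [simp]: "s \<in> mor B B" unfolding s_def using cy by (rule MB.finsum_closed)
    have cm [simp]: "c m \<in> carrier R" using c(1) by simp
    have "finsum (Hom C A A) (\<lambda>k. c k \<odot>\<^bsub>Hom C A A\<^esub> y' k) {..<m} = Comp C A B A i (Comp C A B B s p)"
    proof -
      have "Comp C A B A i (Comp C A B B s p)
          = finsum (Hom C A A) (\<lambda>k. Comp C A B A i (Comp C A B B (c k \<odot>\<^bsub>Hom C B B\<^esub> y k) p)) {..<m}"
        unfolding s_def using cy
        by (subst Comp_finsum_left, simp_all, subst Comp_finsum_right) (auto simp: Comp_closed Pi_def)
      also have "\<dots> = finsum (Hom C A A) (\<lambda>k. c k \<odot>\<^bsub>Hom C A A\<^esub> y' k) {..<m}"
        using c(1) by (intro MA.finsum_cong') (auto simp: y'_def Comp_simps)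
      finally show ?thesis ..
    qed
    moreover have "(\<lambda>k. c k \<odot>\<^bsub>Hom C A A\<^esub> y' k) \<in> {..<m} \<rightarrow> mor A A"
      using c(1) y'c by (auto simp: mor_smult)
    ultimately have "finsum (Hom C A A) (\<lambda>k. c k \<odot>\<^bsub>Hom C A A\<^esub> y' k) {..<Suc m}
        = c m \<odot>\<^bsub>Hom C A A\<^esub> y' m \<oplus>\<^bsub>Hom C A A\<^esub> Comp C A B A i (Comp C A B B s p)"
      using y'c[of m] unfolding lessThan_Suc by (subst MA.finsum_insert) (auto simp: mor_smult)
    then have z: "c m \<odot>\<^bsub>Hom C A A\<^esub> Comp C A B' A j q \<oplus>\<^bsub>Hom C A A\<^esub> Comp C A B A i (Comp C A B B s p) = \<zero>\<^bsub>Hom C A A\<^esub>"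
      using sum unfolding finsum_End by (simp add: End_def y'_def)
    have "Comp C B' A B' q (Comp C B' A A (c m \<odot>\<^bsub>Hom C A A\<^esub> Comp C A B' A j q \<oplus>\<^bsub>Hom C A A\<^esub> Comp C A B A i (Comp C A B B s p)) j)
        = c m \<odot>\<^bsub>Hom C B' B'\<^esub> Ident C B'"
      by (simp add: Comp_simps del: E(5))
    then have cmz: "c m \<odot>\<^bsub>Hom C B' B'\<^esub> Ident C B' = \<zero>\<^bsub>Hom C B' B'\<^esub>"
      unfolding z by (simp add: Comp_simps)
    have "c m = \<zero>\<^bsub>R\<^esub>"
    proof (rule ccontr)
      assume "c m \<noteq> \<zero>\<^bsub>R\<^esub>"
      then have u: "inv\<^bsub>R\<^esub> c m \<in> carrier R" "inv\<^bsub>R\<^esub> c m \<otimes>\<^bsub>R\<^esub> c m = \<one>\<^bsub>R\<^esub>" using F.field_Units by auto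
      have "Ident C B' = inv\<^bsub>R\<^esub> c m \<odot>\<^bsub>Hom C B' B'\<^esub> (c m \<odot>\<^bsub>Hom C B' B'\<^esub> Ident C B')"
        using u by (simp add: MB'.smult_assoc1[symmetric] Ident_closed)
      then show False using u nz unfolding cmz zero_object_def by simp
    qed
    then have ex: "\<exists>k<m. c k \<noteq> \<zero>\<^bsub>R\<^esub>" using c(2) by (metis less_Suc_eq)
    have "Comp C B A B p (Comp C B A A (c m \<odot>\<^bsub>Hom C A A\<^esub> Comp C A B' A j q \<oplus>\<^bsub>Hom C A A\<^esub> Comp C A B A i (Comp C A B B s p)) i) = s"
      by (simp add: Comp_simps del: E(5))
    then have "s = \<zero>\<^bsub>Hom C B B\<^esub>" unfolding z by (simp add: Comp_simps)
    then have "finsum (End C B) (\<lambda>k. c k \<odot>\<^bsub>End C B\<^esub> y k) {..<m} = \<zero>\<^bsub>End C B\<^esub>"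
      unfolding finsum_End s_def by (simp add: End_def)
    moreover have "c \<in> {..<m} \<rightarrow> carrier R" using c(1) by auto
    ultimately show "\<exists>c\<in>{..<m} \<rightarrow> carrier R. (\<exists>k<m. c k \<noteq> \<zero>\<^bsub>R\<^esub>) \<and>
        finsum (End C B) (\<lambda>k. c k \<odot>\<^bsub>End C B\<^esub> y k) {..<m} = \<zero>\<^bsub>End C B\<^esub>"
      using ex by blast
  qed
  then have "rank B \<le> m" unfolding rank_def by (rule Least_le)
  then show ?thesis using m by simp
qed

text \<open>A zero object is needed to close the list; it arises as the complement of
  \<open>A\<close> in itself, by splitting the idempotent \<open>0\<close>.\<close>

lemma summands_singleton:
  assumes "A \<in> Ob C"
  shows "summands C A [A]"
proof -
  have "Comp C A A A (Ident C A) (Ident C A) = Ident C A" using assms by (simp add: Comp_simps)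
  then obtain Z j q where b: "biproduct C A A Z (Ident C A) j (Ident C A) q"
    using biproduct_of_retract[OF split] assms Ident_closed by metis
  note D [simp] = biproductD(1-7)[OF b]
  have "j = \<zero>\<^bsub>Hom C Z A\<^esub>" using biproductD(10)[OF b] by (simp add: Comp_simps)
  then have "zero_object C Z" using biproductD(9)[OF b] unfolding zero_object_def by (simp add: Comp_simps)
  moreover have "direct_sum C A A Z" using b unfolding direct_sum_iff_biproduct by blast
  ultimately show ?thesis by auto
qed

lemma summands_exist:
  assumes "A \<in> Ob C"
  shows "\<exists>Ws. summands C A Ws \<and> (\<forall>W\<in>set Ws. indecomposable C W)"
  using assms
proof (induction "rank A" arbitrary: A rule: less_induct)
  case less
  consider "zero_object C A" | "indecomposable C A"
    | B B' where "direct_sum C A B B'" "\<not> zero_object C B" "\<not> zero_object C B'"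
    using less.prems unfolding indecomposable_def by blast
  then show ?case
  proof cases
    case 1
    then show ?thesis by (intro exI[of _ "[]"]) simp
  next
    case 2
    have "summands C A [A]" by (rule summands_singleton[OF less.prems])
    then show ?thesis using 2 by (intro exI[of _ "[A]"]) simp
  next
    case 3
    then have "rank B < rank A" "rank B' < rank A" "B \<in> Ob C" "B' \<in> Ob C"
      using rank_less direct_sum_sym direct_sum_Ob by blast+
    then obtain Ws Ws' where "summands C B Ws" "summands C B' Ws'"
      "\<forall>W\<in>set Ws. indecomposable C W" "\<forall>W\<in>set Ws'. indecomposable C W"
      using less.hyps by metis
    then show ?thesis using summands_append[OF 3(1)] by (intro exI[of _ "Ws @ Ws'"]) auto
  qed
qed

lemma indecomposable_idempotent:
  assumes W: "indecomposable C W" and [simp]: "e \<in> mor W W" and ee: "Comp C W W W e e = e"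
  shows "e = \<zero>\<^bsub>Hom C W W\<^esub> \<or> e = Ident C W"
proof -
  have [simp]: "W \<in> Ob C" using W unfolding indecomposable_def by blast
  obtain B p i where [simp]: "B \<in> Ob C" "p \<in> mor W B" "i \<in> mor B W"
    and e: "Comp C W B W i p = e" "Comp C B W B p i = Ident C B"
    using split ee unfolding idempotents_split_def by (metis \<open>W \<in> Ob C\<close> assms(2))
  obtain Z j q where b: "biproduct C W B Z i j p q"
    using biproduct_of_retract[OF split _ _ _ _ e(2)] by auto
  note D [simp] = biproductD(1-7)[OF b]
  have "zero_object C B \<or> zero_object C Z"
    using W b unfolding indecomposable_def direct_sum_iff_biproduct by blast
  then show ?thesis
  proof
    assume "zero_object C B"
    then have "p = \<zero>\<^bsub>Hom C W B\<^esub>" by (intro mor_to_zero) simp_all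
    then show ?thesis using e(1) by (simp add: Comp_simps)
  next
    assume "zero_object C Z"
    then have "q = \<zero>\<^bsub>Hom C W Z\<^esub>" by (intro mor_to_zero) simp_all
    then have "Ident C W = e \<oplus>\<^bsub>Hom C W W\<^esub> \<zero>\<^bsub>Hom C W W\<^esub>"
      using b e(1) unfolding biproduct_def by (simp add: Comp_simps)
    then show ?thesis by (simp add: Comp_simps)
  qed
qed

text \<open>Fitting's alternative for \<open>x\<close>, where \<open>y\<close> is
  \<open>1 - x\<close>. Indecomposability supplies its assumption that there are no idempotents
  besides \<open>0\<close> and \<open>1\<close>.\<close>

lemma indecomposable_local:
  assumes W: "indecomposable C W" and c: "x \<in> mor W W" "y \<in> mor W W"
    and s: "x \<oplus>\<^bsub>Hom C W W\<^esub> y = Ident C W"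
  shows "(\<exists>v\<in>mor W W. Comp C W W W v x = Ident C W \<and> Comp C W W W x v = Ident C W)
    \<or> (\<exists>v\<in>mor W W. Comp C W W W v y = Ident C W \<and> Comp C W W W y v = Ident C W)"
proof -
  have [simp]: "W \<in> Ob C" using W unfolding indecomposable_def by blast
  interpret E: ring "End C W" by (rule End_ring) simp
  obtain n where "all_dependent R (End C W) n" using fin by fastforce
  then have "x \<in> Units (End C W) \<or> \<one>\<^bsub>End C W\<^esub> \<ominus>\<^bsub>End C W\<^esub> x \<in> Units (End C W)"
    using c indecomposable_idempotent[OF W]
    by (intro fitting_alternative[OF End_module End_ring scalar_field])
      (auto simp: End_def Comp_smult_left Comp_smult_right)
  moreover have "\<one>\<^bsub>End C W\<^esub> \<ominus>\<^bsub>End C W\<^esub> x = y"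
  proof -
    have "\<one>\<^bsub>End C W\<^esub> = x \<oplus>\<^bsub>End C W\<^esub> y" "x \<in> carrier (End C W)" "y \<in> carrier (End C W)"
      using s c by (auto simp: End_def)
    then show ?thesis by (simp add: a_minus_def E.a_assoc E.r_neg2 E.a_comm[of _ "\<ominus>\<^bsub>End C W\<^esub> x"] E.r_neg1)
  qed
  ultimately show ?thesis unfolding Units_def End_def by auto
qed

text \<open>The identity of \<open>W\<close> is a sum of an endomorphism through \<open>V\<close>
  and one through \<open>Y\<close>, so one of them is invertible. In the first case \<open>V\<close>
  is isomorphic to \<open>W\<close> and the two complements agree. In the second \<open>W\<close> is
  a retract of \<open>Y\<close>, and the induction continues there.\<close>

lemma exchange:
  assumes W: "indecomposable C W" and "summands C A Vs" "\<forall>V\<in>set Vs. indecomposable C V"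
    and "biproduct C A W Z i j p q"
  shows "\<exists>Us V Us'. Vs = Us @ V # Us' \<and> isomorphic C V W \<and> summands C Z (Us @ Us')"
  using assms(2-)
proof (induction Vs arbitrary: A Z i j p q)
  case Nil
  note D [simp] = biproductD(1-7)[OF Nil(3)]
  have "i = \<zero>\<^bsub>Hom C W A\<^esub>" using Nil by (intro mor_to_zero) simp_all
  then have "Ident C W = \<zero>\<^bsub>Hom C W W\<^esub>" using biproductD(8)[OF Nil(3)] by (simp add: Comp_simps)
  then show ?case using W unfolding indecomposable_def zero_object_def by simp
next
  case (Cons V Vs)
  note b = Cons.prems(3)
  obtain Y where Y: "direct_sum C A V Y" "summands C Y Vs" using Cons.prems by auto
  obtain i' j' p' q' where b': "biproduct C A V Y i' j' p' q'" using Y direct_sum_iff_biproduct by metis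
  note D [simp] = biproductD(1-7)[OF b] biproductD(1-7)[OF b']
  note E [simp] = biproductD(8,13)[OF b] biproductD(8,13)[OF b']
  have V: "indecomposable C V" using Cons.prems by simp
  have nzW: "Ident C W \<noteq> \<zero>\<^bsub>Hom C W W\<^esub>" using W unfolding indecomposable_def zero_object_def by simp
  let ?x = "Comp C W A W p (Comp C W V A i' (Comp C W A V p' i))"
  let ?y = "Comp C W A W p (Comp C W Y A j' (Comp C W A Y q' i))"
  have "?x \<oplus>\<^bsub>Hom C W W\<^esub> ?y = Ident C W"
    using biproductD(17)[OF b', of W i] by (simp add: Comp_simps mor_a_ac)
  then consider v where "v \<in> mor W W" "Comp C W W W v ?x = Ident C W" "Comp C W W W ?x v = Ident C W"
    | v where "v \<in> mor W W" "Comp C W W W v ?y = Ident C W" "Comp C W W W ?y v = Ident C W"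
    using indecomposable_local[OF W, of ?x ?y] by (auto simp: Comp_closed)
  then show ?case
  proof cases
    case 1
    note v [simp] = 1(1)
    let ?a = "Comp C V A W p i'" and ?r = "Comp C W A V p' (Comp C W W A i v)"
    have ar: "Comp C W V W ?a ?r = Ident C W" using 1(3) by (simp add: Comp_simps)
    have c [simp]: "?a \<in> mor V W" "?r \<in> mor W V" by (simp_all add: Comp_closed)
    \<comment> \<open>\<open>r a\<close> is idempotent because \<open>a r = 1\<close>, and nonzero
      because \<open>W\<close> is nonzero; in the indecomposable \<open>V\<close> it can only be the
      identity.\<close>
    let ?e = "Comp C V W V ?r ?a"
    have are: "Comp C V V W ?a ?e = ?a"
      using Comp_assoc[of V W V W ?a ?r ?a] ar by (simp add: Ident_left)
    have "Comp C V V V ?e ?e = Comp C V W V ?r (Comp C V V W ?a ?e)"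
      by (rule Comp_assoc[symmetric]) (simp_all add: Comp_closed)
    then have "Comp C V V V ?e ?e = ?e" using are by simp
    then have "?e = \<zero>\<^bsub>Hom C V V\<^esub> \<or> ?e = Ident C V"
      by (intro indecomposable_idempotent[OF V]) (simp_all add: Comp_closed)
    moreover have "?e \<noteq> \<zero>\<^bsub>Hom C V V\<^esub>"
    proof
      assume "?e = \<zero>\<^bsub>Hom C V V\<^esub>"
      then have "?a = \<zero>\<^bsub>Hom C V W\<^esub>" using are by (simp add: Comp_zero_right)
      then have "Comp C W V W \<zero>\<^bsub>Hom C V W\<^esub> ?r = Ident C W" using ar by simp
      then show False using nzW by (simp add: Comp_zero_left)
    qed
    ultimately have ra: "?e = Ident C V" by blast
    have "isomorphic C Z Y"
      by (rule complements_isomorphic[OF b b' c(2) ra ar])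
    then have "summands C Z Vs" using summands_iso[OF Y(2)] isomorphic_sym by simp
    moreover have "isomorphic C V W"
      unfolding isomorphic_def inverse_pair_def using ar ra c by blast
    ultimately show ?thesis by (intro exI[of _ "[]"] exI[of _ V] exI[of _ Vs]) simp
  next
    case 2
    note v [simp] = 2(1)
    let ?i = "Comp C W A Y q' i" and ?p = "Comp C Y W W v (Comp C Y A W p j')"
    have "Comp C W Y W ?p ?i = Ident C W" using 2(2) by (simp add: Comp_simps)
    then obtain Y' k r where y: "biproduct C Y W Y' ?i k ?p r"
      using biproduct_of_retract[OF split, of Y W ?i ?p] by (auto simp: Comp_closed)
    obtain Us V' Us' where IH: "Vs = Us @ V' # Us'" "isomorphic C V' W" "summands C Y' (Us @ Us')"
      using Cons.IH[OF Y(2) _ y] Cons.prems by auto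
    \<comment> \<open>The complement of \<open>W\<close> in \<open>Y\<close> together with
      \<open>V\<close> is a complement of \<open>W\<close> in \<open>A\<close>, but for the
      embedding \<open>j' q' i\<close> instead of \<open>i\<close>. The unit \<open>v\<close>
      compares the two embeddings and so identifies \<open>Z'\<close> with the given
      \<open>Z\<close>.\<close>
    obtain Z' k' r' where z: "biproduct C A W Z' (Comp C W Y A j' ?i) k' (Comp C A Y W ?p q') r'"
      and z': "direct_sum C Z' Y' V"
      using biproduct_assoc[OF split biproduct_sym[OF b'] y] by blast
    have "isomorphic C Z Z'"
      by (rule complements_isomorphic[OF b z v]) (use 2 in \<open>simp_all add: Comp_simps\<close>)
    moreover have "summands C Z' (V # Us @ Us')" using direct_sum_sym[OF z'] IH(3) by auto
    ultimately have "summands C Z (V # Us @ Us')" using summands_iso isomorphic_sym by (metis D(3))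
    then show ?thesis using IH by (intro exI[of _ "V # Us"] exI[of _ V'] exI[of _ Us']) simp
  qed
qed

text \<open>Exchange finds in the second list a partner for the head of the first; removing both
  leaves two decompositions of the same complement.\<close>

lemma summands_unique:
  assumes "summands C A Vs" "summands C A Us"
    and "\<forall>V\<in>set Vs. indecomposable C V" "\<forall>U\<in>set Us. indecomposable C U"
  shows "mset (map (iso_rep C) Vs) = mset (map (iso_rep C) Us)"
  using assms
proof (induction Vs arbitrary: A Us)
  case Nil
  show ?case
  proof (cases Us)
    case (Cons U Us')
    then obtain B where "direct_sum C A U B" using Nil by auto
    then obtain i j p q where b: "biproduct C A U B i j p q" using direct_sum_iff_biproduct by metis
    note D [simp] = biproductD(1-7)[OF b]
    have "i = \<zero>\<^bsub>Hom C U A\<^esub>" using Nil by (intro mor_to_zero) simp_all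
    then have "Ident C U = \<zero>\<^bsub>Hom C U U\<^esub>" using biproductD(8)[OF b] by (simp add: Comp_simps)
    then show ?thesis using Nil(4) Cons unfolding indecomposable_def zero_object_def by simp
  qed simp
next
  case (Cons V Vs)
  then obtain Y where Y: "direct_sum C A V Y" "summands C Y Vs" by auto
  then obtain i j p q where b: "biproduct C A V Y i j p q" using direct_sum_iff_biproduct by metis
  obtain U1 U U2 where U: "Us = U1 @ U # U2" "isomorphic C U V" "summands C Y (U1 @ U2)"
    using exchange[OF _ Cons.prems(2) _ b] Cons.prems by auto
  have "U \<in> Ob C" "V \<in> Ob C" using summands_Ob[OF Cons.prems(2)] summands_Ob[OF Cons.prems(1)] U by auto
  then have "iso_rep C U = iso_rep C V" using U(2) iso_rep_eq_iff by simp
  moreover have "mset (map (iso_rep C) Vs) = mset (map (iso_rep C) (U1 @ U2))"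
    using Cons.IH[OF Y(2) U(3)] Cons.prems U(1) by auto
  ultimately show ?case using U(1) by simp
qed

lemma summands_isomorphic:
  assumes "summands C A Vs" "summands C B Us"
    and "mset (map (iso_rep C) Vs) = mset (map (iso_rep C) Us)"
  shows "isomorphic C A B"
  using assms
proof (induction Vs arbitrary: A B Us)
  case Nil
  then show ?case using zero_objects_isomorphic by simp
next
  case (Cons V Vs)
  then obtain Y where Y: "direct_sum C A V Y" "summands C Y Vs" by auto
  have "iso_rep C V \<in># mset (map (iso_rep C) Us)" by (metis Cons.prems(3) list.set_intros(1) list.simps(9) set_mset_mset)
  then obtain U where "U \<in> set Us" and UV: "iso_rep C V = iso_rep C U" by auto
  then obtain U1 U2 where U: "Us = U1 @ U # U2" by (meson split_list)
  obtain Y' where Y': "direct_sum C B U Y'" "summands C Y' (U1 @ U2)"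
    using summands_extract Cons.prems(2) U by blast
  have "mset (map (iso_rep C) Vs) = mset (map (iso_rep C) (U1 @ U2))"
    using Cons.prems(3) U UV by simp
  then have "isomorphic C Y Y'" using Cons.IH[OF Y(2) Y'(2)] by simp
  moreover have "isomorphic C V U"
    using UV iso_rep_eq_iff direct_sum_Ob[OF Y(1)] direct_sum_Ob[OF Y'(1)] by simp
  ultimately show ?case using direct_sum_iso[OF Y(1) Y'(1)] by blast
qed

end

text \<open>The class of \<open>A\<close> in the free abelian group on isomorphism classes of
  indecomposables; \<open>summands_unique\<close> makes the choice of the list immaterial.
  Coefficients are integers because differences of such classes are formed later.\<close>

definition multiplicities :: "('k, 'o, 'm) rcat \<Rightarrow> 'o \<Rightarrow> 'o \<Rightarrow>\<^sub>0 int" where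
  "multiplicities C A = (\<Sum>W\<leftarrow>(SOME Ws. summands C A Ws \<and> (\<forall>W\<in>set Ws. indecomposable C W)).
     frag_of (iso_rep C W))"

lemma lookup_sum_list_frag_of:
  "poly_mapping.lookup (\<Sum>x\<leftarrow>xs. frag_of (f x)) a = int (count (mset (map f xs)) a)"
  by (induction xs) (auto simp: lookup_add)

context krull_schmidt
begin

lemma multiplicities_eq:
  assumes "summands C A Vs" "\<forall>V\<in>set Vs. indecomposable C V"
  shows "multiplicities C A = (\<Sum>V\<leftarrow>Vs. frag_of (iso_rep C V))"
proof -
  have "mset (map (iso_rep C) (SOME Ws. summands C A Ws \<and> (\<forall>W\<in>set Ws. indecomposable C W)))
      = mset (map (iso_rep C) Vs)"
    using someI[of "\<lambda>Ws. summands C A Ws \<and> (\<forall>W\<in>set Ws. indecomposable C W)" Vs] assms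
    by (intro summands_unique[of A]) auto
  then show ?thesis
    unfolding multiplicities_def by (intro poly_mapping_eqI) (simp only: lookup_sum_list_frag_of)
qed

lemma multiplicities_indecomposable:
  assumes "indecomposable C W"
  shows "multiplicities C W = frag_of (iso_rep C W)"
  using multiplicities_eq[of W "[W]"] summands_singleton assms unfolding indecomposable_def by simp

lemma multiplicities_direct_sum:
  assumes "direct_sum C S A B"
  shows "multiplicities C S = multiplicities C A + multiplicities C B"
proof -
  obtain Vs Us where "summands C A Vs" "\<forall>V\<in>set Vs. indecomposable C V"
    "summands C B Us" "\<forall>U\<in>set Us. indecomposable C U"
    using summands_exist direct_sum_Ob[OF assms] by metis
  then show ?thesis
    using multiplicities_eq[of A Vs] multiplicities_eq[of B Us]
      multiplicities_eq[OF summands_append[OF assms, of Vs Us]] by auto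
qed

lemma multiplicities_eq_iff:
  assumes "A \<in> Ob C" "B \<in> Ob C"
  shows "multiplicities C A = multiplicities C B \<longleftrightarrow> isomorphic C A B"
proof -
  obtain Vs Us where V: "summands C A Vs" "\<forall>V\<in>set Vs. indecomposable C V"
    and U: "summands C B Us" "\<forall>U\<in>set Us. indecomposable C U"
    using summands_exist assms by metis
  show ?thesis
  proof
    assume "multiplicities C A = multiplicities C B"
    then have "int (count (mset (map (iso_rep C) Vs)) a) = int (count (mset (map (iso_rep C) Us)) a)" for a
      unfolding multiplicities_eq[OF V] multiplicities_eq[OF U]
      by (simp only: lookup_sum_list_frag_of[symmetric])
    then have "mset (map (iso_rep C) Vs) = mset (map (iso_rep C) Us)"
      by (intro multiset_eqI) (simp del: mset_map)
    then show "isomorphic C A B" using summands_isomorphic V U by blast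
  next
    assume "isomorphic C A B"
    then show "multiplicities C A = multiplicities C B"
      using multiplicities_eq[OF V] multiplicities_eq[OF summands_iso[OF V(1)] V(2)] assms by simp
  qed
qed

end

section \<open>Extension of scalars\<close>

text \<open>The ring \<open>S\<close> lives on the same type as \<open>R\<close> and receives \<open>R\<close> through \<open>r \<mapsto> 1 \<otimes> r\<close>,
  computed in \<open>S\<close>; this covers localizations as well as residue fields carried by a set of
  representatives. The last assumption makes every tensor a pure one.\<close>

locale scalar_change =
  fixes R S :: "'k ring"
  assumes R_cring: "cring R" and S_cring: "cring S"
    and scalar_hom: "(\<lambda>r. \<one>\<^bsub>S\<^esub> \<otimes>\<^bsub>S\<^esub> r) \<in> ring_hom R S"
    and scalar_act: "\<lbrakk>s \<in> carrier S; r \<in> carrier R\<rbrakk> \<Longrightarrow> s \<otimes>\<^bsub>S\<^esub> (\<one>\<^bsub>S\<^esub> \<otimes>\<^bsub>S\<^esub> r) = s \<otimes>\<^bsub>S\<^esub> r"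
    and common_factor: "\<lbrakk>s \<in> carrier S; t \<in> carrier S\<rbrakk> \<Longrightarrow>
      \<exists>u\<in>carrier S. \<exists>a\<in>carrier R. \<exists>b\<in>carrier R. s = u \<otimes>\<^bsub>S\<^esub> a \<and> t = u \<otimes>\<^bsub>S\<^esub> b"
begin

text \<open>\<open>r\<close> need not lie in \<open>carrier S\<close>, so closedness of
  \<open>S\<close> does not apply directly; the product is first rewritten with the image of
  \<open>r\<close> in \<open>S\<close>.\<close>

lemma scalar_closed: "\<lbrakk>s \<in> carrier S; r \<in> carrier R\<rbrakk> \<Longrightarrow> s \<otimes>\<^bsub>S\<^esub> r \<in> carrier S"
  using ring_hom_closed[OF scalar_hom] S_cring
  by (metis scalar_act cring.cring_simprules(5))

end

lemma frag_extend_fun_add: "frag_extend (\<lambda>a. f a + g a) x = frag_extend f x + frag_extend g x"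
  by (simp add: frag_extend_def frag_cmul_distrib2 sum.distrib)

lemma frag_relator_closed2: "a \<in> S \<Longrightarrow> b \<in> S \<Longrightarrow> frag_of a - frag_of b \<in> carrier (free_Abelian_group S)"
  using keys_diff[of "frag_of a" "frag_of b"] by auto

lemma tensor_generators_closed:
  fixes R S :: "'k ring" and M :: "('k, 'm) module"
  assumes "module R M" and S: "\<And>s t. s \<in> carrier S \<Longrightarrow> t \<in> carrier S \<Longrightarrow> s \<oplus>\<^bsub>S\<^esub> t \<in> carrier S"
    and SR: "\<And>s r. s \<in> carrier S \<Longrightarrow> r \<in> carrier R \<Longrightarrow> s \<otimes>\<^bsub>S\<^esub> r \<in> carrier S"
  shows "{frag_of (s \<oplus>\<^bsub>S\<^esub> t, m) - frag_of (s, m) - frag_of (t, m) | s t m.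
         s \<in> carrier S \<and> t \<in> carrier S \<and> m \<in> carrier M} \<union>
      {frag_of (s, m \<oplus>\<^bsub>M\<^esub> n) - frag_of (s, m) - frag_of (s, n) | s m n.
         s \<in> carrier S \<and> m \<in> carrier M \<and> n \<in> carrier M} \<union>
      {frag_of (s \<otimes>\<^bsub>S\<^esub> r, m) - frag_of (s, r \<odot>\<^bsub>M\<^esub> m) | s r m.
         s \<in> carrier S \<and> r \<in> carrier R \<and> m \<in> carrier M}
      \<subseteq> carrier (free_Abelian_group (carrier S \<times> carrier M))"
proof -
  interpret M: module R M by fact
  let ?F = "free_Abelian_group (carrier S \<times> carrier M)"
  have 1: "frag_of (s \<oplus>\<^bsub>S\<^esub> t, m) - frag_of (s, m) - frag_of (t, m) \<in> carrier ?F"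
    if "s \<in> carrier S" "t \<in> carrier S" "m \<in> carrier M" for s t m
    by (rule frag_relator_closed) (use that S in auto)
  have 2: "frag_of (s, m \<oplus>\<^bsub>M\<^esub> n) - frag_of (s, m) - frag_of (s, n) \<in> carrier ?F"
    if "s \<in> carrier S" "n \<in> carrier M" "m \<in> carrier M" for s n m
    by (rule frag_relator_closed) (use that in auto)
  have 3: "frag_of (s \<otimes>\<^bsub>S\<^esub> r, m) - frag_of (s, r \<odot>\<^bsub>M\<^esub> m) \<in> carrier ?F"
    if "s \<in> carrier S" "r \<in> carrier R" "m \<in> carrier M" for s r m
    by (rule frag_relator_closed2) (use that SR in auto)
  show ?thesis
    by (intro Un_least subsetI; elim CollectE exE conjE) (simp_all only: 1 2 3)
qed

text \<open>The universal property in the form needed here: an additive map sends all relations into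
  a subgroup as soon as it does so for the three kinds of generators. With \<open>h\<close> the
  identity it also bounds the relations by a set that is described only through partial
  maps.\<close>

lemma tensor_rels_subset:
  assumes T': "0 \<in> T'" "\<And>x y. x \<in> T' \<Longrightarrow> y \<in> T' \<Longrightarrow> x + y \<in> T'" "\<And>x. x \<in> T' \<Longrightarrow> - x \<in> T'"
    and h: "\<And>x y. h (x + y) = h x + h y"
    and M: "module R M" and S: "\<And>s t. s \<in> carrier S \<Longrightarrow> t \<in> carrier S \<Longrightarrow> s \<oplus>\<^bsub>S\<^esub> t \<in> carrier S"
    and SR: "\<And>s r. s \<in> carrier S \<Longrightarrow> r \<in> carrier R \<Longrightarrow> s \<otimes>\<^bsub>S\<^esub> r \<in> carrier S"
    and 1: "\<And>s t m. s \<in> carrier S \<Longrightarrow> t \<in> carrier S \<Longrightarrow> m \<in> carrier M \<Longrightarrow>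
      h (frag_of (s \<oplus>\<^bsub>S\<^esub> t, m) - frag_of (s, m) - frag_of (t, m)) \<in> T'"
    and 2: "\<And>s m n. s \<in> carrier S \<Longrightarrow> m \<in> carrier M \<Longrightarrow> n \<in> carrier M \<Longrightarrow>
      h (frag_of (s, m \<oplus>\<^bsub>M\<^esub> n) - frag_of (s, m) - frag_of (s, n)) \<in> T'"
    and 3: "\<And>s r m. s \<in> carrier S \<Longrightarrow> r \<in> carrier R \<Longrightarrow> m \<in> carrier M \<Longrightarrow>
      h (frag_of (s \<otimes>\<^bsub>S\<^esub> r, m) - frag_of (s, r \<odot>\<^bsub>M\<^esub> m)) \<in> T'"
    and x: "x \<in> tensor_rels R S M"
  shows "(h x :: 'c::ab_group_add) \<in> T'"
proof -
  interpret M: module R M by fact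
  let ?F = "free_Abelian_group (carrier S \<times> carrier M)"
  have h0: "h 0 = 0" using h[of 0 0] by simp
  have hm: "h (- x) = - h x" for x using h[of "- x" x] h0 by (simp add: eq_neg_iff_add_eq_0)
  show ?thesis
    using x unfolding tensor_rels_def
  proof (induction rule: generate.induct)
    case one
    then show ?case using h0 T' by simp
  next
    case (incl g)
    then show ?case by (elim UnE CollectE exE conjE) (simp_all only: 1 2 3)
  next
    case (inv g)
    have "g \<in> carrier ?F" by (rule subsetD[OF tensor_generators_closed[OF M S SR] inv])
    then have "inv\<^bsub>?F\<^esub> g = - g" by simp
    moreover have "h g \<in> T'" using inv by (elim UnE CollectE exE conjE) (simp_all only: 1 2 3)
    ultimately show ?case using hm T'(3) by simp
  next
    case (eng g g')
    then show ?case using h T'(2) by simp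
  qed
qed

section \<open>The tensor product as a module over the new scalars\<close>

locale tensor_product = scalar_change R S + module R M for R S :: "'k ring" and M :: "('k, 'm) module"
begin

sublocale S: cring S by (rule S_cring)

abbreviation "F \<equiv> free_Abelian_group (carrier S \<times> carrier M)"
abbreviation "T \<equiv> tensor_rels R S M"
abbreviation "tc \<equiv> tensor_class R S M"

definition pure_tensor :: "'k \<Rightarrow> 'm \<Rightarrow> ('k \<times> 'm \<Rightarrow>\<^sub>0 int) set" where
  "pure_tensor s m = tc (frag_of (s, m))"

lemma T_normal: "T \<lhd> F"
  unfolding tensor_rels_def
  by (intro free_Abelian_normal tensor_generators_closed module_axioms scalar_closed S.a_closed)

lemma T_subset: "x \<in> T \<Longrightarrow> Poly_Mapping.keys x \<subseteq> carrier S \<times> carrier M"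
  using subsetD[OF subgroup.subset[OF normal_imp_subgroup[OF T_normal]], of x] by simp

lemma T_zero: "0 \<in> T"
  using subgroup.one_closed[OF normal_imp_subgroup[OF T_normal]] by simp

lemma T_add: "x \<in> T \<Longrightarrow> y \<in> T \<Longrightarrow> x + y \<in> T"
  using subgroup.m_closed[OF normal_imp_subgroup[OF T_normal]] by simp

lemma T_minus: "x \<in> T \<Longrightarrow> - x \<in> T"
  using subgroup.m_inv_closed[OF normal_imp_subgroup[OF T_normal], of x] T_subset[of x] by simp

lemma T_diff: "x \<in> T \<Longrightarrow> y \<in> T \<Longrightarrow> x - y \<in> T"
  using T_add[of x "- y"] T_minus by simp

lemma T_gens:
  "s \<in> carrier S \<Longrightarrow> t \<in> carrier S \<Longrightarrow> m \<in> carrier M \<Longrightarrow>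
    frag_of (s \<oplus>\<^bsub>S\<^esub> t, m) - frag_of (s, m) - frag_of (t, m) \<in> T"
  "s \<in> carrier S \<Longrightarrow> m \<in> carrier M \<Longrightarrow> n \<in> carrier M \<Longrightarrow>
    frag_of (s, m \<oplus>\<^bsub>M\<^esub> n) - frag_of (s, m) - frag_of (s, n) \<in> T"
  "s \<in> carrier S \<Longrightarrow> r \<in> carrier R \<Longrightarrow> m \<in> carrier M \<Longrightarrow>
    frag_of (s \<otimes>\<^bsub>S\<^esub> r, m) - frag_of (s, r \<odot>\<^bsub>M\<^esub> m) \<in> T"
  unfolding tensor_rels_def by (rule generate.incl, blast)+

lemma tc_mem: "y \<in> tc x \<longleftrightarrow> y - x \<in> T"
  unfolding tensor_class_def r_coset_def by (auto intro!: bexI[of _ "y - x"])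

lemma tc_self: "x \<in> tc x" by (simp add: tc_mem T_zero)

lemma tc_eq_iff: "tc x = tc y \<longleftrightarrow> x - y \<in> T"
proof
  assume "tc x = tc y"
  then show "x - y \<in> T" using tc_self[of x] tc_mem by blast
next
  assume xy: "x - y \<in> T"
  have "z \<in> tc x \<longleftrightarrow> z \<in> tc y" for z
    using T_add[OF _ xy, of "z - x"] T_diff[OF _ xy, of "z - y"] unfolding tc_mem by auto
  then show "tc x = tc y" by blast
qed

lemma tc_zero: "tc 0 = T"
  unfolding set_eq_iff tc_mem by simp

lemma tensor_carrier: "carrier (tensor R S M) = tc ` {x. Poly_Mapping.keys x \<subseteq> carrier S \<times> carrier M}"
  unfolding tensor_def tensor_class_def FactGroup_def RCOSETS_def by (auto simp: Let_def)

lemma tc_closed: "Poly_Mapping.keys x \<subseteq> carrier S \<times> carrier M \<Longrightarrow> tc x \<in> carrier (tensor R S M)"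
  unfolding tensor_carrier by blast

lemma tensor_zero: "\<zero>\<^bsub>tensor R S M\<^esub> = tc 0"
  unfolding tc_zero by (simp add: tensor_def FactGroup_def Let_def)

lemma tensor_add:
  assumes "Poly_Mapping.keys x \<subseteq> carrier S \<times> carrier M" "Poly_Mapping.keys y \<subseteq> carrier S \<times> carrier M"
  shows "tc x \<oplus>\<^bsub>tensor R S M\<^esub> tc y = tc (x + y)"
  using normal.rcos_sum[OF T_normal, of x y] assms
  by (simp add: tensor_def FactGroup_def Let_def tensor_class_def)

lemma tensor_abelian: "abelian_group (tensor R S M)"
proof (rule abelian_groupI)
  have add: "Poly_Mapping.keys (x + y) \<subseteq> carrier S \<times> carrier M"
    if "Poly_Mapping.keys x \<subseteq> carrier S \<times> carrier M" "Poly_Mapping.keys y \<subseteq> carrier S \<times> carrier M" for x y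
    using keys_add[of x y] that by blast
  show "\<zero>\<^bsub>tensor R S M\<^esub> \<in> carrier (tensor R S M)" unfolding tensor_zero by (rule tc_closed) simp
  fix a assume "a \<in> carrier (tensor R S M)"
  then obtain x where x: "Poly_Mapping.keys x \<subseteq> carrier S \<times> carrier M" "a = tc x"
    unfolding tensor_carrier by blast
  then show "\<zero>\<^bsub>tensor R S M\<^esub> \<oplus>\<^bsub>tensor R S M\<^esub> a = a"
    unfolding tensor_zero by (simp add: tensor_add)
  show "\<exists>b\<in>carrier (tensor R S M). b \<oplus>\<^bsub>tensor R S M\<^esub> a = \<zero>\<^bsub>tensor R S M\<^esub>"
    using x by (intro bexI[of _ "tc (- x)"]) (simp_all add: tensor_zero tensor_add tc_closed)
  fix b assume "b \<in> carrier (tensor R S M)"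
  then obtain y where y: "Poly_Mapping.keys y \<subseteq> carrier S \<times> carrier M" "b = tc y"
    unfolding tensor_carrier by blast
  show "a \<oplus>\<^bsub>tensor R S M\<^esub> b \<in> carrier (tensor R S M)"
    "a \<oplus>\<^bsub>tensor R S M\<^esub> b = b \<oplus>\<^bsub>tensor R S M\<^esub> a"
    using x y by (simp_all add: tensor_add tc_closed add add.commute)
  fix c assume "c \<in> carrier (tensor R S M)"
  then obtain z where z: "Poly_Mapping.keys z \<subseteq> carrier S \<times> carrier M" "c = tc z"
    unfolding tensor_carrier by blast
  show "(a \<oplus>\<^bsub>tensor R S M\<^esub> b) \<oplus>\<^bsub>tensor R S M\<^esub> c = a \<oplus>\<^bsub>tensor R S M\<^esub> (b \<oplus>\<^bsub>tensor R S M\<^esub> c)"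
    using x y z by (simp add: tensor_add add add.assoc)
qed

lemma pure_closed: "s \<in> carrier S \<Longrightarrow> m \<in> carrier M \<Longrightarrow> pure_tensor s m \<in> carrier (tensor R S M)"
  unfolding pure_tensor_def by (intro tc_closed) simp

lemma pure_add_left:
  assumes "s \<in> carrier S" "t \<in> carrier S" "m \<in> carrier M"
  shows "pure_tensor (s \<oplus>\<^bsub>S\<^esub> t) m = pure_tensor s m \<oplus>\<^bsub>tensor R S M\<^esub> pure_tensor t m"
  unfolding pure_tensor_def using assms T_gens(1)[of s t m]
  by (simp add: tensor_add tc_eq_iff diff_diff_eq)

lemma pure_add_right:
  assumes "s \<in> carrier S" "m \<in> carrier M" "n \<in> carrier M"
  shows "pure_tensor s (m \<oplus>\<^bsub>M\<^esub> n) = pure_tensor s m \<oplus>\<^bsub>tensor R S M\<^esub> pure_tensor s n"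
  unfolding pure_tensor_def using assms T_gens(2)[of s m n]
  by (simp add: tensor_add tc_eq_iff diff_diff_eq)

lemma pure_smult:
  assumes "s \<in> carrier S" "r \<in> carrier R" "m \<in> carrier M"
  shows "pure_tensor (s \<otimes>\<^bsub>S\<^esub> r) m = pure_tensor s (r \<odot>\<^bsub>M\<^esub> m)"
  unfolding pure_tensor_def using assms T_gens(3)[of s r m] by (simp add: tc_eq_iff)

lemma pure_zero: "s \<in> carrier S \<Longrightarrow> pure_tensor s \<zero>\<^bsub>M\<^esub> = \<zero>\<^bsub>tensor R S M\<^esub>"
proof -
  assume s: "s \<in> carrier S"
  interpret A: abelian_group "tensor R S M" by (rule tensor_abelian)
  show ?thesis
    using pure_add_right[OF s, of "\<zero>\<^bsub>M\<^esub>" "\<zero>\<^bsub>M\<^esub>"] pure_closed[OF s, of "\<zero>\<^bsub>M\<^esub>"]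
    by (simp add: A.add.r_cancel_one')
qed

lemma pure_minus:
  assumes "s \<in> carrier S" "m \<in> carrier M"
  shows "pure_tensor s (\<ominus>\<^bsub>M\<^esub> m) = \<ominus>\<^bsub>tensor R S M\<^esub> pure_tensor s m"
proof -
  interpret A: abelian_group "tensor R S M" by (rule tensor_abelian)
  show ?thesis
    using pure_add_right[OF assms(1), of "\<ominus>\<^bsub>M\<^esub> m" m] pure_zero assms pure_closed
    by (intro A.minus_equality[symmetric]) (auto simp: M.l_neg)
qed

text \<open>\<open>common_factor\<close> writes both scalars as multiples of one \<open>u\<close>,
  and the multipliers move across the tensor sign. Sums of pure tensors become pure in this
  way.\<close>

lemma pure_common:
  assumes "s \<in> carrier S" "m \<in> carrier M" "t \<in> carrier S" "n \<in> carrier M"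
  shows "\<exists>u\<in>carrier S. \<exists>m'\<in>carrier M. \<exists>n'\<in>carrier M.
    pure_tensor s m = pure_tensor u m' \<and> pure_tensor t n = pure_tensor u n'"
  using common_factor[OF assms(1,3)] assms pure_smult smult_closed by metis

lemma tensor_pure:
  assumes "U \<in> carrier (tensor R S M)"
  shows "\<exists>s\<in>carrier S. \<exists>m\<in>carrier M. U = pure_tensor s m"
proof -
  obtain x where x: "Poly_Mapping.keys x \<subseteq> carrier S \<times> carrier M" "U = tc x"
    using assms unfolding tensor_carrier by blast
  interpret A: abelian_group "tensor R S M" by (rule tensor_abelian)
  have "\<exists>s\<in>carrier S. \<exists>m\<in>carrier M. tc x = pure_tensor s m"
  proof (rule free_Abelian_group_induct[OF x(1)])
    show "\<exists>s\<in>carrier S. \<exists>m\<in>carrier M. tc 0 = pure_tensor s m"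
      using pure_zero[of "\<zero>\<^bsub>S\<^esub>"] tensor_zero by (metis S.zero_closed M.zero_closed)
  next
    fix x y assume c: "Poly_Mapping.keys x \<subseteq> carrier S \<times> carrier M" "Poly_Mapping.keys y \<subseteq> carrier S \<times> carrier M"
      and "\<exists>s\<in>carrier S. \<exists>m\<in>carrier M. tc x = pure_tensor s m" "\<exists>s\<in>carrier S. \<exists>m\<in>carrier M. tc y = pure_tensor s m"
    then obtain u m n where u: "u \<in> carrier S" "m \<in> carrier M" "n \<in> carrier M"
      "tc x = pure_tensor u m" "tc y = pure_tensor u n"
      using pure_common by metis
    have "tc (x - y) \<oplus>\<^bsub>tensor R S M\<^esub> tc y = tc x"
      using c keys_diff[of x y] by (subst tensor_add) auto
    moreover have "tc (x - y) \<in> carrier (tensor R S M)"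
      using c keys_diff[of x y] by (intro tc_closed) blast
    ultimately have "tc (x - y) = pure_tensor u m \<oplus>\<^bsub>tensor R S M\<^esub> \<ominus>\<^bsub>tensor R S M\<^esub> pure_tensor u n"
      using u pure_closed by (metis A.add.inv_solve_right)
    also have "\<dots> = pure_tensor u (m \<oplus>\<^bsub>M\<^esub> \<ominus>\<^bsub>M\<^esub> n)"
      using u by (simp add: pure_add_right pure_minus)
    finally show "\<exists>s\<in>carrier S. \<exists>m\<in>carrier M. tc (x - y) = pure_tensor s m" using u by blast
  qed (auto simp: pure_tensor_def)
  then show ?thesis using x(2) by simp
qed

lemma tensor_pure2:
  assumes "U \<in> carrier (tensor R S M)" "V \<in> carrier (tensor R S M)"
  shows "\<exists>u\<in>carrier S. \<exists>m\<in>carrier M. \<exists>n\<in>carrier M. U = pure_tensor u m \<and> V = pure_tensor u n"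
  using tensor_pure[OF assms(1)] tensor_pure[OF assms(2)] pure_common by metis

lemma scalar_assoc:
  assumes "s \<in> carrier S" "t \<in> carrier S" "r \<in> carrier R"
  shows "s \<otimes>\<^bsub>S\<^esub> (t \<otimes>\<^bsub>S\<^esub> r) = (s \<otimes>\<^bsub>S\<^esub> t) \<otimes>\<^bsub>S\<^esub> r"
  using scalar_act[of t r] scalar_act[of "s \<otimes>\<^bsub>S\<^esub> t" r] assms ring_hom_closed[OF scalar_hom assms(3)]
    S.m_assoc[of s t "\<one>\<^bsub>S\<^esub> \<otimes>\<^bsub>S\<^esub> r"] by simp

lemma scalar_swap:
  assumes "s \<in> carrier S" "t \<in> carrier S" "r \<in> carrier R"
  shows "(s \<otimes>\<^bsub>S\<^esub> r) \<otimes>\<^bsub>S\<^esub> t = (s \<otimes>\<^bsub>S\<^esub> t) \<otimes>\<^bsub>S\<^esub> r"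
  using scalar_assoc[of t s r] scalar_closed assms S.m_comm by metis

lemma T_gen_swap: "\<lbrakk>s \<in> carrier S; t \<in> carrier S; r \<in> carrier R; m \<in> carrier M\<rbrakk> \<Longrightarrow>
    frag_of ((s \<otimes>\<^bsub>S\<^esub> r) \<otimes>\<^bsub>S\<^esub> t, m) - frag_of (s \<otimes>\<^bsub>S\<^esub> t, r \<odot>\<^bsub>M\<^esub> m) \<in> T"
  using T_gens(3)[of "s \<otimes>\<^bsub>S\<^esub> t" r m] by (simp add: scalar_swap[of s t r])

text \<open>Operations on cosets are defined as unions over representatives; once the value is
  independent of the representative, the union collapses to it.\<close>

lemma coset_union:
  assumes "\<And>y. y - x \<in> T \<Longrightarrow> f y = f x"
  shows "(\<Union>y\<in>tc x. f y) = f x"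
  using assms tc_mem tc_self[of x] by blast

lemma tensor_smult:
  assumes "s \<in> carrier S" "t \<in> carrier S" "m \<in> carrier M"
  shows "s \<odot>\<^bsub>tensor R S M\<^esub> pure_tensor t m = pure_tensor (s \<otimes>\<^bsub>S\<^esub> t) m"
proof -
  let ?h = "frag_extend (\<lambda>(t, m). frag_of (s \<otimes>\<^bsub>S\<^esub> t, m))"
  have hT: "?h x \<in> T" if "x \<in> T" for x
    by (rule tensor_rels_subset[where h = ?h, OF T_zero T_add T_minus _ module_axioms _ scalar_closed _ _ _ that])
      (use assms in \<open>auto simp: frag_extend_add frag_extend_diff S.r_distr scalar_assoc intro!: T_gens\<close>)
  have "(\<Union>y\<in>tc (frag_of (t, m)). tc (?h y)) = tc (?h (frag_of (t, m)))"
    by (rule coset_union) (use hT in \<open>simp add: tc_eq_iff frag_extend_diff[symmetric] del: frag_extend_of\<close>)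
  then show ?thesis unfolding pure_tensor_def by (simp add: tensor_def Let_def)
qed

lemma tensor_module: "module S (tensor R S M)"
proof (rule moduleI)
  show "cring S" by (rule S_cring)
  show "abelian_group (tensor R S M)" by (rule tensor_abelian)
  fix x assume x: "x \<in> carrier (tensor R S M)"
  obtain t m where t: "t \<in> carrier S" "m \<in> carrier M" "x = pure_tensor t m" using tensor_pure[OF x] by blast
  show "\<one>\<^bsub>S\<^esub> \<odot>\<^bsub>tensor R S M\<^esub> x = x" using t by (simp add: tensor_smult)
  fix a assume a: "a \<in> carrier S"
  show "a \<odot>\<^bsub>tensor R S M\<^esub> x \<in> carrier (tensor R S M)"
    using a t by (simp add: tensor_smult pure_closed)
  show "(a \<oplus>\<^bsub>S\<^esub> b) \<odot>\<^bsub>tensor R S M\<^esub> x = a \<odot>\<^bsub>tensor R S M\<^esub> x \<oplus>\<^bsub>tensor R S M\<^esub> b \<odot>\<^bsub>tensor R S M\<^esub> x"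
    "a \<otimes>\<^bsub>S\<^esub> b \<odot>\<^bsub>tensor R S M\<^esub> x = a \<odot>\<^bsub>tensor R S M\<^esub> (b \<odot>\<^bsub>tensor R S M\<^esub> x)" if b: "b \<in> carrier S" for b
    using a b t by (simp_all add: tensor_smult S.l_distr pure_add_left S.m_assoc)
  show "a \<odot>\<^bsub>tensor R S M\<^esub> (x \<oplus>\<^bsub>tensor R S M\<^esub> y) = a \<odot>\<^bsub>tensor R S M\<^esub> x \<oplus>\<^bsub>tensor R S M\<^esub> a \<odot>\<^bsub>tensor R S M\<^esub> y"
    if y: "y \<in> carrier (tensor R S M)" for y
    using tensor_pure2[OF x y] a by (auto simp: tensor_smult pure_add_right[symmetric])
qed

lemma span_tensor:
  assumes "set gs \<subseteq> carrier M" "m \<in> span_list R M gs" "s \<in> carrier S"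
  shows "pure_tensor s m \<in> span_list S (tensor R S M) (map (pure_tensor \<one>\<^bsub>S\<^esub>) gs)"
  using assms
proof (induction gs arbitrary: m)
  case Nil
  then show ?case by (simp add: pure_zero)
next
  case (Cons g gs)
  then obtain c z where c: "c \<in> carrier R" "z \<in> span_list R M gs" "m = c \<odot>\<^bsub>M\<^esub> g \<oplus>\<^bsub>M\<^esub> z" by auto
  have z: "z \<in> carrier M" using c(2) submoduleE(1)[OF span_list_submodule[of gs]] Cons.prems by auto
  have sc: "s \<otimes>\<^bsub>S\<^esub> c \<in> carrier S" using scalar_closed Cons.prems c by blast
  have "pure_tensor s m = (s \<otimes>\<^bsub>S\<^esub> c) \<odot>\<^bsub>tensor R S M\<^esub> pure_tensor \<one>\<^bsub>S\<^esub> g \<oplus>\<^bsub>tensor R S M\<^esub> pure_tensor s z"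
    using c z Cons.prems sc by (simp add: pure_add_right pure_smult[symmetric] tensor_smult)
  then show ?case using Cons.IH[OF _ c(2)] Cons.prems sc by auto
qed

lemma tensor_spanned:
  assumes "set gs \<subseteq> carrier M" "carrier M \<subseteq> span_list R M gs"
  shows "carrier (tensor R S M) \<subseteq> span_list S (tensor R S M) (map (pure_tensor \<one>\<^bsub>S\<^esub>) gs)"
  using tensor_pure span_tensor[OF assms(1)] assms(2) by blast

end

lemma (in module) submodule_finsum:
  assumes "submodule N R M" "f \<in> A \<rightarrow> N"
  shows "finsum M f A \<in> N"
  using assms(2)
proof (induction A rule: infinite_finite_induct)
  case (insert x A)
  note S = submoduleE[OF assms(1)]
  have "f x \<in> N" "f \<in> A \<rightarrow> N" using insert by auto
  moreover have "f \<in> A \<rightarrow> carrier M" "f x \<in> carrier M" using calculation S(1) by auto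
  ultimately show ?case using insert S(5) by simp
qed (use submoduleE(2,4)[OF assms(1)] submoduleE(1)[OF assms(1)] in
    \<open>auto; metis R.zero_closed ex_in_conv smult_l_null subsetD\<close>)+

lemma lincombs_spanned:
  fixes R :: "'k ring" and M :: "('k, 'm) module"
  assumes "module R M" "finite A" "A \<subseteq> carrier M" "carrier M = lincombs R M A"
  shows "\<exists>gs. set gs \<subseteq> carrier M \<and> carrier M \<subseteq> span_list R M gs"
proof -
  interpret module R M by fact
  obtain gs where gs: "set gs = A" using finite_list assms(2) by blast
  note S = submoduleE[OF span_list_submodule[of gs]]
  have "x \<in> span_list R M gs" if x: "x \<in> carrier M" for x
  proof -
    obtain c where c: "c \<in> A \<rightarrow> carrier R" "x = finsum M (\<lambda>x. c x \<odot>\<^bsub>M\<^esub> x) A"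
      using x assms(4) unfolding lincombs_def by blast
    show ?thesis unfolding c(2)
      using c(1) gs assms(3) span_list_generators[of gs] S(4)
      by (intro submodule_finsum span_list_submodule) (auto simp: Pi_iff)
  qed
  then show ?thesis using gs assms(3) by blast
qed

section \<open>Base change of an enriched category\<close>

locale category_base_change = R_category R C + scalar_change R S
  for R S :: "'k ring" and C :: "('k, 'o, 'm) rcat"
begin

sublocale S: cring S by (rule S_cring)

abbreviation "D \<equiv> scalar_extension R S C"

definition pt :: "'o \<Rightarrow> 'o \<Rightarrow> 'k \<Rightarrow> 'm \<Rightarrow> ('k \<times> 'm \<Rightarrow>\<^sub>0 int) set" where
  "pt A B s m = tensor_class R S (Hom C A B) (frag_of (s, m))"

lemma tensor_product_Hom: "A \<in> Ob C \<Longrightarrow> B \<in> Ob C \<Longrightarrow> tensor_product R S (Hom C A B)"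
  by (intro tensor_product.intro scalar_change_axioms Hom_module)

lemma pt_pure: "A \<in> Ob C \<Longrightarrow> B \<in> Ob C \<Longrightarrow> pt A B s m = tensor_product.pure_tensor R S (Hom C A B) s m"
  using tensor_product.pure_tensor_def[OF tensor_product_Hom] unfolding pt_def by simp

lemma D_Ob [simp]: "Ob D = Ob C" by (simp add: scalar_extension_def)
lemma D_Hom: "Hom D A B = tensor R S (Hom C A B)" by (simp add: scalar_extension_def)
lemma D_Ident: "Ident D A = pt A A \<one>\<^bsub>S\<^esub> (Ident C A)" by (simp add: scalar_extension_def pt_def)

context
  fixes A B
  assumes A: "A \<in> Ob C" and B: "B \<in> Ob C"
begin

interpretation tensor_product R S "Hom C A B" by (rule tensor_product_Hom[OF A B])

lemma
  shows pt_closed: "s \<in> carrier S \<Longrightarrow> m \<in> mor A B \<Longrightarrow> pt A B s m \<in> carrier (Hom D A B)"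
    and pt_add_right: "s \<in> carrier S \<Longrightarrow> m \<in> mor A B \<Longrightarrow> n \<in> mor A B \<Longrightarrow>
      pt A B s (m \<oplus>\<^bsub>Hom C A B\<^esub> n) = pt A B s m \<oplus>\<^bsub>Hom D A B\<^esub> pt A B s n"
    and pt_smult: "s \<in> carrier S \<Longrightarrow> r \<in> carrier R \<Longrightarrow> m \<in> mor A B \<Longrightarrow>
      pt A B (s \<otimes>\<^bsub>S\<^esub> r) m = pt A B s (r \<odot>\<^bsub>Hom C A B\<^esub> m)"
    and pt_zero: "s \<in> carrier S \<Longrightarrow> pt A B s \<zero>\<^bsub>Hom C A B\<^esub> = \<zero>\<^bsub>Hom D A B\<^esub>"
    and pt_exists: "U \<in> carrier (Hom D A B) \<Longrightarrow> \<exists>s\<in>carrier S. \<exists>m\<in>mor A B. U = pt A B s m"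
    and pt_exists2: "U \<in> carrier (Hom D A B) \<Longrightarrow> V \<in> carrier (Hom D A B) \<Longrightarrow>
      \<exists>u\<in>carrier S. \<exists>m\<in>mor A B. \<exists>n\<in>mor A B. U = pt A B u m \<and> V = pt A B u n"
    and D_smult: "s \<in> carrier S \<Longrightarrow> t \<in> carrier S \<Longrightarrow> m \<in> mor A B \<Longrightarrow>
      s \<odot>\<^bsub>Hom D A B\<^esub> pt A B t m = pt A B (s \<otimes>\<^bsub>S\<^esub> t) m"
    and D_module: "module S (Hom D A B)"
  unfolding pt_pure[OF A B] D_Hom
  by (rule pure_closed pure_add_right pure_smult pure_zero tensor_pure tensor_pure2
    tensor_smult tensor_module; assumption)+

lemma pt_eq_iff: "pt A B s m = pt A B t n \<longleftrightarrow>
    frag_of (s, m) - frag_of (t, n) \<in> tensor_rels R S (Hom C A B)"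
  unfolding pt_def by (rule tc_eq_iff)

end

text \<open>Composition is a double union over representatives, so independence is required in both
  arguments: the biadditive map \<open>b\<close> on the free groups must send relations in either
  argument to relations.\<close>

lemma pt_Comp:
  assumes Ob: "A \<in> Ob C" "B \<in> Ob C" "E \<in> Ob C"
    and c: "s \<in> carrier S" "g \<in> mor B E" "t \<in> carrier S" "f \<in> mor A B"
  shows "Comp D A B E (pt B E s g) (pt A B t f) = pt A E (s \<otimes>\<^bsub>S\<^esub> t) (Comp C A B E g f)"
proof -
  interpret AB: tensor_product R S "Hom C A B" by (rule tensor_product_Hom[OF Ob(1,2)])
  interpret BE: tensor_product R S "Hom C B E" by (rule tensor_product_Hom[OF Ob(2,3)])
  interpret AE: tensor_product R S "Hom C A E" by (rule tensor_product_Hom[OF Ob(1,3)])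
  define k where "k = (\<lambda>(s, g) (t, f). frag_of (s \<otimes>\<^bsub>S\<^esub> t, Comp C A B E g f))"
  define b where "b x y = frag_extend (\<lambda>v. frag_extend (k v) x) y" for x y
  have b_add: "b (x + x') y = b x y + b x' y" "b x (y + y') = b x y + b x y'" for x x' y y'
    unfolding b_def by (simp_all add: frag_extend_add frag_extend_fun_add)
  have b_diff: "b (x - x') y = b x y - b x' y" "b x (y - y') = b x y - b x y'" for x x' y y'
    by (metis add_diff_cancel_right' diff_add_cancel b_add(1), metis add_diff_cancel_right' diff_add_cancel b_add(2))
  have b0: "b 0 y = 0" for y using b_diff(1)[of 0 0 y] by simp
  have left: "b x (frag_of v) \<in> AE.T" if "x \<in> AB.T" "v \<in> carrier S \<times> mor B E" for x v
    using that(2)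
    by (intro tensor_rels_subset[where h = "\<lambda>x. b x (frag_of v)", OF AE.T_zero AE.T_add AE.T_minus _
            AB.module_axioms _ scalar_closed _ _ _ that(1)])
      (auto simp: b_def k_def frag_extend_add frag_extend_diff S.r_distr AB.scalar_assoc Ob
        Comp_add_right Comp_smult_right Comp_closed intro!: AE.T_gens)
  have right: "b (frag_of u) y \<in> AE.T" if "y \<in> BE.T" "u \<in> carrier S \<times> mor A B" for y u
    using that(2)
    by (intro tensor_rels_subset[where h = "\<lambda>y. b (frag_of u) y", OF AE.T_zero AE.T_add AE.T_minus _
            BE.module_axioms _ scalar_closed _ _ _ that(1)])
      (auto simp: b_def k_def frag_extend_add frag_extend_diff S.l_distr Ob
        Comp_add_left Comp_smult_left Comp_closed intro!: AE.T_gens(1,2) AE.T_gen_swap)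
  \<comment> \<open>The first argument is extended from generators to arbitrary elements, because in
    \<open>const\<close> it is an arbitrary representative of its coset.\<close>
  have right': "b x y \<in> AE.T" if y: "y \<in> BE.T" and x: "Poly_Mapping.keys x \<subseteq> carrier S \<times> mor A B" for x y
    by (rule free_Abelian_group_induct[OF x]) (auto simp: b0 b_diff AE.T_zero AE.T_diff right[OF y])
  \<comment> \<open>Both arguments change at once; the difference of values is split as
    \<open>b x (y - y0) + b (x - x0) y0\<close>.\<close>
  have const: "tensor_class R S (Hom C A E) (b x y) = tensor_class R S (Hom C A E) (b (frag_of (t, f)) (frag_of (s, g)))"
    if x: "x - frag_of (t, f) \<in> AB.T" and y: "y - frag_of (s, g) \<in> BE.T" for x y
  proof -
    have "Poly_Mapping.keys x \<subseteq> carrier S \<times> mor A B"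
      using AB.T_subset[OF x] c keys_add[of "x - frag_of (t, f)" "frag_of (t, f)"] by auto
    then have "b x (y - frag_of (s, g)) \<in> AE.T" by (rule right'[OF y])
    moreover have "b (x - frag_of (t, f)) (frag_of (s, g)) \<in> AE.T" using left[OF x] c by simp
    ultimately have "b x (y - frag_of (s, g)) + b (x - frag_of (t, f)) (frag_of (s, g)) \<in> AE.T"
      by (rule AE.T_add)
    then show ?thesis unfolding AE.tc_eq_iff by (simp add: b_diff)
  qed
  have inner: "(\<Union>x\<in>AB.tc (frag_of (t, f)). tensor_class R S (Hom C A E) (b x y))
      = tensor_class R S (Hom C A E) (b (frag_of (t, f)) (frag_of (s, g)))"
    if y: "y - frag_of (s, g) \<in> BE.T" for y
  proof -
    have "tensor_class R S (Hom C A E) (b (frag_of (t, f)) y)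
        = tensor_class R S (Hom C A E) (b (frag_of (t, f)) (frag_of (s, g)))"
      by (rule const[OF _ y]) (simp add: AB.T_zero)
    then show ?thesis
      using AB.coset_union[of "frag_of (t, f)" "\<lambda>x. tensor_class R S (Hom C A E) (b x y)"] const[OF _ y]
      by simp
  qed
  have "Comp D A B E (pt B E s g) (pt A B t f) =
      (\<Union>y\<in>BE.tc (frag_of (s, g)). \<Union>x\<in>AB.tc (frag_of (t, f)). tensor_class R S (Hom C A E) (b x y))"
    unfolding pt_def scalar_extension_def b_def k_def by (simp add: case_prod_unfold)
  also have "\<dots> = tensor_class R S (Hom C A E) (b (frag_of (t, f)) (frag_of (s, g)))"
    using BE.coset_union[of "frag_of (s, g)"
        "\<lambda>y. \<Union>x\<in>AB.tc (frag_of (t, f)). tensor_class R S (Hom C A E) (b x y)"]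
      inner inner[of "frag_of (s, g)"] BE.T_zero by simp
  also have "\<dots> = pt A E (s \<otimes>\<^bsub>S\<^esub> t) (Comp C A B E g f)"
    unfolding pt_def b_def k_def by simp
  finally show ?thesis .
qed

lemma D_category: "R_category S D"
proof (intro R_category.intro S_cring, goal_cases)
  case (1 A B) then show ?case using D_module by simp
next
  case (2 A) then show ?case unfolding D_Ident by (simp add: pt_closed Ident_closed)
next
  case (3 A B E g f)
  then show ?case using pt_exists[of A B f] pt_exists[of B E g] by (auto simp: pt_Comp pt_closed Comp_closed)
next
  case (4 A B E G h g f)
  then show ?case using pt_exists[of A B f] pt_exists[of B E g] pt_exists[of E G h]
    by (auto simp: pt_Comp pt_closed Comp_closed S.m_assoc Comp_assoc)
next
  case (5 A B f)
  then show ?case using pt_exists[of A B f] by (auto simp: D_Ident pt_Comp Ident_closed Ident_left)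
next
  case (6 A B f)
  then show ?case using pt_exists[of A B f] by (auto simp: D_Ident pt_Comp Ident_closed Ident_right)
next
  case (7 A B E g g' f)
  then show ?case using pt_exists2[of B E g g'] pt_exists[of A B f]
    by (auto simp: pt_Comp pt_add_right[symmetric] mor_add Comp_closed Comp_add_left)
next
  case (8 A B E g f f')
  then show ?case using pt_exists2[of A B f f'] pt_exists[of B E g]
    by (auto simp: pt_Comp pt_add_right[symmetric] mor_add Comp_closed Comp_add_right)
next
  case (9 A B E r g f)
  then show ?case using pt_exists[of A B f] pt_exists[of B E g]
    by (auto simp: pt_Comp D_smult Comp_closed S.m_assoc)
next
  case (10 A B E r g f)
  then show ?case using pt_exists[of A B f] pt_exists[of B E g]
    by (auto simp: pt_Comp D_smult Comp_closed S.m_lcomm)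
qed

lemma D_spanned:
  assumes "hom_finite R C" "A \<in> Ob C" "B \<in> Ob C"
  shows "\<exists>gs. set gs \<subseteq> carrier (Hom D A B) \<and> carrier (Hom D A B) \<subseteq> span_list S (Hom D A B) gs"
proof -
  interpret tensor_product R S "Hom C A B" by (rule tensor_product_Hom[OF assms(2,3)])
  obtain gs where gs: "set gs \<subseteq> mor A B" "mor A B \<subseteq> span_list R (Hom C A B) gs"
    using assms lincombs_spanned[OF module_axioms] unfolding hom_finite_def by metis
  then show ?thesis using tensor_spanned[OF gs] pure_closed unfolding D_Hom
    by (intro exI[of _ "map (pure_tensor \<one>\<^bsub>S\<^esub>) gs"]) auto
qed

end

section \<open>The fully additive envelope\<close>

lemma (in comm_monoid) finprod_swap:
  assumes "finite A" "finite B" "\<And>i j. i \<in> A \<Longrightarrow> j \<in> B \<Longrightarrow> f i j \<in> carrier G"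
  shows "finprod G (\<lambda>i. finprod G (f i) B) A = finprod G (\<lambda>j. finprod G (\<lambda>i. f i j) A) B"
  using assms(1,3)
proof (induction A)
  case empty
  then show ?case by simp
next
  case (insert a A)
  have c: "(\<lambda>i. finprod G (f i) B) \<in> A \<rightarrow> carrier G" "(\<lambda>j. finprod G (\<lambda>i. f i j) A) \<in> B \<rightarrow> carrier G"
    "f a \<in> B \<rightarrow> carrier G"
    using insert.prems by (auto intro!: finprod_closed)
  have "finprod G (\<lambda>j. finprod G (\<lambda>i. f i j) (insert a A)) B
      = finprod G (\<lambda>j. f a j \<otimes> finprod G (\<lambda>i. f i j) A) B"
    using insert c by (intro finprod_cong') (auto simp: Pi_def)
  then show ?case using insert c by (simp add: finprod_multf finprod_closed Pi_def)
qed

text \<open>Additive inverses of matrices will be taken as multiples by minus one, so that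
  compatibility of composition with scalars covers negation as well.\<close>

lemma (in module) neg_one_smult: "x \<in> carrier M \<Longrightarrow> (\<ominus> \<one>) \<odot>\<^bsub>M\<^esub> x \<oplus>\<^bsub>M\<^esub> x = \<zero>\<^bsub>M\<^esub>"
  by (simp add: smult_l_minus M.l_neg)

context R_category
begin

section \<open>Matrices of morphisms\<close>

abbreviation "Objs As \<equiv> set As \<subseteq> Ob C"

lemma nth_Ob: "Objs As \<Longrightarrow> j < length As \<Longrightarrow> As ! j \<in> Ob C"
  by (meson nth_mem subsetD)

lemma mats_entry: "x \<in> mats C As Bs \<Longrightarrow> i < length Bs \<Longrightarrow> j < length As \<Longrightarrow> x (i, j) \<in> mor (As ! j) (Bs ! i)"
  unfolding mats_def index_set_def by (auto dest!: PiE_mem)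

lemma matsI:
  assumes "\<And>i j. i < length Bs \<Longrightarrow> j < length As \<Longrightarrow> f (i, j) \<in> mor (As ! j) (Bs ! i)"
  shows "restrict f (index_set As Bs) \<in> mats C As Bs"
  unfolding mats_def using assms by (intro restrict_PiE_iff[THEN iffD2]) (auto simp: index_set_def)

lemma mat_eqI:
  assumes "x \<in> mats C As Bs" "y \<in> mats C As Bs"
    and "\<And>i j. i < length Bs \<Longrightarrow> j < length As \<Longrightarrow> x (i, j) = y (i, j)"
  shows "x = y"
  using assms(1,2) unfolding mats_def by (rule PiE_ext) (auto simp: index_set_def assms(3))

lemma index_set_iff: "(i, j) \<in> index_set As Bs \<longleftrightarrow> i < length Bs \<and> j < length As"
  by (simp add: index_set_def)

definition mat_add where
  "mat_add As Bs x y = (\<lambda>(i, j)\<in>index_set As Bs. x (i, j) \<oplus>\<^bsub>Hom C (As ! j) (Bs ! i)\<^esub> y (i, j))"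

definition mat_smult where
  "mat_smult As Bs r x = (\<lambda>(i, j)\<in>index_set As Bs. r \<odot>\<^bsub>Hom C (As ! j) (Bs ! i)\<^esub> x (i, j))"

definition mat_zero where
  "mat_zero As Bs = (\<lambda>(i, j)\<in>index_set As Bs. \<zero>\<^bsub>Hom C (As ! j) (Bs ! i)\<^esub>)"

lemma mat_entries:
  assumes "i < length Bs" "j < length As"
  shows "mat_add As Bs x y (i, j) = x (i, j) \<oplus>\<^bsub>Hom C (As ! j) (Bs ! i)\<^esub> y (i, j)"
    and "mat_smult As Bs r x (i, j) = r \<odot>\<^bsub>Hom C (As ! j) (Bs ! i)\<^esub> x (i, j)"
    and "mat_zero As Bs (i, j) = \<zero>\<^bsub>Hom C (As ! j) (Bs ! i)\<^esub>"
    and "mat_comp C As Ds Bs g f (i, j) = finsum (Hom C (As ! j) (Bs ! i))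
      (\<lambda>l. Comp C (As ! j) (Ds ! l) (Bs ! i) (g (i, l)) (f (l, j))) {..<length Ds}"
  using assms by (simp_all add: mat_add_def mat_smult_def mat_zero_def mat_comp_def index_set_iff)

lemma mat_ident_entry:
  "i < length As \<Longrightarrow> j < length As \<Longrightarrow>
    mat_ident C As (i, j) = (if i = j then Ident C (As ! i) else \<zero>\<^bsub>Hom C (As ! j) (As ! i)\<^esub>)"
  by (simp add: mat_ident_def index_set_iff)

lemma mat_closed:
  assumes "Objs As" "Objs Bs"
  shows "x \<in> mats C As Bs \<Longrightarrow> y \<in> mats C As Bs \<Longrightarrow> mat_add As Bs x y \<in> mats C As Bs"
    and "x \<in> mats C As Bs \<Longrightarrow> r \<in> carrier R \<Longrightarrow> mat_smult As Bs r x \<in> mats C As Bs"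
    and "mat_zero As Bs \<in> mats C As Bs"
  unfolding mat_add_def mat_smult_def mat_zero_def
  using assms by (auto intro!: matsI mor_add mor_smult mor_zero nth_Ob dest: mats_entry)

lemma mat_ident_closed: "Objs As \<Longrightarrow> mat_ident C As \<in> mats C As As"
  unfolding mat_ident_def by (auto intro!: matsI mor_zero nth_Ob Ident_closed)

lemma finsum_mor_closed:
  "A \<in> Ob C \<Longrightarrow> B \<in> Ob C \<Longrightarrow> f \<in> I \<rightarrow> mor A B \<Longrightarrow> finsum (Hom C A B) f I \<in> mor A B"
  using abelian_monoid.finsum_closed Hom_abelian abelian_group.axioms(1) by blast

lemma mat_terms_closed:
  assumes "Objs As" "Objs Bs" "Objs Ds" "g \<in> mats C Bs Ds" "f \<in> mats C As Bs" "i < length Ds" "k < length As"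
  shows "(\<lambda>j. Comp C (As ! k) (Bs ! j) (Ds ! i) (g (i, j)) (f (j, k))) \<in> {..<length Bs} \<rightarrow> mor (As ! k) (Ds ! i)"
  using assms by (auto intro!: Comp_closed nth_Ob simp: mats_entry)

lemma mat_comp_closed:
  assumes "Objs As" "Objs Bs" "Objs Ds" "g \<in> mats C Bs Ds" "f \<in> mats C As Bs"
  shows "mat_comp C As Bs Ds g f \<in> mats C As Ds"
  unfolding mat_comp_def
  by (rule matsI) (use mat_terms_closed[OF assms] assms in \<open>auto intro!: finsum_mor_closed nth_Ob\<close>)

lemma mat_comp_assoc:
  assumes O: "Objs As" "Objs Bs" "Objs Ds" "Objs Es"
    and m: "h \<in> mats C Ds Es" "g \<in> mats C Bs Ds" "f \<in> mats C As Bs"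
  shows "mat_comp C As Ds Es h (mat_comp C As Bs Ds g f) = mat_comp C As Bs Es (mat_comp C Bs Ds Es h g) f"
proof (rule mat_eqI)
  show "mat_comp C As Ds Es h (mat_comp C As Bs Ds g f) \<in> mats C As Es"
    "mat_comp C As Bs Es (mat_comp C Bs Ds Es h g) f \<in> mats C As Es"
    using O m by (auto intro!: mat_comp_closed)
  fix i l assume il: "i < length Es" "l < length As"
  let ?A = "As ! l" and ?E = "Es ! i"
  have Ob: "?A \<in> Ob C" "?E \<in> Ob C" using O il nth_Ob by auto
  interpret M: module R "Hom C ?A ?E" using Ob by (rule Hom_module)
  let ?t = "\<lambda>k j. Comp C ?A (Bs ! j) ?E (Comp C (Bs ! j) (Ds ! k) ?E (h (i, k)) (g (k, j))) (f (j, l))"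
  have tc: "?t k j \<in> mor ?A ?E" if "k < length Ds" "j < length Bs" for k j
    using that O m il by (auto intro!: Comp_closed nth_Ob simp: mats_entry)
  have "mat_comp C As Ds Es h (mat_comp C As Bs Ds g f) (i, l)
      = finsum (Hom C ?A ?E) (\<lambda>k. finsum (Hom C ?A ?E) (?t k) {..<length Bs}) {..<length Ds}"
  proof -
    have "Comp C ?A (Ds ! k) ?E (h (i, k)) (mat_comp C As Bs Ds g f (k, l))
        = finsum (Hom C ?A ?E) (?t k) {..<length Bs}" if k: "k < length Ds" for k
    proof -
      have Dk: "Ds ! k \<in> Ob C" "h (i, k) \<in> mor (Ds ! k) ?E" using O m k il nth_Ob mats_entry by auto
      have "Comp C ?A (Ds ! k) ?E (h (i, k)) (mat_comp C As Bs Ds g f (k, l))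
        = finsum (Hom C ?A ?E) (\<lambda>j. Comp C ?A (Ds ! k) ?E (h (i, k))
            (Comp C ?A (Bs ! j) (Ds ! k) (g (k, j)) (f (j, l)))) {..<length Bs}"
        using k il Ob Dk mat_terms_closed[OF O(1,2,3) m(2,3) k il(2)]
        by (simp add: mat_entries Comp_finsum_right)
      also have "\<dots> = finsum (Hom C ?A ?E) (?t k) {..<length Bs}"
        using k il Ob Dk O m tc[OF k] by (intro M.finsum_cong') (auto simp: Comp_assoc nth_Ob mats_entry)
      finally show ?thesis .
    qed
    then show ?thesis unfolding mat_entries(4)[OF il]
      by (intro M.finsum_cong') (use tc in \<open>auto intro!: M.finsum_closed\<close>)
  qed
  also have "\<dots> = finsum (Hom C ?A ?E) (\<lambda>j. finsum (Hom C ?A ?E) (\<lambda>k. ?t k j) {..<length Ds}) {..<length Bs}"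
    using tc by (intro M.add.finprod_swap[folded finsum_def]) auto
  also have "\<dots> = mat_comp C As Bs Es (mat_comp C Bs Ds Es h g) f (i, l)"
  proof -
    have "Comp C ?A (Bs ! j) ?E (mat_comp C Bs Ds Es h g (i, j)) (f (j, l))
        = finsum (Hom C ?A ?E) (\<lambda>k. ?t k j) {..<length Ds}" if j: "j < length Bs" for j
    proof -
      have "Bs ! j \<in> Ob C" "f (j, l) \<in> mor ?A (Bs ! j)" using O m j il nth_Ob mats_entry by auto
      then show ?thesis
        using j il Ob mat_terms_closed[OF O(2,3,4) m(1,2) il(1) j]
        by (simp add: mat_entries Comp_finsum_left)
    qed
    then show ?thesis unfolding mat_entries(4)[OF il]
      by (intro M.finsum_cong' refl) (use tc in \<open>auto intro!: M.finsum_closed\<close>)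
  qed
  finally show "mat_comp C As Ds Es h (mat_comp C As Bs Ds g f) (i, l)
      = mat_comp C As Bs Es (mat_comp C Bs Ds Es h g) f (i, l)" .
qed

lemma mat_ident_left:
  assumes O: "Objs As" "Objs Bs" and f: "f \<in> mats C As Bs"
  shows "mat_comp C As Bs Bs (mat_ident C Bs) f = f"
proof (rule mat_eqI[OF _ f])
  show "mat_comp C As Bs Bs (mat_ident C Bs) f \<in> mats C As Bs"
    using O f by (intro mat_comp_closed mat_ident_closed)
  fix i j assume ij: "i < length Bs" "j < length As"
  have Ob: "As ! j \<in> Ob C" "Bs ! i \<in> Ob C" using O ij nth_Ob by auto
  interpret M: module R "Hom C (As ! j) (Bs ! i)" using Ob by (rule Hom_module)
  have "mat_comp C As Bs Bs (mat_ident C Bs) f (i, j)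
     = finsum (Hom C (As ! j) (Bs ! i)) (\<lambda>l. if i = l then f (i, j) else \<zero>\<^bsub>Hom C (As ! j) (Bs ! i)\<^esub>) {..<length Bs}"
    using ij Ob O f mats_entry[OF f] nth_Ob[OF O(2)]
    by (simp add: mat_entries) (intro M.finsum_cong', auto simp: mat_ident_entry Ident_left Comp_zero_left mor_zero)
  also have "\<dots> = f (i, j)"
    by (rule M.add.finprod_singleton[folded finsum_def])
      (use ij f O in \<open>auto simp: mor_zero nth_Ob mats_entry\<close>)
  finally show "mat_comp C As Bs Bs (mat_ident C Bs) f (i, j) = f (i, j)" .
qed

lemma mat_ident_right:
  assumes O: "Objs As" "Objs Bs" and f: "f \<in> mats C As Bs"
  shows "mat_comp C As As Bs f (mat_ident C As) = f"
proof (rule mat_eqI[OF _ f])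
  show "mat_comp C As As Bs f (mat_ident C As) \<in> mats C As Bs"
    using O f by (intro mat_comp_closed mat_ident_closed)
  fix i j assume ij: "i < length Bs" "j < length As"
  have Ob: "As ! j \<in> Ob C" "Bs ! i \<in> Ob C" using O ij nth_Ob by auto
  interpret M: module R "Hom C (As ! j) (Bs ! i)" using Ob by (rule Hom_module)
  have "mat_comp C As As Bs f (mat_ident C As) (i, j)
     = finsum (Hom C (As ! j) (Bs ! i)) (\<lambda>l. if j = l then f (i, j) else \<zero>\<^bsub>Hom C (As ! j) (Bs ! i)\<^esub>) {..<length As}"
    using ij Ob O f mats_entry[OF f] nth_Ob[OF O(1)]
    by (simp add: mat_entries) (intro M.finsum_cong', auto simp: mat_ident_entry Ident_right Comp_zero_right mor_zero)
  also have "\<dots> = f (i, j)"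
    by (rule M.add.finprod_singleton[folded finsum_def])
      (use ij f O in \<open>auto simp: mor_zero nth_Ob mats_entry\<close>)
  finally show "mat_comp C As As Bs f (mat_ident C As) (i, j) = f (i, j)" .
qed

lemma mat_comp_add_left:
  assumes O: "Objs As" "Objs Bs" "Objs Ds" and m: "g \<in> mats C Bs Ds" "g' \<in> mats C Bs Ds" "f \<in> mats C As Bs"
  shows "mat_comp C As Bs Ds (mat_add Bs Ds g g') f = mat_add As Ds (mat_comp C As Bs Ds g f) (mat_comp C As Bs Ds g' f)"
proof (rule mat_eqI)
  fix i j assume ij: "i < length Ds" "j < length As"
  have Ob: "As ! j \<in> Ob C" "Ds ! i \<in> Ob C" using O ij nth_Ob by auto
  interpret M: module R "Hom C (As ! j) (Ds ! i)" using Ob by (rule Hom_module)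
  let ?H = "Hom C (As ! j) (Ds ! i)"
  have "mat_comp C As Bs Ds (mat_add Bs Ds g g') f (i, j)
      = finsum ?H (\<lambda>l. Comp C (As ! j) (Bs ! l) (Ds ! i) (g (i, l)) (f (l, j)) \<oplus>\<^bsub>?H\<^esub>
          Comp C (As ! j) (Bs ! l) (Ds ! i) (g' (i, l)) (f (l, j))) {..<length Bs}"
    unfolding mat_entries(4)[OF ij]
    by (rule M.finsum_cong') (use ij Ob O m in \<open>auto simp: mat_entries Comp_add_left mats_entry nth_Ob
      intro!: mor_add Comp_closed\<close>)
  also have "\<dots> = mat_add As Ds (mat_comp C As Bs Ds g f) (mat_comp C As Bs Ds g' f) (i, j)"
    unfolding mat_entries(1)[OF ij] mat_entries(4)[OF ij]
    by (rule M.finsum_addf[OF mat_terms_closed[OF O m(1,3) ij] mat_terms_closed[OF O m(2,3) ij]])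
  finally show "mat_comp C As Bs Ds (mat_add Bs Ds g g') f (i, j)
      = mat_add As Ds (mat_comp C As Bs Ds g f) (mat_comp C As Bs Ds g' f) (i, j)" .
qed (use assms in \<open>auto intro!: mat_comp_closed mat_closed\<close>)

lemma mat_comp_add_right:
  assumes O: "Objs As" "Objs Bs" "Objs Ds" and m: "g \<in> mats C Bs Ds" "f \<in> mats C As Bs" "f' \<in> mats C As Bs"
  shows "mat_comp C As Bs Ds g (mat_add As Bs f f') = mat_add As Ds (mat_comp C As Bs Ds g f) (mat_comp C As Bs Ds g f')"
proof (rule mat_eqI)
  fix i j assume ij: "i < length Ds" "j < length As"
  have Ob: "As ! j \<in> Ob C" "Ds ! i \<in> Ob C" using O ij nth_Ob by auto
  interpret M: module R "Hom C (As ! j) (Ds ! i)" using Ob by (rule Hom_module)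
  let ?H = "Hom C (As ! j) (Ds ! i)"
  have "mat_comp C As Bs Ds g (mat_add As Bs f f') (i, j)
      = finsum ?H (\<lambda>l. Comp C (As ! j) (Bs ! l) (Ds ! i) (g (i, l)) (f (l, j)) \<oplus>\<^bsub>?H\<^esub>
          Comp C (As ! j) (Bs ! l) (Ds ! i) (g (i, l)) (f' (l, j))) {..<length Bs}"
    unfolding mat_entries(4)[OF ij]
    by (rule M.finsum_cong') (use ij Ob O m in \<open>auto simp: mat_entries Comp_add_right mats_entry nth_Ob
      intro!: mor_add Comp_closed\<close>)
  also have "\<dots> = mat_add As Ds (mat_comp C As Bs Ds g f) (mat_comp C As Bs Ds g f') (i, j)"
    unfolding mat_entries(1)[OF ij] mat_entries(4)[OF ij]
    by (rule M.finsum_addf[OF mat_terms_closed[OF O m(1,2) ij] mat_terms_closed[OF O m(1,3) ij]])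
  finally show "mat_comp C As Bs Ds g (mat_add As Bs f f') (i, j)
      = mat_add As Ds (mat_comp C As Bs Ds g f) (mat_comp C As Bs Ds g f') (i, j)" .
qed (use assms in \<open>auto intro!: mat_comp_closed mat_closed\<close>)

lemma mat_comp_smult_left:
  assumes O: "Objs As" "Objs Bs" "Objs Ds" and m: "g \<in> mats C Bs Ds" "f \<in> mats C As Bs" and r: "r \<in> carrier R"
  shows "mat_comp C As Bs Ds (mat_smult Bs Ds r g) f = mat_smult As Ds r (mat_comp C As Bs Ds g f)"
proof (rule mat_eqI)
  fix i j assume ij: "i < length Ds" "j < length As"
  have Ob: "As ! j \<in> Ob C" "Ds ! i \<in> Ob C" using O ij nth_Ob by auto
  interpret M: module R "Hom C (As ! j) (Ds ! i)" using Ob by (rule Hom_module)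
  let ?H = "Hom C (As ! j) (Ds ! i)"
  have "mat_comp C As Bs Ds (mat_smult Bs Ds r g) f (i, j)
      = finsum ?H (\<lambda>l. r \<odot>\<^bsub>?H\<^esub> Comp C (As ! j) (Bs ! l) (Ds ! i) (g (i, l)) (f (l, j))) {..<length Bs}"
    unfolding mat_entries(4)[OF ij]
    by (rule M.finsum_cong') (use ij Ob O m r in \<open>auto simp: mat_entries Comp_smult_left mats_entry nth_Ob
      intro!: mor_smult Comp_closed\<close>)
  also have "\<dots> = mat_smult As Ds r (mat_comp C As Bs Ds g f) (i, j)"
    unfolding mat_entries(2)[OF ij] mat_entries(4)[OF ij]
    by (rule M.finsum_smult_ldistr[OF _ r mat_terms_closed[OF O m ij], symmetric]) simp
  finally show "mat_comp C As Bs Ds (mat_smult Bs Ds r g) f (i, j) = mat_smult As Ds r (mat_comp C As Bs Ds g f) (i, j)" .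
qed (use assms in \<open>auto intro!: mat_comp_closed mat_closed\<close>)

lemma mat_comp_smult_right:
  assumes O: "Objs As" "Objs Bs" "Objs Ds" and m: "g \<in> mats C Bs Ds" "f \<in> mats C As Bs" and r: "r \<in> carrier R"
  shows "mat_comp C As Bs Ds g (mat_smult As Bs r f) = mat_smult As Ds r (mat_comp C As Bs Ds g f)"
proof (rule mat_eqI)
  fix i j assume ij: "i < length Ds" "j < length As"
  have Ob: "As ! j \<in> Ob C" "Ds ! i \<in> Ob C" using O ij nth_Ob by auto
  interpret M: module R "Hom C (As ! j) (Ds ! i)" using Ob by (rule Hom_module)
  let ?H = "Hom C (As ! j) (Ds ! i)"
  have "mat_comp C As Bs Ds g (mat_smult As Bs r f) (i, j)
      = finsum ?H (\<lambda>l. r \<odot>\<^bsub>?H\<^esub> Comp C (As ! j) (Bs ! l) (Ds ! i) (g (i, l)) (f (l, j))) {..<length Bs}"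
    unfolding mat_entries(4)[OF ij]
    by (rule M.finsum_cong') (use ij Ob O m r in \<open>auto simp: mat_entries Comp_smult_right mats_entry nth_Ob
      intro!: mor_smult Comp_closed\<close>)
  also have "\<dots> = mat_smult As Ds r (mat_comp C As Bs Ds g f) (i, j)"
    unfolding mat_entries(2)[OF ij] mat_entries(4)[OF ij]
    by (rule M.finsum_smult_ldistr[OF _ r mat_terms_closed[OF O m ij], symmetric]) simp
  finally show "mat_comp C As Bs Ds g (mat_smult As Bs r f) (i, j) = mat_smult As Ds r (mat_comp C As Bs Ds g f) (i, j)" .
qed (use assms in \<open>auto intro!: mat_comp_closed mat_closed\<close>)

section \<open>The envelope as a category enriched in modules\<close>

abbreviation "E \<equiv> add_envelope C"

lemma E_Ob_iff: "(As, e) \<in> Ob E \<longleftrightarrow> Objs As \<and> e \<in> mats C As As \<and> mat_comp C As As As e e = e"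
  by (simp add: add_envelope_def)

lemma E_sel:
  "carrier (Hom E (As, e) (Bs, f)) =
     {x \<in> mats C As Bs. mat_comp C As Bs Bs f x = x \<and> mat_comp C As As Bs x e = x}"
  "\<zero>\<^bsub>Hom E (As, e) (Bs, f)\<^esub> = mat_zero As Bs"
  "x \<oplus>\<^bsub>Hom E (As, e) (Bs, f)\<^esub> y = mat_add As Bs x y"
  "r \<odot>\<^bsub>Hom E (As, e) (Bs, f)\<^esub> x = mat_smult As Bs r x"
  "Comp E (As, e) (Bs, f) (Ds, g) = mat_comp C As Bs Ds"
  "Ident E (As, e) = e"
  by (simp_all add: add_envelope_def mat_zero_def mat_add_def mat_smult_def)

context
  fixes As Bs
  assumes O: "Objs As" "Objs Bs"
begin

lemma
  assumes x: "x \<in> mats C As Bs"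
  shows mat_zero_add: "mat_add As Bs (mat_zero As Bs) x = x"
    and mat_neg_add: "mat_add As Bs (mat_smult As Bs (\<ominus>\<^bsub>R\<^esub> \<one>\<^bsub>R\<^esub>) x) x = mat_zero As Bs"
    and mat_one_smult: "mat_smult As Bs \<one>\<^bsub>R\<^esub> x = x"
    and mat_zero_smult: "mat_smult As Bs \<zero>\<^bsub>R\<^esub> x = mat_zero As Bs"
    and mat_smult_add: "r \<in> carrier R \<Longrightarrow> s \<in> carrier R \<Longrightarrow>
      mat_smult As Bs (r \<oplus>\<^bsub>R\<^esub> s) x = mat_add As Bs (mat_smult As Bs r x) (mat_smult As Bs s x)"
    and mat_smult_mult: "r \<in> carrier R \<Longrightarrow> s \<in> carrier R \<Longrightarrow>
      mat_smult As Bs (r \<otimes>\<^bsub>R\<^esub> s) x = mat_smult As Bs r (mat_smult As Bs s x)"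
    and mat_add_comm: "y \<in> mats C As Bs \<Longrightarrow> mat_add As Bs x y = mat_add As Bs y x"
    and mat_add_smult: "y \<in> mats C As Bs \<Longrightarrow> r \<in> carrier R \<Longrightarrow>
      mat_smult As Bs r (mat_add As Bs x y) = mat_add As Bs (mat_smult As Bs r x) (mat_smult As Bs r y)"
    and mat_add_assoc: "y \<in> mats C As Bs \<Longrightarrow> z \<in> mats C As Bs \<Longrightarrow>
      mat_add As Bs (mat_add As Bs x y) z = mat_add As Bs x (mat_add As Bs y z)"
proof -
  interpret R: cring R by (rule scalars)
  have M: "module R (Hom C (As ! j) (Bs ! i))" if "i < length Bs" "j < length As" for i j
    using that O by (intro Hom_module nth_Ob)
  note rules = mat_entries nth_Ob mats_entry mor_a_assoc mor_l_zero
    module.smult_one[OF M] module.smult_r_distr[OF M] module.smult_l_distr[OF M] module.smult_assoc1[OF M]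
    module.smult_l_null[OF M] module.neg_one_smult[OF M]
  show "mat_add As Bs (mat_zero As Bs) x = x"
    "mat_add As Bs (mat_smult As Bs (\<ominus>\<^bsub>R\<^esub> \<one>\<^bsub>R\<^esub>) x) x = mat_zero As Bs"
    "mat_smult As Bs \<one>\<^bsub>R\<^esub> x = x"
    "mat_smult As Bs \<zero>\<^bsub>R\<^esub> x = mat_zero As Bs"
    "r \<in> carrier R \<Longrightarrow> s \<in> carrier R \<Longrightarrow>
      mat_smult As Bs (r \<oplus>\<^bsub>R\<^esub> s) x = mat_add As Bs (mat_smult As Bs r x) (mat_smult As Bs s x)"
    "r \<in> carrier R \<Longrightarrow> s \<in> carrier R \<Longrightarrow>
      mat_smult As Bs (r \<otimes>\<^bsub>R\<^esub> s) x = mat_smult As Bs r (mat_smult As Bs s x)"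
    "y \<in> mats C As Bs \<Longrightarrow> r \<in> carrier R \<Longrightarrow>
      mat_smult As Bs r (mat_add As Bs x y) = mat_add As Bs (mat_smult As Bs r x) (mat_smult As Bs r y)"
    "y \<in> mats C As Bs \<Longrightarrow> z \<in> mats C As Bs \<Longrightarrow>
      mat_add As Bs (mat_add As Bs x y) z = mat_add As Bs x (mat_add As Bs y z)"
    using O x by (auto intro!: mat_eqI[where As = As and Bs = Bs] mat_closed simp: rules)
  show "y \<in> mats C As Bs \<Longrightarrow> mat_add As Bs x y = mat_add As Bs y x"
    by (rule mat_eqI[where As = As and Bs = Bs])
      (use O x in \<open>auto intro!: mat_closed mor_a_comm nth_Ob simp: mat_entries mats_entry\<close>)
qed

end

lemma E_module:
  assumes "A \<in> Ob E" "B \<in> Ob E"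
  shows "module R (Hom E A B)"
proof -
  obtain As e Bs f where AB: "A = (As, e)" "B = (Bs, f)" by (metis surj_pair)
  have O: "Objs As" "e \<in> mats C As As" "Objs Bs" "f \<in> mats C Bs Bs"
    using assms unfolding AB E_Ob_iff by auto
  interpret R: cring R by (rule scalars)
  note closed = mat_closed[OF O(1,3)]
  \<comment> \<open>The zero matrix is \<open>0\<close> times itself, so its composites vanish by
    compatibility with scalars.\<close>
  have fz: "mat_comp C As Bs Bs f (mat_zero As Bs) = mat_zero As Bs"
    using mat_comp_smult_right[OF O(1,3,3,4) closed(3) R.zero_closed]
      mat_zero_smult[OF O(1,3)] mat_comp_closed[OF O(1,3,3,4)] closed(3) by simp
  have ze: "mat_comp C As As Bs (mat_zero As Bs) e = mat_zero As Bs"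
    using mat_comp_smult_left[OF O(1,1,3) closed(3) O(2) R.zero_closed]
      mat_zero_smult[OF O(1,3)] mat_comp_closed[OF O(1,1,3) _ O(2)] closed(3) by simp
  note bil = mat_comp_add_left[OF O(1,1,3)] mat_comp_add_right[OF O(1,3,3)]
    mat_comp_smult_left[OF O(1,1,3)] mat_comp_smult_right[OF O(1,3,3)] fz ze
  show ?thesis unfolding AB
  proof (rule moduleI)
    show "cring R" by (rule scalars)
    show "abelian_group (Hom E (As, e) (Bs, f))"
    proof (rule abelian_groupI)
      fix x assume x: "x \<in> carrier (Hom E (As, e) (Bs, f))"
      then show "\<exists>y\<in>carrier (Hom E (As, e) (Bs, f)). y \<oplus>\<^bsub>Hom E (As, e) (Bs, f)\<^esub> x = \<zero>\<^bsub>Hom E (As, e) (Bs, f)\<^esub>"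
        unfolding E_sel using mat_neg_add[OF O(1,3), of x] O
        by (intro bexI[of _ "mat_smult As Bs (\<ominus>\<^bsub>R\<^esub> \<one>\<^bsub>R\<^esub>) x"]) (auto simp: bil closed)
      show "\<zero>\<^bsub>Hom E (As, e) (Bs, f)\<^esub> \<oplus>\<^bsub>Hom E (As, e) (Bs, f)\<^esub> x = x"
        using x mat_zero_add[OF O(1,3)] unfolding E_sel by simp
      fix y assume y: "y \<in> carrier (Hom E (As, e) (Bs, f))"
      show "x \<oplus>\<^bsub>Hom E (As, e) (Bs, f)\<^esub> y = y \<oplus>\<^bsub>Hom E (As, e) (Bs, f)\<^esub> x"
        using x y mat_add_comm[OF O(1,3), of x y] unfolding E_sel by simp
    qed (use O in \<open>auto simp: E_sel bil closed mat_add_assoc\<close>)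
  qed (use O in \<open>auto simp: E_sel bil closed mat_one_smult mat_smult_add mat_add_smult mat_smult_mult\<close>)
qed

lemma E_category: "R_category R E"
proof (intro R_category.intro scalars, goal_cases)
  case (1 A B)
  then show ?case by (rule E_module)
next
  case (2 A)
  then show ?case by (cases A) (auto simp: E_Ob_iff E_sel)
next
  case (3 A B D g f)
  then show ?case
    by (cases A; cases B; cases D) (auto simp: E_Ob_iff E_sel mat_comp_closed mat_comp_assoc, simp_all flip: mat_comp_assoc)
next
  case (4 A B D G h g f)
  then show ?case by (cases A; cases B; cases D; cases G) (auto simp: E_Ob_iff E_sel mat_comp_assoc)
next
  case (5 A B f)
  then show ?case by (cases A; cases B) (auto simp: E_sel)
next
  case (6 A B f)
  then show ?case by (cases A; cases B) (auto simp: E_sel)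
next
  case (7 A B D g g' f)
  then show ?case by (cases A; cases B; cases D) (auto simp: E_Ob_iff E_sel mat_comp_add_left)
next
  case (8 A B D g f f')
  then show ?case by (cases A; cases B; cases D) (auto simp: E_Ob_iff E_sel mat_comp_add_right)
next
  case (9 A B D r g f)
  then show ?case by (cases A; cases B; cases D) (auto simp: E_Ob_iff E_sel mat_comp_smult_left)
next
  case (10 A B D r g f)
  then show ?case by (cases A; cases B; cases D) (auto simp: E_Ob_iff E_sel mat_comp_smult_right)
qed

text \<open>An idempotent \<open>x\<close> of \<open>(As, e)\<close> is split by the object
  \<open>(As, x)\<close>, with \<open>x\<close> itself serving as projection and as
  inclusion.\<close>

lemma E_idempotents_split: "idempotents_split E"
  unfolding idempotents_split_def
proof (intro ballI impI)
  fix A x assume A: "A \<in> Ob E" and x: "x \<in> carrier (Hom E A A)" "Comp E A A A x x = x"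
  obtain As e where As: "A = (As, e)" by (metis surj_pair)
  show "\<exists>B\<in>Ob E. \<exists>p\<in>carrier (Hom E A B). \<exists>i\<in>carrier (Hom E B A).
      Comp E A B A i p = x \<and> Comp E B A B p i = Ident E B"
    using A x unfolding As
    by (intro bexI[of _ "(As, x)"] bexI[of _ x]) (auto simp: E_sel E_Ob_iff)
qed

section \<open>The full embedding into the envelope\<close>

lemma env_ob_Ob: "A \<in> Ob C \<Longrightarrow> env_ob C A \<in> Ob E"
  unfolding env_ob_def E_Ob_iff by (simp add: mat_ident_closed mat_ident_left)

lemma index_set_singleton: "index_set [A] [B] = {(0, 0)}"
  by (auto simp: index_set_def)

lemma env_mor_mats: "env_mor a \<in> mats C [A] [B] \<longleftrightarrow> a \<in> mor A B"
  unfolding env_mor_def mats_def index_set_singleton by (auto simp: PiE_iff)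

lemma mats_singleton: "mats C [A] [B] = env_mor ` mor A B"
proof
  show "mats C [A] [B] \<subseteq> env_mor ` mor A B"
  proof
    fix x assume x: "x \<in> mats C [A] [B]"
    then have "x = env_mor (x (0, 0))"
      unfolding mats_def index_set_singleton env_mor_def by (auto simp: PiE_iff extensional_def)
    moreover have "x (0, 0) \<in> mor A B" using mats_entry[OF x, of 0 0] by simp
    ultimately show "x \<in> env_mor ` mor A B" by blast
  qed
qed (use env_mor_mats in blast)

lemma env_mor_eq_iff: "env_mor a = env_mor b \<longleftrightarrow> a = b"
  unfolding env_mor_def by (metis restrict_apply' singletonI)

lemma mat_ident_singleton: "mat_ident C [A] = env_mor (Ident C A)"
  unfolding mat_ident_def env_mor_def index_set_singleton by auto

lemma env_Hom:
  assumes "A \<in> Ob C" "B \<in> Ob C"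
  shows "carrier (Hom E (env_ob C A) (env_ob C B)) = env_mor ` mor A B"
  unfolding env_ob_def E_sel using assms
  by (auto simp: mat_ident_left mat_ident_right mats_singleton[symmetric])

lemma env_Comp:
  assumes "A \<in> Ob C" "B \<in> Ob C" "D \<in> Ob C" "g \<in> mor B D" "f \<in> mor A B"
  shows "Comp E (env_ob C A) (env_ob C B) (env_ob C D) (env_mor g) (env_mor f) = env_mor (Comp C A B D g f)"
proof -
  interpret M: module R "Hom C A D" using assms by (intro Hom_module)
  have "finsum (Hom C A D) (\<lambda>j. Comp C A ([B] ! j) D (env_mor g (0, j)) (env_mor f (j, 0))) {..<Suc 0}
      = Comp C A B D g f"
    using assms unfolding lessThan_Suc
    by (subst M.finsum_insert) (auto simp: env_mor_def Comp_closed)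
  then show ?thesis
    unfolding env_ob_def E_sel mat_comp_def index_set_singleton
    by (intro ext) (auto simp: env_mor_def)
qed

lemma env_Ident: "Ident E (env_ob C A) = env_mor (Ident C A)"
  unfolding env_ob_def E_sel mat_ident_singleton ..

lemma env_zero: "\<zero>\<^bsub>Hom E (env_ob C A) (env_ob C B)\<^esub> = env_mor \<zero>\<^bsub>Hom C A B\<^esub>"
  unfolding env_ob_def E_sel mat_zero_def index_set_singleton env_mor_def by auto

lemma env_add: "env_mor a \<oplus>\<^bsub>Hom E (env_ob C A) (env_ob C B)\<^esub> env_mor b = env_mor (a \<oplus>\<^bsub>Hom C A B\<^esub> b)"
  unfolding env_ob_def E_sel mat_add_def index_set_singleton env_mor_def by auto

lemma env_isomorphic_iff:
  assumes "A \<in> Ob C" "B \<in> Ob C"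
  shows "isomorphic E (env_ob C A) (env_ob C B) \<longleftrightarrow> isomorphic C A B"
proof -
  have "inverse_pair E (env_ob C A) (env_ob C B) (env_mor f) (env_mor g) \<longleftrightarrow> inverse_pair C A B f g" for f g
  proof (cases "f \<in> mor A B \<and> g \<in> mor B A")
    case True
    then show ?thesis using assms
      by (simp add: inverse_pair_def env_Hom env_Comp env_Ident env_mor_eq_iff)
  next
    case False
    then show ?thesis using assms
      by (auto simp: inverse_pair_def env_Hom image_iff env_mor_eq_iff)
  qed
  moreover have "\<exists>f' g'. f = env_mor f' \<and> g = env_mor g'"
    if "inverse_pair E (env_ob C A) (env_ob C B) f g" for f g
    using that assms unfolding inverse_pair_def by (auto simp: env_Hom)
  ultimately show ?thesis unfolding isomorphic_def by metis
qed

lemma env_biproduct: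
  assumes "biproduct C S A B i j p q"
  shows "biproduct E (env_ob C S) (env_ob C A) (env_ob C B) (env_mor i) (env_mor j) (env_mor p) (env_mor q)"
  using assms unfolding biproduct_def
  by (simp add: env_ob_Ob env_Hom env_Comp env_Ident env_zero env_add)

text \<open>\<open>y \<mapsto> i y p\<close> embeds the endomorphisms of the retract linearly into
  those of \<open>A\<close>, with left inverse given by compression with \<open>p\<close> and
  \<open>i\<close>; relations can be pulled back.\<close>

lemma all_dependent_retract:
  assumes dep: "all_dependent R (End C A) n" and [simp]: "A \<in> Ob C" "W \<in> Ob C" "i \<in> mor W A" "p \<in> mor A W"
    and pi: "Comp C W A W p i = Ident C W"
  shows "all_dependent R (End C W) n"
  unfolding all_dependent_def
proof
  interpret MA: module R "Hom C A A" by (rule Hom_module) simp_all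
  interpret MW: module R "Hom C W W" by (rule Hom_module) simp_all
  have fE: "finsum (End C B) = finsum (Hom C B B)" for B unfolding finsum_def End_def by simp
  fix y assume "y \<in> {..<n} \<rightarrow> carrier (End C W)"
  then have y: "y k \<in> mor W W" if "k < n" for k using that by (auto simp: End_def)
  define y' where "y' k = Comp C A W A i (Comp C A W W (y k) p)" for k
  have y'c: "y' \<in> {..<n} \<rightarrow> carrier (End C A)" using y by (auto simp: y'_def End_def Comp_closed)
  obtain c where c: "c \<in> {..<n} \<rightarrow> carrier R" "\<exists>k<n. c k \<noteq> \<zero>\<^bsub>R\<^esub>"
    and sum: "finsum (Hom C A A) (\<lambda>k. c k \<odot>\<^bsub>Hom C A A\<^esub> y' k) {..<n} = \<zero>\<^bsub>Hom C A A\<^esub>"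
    using dep[unfolded all_dependent_def, rule_format, OF y'c] unfolding fE by (auto simp: End_def)
  have cy: "(\<lambda>k. c k \<odot>\<^bsub>Hom C W W\<^esub> y k) \<in> {..<n} \<rightarrow> mor W W" using c(1) y by (auto simp: mor_smult Pi_iff)
  define s where "s = finsum (Hom C W W) (\<lambda>k. c k \<odot>\<^bsub>Hom C W W\<^esub> y k) {..<n}"
  have s: "s \<in> mor W W" unfolding s_def using cy by (rule MW.finsum_closed)
  have "Comp C A W A i (Comp C A W W s p) = finsum (Hom C A A) (\<lambda>k. c k \<odot>\<^bsub>Hom C A A\<^esub> y' k) {..<n}"
  proof -
    have "Comp C A W A i (Comp C A W W s p)
        = finsum (Hom C A A) (\<lambda>k. Comp C A W A i (Comp C A W W (c k \<odot>\<^bsub>Hom C W W\<^esub> y k) p)) {..<n}"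
      unfolding s_def using cy
      by (subst Comp_finsum_left, simp_all, subst Comp_finsum_right) (auto simp: Comp_closed Pi_def)
    also have "\<dots> = finsum (Hom C A A) (\<lambda>k. c k \<odot>\<^bsub>Hom C A A\<^esub> y' k) {..<n}"
      using c(1) y by (intro MA.finsum_cong') (auto simp: y'_def Comp_simps Pi_iff)
    finally show ?thesis .
  qed
  then have z: "Comp C A W A i (Comp C A W W s p) = \<zero>\<^bsub>Hom C A A\<^esub>" using sum by simp
  have "s = Comp C W A W p (Comp C W A A (Comp C A W A i (Comp C A W W s p)) i)"
    using s by (simp add: Comp_simps pi Comp_Comp_eq[OF pi])
  then have "s = \<zero>\<^bsub>Hom C W W\<^esub>" unfolding z by (simp add: Comp_simps)
  then show "\<exists>c\<in>{..<n} \<rightarrow> carrier R. (\<exists>k<n. c k \<noteq> \<zero>\<^bsub>R\<^esub>) \<and>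
      finsum (End C W) (\<lambda>k. c k \<odot>\<^bsub>End C W\<^esub> y k) {..<n} = \<zero>\<^bsub>End C W\<^esub>"
    using c unfolding s_def fE by (auto simp: End_def)
qed

definition elementary where
  "elementary As Bs i j a = (\<lambda>(k, l)\<in>index_set As Bs. if k = i \<and> l = j then a else \<zero>\<^bsub>Hom C (As ! l) (Bs ! k)\<^esub>)"

lemma elementary_entry: "k < length Bs \<Longrightarrow> l < length As \<Longrightarrow>
    elementary As Bs i j a (k, l) = (if k = i \<and> l = j then a else \<zero>\<^bsub>Hom C (As ! l) (Bs ! k)\<^esub>)"
  by (simp add: elementary_def index_set_iff)

lemma elementary_closed:
  "Objs As \<Longrightarrow> Objs Bs \<Longrightarrow> a \<in> mor (As ! j) (Bs ! i) \<Longrightarrow> elementary As Bs i j a \<in> mats C As Bs"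
  unfolding elementary_def by (auto intro!: matsI mor_zero nth_Ob)

text \<open>The spanning list consists of matrix units filled with generators of the corresponding
  Hom module. \<open>el\<close> treats one entry; a full matrix is then assembled position by
  position.\<close>

lemma mats_spanned:
  assumes O: "Objs As" and sp: "\<And>A B. A \<in> Ob C \<Longrightarrow> B \<in> Ob C \<Longrightarrow>
      \<exists>gs. set gs \<subseteq> mor A B \<and> mor A B \<subseteq> span_list R (Hom C A B) gs"
  defines "N \<equiv> Hom E (As, mat_ident C As) (As, mat_ident C As)"
  shows "\<exists>gs. set gs \<subseteq> carrier N \<and> carrier N \<subseteq> span_list R N gs"
proof -
  have EO: "(As, mat_ident C As) \<in> Ob E" using O by (simp add: E_Ob_iff mat_ident_closed mat_ident_left)
  interpret N: module R N unfolding N_def using EO EO by (rule E_module)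
  have Nc: "carrier N = mats C As As" unfolding N_def E_sel using O by (auto simp: mat_ident_left mat_ident_right)
  have Nops: "\<zero>\<^bsub>N\<^esub> = mat_zero As As" "\<And>x y. x \<oplus>\<^bsub>N\<^esub> y = mat_add As As x y"
    "\<And>r x. r \<odot>\<^bsub>N\<^esub> x = mat_smult As As r x" unfolding N_def E_sel by auto
  let ?n = "length As"
  have "\<forall>ij. \<exists>gs. fst ij < ?n \<and> snd ij < ?n \<longrightarrow> set gs \<subseteq> mor (As ! snd ij) (As ! fst ij) \<and>
      mor (As ! snd ij) (As ! fst ij) \<subseteq> span_list R (Hom C (As ! snd ij) (As ! fst ij)) gs"
    using sp nth_Ob[OF O] by blast
  then obtain G where G: "\<And>i j. i < ?n \<Longrightarrow> j < ?n \<Longrightarrow> set (G (i, j)) \<subseteq> mor (As ! j) (As ! i)"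
    "\<And>i j. i < ?n \<Longrightarrow> j < ?n \<Longrightarrow> mor (As ! j) (As ! i) \<subseteq> span_list R (Hom C (As ! j) (As ! i)) (G (i, j))"
    by (metis fst_conv snd_conv)
  define gs where "gs = concat (map (\<lambda>(i, j). map (elementary As As i j) (G (i, j))) (List.product [0..<?n] [0..<?n]))"
  have gsc: "set gs \<subseteq> carrier N"
    unfolding gs_def Nc using G(1) O by (fastforce intro!: elementary_closed)
  note S = N.submoduleE[OF N.span_list_submodule[OF gsc]]
  have z: "mat_zero As As \<in> span_list R N gs"
    using subgroup.one_closed[OF submodule.axioms(1)[OF N.span_list_submodule[OF gsc]]] by (simp add: Nops)
  have el: "elementary As As i j a \<in> span_list R N gs" if ij: "i < ?n" "j < ?n" and a: "a \<in> mor (As ! j) (As ! i)" for i j a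
  proof -
    let ?M = "Hom C (As ! j) (As ! i)"
    have Ob: "As ! j \<in> Ob C" "As ! i \<in> Ob C" using ij nth_Ob[OF O] by auto
    interpret M: module R ?M using Ob by (rule Hom_module)
    have "elementary As As i j a \<in> span_list R N gs"
      if "set hs \<subseteq> set (G (i, j))" "a \<in> span_list R ?M hs" for hs a
      using that
    proof (induction hs arbitrary: a)
      case Nil
      have "elementary As As i j \<zero>\<^bsub>?M\<^esub> = mat_zero As As"
        by (rule mat_eqI[where As = As and Bs = As]) (use O Ob in \<open>auto simp: elementary_closed mor_zero mat_closed elementary_entry mat_entries\<close>)
      then show ?case using Nil z by simp
    next
      case (Cons h hs)
      then obtain c b where cb: "c \<in> carrier R" "b \<in> span_list R ?M hs" "a = c \<odot>\<^bsub>?M\<^esub> h \<oplus>\<^bsub>?M\<^esub> b" by auto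
      have hc: "set hs \<subseteq> mor (As ! j) (As ! i)" "h \<in> mor (As ! j) (As ! i)"
        using Cons.prems(1) G(1)[OF ij] by auto
      then have bc: "b \<in> mor (As ! j) (As ! i)"
        using cb(2) M.submoduleE(1)[OF M.span_list_submodule] by blast
      have "elementary As As i j a = mat_add As As (mat_smult As As c (elementary As As i j h)) (elementary As As i j b)"
        by (rule mat_eqI[where As = As and Bs = As]) (use O Ob hc bc cb in \<open>auto simp: elementary_closed mor_zero mor_add mor_smult mat_closed
            elementary_entry mat_entries nth_Ob mor_l_zero module.smult_r_null[OF Hom_module]\<close>)
      moreover have "elementary As As i j h \<in> set gs"
        unfolding gs_def using ij Cons.prems(1) by force
      ultimately show ?case
        using Cons.IH[OF _ cb(2)] Cons.prems(1) S(4,5) cb(1) N.span_list_generators[OF gsc] by (simp add: Nops)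
    qed
    then show ?thesis using G(2)[OF ij] a by blast
  qed
  have "carrier N \<subseteq> span_list R N gs"
  proof
    fix x assume "x \<in> carrier N"
    then have x: "x \<in> mats C As As" unfolding Nc .
    \<comment> \<open>\<open>J\<close> is the set of positions already filled, all others being
      zero.\<close>
    have "restrict (\<lambda>ij. if ij \<in> J then x ij else mat_zero As As ij) (index_set As As) \<in> span_list R N gs"
      if "finite J" "J \<subseteq> index_set As As" for J
      using that
    proof (induction J)
      case empty
      have "restrict (\<lambda>ij. if ij \<in> {} then x ij else mat_zero As As ij) (index_set As As) = mat_zero As As"
        by (auto simp: mat_zero_def)
      then show ?case using z by simp
    next
      case (insert ij J)
      obtain i j where ij: "ij = (i, j)" "i < ?n" "j < ?n" using insert.prems index_set_iff by (metis insert_subset surj_pair)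
      let ?x = "\<lambda>J. restrict (\<lambda>ij. if ij \<in> J then x ij else mat_zero As As ij) (index_set As As)"
      have xc: "?x J \<in> mats C As As" for J
        by (rule matsI) (use O mats_entry[OF x] in \<open>auto simp: mat_entries mor_zero nth_Ob\<close>)
      have eq: "?x (insert ij J) = mat_add As As (elementary As As i j (x (i, j))) (?x J)"
      proof (rule mat_eqI[OF xc])
        show "mat_add As As (elementary As As i j (x (i, j))) (?x J) \<in> mats C As As"
          using O ij mats_entry[OF x] xc by (intro mat_closed elementary_closed) auto
        fix k l assume kl: "k < ?n" "l < ?n"
        show "?x (insert ij J) (k, l) = mat_add As As (elementary As As i j (x (i, j))) (?x J) (k, l)"
          using kl ij insert.hyps O mats_entry[OF x kl]
          by (auto simp: mat_entries elementary_entry index_set_iff nth_Ob mor_l_zero mor_r_zero mor_zero)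
      qed
      have "?x J \<in> span_list R N gs" using insert by blast
      from S(5)[OF el[OF ij(2,3) mats_entry[OF x ij(2,3)]] this]
      show ?case unfolding Nops eq .
    qed
    from this[of "index_set As As"] have "restrict x (index_set As As) \<in> span_list R N gs"
      by (simp add: index_set_def cong: restrict_cong)
    moreover have "restrict x (index_set As As) = x"
      using x unfolding mats_def by (intro extensional_restrict) (auto simp: PiE_def)
    ultimately show "x \<in> span_list R N gs" by simp
  qed
  then show ?thesis using gsc by blast
qed

text \<open>An object \<open>(As, e)\<close> is a retract of the free object
  \<open>(As, mat_ident C As)\<close>, with \<open>e\<close> as inclusion and projection, so the
  dimension bound for full matrix rings passes to it.\<close>

lemma E_krull_schmidt:
  assumes "field R" and sp: "\<And>A B. A \<in> Ob C \<Longrightarrow> B \<in> Ob C \<Longrightarrow>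
      \<exists>gs. set gs \<subseteq> mor A B \<and> mor A B \<subseteq> span_list R (Hom C A B) gs"
  shows "krull_schmidt R E"
proof (intro krull_schmidt.intro krull_schmidt_axioms.intro E_category E_idempotents_split assms(1))
  interpret Ec: R_category R E by (rule E_category)
  fix A assume A: "A \<in> Ob E"
  obtain As e where As: "A = (As, e)" by (metis surj_pair)
  have e: "Objs As" "e \<in> mats C As As" "mat_comp C As As As e e = e" using A unfolding As E_Ob_iff by auto
  let ?I = "(As, mat_ident C As)"
  have I: "?I \<in> Ob E" using e by (simp add: E_Ob_iff mat_ident_closed mat_ident_left)
  obtain gs where gs: "set gs \<subseteq> carrier (Hom E ?I ?I)" "carrier (Hom E ?I ?I) \<subseteq> span_list R (Hom E ?I ?I) gs"
    using mats_spanned[OF e(1) sp] by metis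
  have "all_dependent R (Hom E ?I ?I) (Suc (length gs))"
    by (rule module.all_dependent_of_span[OF E_module[OF I I] assms(1) gs])
  then have "all_dependent R (End E ?I) (Suc (length gs))"
    unfolding all_dependent_def finsum_def End_def by simp
  then have "all_dependent R (End E A) (Suc (length gs))"
    by (rule Ec.all_dependent_retract[OF _ I A, of _ e e])
      (use e in \<open>auto simp: As E_sel mat_ident_left mat_ident_right\<close>)
  then show "\<exists>n. all_dependent R (End E A) n" ..
qed

end

section \<open>Noetherian domains of dimension at most one\<close>

lemma (in noetherian_ring) maximal_in_family:
  assumes "\<A> \<noteq> {}" "\<And>I. I \<in> \<A> \<Longrightarrow> ideal I R"
  shows "\<exists>M\<in>\<A>. \<forall>I\<in>\<A>. M \<subseteq> I \<longrightarrow> I = M"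
proof (rule subset_Zorn_nonempty[OF assms(1)])
  fix \<C> assume c: "\<C> \<noteq> {}" "subset.chain \<A> \<C>"
  then have "\<C> \<subseteq> \<A>" and "subset.chain {I. ideal I R} \<C>"
    using assms(2) by (auto simp: subset_chain_def)
  then show "\<Union>\<C> \<in> \<A>" using ideal_chain_is_trivial[OF c(1)] by (meson subsetD)
qed

lemma (in ring) ideal_zero_mem: "ideal I R \<Longrightarrow> \<zero> \<in> I"
  by (rule additive_subgroup.zero_closed[OF ideal.axioms(1)])

lemma (in ring) ideal_add_mem: "ideal I R \<Longrightarrow> a \<in> I \<Longrightarrow> b \<in> I \<Longrightarrow> a \<oplus> b \<in> I"
  by (rule additive_subgroup.a_closed[OF ideal.axioms(1)])

lemma (in noetherian_ring) maximalideal_exists: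
  assumes "\<one> \<noteq> \<zero>"
  shows "\<exists>P. maximalideal P R"
proof -
  define \<A> where "\<A> = {I. ideal I R \<and> I \<noteq> carrier R}"
  have "{\<zero>} \<in> \<A>" unfolding \<A>_def using assms one_closed zeroideal by auto
  then have "\<exists>P\<in>\<A>. \<forall>I\<in>\<A>. P \<subseteq> I \<longrightarrow> I = P"
    by (intro maximal_in_family) (auto simp: \<A>_def)
  then obtain P where P: "P \<in> \<A>" and max: "\<And>I. I \<in> \<A> \<Longrightarrow> P \<subseteq> I \<Longrightarrow> I = P" by blast
  have "maximalideal P R"
    by (rule maximalidealI) (use P max in \<open>auto simp: \<A>_def\<close>)
  then show ?thesis ..
qed

lemma (in cring) prime_contains_sum:
  assumes I: "ideal I R" and a: "a \<in> carrier R" and b: "b \<in> carrier R" "a \<otimes> b \<in> I"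
    and P: "primeideal P R" "I \<subseteq> P"
  shows "set_add R I (PIdl a) \<subseteq> P \<or> set_add R I (PIdl b) \<subseteq> P"
proof -
  interpret P: primeideal P R by fact
  have "set_add R I (PIdl c) \<subseteq> P" if "c \<in> P" for c
    using cgenideal_minimal[OF P.is_ideal that] P(2) unfolding set_add_def'
    by (auto intro!: ideal_add_mem[OF P.is_ideal])
  then show ?thesis using P.I_prime[OF a b(1)] b(2) P(2) by blast
qed

text \<open>Noetherian induction: an ideal maximal among those contained in infinitely many maximal
  ideals would be prime, hence maximal itself.\<close>

lemma finite_maximalideals_containing:
  fixes R :: "'k ring" (structure)
  assumes "noetherian_domain R"
    and dim: "\<And>P. primeideal P R \<Longrightarrow> P \<noteq> {\<zero>\<^bsub>R\<^esub>} \<Longrightarrow> maximalideal P R"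
    and s: "s \<in> carrier R" "s \<noteq> \<zero>\<^bsub>R\<^esub>"
  shows "finite {P. maximalideal P R \<and> s \<in> P}"
proof -
  interpret noetherian_domain R by fact
  define V where "V I = {P. maximalideal P R \<and> I \<subseteq> P}" for I
  \<comment> \<open>The zero ideal lies in every maximal ideal, so it has to be kept out of the
    family.\<close>
  define \<A> where "\<A> = {I. ideal I R \<and> I \<noteq> {\<zero>} \<and> infinite (V I)}"
  have "\<A> = {}"
  proof (rule ccontr)
    assume "\<A> \<noteq> {}"
    then obtain I where I: "I \<in> \<A>" and max: "\<And>J. J \<in> \<A> \<Longrightarrow> I \<subseteq> J \<Longrightarrow> J = I"
      using maximal_in_family[of \<A>] unfolding \<A>_def by blast
    have id: "ideal I R" and nz: "I \<noteq> {\<zero>}" and inf: "infinite (V I)" using I unfolding \<A>_def by auto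
    interpret I: ideal I R by fact
    have "\<not> maximalideal I R"
    proof
      assume m: "maximalideal I R"
      have "V I \<subseteq> {I}"
      proof
        fix P assume "P \<in> V I"
        then have P: "maximalideal P R" "I \<subseteq> P" unfolding V_def by auto
        interpret P: maximalideal P R by fact
        have "P = I \<or> P = carrier R"
          using maximalideal.I_maximal[OF m P.is_ideal P(2)] P.a_subset by metis
        then show "P \<in> {I}" using P.I_notcarr by simp
      qed
      then show False using inf finite_subset by blast
    qed
    then have "\<not> primeideal I R" using dim nz by metis
    moreover have "carrier R \<noteq> I"
    proof
      assume "carrier R = I"
      then have "V I = {}"
        unfolding V_def using maximalideal.I_notcarr maximalideal.axioms(1) ideal.Icarr
        by (metis (no_types, lifting) Collect_empty_eq subset_antisym subsetI)
      then show False using inf by simp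
    qed
    ultimately obtain a b where ab: "a \<in> carrier R" "b \<in> carrier R" "a \<otimes> b \<in> I" "a \<notin> I" "b \<notin> I"
      using primeidealI[OF id is_cring] by blast
    have fin: "finite (V (set_add R I (PIdl c)))" if c: "c \<in> carrier R" "c \<notin> I" for c
    proof -
      let ?J = "set_add R I (PIdl c)"
      have J: "ideal ?J R" using add_ideals[OF id cgenideal_ideal[OF c(1)]] .
      interpret Pc: ideal "PIdl c" R by (rule cgenideal_ideal[OF c(1)])
      have sub: "I \<subseteq> ?J"
      proof
        fix x assume "x \<in> I"
        then have "x = x \<oplus> \<zero>" "x \<in> I" using I.Icarr by auto
        then show "x \<in> ?J" unfolding set_add_def' using ideal_zero_mem[OF Pc.is_ideal] by blast
      qed
      have "c \<in> ?J"
      proof -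
        have "c = \<zero> \<oplus> c" using c by simp
        then show ?thesis unfolding set_add_def' using ideal_zero_mem[OF id] cgenideal_self[OF c(1)] by blast
      qed
      then have "?J \<noteq> I" using c by blast
      moreover have "?J \<noteq> {\<zero>}" using sub nz ideal_zero_mem[OF id] by blast
      ultimately show ?thesis using max[OF _ sub] J unfolding \<A>_def by blast
    qed
    \<comment> \<open>A prime ideal containing \<open>I\<close>, and hence \<open>a b\<close>,
      contains \<open>a\<close> or \<open>b\<close>. Both enlarged ideals have finite
      \<open>V\<close> by the maximality of \<open>I\<close>, which contradicts the choice of
      \<open>I\<close>.\<close>
    have "V I \<subseteq> V (set_add R I (PIdl a)) \<union> V (set_add R I (PIdl b))"
    proof
      fix P assume "P \<in> V I"
      then have P: "maximalideal P R" "I \<subseteq> P" unfolding V_def by simp_all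
      from prime_contains_sum[OF id ab(1-3) maximalideal_prime[OF P(1)] P(2)]
      show "P \<in> V (set_add R I (PIdl a)) \<union> V (set_add R I (PIdl b))"
        unfolding V_def using P(1) by simp
    qed
    then show False using fin[OF ab(1,4)] fin[OF ab(2,5)] inf finite_subset by blast
  qed
  moreover have "ideal (PIdl s) R" "PIdl s \<noteq> {\<zero>}"
    using cgenideal_ideal[OF s(1)] cgenideal_self[OF s(1)] s(2) by auto
  ultimately have "finite (V (PIdl s))" unfolding \<A>_def by blast
  moreover have "{P. maximalideal P R \<and> s \<in> P} \<subseteq> V (PIdl s)"
    unfolding V_def using cgenideal_minimal maximalideal.axioms(1) by blast
  ultimately show ?thesis by (rule rev_finite_subset)
qed

lemma (in abelian_group) eq_of_minus_zero:
  assumes "a \<in> carrier G" "b \<in> carrier G" "a \<ominus> b = \<zero>"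
  shows "a = b"
proof -
  have "a = (a \<ominus> b) \<oplus> b" using assms(1,2) by (simp add: a_minus_def a_assoc l_neg)
  then show ?thesis using assms by simp
qed

section \<open>Local isomorphism over the base ring\<close>

text \<open>Isomorphism with cleared denominators, expressed inside \<open>C\<close>. The same
  condition describes isomorphism over the localization and over the residue field at a maximal
  \<open>P\<close>, and rational isomorphism for \<open>P = 0\<close>, so all three can be
  compared.\<close>

definition loc_iso :: "'k ring \<Rightarrow> ('k, 'o, 'm) rcat \<Rightarrow> 'k set \<Rightarrow> 'o \<Rightarrow> 'o \<Rightarrow> bool" where
  "loc_iso R C P A B \<longleftrightarrow> (\<exists>f\<in>carrier (Hom C A B). \<exists>g\<in>carrier (Hom C B A). \<exists>s\<in>carrier R - P.
     Comp C A B A g f = s \<odot>\<^bsub>Hom C A A\<^esub> Ident C A \<and> Comp C B A B f g = s \<odot>\<^bsub>Hom C B B\<^esub> Ident C B)"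

context category_base_change
begin

lemma ext_isomorphic_iff:
  assumes "A \<in> Ob C" "B \<in> Ob C"
  shows "isomorphic (add_ext R S C) (ext_ob R S C A) (ext_ob R S C B) \<longleftrightarrow> isomorphic D A B"
  using R_category.env_isomorphic_iff[OF D_category] assms unfolding add_ext_def ext_ob_def by simp

lemma D_biproduct:
  assumes "biproduct C T A B i j p q"
  shows "biproduct D T A B (pt A T \<one>\<^bsub>S\<^esub> i) (pt B T \<one>\<^bsub>S\<^esub> j) (pt T A \<one>\<^bsub>S\<^esub> p) (pt T B \<one>\<^bsub>S\<^esub> q)"
  using assms unfolding biproduct_def
  by (simp add: pt_closed pt_Comp D_Ident pt_zero pt_add_right[symmetric] Comp_closed)

lemma ext_direct_sum:
  assumes "direct_sum C T A B"
  shows "direct_sum (add_ext R S C) (ext_ob R S C T) (ext_ob R S C A) (ext_ob R S C B)"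
  using assms D_biproduct R_category.env_biproduct[OF D_category]
  unfolding direct_sum_iff_biproduct add_ext_def ext_ob_def by blast

lemma ext_Ob: "A \<in> Ob C \<Longrightarrow> ext_ob R S C A \<in> Ob (add_ext R S C)"
  using R_category.env_ob_Ob[OF D_category] unfolding add_ext_def ext_ob_def by simp

lemma ext_krull_schmidt: "field S \<Longrightarrow> hom_finite R C \<Longrightarrow> krull_schmidt S (add_ext R S C)"
  unfolding add_ext_def
  using R_category.E_krull_schmidt[OF D_category] D_spanned by simp

end


section \<open>Localizations\<close>

text \<open>\<open>P\<close> ranges over prime ideals so that the zero ideal is included; its
  localization is \<open>K\<close>.\<close>

locale localization_setup =
  fixes R :: "'k ring" and K :: "'k ring" (structure) and P :: "'k set"
  assumes frac: "fraction_field R K" and prime: "primeideal P R"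
begin

sublocale K: field K using frac unfolding fraction_field_def by blast
sublocale P: primeideal P R by (rule prime)

lemma R_eq: "R = K\<lparr>carrier := carrier R\<rparr>" and R_sub: "subring (carrier R) K"
  using frac unfolding fraction_field_def by blast+

lemma R_ops: "a \<otimes>\<^bsub>R\<^esub> b = a \<otimes> b" "a \<oplus>\<^bsub>R\<^esub> b = a \<oplus> b" "\<one>\<^bsub>R\<^esub> = \<one>" "\<zero>\<^bsub>R\<^esub> = \<zero>"
  by (subst R_eq, simp)+

abbreviation "S \<equiv> localization R K P"

lemma S_ops: "a \<otimes>\<^bsub>S\<^esub> b = a \<otimes> b" "a \<oplus>\<^bsub>S\<^esub> b = a \<oplus> b" "\<one>\<^bsub>S\<^esub> = \<one>" "\<zero>\<^bsub>S\<^esub> = \<zero>"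
  by (simp_all add: localization_def)

lemma S_carrier: "x \<in> carrier S \<longleftrightarrow> (\<exists>a b. x = a \<otimes> inv b \<and> a \<in> carrier R \<and> b \<in> carrier R - P)"
  by (auto simp: localization_def)

lemma RK: "a \<in> carrier R \<Longrightarrow> a \<in> carrier K" using subringE(1)[OF R_sub] by blast

lemma denom: "b \<in> carrier R - P \<Longrightarrow> b \<in> carrier K \<and> b \<noteq> \<zero>"
  using RK P.ideal_zero_mem[OF P.is_ideal] R_ops(4) by auto

lemma denom_inv:
  assumes "b \<in> carrier R - P"
  shows "inv b \<in> carrier K" "b \<otimes> inv b = \<one>" "inv b \<otimes> b = \<one>"
  using denom[OF assms] K.field_Units by auto

lemma one_denom: "\<one>\<^bsub>R\<^esub> \<in> carrier R - P"
  using P.one_imp_carrier P.I_notcarr by auto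

lemma denom_mult: "b \<in> carrier R - P \<Longrightarrow> c \<in> carrier R - P \<Longrightarrow> b \<otimes>\<^bsub>R\<^esub> c \<in> carrier R - P"
  using P.I_prime by blast

lemma fracI: "a \<in> carrier R \<Longrightarrow> b \<in> carrier R - P \<Longrightarrow> x \<in> carrier K \<Longrightarrow> x \<otimes> b = a \<Longrightarrow> x \<in> carrier S"
proof -
  assume a: "a \<in> carrier R" and b: "b \<in> carrier R - P" and x: "x \<in> carrier K" "x \<otimes> b = a"
  have "a \<otimes> inv b = x \<otimes> (b \<otimes> inv b)"
    using x denom[OF b] denom_inv(1)[OF b] by (simp add: K.m_assoc flip: x(2))
  then show ?thesis using a b x denom_inv[OF b] unfolding S_carrier by auto
qed

lemma fracE:
  assumes "x \<in> carrier S"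
  obtains b where "b \<in> carrier R - P" "x \<otimes> b \<in> carrier R" "x \<in> carrier K"
proof -
  obtain a b where ab: "x = a \<otimes> inv b" "a \<in> carrier R" "b \<in> carrier R - P"
    using assms S_carrier by blast
  have "x \<otimes> b = a" using ab RK denom[OF ab(3)] denom_inv[OF ab(3)] by (simp add: K.m_assoc)
  then show ?thesis using that[OF ab(3)] ab RK denom_inv by simp
qed

lemma denom_extend:
  assumes "x \<in> carrier K" "b \<in> carrier R" "x \<otimes> b \<in> carrier R" "c \<in> carrier R"
  shows "x \<otimes> (b \<otimes>\<^bsub>R\<^esub> c) \<in> carrier R" "x \<otimes> (c \<otimes>\<^bsub>R\<^esub> b) \<in> carrier R"
    "x \<otimes> (b \<otimes>\<^bsub>R\<^esub> c) = (x \<otimes> b) \<otimes>\<^bsub>R\<^esub> c"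
proof -
  show "x \<otimes> (b \<otimes>\<^bsub>R\<^esub> c) = (x \<otimes> b) \<otimes>\<^bsub>R\<^esub> c"
    using assms RK by (simp add: R_ops K.m_assoc)
  then show "x \<otimes> (b \<otimes>\<^bsub>R\<^esub> c) \<in> carrier R" using assms by simp
  then show "x \<otimes> (c \<otimes>\<^bsub>R\<^esub> b) \<in> carrier R" using assms P.m_comm by simp
qed

lemma R_in_S: "a \<in> carrier R \<Longrightarrow> a \<in> carrier S"
  using one_denom RK by (intro fracI[of a "\<one>\<^bsub>R\<^esub>"]) (auto simp: R_ops)

lemma inv_in_S: "b \<in> carrier R - P \<Longrightarrow> inv b \<in> carrier S"
  using denom_inv one_denom by (intro fracI[of "\<one>\<^bsub>R\<^esub>" b]) (auto simp: R_ops)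

lemma S_subring: "subring (carrier S) K"
proof (rule K.subringI)
  show "carrier S \<subseteq> carrier K" using fracE by blast
  show "\<one> \<in> carrier S" using R_in_S[OF P.one_closed] by (simp add: R_ops)
  fix x assume x: "x \<in> carrier S"
  obtain b where b: "b \<in> carrier R - P" "x \<otimes> b \<in> carrier R" "x \<in> carrier K" using fracE[OF x] .
  show "\<ominus> x \<in> carrier S"
    using b RK subringE(5)[OF R_sub] by (intro fracI[of "\<ominus> (x \<otimes> b)" b]) (auto simp: K.l_minus)
  fix y assume y: "y \<in> carrier S"
  obtain c where c: "c \<in> carrier R - P" "y \<otimes> c \<in> carrier R" "y \<in> carrier K" using fracE[OF y] .
  have bc: "b \<in> carrier K" "c \<in> carrier K" using b c RK by auto
  show "x \<otimes> y \<in> carrier S"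
    using b c bc denom_mult subringE(6)[OF R_sub b(2) c(2)]
    by (intro fracI[of "(x \<otimes> b) \<otimes> (y \<otimes> c)" "b \<otimes>\<^bsub>R\<^esub> c"]) (auto simp: R_ops K.m_ac)
  show "x \<oplus> y \<in> carrier S"
    using b c bc denom_mult denom_extend[of x b c] denom_extend[of y c b] RK
      subringE(7)[OF R_sub, of "x \<otimes> (b \<otimes>\<^bsub>R\<^esub> c)" "y \<otimes> (b \<otimes>\<^bsub>R\<^esub> c)"]
    by (intro fracI[of "x \<otimes> (b \<otimes>\<^bsub>R\<^esub> c) \<oplus>\<^bsub>R\<^esub> y \<otimes> (b \<otimes>\<^bsub>R\<^esub> c)" "b \<otimes>\<^bsub>R\<^esub> c"])
      (auto simp: R_ops K.l_distr)
qed

lemma SK: "x \<in> carrier S \<Longrightarrow> x \<in> carrier K" using subringE(1)[OF S_subring] by blast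

lemma scalar_change: "scalar_change R S"
proof (rule scalar_change.intro)
  show "cring R" by (rule P.is_cring)
  have "cring (K\<lparr>carrier := carrier S\<rparr>)"
    using K.subcring_iff K.subcringI' S_subring subringE(1)[OF S_subring] by blast
  moreover have "K\<lparr>carrier := carrier S\<rparr> = S" by (simp add: localization_def)
  ultimately show "cring S" by simp
  show "(\<lambda>r. \<one>\<^bsub>S\<^esub> \<otimes>\<^bsub>S\<^esub> r) \<in> ring_hom R S"
    by (rule ring_hom_memI) (use R_in_S RK in \<open>simp_all add: S_ops R_ops subringE(6,7)[OF R_sub]\<close>)
  show "s \<otimes>\<^bsub>S\<^esub> (\<one>\<^bsub>S\<^esub> \<otimes>\<^bsub>S\<^esub> r) = s \<otimes>\<^bsub>S\<^esub> r" if "s \<in> carrier S" "r \<in> carrier R" for s r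
    using that RK SK by (simp add: S_ops)
  show "\<exists>u\<in>carrier S. \<exists>a\<in>carrier R. \<exists>b\<in>carrier R. s = u \<otimes>\<^bsub>S\<^esub> a \<and> t = u \<otimes>\<^bsub>S\<^esub> b"
    if st: "s \<in> carrier S" "t \<in> carrier S" for s t
  proof -
    obtain b where b: "b \<in> carrier R - P" "s \<otimes> b \<in> carrier R" "s \<in> carrier K" using fracE[OF st(1)] .
    obtain c where c: "c \<in> carrier R - P" "t \<otimes> c \<in> carrier R" "t \<in> carrier K" using fracE[OF st(2)] .
    let ?d = "b \<otimes>\<^bsub>R\<^esub> c"
    have d: "?d \<in> carrier R - P" using denom_mult b c by blast
    have *: "x = inv ?d \<otimes>\<^bsub>S\<^esub> (x \<otimes> ?d)" if x: "x \<in> carrier K" for x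
    proof -
      have "inv ?d \<otimes> (x \<otimes> ?d) = x \<otimes> (inv ?d \<otimes> ?d)"
        using x denom[OF d] denom_inv(1)[OF d] by (simp add: K.m_lcomm)
      then show ?thesis using denom_inv[OF d] x by (simp add: S_ops)
    qed
    show ?thesis
      using *[OF b(3)] *[OF c(3)] inv_in_S[OF d] denom_extend[of s b c] denom_extend[of t c b] b c by blast
  qed
qed

text \<open>The elements that vanish after clearing denominators contain the defining relations of the
  tensor product.\<close>

lemma tensor_eq_imp:
  assumes M: "module R M" and mn: "m \<in> carrier M" "n \<in> carrier M"
    and rel: "frag_of (\<one>\<^bsub>S\<^esub>, m) - frag_of (\<one>\<^bsub>S\<^esub>, n) \<in> tensor_rels R S M"
  shows "\<exists>t\<in>carrier R - P. t \<odot>\<^bsub>M\<^esub> m = t \<odot>\<^bsub>M\<^esub> n"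
proof -
  interpret M: module R M by fact
  interpret sc: scalar_change R S by (rule scalar_change)
  \<comment> \<open>\<open>D t\<close> holds the pairs whose scalar becomes integral after
    multiplication by \<open>t\<close>. On it \<open>s \<otimes> m\<close> can be evaluated in
    \<open>M\<close> itself, as \<open>(s t) m\<close>, and no localized module is needed.\<close>
  define D where "D t = {s \<in> carrier S. s \<otimes> t \<in> carrier R} \<times> carrier M" for t
  have "\<exists>h. h \<in> hom (free_Abelian_group (D t)) (add_monoid M) \<and>
      (\<forall>s m. (s, m) \<in> D t \<longrightarrow> h (frag_of (s, m)) = (s \<otimes> t) \<odot>\<^bsub>M\<^esub> m)" for t
  proof -
    have "(\<lambda>(s, m). (s \<otimes> t) \<odot>\<^bsub>M\<^esub> m) ` D t \<subseteq> carrier (add_monoid M)" by (auto simp: D_def)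
    from comm_group.free_Abelian_group_universal[OF M.M.a_comm_group this]
    obtain h where "h \<in> hom (free_Abelian_group (D t)) (add_monoid M)"
      "\<And>x. x \<in> D t \<Longrightarrow> h (frag_of x) = (\<lambda>(s, m). (s \<otimes> t) \<odot>\<^bsub>M\<^esub> m) x" by metis
    then show ?thesis by (intro exI[of _ h]) simp
  qed
  then obtain h where hh: "\<And>t. h t \<in> hom (free_Abelian_group (D t)) (add_monoid M)"
    and hf: "\<And>t s m. (s, m) \<in> D t \<Longrightarrow> h t (frag_of (s, m)) = (s \<otimes> t) \<odot>\<^bsub>M\<^esub> m" by metis
  interpret h: group_hom "free_Abelian_group (D t)" "add_monoid M" "h t" for t
    using hh M.M.a_group by (simp add: group_hom_def group_hom_axioms_def)
  have hc: "h t x \<in> carrier M" if "Poly_Mapping.keys x \<subseteq> D t" for t x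
    using h.hom_closed[of x t] that by simp
  have h0: "h t 0 = \<zero>\<^bsub>M\<^esub>" for t using h.hom_one[of t] by simp
  have hadd: "h t (x + y) = h t x \<oplus>\<^bsub>M\<^esub> h t y"
    if "Poly_Mapping.keys x \<subseteq> D t" "Poly_Mapping.keys y \<subseteq> D t" for t x y
    using h.hom_mult[of x t y] that by simp
  have hneg: "h t (- x) = \<ominus>\<^bsub>M\<^esub> h t x" if "Poly_Mapping.keys x \<subseteq> D t" for t x
    using h.hom_inv[of x t] that by (simp add: a_inv_def)
  have hdiff: "h t (x - y) = h t x \<ominus>\<^bsub>M\<^esub> h t y"
    if "Poly_Mapping.keys x \<subseteq> D t" "Poly_Mapping.keys y \<subseteq> D t" for t x y
    using hadd[of x t "- y"] hneg[of y t] that by (simp add: a_minus_def)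
  have h3: "h t (frag_of x - frag_of y - frag_of z) = \<zero>\<^bsub>M\<^esub>"
    if in_D: "x \<in> D t" "y \<in> D t" "z \<in> D t" and e: "h t (frag_of x) = h t (frag_of y) \<oplus>\<^bsub>M\<^esub> h t (frag_of z)"
    for t x y z
  proof -
    have "Poly_Mapping.keys (frag_of x - frag_of y) \<subseteq> D t" using frag_relator_closed2[OF in_D(1,2)] by simp
    then have "h t (frag_of x - frag_of y - frag_of z) = h t (frag_of x) \<ominus>\<^bsub>M\<^esub> h t (frag_of y) \<ominus>\<^bsub>M\<^esub> h t (frag_of z)"
      using in_D by (simp add: hdiff)
    moreover have "h t (frag_of y) \<in> carrier M" "h t (frag_of z) \<in> carrier M" using hc in_D by simp_all
    ultimately show ?thesis unfolding e
      by (simp add: a_minus_def M.M.a_assoc M.M.a_lcomm[of "h t (frag_of z)"] M.M.r_neg)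
  qed
  have Dext: "D t \<subseteq> D (t \<otimes>\<^bsub>R\<^esub> u)" "D t \<subseteq> D (u \<otimes>\<^bsub>R\<^esub> t)" if "t \<in> carrier R" "u \<in> carrier R" for t u
    using that SK denom_extend unfolding D_def by auto
  \<comment> \<open>Enlarging the denominator by \<open>u\<close> multiplies the value by
    \<open>u\<close>; in particular vanishing persists, so two elements can be treated with one
    denominator.\<close>
  have hext: "h (t \<otimes>\<^bsub>R\<^esub> u) x = u \<odot>\<^bsub>M\<^esub> h t x"
    if x: "Poly_Mapping.keys x \<subseteq> D t" and tu: "t \<in> carrier R" "u \<in> carrier R" for t u x
  proof (rule free_Abelian_group_induct[OF x])
    show "h (t \<otimes>\<^bsub>R\<^esub> u) 0 = u \<odot>\<^bsub>M\<^esub> h t 0" using tu by (simp add: h0)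
  next
    fix x y assume xy: "Poly_Mapping.keys x \<subseteq> D t" "Poly_Mapping.keys y \<subseteq> D t"
      "h (t \<otimes>\<^bsub>R\<^esub> u) x = u \<odot>\<^bsub>M\<^esub> h t x" "h (t \<otimes>\<^bsub>R\<^esub> u) y = u \<odot>\<^bsub>M\<^esub> h t y"
    then have "Poly_Mapping.keys x \<subseteq> D (t \<otimes>\<^bsub>R\<^esub> u)" "Poly_Mapping.keys y \<subseteq> D (t \<otimes>\<^bsub>R\<^esub> u)"
      using Dext[OF tu] by auto
    then show "h (t \<otimes>\<^bsub>R\<^esub> u) (x - y) = u \<odot>\<^bsub>M\<^esub> h t (x - y)"
      using xy hc tu by (simp add: hdiff a_minus_def M.smult_r_distr M.smult_r_minus)
  next
    fix a assume a: "a \<in> D t"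
    then obtain s m where sm: "a = (s, m)" "s \<in> carrier S" "s \<otimes> t \<in> carrier R" "m \<in> carrier M"
      by (auto simp: D_def)
    have "h (t \<otimes>\<^bsub>R\<^esub> u) (frag_of a) = ((s \<otimes> t) \<otimes>\<^bsub>R\<^esub> u) \<odot>\<^bsub>M\<^esub> m"
      using hf[of s m "t \<otimes>\<^bsub>R\<^esub> u"] a Dext(1)[OF tu] sm denom_extend(3)[of s t u] SK tu by auto
    then show "h (t \<otimes>\<^bsub>R\<^esub> u) (frag_of a) = u \<odot>\<^bsub>M\<^esub> h t (frag_of a)"
      using hf[of s m t] a sm tu M.smult_assoc1[of u "s \<otimes> t" m] by (simp add: P.m_comm)
  qed
  \<comment> \<open>Elements that vanish for some denominator. Passing to products of denominators
    makes \<open>Z\<close> closed under addition, although each \<open>h t\<close> is meaningful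
    only on its own \<open>D t\<close>.\<close>
  define Z where "Z = {x. \<exists>t\<in>carrier R - P. Poly_Mapping.keys x \<subseteq> D t \<and> h t x = \<zero>\<^bsub>M\<^esub>}"
  have "frag_of (\<one>\<^bsub>S\<^esub>, m) - frag_of (\<one>\<^bsub>S\<^esub>, n) \<in> Z"
  proof (rule tensor_rels_subset[where h = "\<lambda>x. x" and T' = Z, OF _ _ _ _ M _ sc.scalar_closed _ _ _ rel])
    show "0 \<in> Z" unfolding Z_def using one_denom h0 by auto
    show "x + y \<in> Z" if "x \<in> Z" "y \<in> Z" for x y
    proof -
      obtain t where t: "t \<in> carrier R - P" "Poly_Mapping.keys x \<subseteq> D t" "h t x = \<zero>\<^bsub>M\<^esub>" using \<open>x \<in> Z\<close> unfolding Z_def by blast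
      obtain u where u: "u \<in> carrier R - P" "Poly_Mapping.keys y \<subseteq> D u" "h u y = \<zero>\<^bsub>M\<^esub>" using \<open>y \<in> Z\<close> unfolding Z_def by blast
      let ?v = "t \<otimes>\<^bsub>R\<^esub> u"
      have k: "Poly_Mapping.keys x \<subseteq> D ?v" "Poly_Mapping.keys y \<subseteq> D ?v" using t u Dext by blast+
      have "h ?v x = \<zero>\<^bsub>M\<^esub>" using hext[OF t(2), of u] t u by simp
      moreover have "h ?v y = \<zero>\<^bsub>M\<^esub>" using hext[OF u(2), of t] t u by (simp add: P.m_comm)
      ultimately have "h ?v (x + y) = \<zero>\<^bsub>M\<^esub>" using hadd[OF k] by simp
      moreover have "Poly_Mapping.keys (x + y) \<subseteq> D ?v" using k keys_add[of x y] by blast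
      ultimately show ?thesis using denom_mult[OF t(1) u(1)] unfolding Z_def by blast
    qed
    show "- x \<in> Z" if "x \<in> Z" for x
    proof -
      obtain t where t: "t \<in> carrier R - P" "Poly_Mapping.keys x \<subseteq> D t" "h t x = \<zero>\<^bsub>M\<^esub>" using \<open>x \<in> Z\<close> unfolding Z_def by blast
      then have "Poly_Mapping.keys (- x) \<subseteq> D t" "h t (- x) = \<zero>\<^bsub>M\<^esub>" using hneg[OF t(2)] by simp_all
      then show ?thesis using t(1) unfolding Z_def by blast
    qed
  next
    fix s t m assume s: "s \<in> carrier S" and t: "t \<in> carrier S" and m: "m \<in> carrier M"
    obtain b where b: "b \<in> carrier R - P" "s \<otimes> b \<in> carrier R" "s \<in> carrier K" using fracE[OF s] .
    obtain c where c: "c \<in> carrier R - P" "t \<otimes> c \<in> carrier R" "t \<in> carrier K" using fracE[OF t] .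
    let ?d = "b \<otimes>\<^bsub>R\<^esub> c"
    have d: "?d \<in> carrier R - P" using denom_mult b c by blast
    have sd: "s \<otimes> ?d \<in> carrier R" "t \<otimes> ?d \<in> carrier R"
      using denom_extend[of s b c] denom_extend[of t c b] b c by auto
    have std: "(s \<oplus>\<^bsub>S\<^esub> t) \<otimes> ?d = s \<otimes> ?d \<oplus>\<^bsub>R\<^esub> t \<otimes> ?d"
      using b c denom[OF d] by (simp add: R_ops S_ops K.l_distr)
    have in_D: "(s, m) \<in> D ?d" "(t, m) \<in> D ?d" "(s \<oplus>\<^bsub>S\<^esub> t, m) \<in> D ?d"
      unfolding D_def using s t m sd std subringE(7)[OF S_subring s t] by (auto simp: S_ops)
    have "h ?d (frag_of (s \<oplus>\<^bsub>S\<^esub> t, m) - frag_of (s, m) - frag_of (t, m)) = \<zero>\<^bsub>M\<^esub>"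
      using hf[OF in_D(1)] hf[OF in_D(2)] hf[OF in_D(3)] sd m std by (intro h3 in_D) (simp add: M.smult_l_distr)
    moreover have "Poly_Mapping.keys (frag_of (s \<oplus>\<^bsub>S\<^esub> t, m) - frag_of (s, m) - frag_of (t, m)) \<subseteq> D ?d"
      using frag_relator_closed[OF in_D(3,1,2)] by simp
    ultimately show "frag_of (s \<oplus>\<^bsub>S\<^esub> t, m) - frag_of (s, m) - frag_of (t, m) \<in> Z"
      using d unfolding Z_def by blast
  next
    fix s m n assume s: "s \<in> carrier S" and m: "m \<in> carrier M" and n: "n \<in> carrier M"
    obtain b where b: "b \<in> carrier R - P" "s \<otimes> b \<in> carrier R" "s \<in> carrier K" using fracE[OF s] .
    have in_D: "(s, m) \<in> D b" "(s, n) \<in> D b" "(s, m \<oplus>\<^bsub>M\<^esub> n) \<in> D b"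
      unfolding D_def using s m n b by auto
    have "h b (frag_of (s, m \<oplus>\<^bsub>M\<^esub> n) - frag_of (s, m) - frag_of (s, n)) = \<zero>\<^bsub>M\<^esub>"
      using hf[OF in_D(1)] hf[OF in_D(2)] hf[OF in_D(3)] b m n by (intro h3 in_D) (simp add: M.smult_r_distr)
    moreover have "Poly_Mapping.keys (frag_of (s, m \<oplus>\<^bsub>M\<^esub> n) - frag_of (s, m) - frag_of (s, n)) \<subseteq> D b"
      using frag_relator_closed[OF in_D(3,1,2)] by simp
    ultimately show "frag_of (s, m \<oplus>\<^bsub>M\<^esub> n) - frag_of (s, m) - frag_of (s, n) \<in> Z"
      using b unfolding Z_def by blast
  next
    fix s r m assume s: "s \<in> carrier S" and r: "r \<in> carrier R" and m: "m \<in> carrier M"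
    obtain b where b: "b \<in> carrier R - P" "s \<otimes> b \<in> carrier R" "s \<in> carrier K" using fracE[OF s] .
    have srb: "(s \<otimes>\<^bsub>S\<^esub> r) \<otimes> b = (s \<otimes> b) \<otimes>\<^bsub>R\<^esub> r"
      using b r RK by (simp add: S_ops R_ops K.m_ac)
    have in_D: "(s, r \<odot>\<^bsub>M\<^esub> m) \<in> D b" "(s \<otimes>\<^bsub>S\<^esub> r, m) \<in> D b"
      unfolding D_def using s m b r srb sc.scalar_closed[OF s r] by auto
    have "h b (frag_of (s \<otimes>\<^bsub>S\<^esub> r, m) - frag_of (s, r \<odot>\<^bsub>M\<^esub> m)) = \<zero>\<^bsub>M\<^esub>"
      using in_D hf b m r srb
      by (subst hdiff) (auto simp: M.smult_assoc1 a_minus_def M.M.r_neg)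
    moreover have "Poly_Mapping.keys (frag_of (s \<otimes>\<^bsub>S\<^esub> r, m) - frag_of (s, r \<odot>\<^bsub>M\<^esub> m)) \<subseteq> D b"
      using frag_relator_closed2[OF in_D(2,1)] by simp
    ultimately show "frag_of (s \<otimes>\<^bsub>S\<^esub> r, m) - frag_of (s, r \<odot>\<^bsub>M\<^esub> m) \<in> Z"
      using b unfolding Z_def by blast
  qed (use subringE(7)[OF S_subring] in \<open>auto simp: S_ops\<close>)
  then obtain t where t: "t \<in> carrier R - P" "h t (frag_of (\<one>\<^bsub>S\<^esub>, m) - frag_of (\<one>\<^bsub>S\<^esub>, n)) = \<zero>\<^bsub>M\<^esub>"
    unfolding Z_def by blast
  have in_D: "(\<one>\<^bsub>S\<^esub>, m) \<in> D t" "(\<one>\<^bsub>S\<^esub>, n) \<in> D t"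
    unfolding D_def using mn t denom[OF t(1)] subringE(3)[OF S_subring] by (auto simp: S_ops)
  have "t \<odot>\<^bsub>M\<^esub> m \<ominus>\<^bsub>M\<^esub> t \<odot>\<^bsub>M\<^esub> n = \<zero>\<^bsub>M\<^esub>"
    using t(2) hdiff[of "frag_of (\<one>\<^bsub>S\<^esub>, m)" t "frag_of (\<one>\<^bsub>S\<^esub>, n)"] in_D hf[OF in_D(1)] hf[OF in_D(2)] denom[OF t(1)]
    by (simp add: S_ops)
  then show ?thesis using t mn M.M.eq_of_minus_zero by blast
qed

end

text \<open>Forward, denominators of an inverse pair are cleared; backward, \<open>g\<close> is
  divided by \<open>s\<close>. Hom modules may have torsion, so equality of tensors only gives
  equality in \<open>C\<close> after a further factor outside \<open>P\<close>.\<close>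

lemma (in localization_setup) isomorphic_iff_loc_iso:
  fixes C :: "('k, 'o, 'm) rcat"
  assumes "R_category R C" and A: "A \<in> Ob C" and B: "B \<in> Ob C"
  shows "isomorphic (add_ext R S C) (ext_ob R S C A) (ext_ob R S C B) \<longleftrightarrow> loc_iso R C P A B"
proof -
  interpret category_base_change R S C
    by (rule category_base_change.intro[OF assms(1) scalar_change])
  have one: "\<one>\<^bsub>S\<^esub> \<in> carrier S" by simp
  have den: "\<exists>b\<in>carrier R - P. \<exists>m\<in>mor A B. U = pt A B (inv b) m"
    if Ob: "A \<in> Ob C" "B \<in> Ob C" and U: "U \<in> carrier (Hom D A B)" for U A B
  proof -
    obtain s m where s: "s \<in> carrier S" "m \<in> mor A B" "U = pt A B s m" using pt_exists[OF Ob U] by blast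
    obtain b where b: "b \<in> carrier R - P" "s \<otimes> b \<in> carrier R" "s \<in> carrier K" using fracE[OF s(1)] .
    have "inv b \<otimes>\<^bsub>S\<^esub> (s \<otimes> b) = s"
      using b denom[OF b(1)] denom_inv[OF b(1)] K.m_lcomm[of "inv b" s b] by (simp add: S_ops)
    then have "U = pt A B (inv b) ((s \<otimes> b) \<odot>\<^bsub>Hom C A B\<^esub> m)"
      using pt_smult[OF Ob inv_in_S[OF b(1)] b(2) s(2)] s(3) by simp
    then show ?thesis using b s mor_smult[OF Ob] by blast
  qed
  \<comment> \<open>\<open>b\<close> and \<open>d\<close> are the denominators of the two factors of
    the composite \<open>x\<close>, and \<open>t\<close> is the extra factor that kills
    torsion.\<close>
  have clear: "\<exists>t\<in>carrier R - P. t \<odot>\<^bsub>Hom C A A\<^esub> x = (t \<otimes>\<^bsub>R\<^esub> (b \<otimes>\<^bsub>R\<^esub> d)) \<odot>\<^bsub>Hom C A A\<^esub> Ident C A"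
    if Ob: "A \<in> Ob C" and x: "x \<in> mor A A" and bd: "b \<in> carrier R - P" "d \<in> carrier R - P"
      and eq: "pt A A (inv b \<otimes>\<^bsub>S\<^esub> inv d) x = pt A A \<one>\<^bsub>S\<^esub> (Ident C A)" for A x b d
  proof -
    let ?w = "b \<otimes>\<^bsub>R\<^esub> d"
    have w: "?w \<in> carrier R" "?w \<in> carrier S" using denom_mult[OF bd] R_in_S by auto
    have inv: "inv b \<otimes>\<^bsub>S\<^esub> inv d \<in> carrier S" using inv_in_S bd by simp
    have "?w \<otimes>\<^bsub>S\<^esub> (inv b \<otimes>\<^bsub>S\<^esub> inv d) = (b \<otimes> inv b) \<otimes> (d \<otimes> inv d)"
      using denom[OF bd(1)] denom[OF bd(2)] denom_inv(1)[OF bd(1)] denom_inv(1)[OF bd(2)]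
      unfolding S_ops R_ops by (simp only: K.m_ac K.m_closed)
    then have w1: "?w \<otimes>\<^bsub>S\<^esub> (inv b \<otimes>\<^bsub>S\<^esub> inv d) = \<one>\<^bsub>S\<^esub>"
      using denom_inv[OF bd(1)] denom_inv[OF bd(2)] by (simp add: S_ops)
    have "pt A A \<one>\<^bsub>S\<^esub> x = ?w \<odot>\<^bsub>Hom D A A\<^esub> pt A A (inv b \<otimes>\<^bsub>S\<^esub> inv d) x"
      using D_smult[OF Ob Ob w(2) inv x] w1 by simp
    also have "\<dots> = pt A A (?w \<otimes>\<^bsub>S\<^esub> \<one>\<^bsub>S\<^esub>) (Ident C A)"
      unfolding eq by (rule D_smult[OF Ob Ob w(2) one Ident_closed[OF Ob]])
    also have "?w \<otimes>\<^bsub>S\<^esub> \<one>\<^bsub>S\<^esub> = \<one>\<^bsub>S\<^esub> \<otimes>\<^bsub>S\<^esub> ?w" using w(2) by simp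
    also have "pt A A (\<one>\<^bsub>S\<^esub> \<otimes>\<^bsub>S\<^esub> ?w) (Ident C A) = pt A A \<one>\<^bsub>S\<^esub> (?w \<odot>\<^bsub>Hom C A A\<^esub> Ident C A)"
      by (rule pt_smult[OF Ob Ob one w(1) Ident_closed[OF Ob]])
    finally have "\<exists>t\<in>carrier R - P. t \<odot>\<^bsub>Hom C A A\<^esub> x = t \<odot>\<^bsub>Hom C A A\<^esub> (?w \<odot>\<^bsub>Hom C A A\<^esub> Ident C A)"
      unfolding pt_eq_iff[OF Ob Ob] by (intro tensor_eq_imp Hom_module Ob x mor_smult Ident_closed w)
    then show ?thesis
      using module.smult_assoc1[OF Hom_module[OF Ob Ob] _ w(1) Ident_closed[OF Ob]] by auto
  qed
  show ?thesis unfolding ext_isomorphic_iff[OF A B]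
  proof
    assume "isomorphic D A B"
    then obtain F G where FG: "F \<in> carrier (Hom D A B)" "G \<in> carrier (Hom D B A)"
      "Comp D A B A G F = Ident D A" "Comp D B A B F G = Ident D B"
      unfolding isomorphic_def inverse_pair_def by blast
    obtain b f where f: "b \<in> carrier R - P" "f \<in> mor A B" "F = pt A B (inv b) f" using den[OF A B FG(1)] by blast
    obtain d g where g: "d \<in> carrier R - P" "g \<in> mor B A" "G = pt B A (inv d) g" using den[OF B A FG(2)] by blast
    note Cm = pt_Comp[OF A B A inv_in_S[OF g(1)] g(2) inv_in_S[OF f(1)] f(2)]
      pt_Comp[OF B A B inv_in_S[OF f(1)] f(2) inv_in_S[OF g(1)] g(2)]
    have gf: "Comp C A B A g f \<in> mor A A" "Comp C B A B f g \<in> mor B B"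
      using A B f g by (simp_all add: Comp_closed)
    have eq: "pt A A (inv d \<otimes>\<^bsub>S\<^esub> inv b) (Comp C A B A g f) = pt A A \<one>\<^bsub>S\<^esub> (Ident C A)"
      "pt B B (inv b \<otimes>\<^bsub>S\<^esub> inv d) (Comp C B A B f g) = pt B B \<one>\<^bsub>S\<^esub> (Ident C B)"
      using FG(3,4) by (simp_all only: f(3) g(3) D_Ident Cm)
    obtain t where t: "t \<in> carrier R - P"
      "t \<odot>\<^bsub>Hom C A A\<^esub> Comp C A B A g f = (t \<otimes>\<^bsub>R\<^esub> (d \<otimes>\<^bsub>R\<^esub> b)) \<odot>\<^bsub>Hom C A A\<^esub> Ident C A"
      using clear[OF A gf(1) g(1) f(1) eq(1)] by blast
    obtain u where u: "u \<in> carrier R - P"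
      "u \<odot>\<^bsub>Hom C B B\<^esub> Comp C B A B f g = (u \<otimes>\<^bsub>R\<^esub> (b \<otimes>\<^bsub>R\<^esub> d)) \<odot>\<^bsub>Hom C B B\<^esub> Ident C B"
      using clear[OF B gf(2) f(1) g(1) eq(2)] by blast
    have R: "t \<in> carrier R" "u \<in> carrier R" "b \<in> carrier R" "d \<in> carrier R" using t u f g by auto
    interpret MA: module R "Hom C A A" by (rule Hom_module[OF A A])
    interpret MB: module R "Hom C B B" by (rule Hom_module[OF B B])
    \<comment> \<open>The two composites come with their own torsion factors \<open>t\<close> and
      \<open>u\<close>. Scaling \<open>g\<close> by \<open>t u\<close> turns both composites into
      the same multiple of the identity.\<close>
    let ?s = "(t \<otimes>\<^bsub>R\<^esub> u) \<otimes>\<^bsub>R\<^esub> (b \<otimes>\<^bsub>R\<^esub> d)"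
    have "?s \<in> carrier R - P" by (intro denom_mult t(1) u(1) f(1) g(1))
    moreover have "Comp C A B A ((t \<otimes>\<^bsub>R\<^esub> u) \<odot>\<^bsub>Hom C B A\<^esub> g) f = ?s \<odot>\<^bsub>Hom C A A\<^esub> Ident C A"
    proof -
      have "Comp C A B A ((t \<otimes>\<^bsub>R\<^esub> u) \<odot>\<^bsub>Hom C B A\<^esub> g) f = (u \<otimes>\<^bsub>R\<^esub> t) \<odot>\<^bsub>Hom C A A\<^esub> Comp C A B A g f"
        using A B R f g by (simp add: Comp_smult_left P.m_comm)
      also have "\<dots> = u \<odot>\<^bsub>Hom C A A\<^esub> ((t \<otimes>\<^bsub>R\<^esub> (d \<otimes>\<^bsub>R\<^esub> b)) \<odot>\<^bsub>Hom C A A\<^esub> Ident C A)"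
        using R gf t(2) by (simp add: MA.smult_assoc1)
      also have "\<dots> = (u \<otimes>\<^bsub>R\<^esub> (t \<otimes>\<^bsub>R\<^esub> (d \<otimes>\<^bsub>R\<^esub> b))) \<odot>\<^bsub>Hom C A A\<^esub> Ident C A"
        using R A Ident_closed by (intro MA.smult_assoc1[symmetric]) auto
      also have "u \<otimes>\<^bsub>R\<^esub> (t \<otimes>\<^bsub>R\<^esub> (d \<otimes>\<^bsub>R\<^esub> b)) = ?s" using R by (simp add: P.m_ac)
      finally show ?thesis .
    qed
    moreover have "Comp C B A B f ((t \<otimes>\<^bsub>R\<^esub> u) \<odot>\<^bsub>Hom C B A\<^esub> g) = ?s \<odot>\<^bsub>Hom C B B\<^esub> Ident C B"
    proof -
      have "Comp C B A B f ((t \<otimes>\<^bsub>R\<^esub> u) \<odot>\<^bsub>Hom C B A\<^esub> g) = (t \<otimes>\<^bsub>R\<^esub> u) \<odot>\<^bsub>Hom C B B\<^esub> Comp C B A B f g"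
        using A B R f g by (simp add: Comp_smult_right)
      also have "\<dots> = t \<odot>\<^bsub>Hom C B B\<^esub> ((u \<otimes>\<^bsub>R\<^esub> (b \<otimes>\<^bsub>R\<^esub> d)) \<odot>\<^bsub>Hom C B B\<^esub> Ident C B)"
        using R gf u(2) by (simp add: MB.smult_assoc1)
      also have "\<dots> = (t \<otimes>\<^bsub>R\<^esub> (u \<otimes>\<^bsub>R\<^esub> (b \<otimes>\<^bsub>R\<^esub> d))) \<odot>\<^bsub>Hom C B B\<^esub> Ident C B"
        using R B Ident_closed by (intro MB.smult_assoc1[symmetric]) auto
      also have "t \<otimes>\<^bsub>R\<^esub> (u \<otimes>\<^bsub>R\<^esub> (b \<otimes>\<^bsub>R\<^esub> d)) = ?s" using R by (simp add: P.m_ac)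
      finally show ?thesis .
    qed
    moreover have "(t \<otimes>\<^bsub>R\<^esub> u) \<odot>\<^bsub>Hom C B A\<^esub> g \<in> mor B A" using A B R g by (simp add: mor_smult)
    ultimately show "loc_iso R C P A B" unfolding loc_iso_def using f(2) by blast
  next
    assume "loc_iso R C P A B"
    then obtain f g s where fg: "f \<in> mor A B" "g \<in> mor B A" and s: "s \<in> carrier R - P"
      and e: "Comp C A B A g f = s \<odot>\<^bsub>Hom C A A\<^esub> Ident C A" "Comp C B A B f g = s \<odot>\<^bsub>Hom C B B\<^esub> Ident C B"
      unfolding loc_iso_def by blast
    have i: "inv s \<in> carrier S" "inv s \<otimes>\<^bsub>S\<^esub> s = \<one>\<^bsub>S\<^esub>" "s \<in> carrier R"
      using inv_in_S[OF s] denom_inv[OF s] s by (auto simp: S_ops)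
    have "Comp D A B A (pt B A (inv s) g) (pt A B \<one>\<^bsub>S\<^esub> f) = Ident D A"
      using A B fg i pt_smult[OF A A i(1,3) Ident_closed[OF A]] by (simp add: pt_Comp e D_Ident)
    moreover have "Comp D B A B (pt A B \<one>\<^bsub>S\<^esub> f) (pt B A (inv s) g) = Ident D B"
      using A B fg i pt_smult[OF B B i(1,3) Ident_closed[OF B]] by (simp add: pt_Comp e D_Ident)
    ultimately show "isomorphic D A B"
      unfolding isomorphic_def inverse_pair_def
      using pt_closed[OF A B one fg(1)] pt_closed[OF B A i(1) fg(2)] by blast
  qed
qed

section \<open>Nakayama's lemma\<close>

lemma (in module) span_list_least:
  assumes "submodule N R M" "set gs \<subseteq> N"
  shows "span_list R M gs \<subseteq> N"
  using assms(2)
proof (induction gs)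
  case Nil
  then show ?case using subgroup.one_closed[OF submodule.axioms(1)[OF assms(1)]] by simp
next
  case (Cons g gs)
  then show ?case using submoduleE(4,5)[OF assms(1)] by auto
qed

context module
begin

lemma ideal_span_smult:
  assumes I: "ideal I R" and gs: "set gs \<subseteq> carrier M" and p: "p \<in> I" and m: "m \<in> span_list R M gs"
  shows "p \<odot>\<^bsub>M\<^esub> m \<in> span_list (R\<lparr>carrier := I\<rparr>) M gs"
  using gs m
proof (induction gs arbitrary: m)
  case Nil
  then show ?case using ideal.Icarr[OF I p] by simp
next
  case (Cons g gs)
  then obtain c z where c: "c \<in> carrier R" "z \<in> span_list R M gs" "m = c \<odot>\<^bsub>M\<^esub> g \<oplus>\<^bsub>M\<^esub> z" by auto
  have z: "z \<in> carrier M" using c(2) submoduleE(1)[OF span_list_submodule[of gs]] Cons.prems by auto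
  have pc: "p \<in> carrier R" by (rule ideal.Icarr[OF I p])
  have "p \<odot>\<^bsub>M\<^esub> m = (p \<otimes> c) \<odot>\<^bsub>M\<^esub> g \<oplus>\<^bsub>M\<^esub> p \<odot>\<^bsub>M\<^esub> z"
    using c z pc Cons.prems by (simp add: smult_r_distr smult_assoc1)
  then show ?case using Cons.IH[OF _ c(2)] Cons.prems ideal.I_r_closed[OF I p c(1)] by auto
qed

text \<open>A linear map preserves the product of \<open>I\<close> with \<open>M\<close>. Source and
  target carry separate lists because the induction consumes the first while the second must keep
  spanning \<open>M\<close>.\<close>

lemma ideal_span_linear_image:
  assumes I: "ideal I R" and gs: "set gs \<subseteq> carrier M" "carrier M \<subseteq> span_list R M gs"
    and f: "\<And>x. x \<in> carrier M \<Longrightarrow> f x \<in> carrier M"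
      "\<And>x y. x \<in> carrier M \<Longrightarrow> y \<in> carrier M \<Longrightarrow> f (x \<oplus>\<^bsub>M\<^esub> y) = f x \<oplus>\<^bsub>M\<^esub> f y"
      "\<And>r x. r \<in> carrier R \<Longrightarrow> x \<in> carrier M \<Longrightarrow> f (r \<odot>\<^bsub>M\<^esub> x) = r \<odot>\<^bsub>M\<^esub> f x"
    and hs: "set hs \<subseteq> carrier M" and w: "w \<in> span_list (R\<lparr>carrier := I\<rparr>) M hs"
  shows "f w \<in> span_list (R\<lparr>carrier := I\<rparr>) M gs"
  using hs w
proof (induction hs arbitrary: w)
  note S = submoduleE[OF span_list_ideal_submodule[OF I gs(1)]]
  case Nil
  have "f \<zero>\<^bsub>M\<^esub> = \<zero>\<^bsub>M\<^esub>" using f(1)[of "\<zero>\<^bsub>M\<^esub>"] f(3)[of "\<zero>" "\<zero>\<^bsub>M\<^esub>"] by simp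
  then show ?case
    using Nil subgroup.one_closed[OF submodule.axioms(1)[OF span_list_ideal_submodule[OF I gs(1)]]] by simp
next
  note S = submoduleE[OF span_list_ideal_submodule[OF I gs(1)]]
  case (Cons h hs)
  then obtain c z where c: "c \<in> I" "z \<in> span_list (R\<lparr>carrier := I\<rparr>) M hs" "w = c \<odot>\<^bsub>M\<^esub> h \<oplus>\<^bsub>M\<^esub> z" by auto
  have hc: "h \<in> carrier M" "c \<in> carrier R" using Cons.prems ideal.Icarr[OF I c(1)] by auto
  have z: "z \<in> carrier M" using c(2) submoduleE(1)[OF span_list_ideal_submodule[OF I]] Cons.prems by auto
  have "f w = c \<odot>\<^bsub>M\<^esub> f h \<oplus>\<^bsub>M\<^esub> f z" using c hc z by (simp add: f)
  moreover have "c \<odot>\<^bsub>M\<^esub> f h \<in> span_list (R\<lparr>carrier := I\<rparr>) M gs"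
    using ideal_span_smult[OF I gs(1) c(1)] gs(2) f(1)[OF hc(1)] by blast
  ultimately show ?case using Cons.IH[OF _ c(2)] Cons.prems S(5) by simp
qed

lemma smult_vimage_submodule:
  assumes N: "submodule N R M" and s: "s \<in> carrier R"
  shows "submodule {z \<in> carrier M. s \<odot>\<^bsub>M\<^esub> z \<in> N} R M"
proof (rule submoduleI)
  note NS = submoduleE[OF N]
  show "\<zero>\<^bsub>M\<^esub> \<in> {z \<in> carrier M. s \<odot>\<^bsub>M\<^esub> z \<in> N}"
    using s subgroup.one_closed[OF submodule.axioms(1)[OF N]] by simp
  fix a assume a: "a \<in> {z \<in> carrier M. s \<odot>\<^bsub>M\<^esub> z \<in> N}"
  then show "\<ominus>\<^bsub>M\<^esub> a \<in> {z \<in> carrier M. s \<odot>\<^bsub>M\<^esub> z \<in> N}"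
    using s NS(3) by (simp add: smult_r_minus)
  show "r \<odot>\<^bsub>M\<^esub> a \<in> {z \<in> carrier M. s \<odot>\<^bsub>M\<^esub> z \<in> N}" if r: "r \<in> carrier R" for r
  proof -
    have "s \<odot>\<^bsub>M\<^esub> (r \<odot>\<^bsub>M\<^esub> a) = r \<odot>\<^bsub>M\<^esub> (s \<odot>\<^bsub>M\<^esub> a)"
      using a r s by (simp add: smult_assoc1[symmetric] R.m_comm)
    then show ?thesis using a r NS(4) by simp
  qed
  fix b assume "b \<in> {z \<in> carrier M. s \<odot>\<^bsub>M\<^esub> z \<in> N}"
  then show "a \<oplus>\<^bsub>M\<^esub> b \<in> {z \<in> carrier M. s \<odot>\<^bsub>M\<^esub> z \<in> N}"
    using a s NS(5) by (simp add: smult_r_distr)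
qed simp

text \<open>Induction on the generators: the coefficient \<open>t - p\<close> of the first one stays outside \<open>P\<close>
  and allows to eliminate it.\<close>

lemma nakayama_span:
  assumes P: "primeideal P R" and N: "submodule N R M" and "set gs \<subseteq> carrier M"
    and "\<And>x. x \<in> set gs \<Longrightarrow> \<exists>t\<in>carrier R - P. \<exists>n\<in>N. \<exists>w\<in>span_list (R\<lparr>carrier := P\<rparr>) M gs.
      t \<odot>\<^bsub>M\<^esub> x = n \<oplus>\<^bsub>M\<^esub> w"
  shows "\<exists>s\<in>carrier R - P. \<forall>x\<in>set gs. s \<odot>\<^bsub>M\<^esub> x \<in> N"
  using assms(3-)
proof (induction gs)
  case Nil
  interpret P: primeideal P R by fact
  show ?case using P.one_imp_carrier P.I_notcarr by auto
next
  case (Cons y gs)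
  interpret P: primeideal P R by fact
  note P_id = P.is_ideal
  have y: "y \<in> carrier M" and gs: "set gs \<subseteq> carrier M" using Cons.prems by auto
  let ?W = "span_list (R\<lparr>carrier := P\<rparr>) M gs"
  note W = submoduleE[OF span_list_ideal_submodule[OF P_id gs]]
  note NS = submoduleE[OF N]
  have prod: "a \<otimes> b \<in> carrier R - P" if "a \<in> carrier R - P" "b \<in> carrier R - P" for a b
    using that P.I_prime by blast
  have decomp: "\<exists>t\<in>carrier R - P. \<exists>n\<in>N. \<exists>p\<in>P. \<exists>w\<in>?W. t \<odot>\<^bsub>M\<^esub> x = n \<oplus>\<^bsub>M\<^esub> (p \<odot>\<^bsub>M\<^esub> y \<oplus>\<^bsub>M\<^esub> w)"
    if "x \<in> set (y # gs)" for x
    using Cons.prems(2)[OF that] by auto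
  obtain t n p w where t: "t \<in> carrier R - P" "n \<in> N" "p \<in> P" "w \<in> ?W"
    and ty: "t \<odot>\<^bsub>M\<^esub> y = n \<oplus>\<^bsub>M\<^esub> (p \<odot>\<^bsub>M\<^esub> y \<oplus>\<^bsub>M\<^esub> w)" using decomp[of y] by auto
  have pc: "p \<in> carrier R" by (rule P.Icarr[OF t(3)])
  have nw: "n \<in> carrier M" "w \<in> carrier M" using t NS(1) W(1) by auto
  define u where "u = t \<ominus> p"
  have u: "u \<in> carrier R - P"
  proof -
    have "t = u \<oplus> p" using t pc by (simp add: u_def a_minus_def R.a_assoc R.l_neg)
    then show ?thesis using t pc ideal_add_mem[OF P_id _ t(3), of u] by (auto simp: u_def)
  qed
  have uy: "u \<odot>\<^bsub>M\<^esub> y = n \<oplus>\<^bsub>M\<^esub> w"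
  proof -
    have "u \<odot>\<^bsub>M\<^esub> y = (n \<oplus>\<^bsub>M\<^esub> (p \<odot>\<^bsub>M\<^esub> y \<oplus>\<^bsub>M\<^esub> w)) \<oplus>\<^bsub>M\<^esub> \<ominus>\<^bsub>M\<^esub> (p \<odot>\<^bsub>M\<^esub> y)"
      using t pc y unfolding u_def by (simp add: a_minus_def smult_l_distr smult_l_minus flip: ty)
    also have "\<dots> = n \<oplus>\<^bsub>M\<^esub> w"
      using nw pc y by (simp add: M.a_assoc M.a_comm[of w] M.r_neg2)
    finally show ?thesis .
  qed
  have "\<exists>t\<in>carrier R - P. \<exists>n\<in>N. \<exists>w\<in>?W. t \<odot>\<^bsub>M\<^esub> x = n \<oplus>\<^bsub>M\<^esub> w" if x: "x \<in> set gs" for x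
  proof -
    obtain t' n' p' w' where t': "t' \<in> carrier R - P" "n' \<in> N" "p' \<in> P" "w' \<in> ?W"
      and tx: "t' \<odot>\<^bsub>M\<^esub> x = n' \<oplus>\<^bsub>M\<^esub> (p' \<odot>\<^bsub>M\<^esub> y \<oplus>\<^bsub>M\<^esub> w')" using decomp[of x] x by auto
    have c: "n' \<in> carrier M" "w' \<in> carrier M" "x \<in> carrier M" "p' \<in> carrier R" "t' \<in> carrier R" "u \<in> carrier R"
      using t' u x gs NS(1) W(1) P.Icarr by auto
    \<comment> \<open>The equation for \<open>x\<close> is multiplied by \<open>u\<close> so that
      \<open>u y\<close> can be replaced by \<open>n + w\<close>; the eliminated generator
      \<open>y\<close> then no longer occurs.\<close>
    have "(u \<otimes> t') \<odot>\<^bsub>M\<^esub> x = u \<odot>\<^bsub>M\<^esub> n' \<oplus>\<^bsub>M\<^esub> (p' \<odot>\<^bsub>M\<^esub> (u \<odot>\<^bsub>M\<^esub> y) \<oplus>\<^bsub>M\<^esub> u \<odot>\<^bsub>M\<^esub> w')"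
    proof -
      have "u \<odot>\<^bsub>M\<^esub> (p' \<odot>\<^bsub>M\<^esub> y) = p' \<odot>\<^bsub>M\<^esub> (u \<odot>\<^bsub>M\<^esub> y)"
        using c y by (simp add: smult_assoc1[symmetric] R.m_comm)
      moreover have "(u \<otimes> t') \<odot>\<^bsub>M\<^esub> x = u \<odot>\<^bsub>M\<^esub> (n' \<oplus>\<^bsub>M\<^esub> (p' \<odot>\<^bsub>M\<^esub> y \<oplus>\<^bsub>M\<^esub> w'))"
        using c by (simp add: smult_assoc1 tx)
      ultimately show ?thesis using c y by (simp add: smult_r_distr)
    qed
    also have "\<dots> = (u \<odot>\<^bsub>M\<^esub> n' \<oplus>\<^bsub>M\<^esub> p' \<odot>\<^bsub>M\<^esub> n) \<oplus>\<^bsub>M\<^esub> (p' \<odot>\<^bsub>M\<^esub> w \<oplus>\<^bsub>M\<^esub> u \<odot>\<^bsub>M\<^esub> w')"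
      using c nw unfolding uy by (simp add: smult_r_distr M.a_assoc)
    finally have eq: "(u \<otimes> t') \<odot>\<^bsub>M\<^esub> x = (u \<odot>\<^bsub>M\<^esub> n' \<oplus>\<^bsub>M\<^esub> p' \<odot>\<^bsub>M\<^esub> n) \<oplus>\<^bsub>M\<^esub> (p' \<odot>\<^bsub>M\<^esub> w \<oplus>\<^bsub>M\<^esub> u \<odot>\<^bsub>M\<^esub> w')" .
    have "u \<odot>\<^bsub>M\<^esub> n' \<oplus>\<^bsub>M\<^esub> p' \<odot>\<^bsub>M\<^esub> n \<in> N"
      by (rule NS(5)[OF NS(4)[OF c(6) t'(2)] NS(4)[OF c(4) t(2)]])
    moreover have "p' \<odot>\<^bsub>M\<^esub> w \<oplus>\<^bsub>M\<^esub> u \<odot>\<^bsub>M\<^esub> w' \<in> ?W"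
      by (rule W(5)[OF W(4)[OF c(4) t(4)] W(4)[OF c(6) t'(4)]])
    ultimately show ?thesis using eq prod[OF u t'(1)] by (intro bexI)
  qed
  then obtain s where s: "s \<in> carrier R - P" "\<forall>x\<in>set gs. s \<odot>\<^bsub>M\<^esub> x \<in> N"
    using Cons.IH[OF gs] by blast
  have sN: "submodule {z \<in> carrier M. s \<odot>\<^bsub>M\<^esub> z \<in> N} R M"
    using smult_vimage_submodule[OF N] s(1) by blast
  \<comment> \<open>The generator \<open>y\<close> is treated last: \<open>s\<close> carries all of
    \<open>gs\<close>, hence \<open>w\<close>, into \<open>N\<close>, and \<open>u y = n + w\<close>
    shows that \<open>s u\<close> carries \<open>y\<close> there too.\<close>
  have "?W \<subseteq> span_list R M gs"
    using P.a_subset by (induction gs) auto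
  also have "\<dots> \<subseteq> {z \<in> carrier M. s \<odot>\<^bsub>M\<^esub> z \<in> N}"
    by (rule span_list_least[OF sN]) (use s gs in auto)
  finally have sw: "s \<odot>\<^bsub>M\<^esub> w \<in> N" using t by blast
  have "(s \<otimes> u) \<odot>\<^bsub>M\<^esub> y = s \<odot>\<^bsub>M\<^esub> n \<oplus>\<^bsub>M\<^esub> s \<odot>\<^bsub>M\<^esub> w"
    using s u y nw by (simp add: smult_assoc1 uy smult_r_distr)
  then have "(s \<otimes> u) \<odot>\<^bsub>M\<^esub> y \<in> N" using NS(4,5) s t sw by auto
  moreover have "(s \<otimes> u) \<odot>\<^bsub>M\<^esub> x \<in> N" if "x \<in> set gs" for x
  proof -
    have "(s \<otimes> u) \<odot>\<^bsub>M\<^esub> x = u \<odot>\<^bsub>M\<^esub> (s \<odot>\<^bsub>M\<^esub> x)"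
      using s u that gs by (simp add: R.m_comm[of s u] smult_assoc1 subset_iff)
    then show ?thesis using s(2) that NS(4) u by auto
  qed
  ultimately show ?case using prod[OF s(1) u] by auto
qed

text \<open>Nakayama applied to the image of \<open>f\<close>, which together with the product of
  \<open>P\<close> and \<open>M\<close> is everything because \<open>x = f x + (x - f x)\<close>.
  With \<open>f\<close> a composition in an endomorphism ring and \<open>z\<close> the identity, it
  yields one-sided inverses up to a scalar.\<close>

lemma nakayama_endomorphism:
  assumes P: "primeideal P R" and gs: "set gs \<subseteq> carrier M" "carrier M \<subseteq> span_list R M gs"
    and f: "\<And>x. x \<in> carrier M \<Longrightarrow> f x \<in> carrier M"
      "\<And>x y. x \<in> carrier M \<Longrightarrow> y \<in> carrier M \<Longrightarrow> f (x \<oplus>\<^bsub>M\<^esub> y) = f x \<oplus>\<^bsub>M\<^esub> f y"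
      "\<And>r x. r \<in> carrier R \<Longrightarrow> x \<in> carrier M \<Longrightarrow> f (r \<odot>\<^bsub>M\<^esub> x) = r \<odot>\<^bsub>M\<^esub> f x"
    and id: "\<And>x. x \<in> carrier M \<Longrightarrow> x \<ominus>\<^bsub>M\<^esub> f x \<in> span_list (R\<lparr>carrier := P\<rparr>) M gs"
    and z: "z \<in> carrier M"
  shows "\<exists>s\<in>carrier R - P. \<exists>y\<in>carrier M. f y = s \<odot>\<^bsub>M\<^esub> z"
proof -
  interpret P: primeideal P R by fact
  have f0: "f \<zero>\<^bsub>M\<^esub> = \<zero>\<^bsub>M\<^esub>" using f(1)[of "\<zero>\<^bsub>M\<^esub>"] f(3)[of "\<zero>" "\<zero>\<^bsub>M\<^esub>"] by simp
  have fm: "f (\<ominus>\<^bsub>M\<^esub> x) = \<ominus>\<^bsub>M\<^esub> f x" if "x \<in> carrier M" for x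
    using f(2)[of "\<ominus>\<^bsub>M\<^esub> x" x] f0 that f(1) by (intro M.minus_equality[symmetric]) (auto simp: M.l_neg)
  have N: "submodule (f ` carrier M) R M"
  proof (rule submoduleI)
    show "\<zero>\<^bsub>M\<^esub> \<in> f ` carrier M" using f0 by (metis M.zero_closed imageI)
    fix a assume "a \<in> f ` carrier M"
    then obtain x where x: "x \<in> carrier M" "a = f x" by blast
    show "\<ominus>\<^bsub>M\<^esub> a \<in> f ` carrier M"
      using x fm by (intro image_eqI[of _ _ "\<ominus>\<^bsub>M\<^esub> x"]) simp_all
    show "r \<odot>\<^bsub>M\<^esub> a \<in> f ` carrier M" if "r \<in> carrier R" for r
      using x that f(3) by (intro image_eqI[of _ _ "r \<odot>\<^bsub>M\<^esub> x"]) simp_all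
    fix b assume "b \<in> f ` carrier M"
    then obtain y where y: "y \<in> carrier M" "b = f y" by blast
    show "a \<oplus>\<^bsub>M\<^esub> b \<in> f ` carrier M"
      using x y f(2) by (intro image_eqI[of _ _ "x \<oplus>\<^bsub>M\<^esub> y"]) simp_all
  qed (use f(1) in auto)
  have "\<exists>s\<in>carrier R - P. \<forall>x\<in>set gs. s \<odot>\<^bsub>M\<^esub> x \<in> f ` carrier M"
  proof (rule nakayama_span[OF P N gs(1)])
    fix x assume "x \<in> set gs"
    then have x: "x \<in> carrier M" using gs by blast
    have "\<one> \<odot>\<^bsub>M\<^esub> x = f x \<oplus>\<^bsub>M\<^esub> (x \<ominus>\<^bsub>M\<^esub> f x)"
      using x f(1)[OF x] by (simp add: a_minus_def M.a_comm[of x] M.r_neg2)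
    moreover have "\<one> \<in> carrier R - P" using P.one_imp_carrier P.I_notcarr by auto
    ultimately show "\<exists>t\<in>carrier R - P. \<exists>n\<in>f ` carrier M. \<exists>w\<in>span_list (R\<lparr>carrier := P\<rparr>) M gs. t \<odot>\<^bsub>M\<^esub> x = n \<oplus>\<^bsub>M\<^esub> w"
      using id[OF x] x by blast
  qed
  then obtain s where s: "s \<in> carrier R - P" "\<forall>x\<in>set gs. s \<odot>\<^bsub>M\<^esub> x \<in> f ` carrier M" by blast
  note NS = submoduleE[OF N]
  have sN: "submodule {z \<in> carrier M. s \<odot>\<^bsub>M\<^esub> z \<in> f ` carrier M} R M"
    using smult_vimage_submodule[OF N] s(1) by blast
  have "set gs \<subseteq> {z \<in> carrier M. s \<odot>\<^bsub>M\<^esub> z \<in> f ` carrier M}" using s(2) gs(1) by blast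
  from span_list_least[OF sN this] have "s \<odot>\<^bsub>M\<^esub> z \<in> f ` carrier M" using gs(2) z by blast
  then obtain y where "y \<in> carrier M" "f y = s \<odot>\<^bsub>M\<^esub> z" by (metis imageE)
  then show ?thesis using s(1) by blast
qed

end

section \<open>Residue fields\<close>

text \<open>Representatives of the cosets are used so that the residue field lives on the type of \<open>R\<close>.\<close>

definition residue_rep :: "'k ring \<Rightarrow> 'k set \<Rightarrow> 'k \<Rightarrow> 'k" where
  "residue_rep R P x = (SOME y. y \<in> P +>\<^bsub>R\<^esub> x)"

definition residue_field :: "'k ring \<Rightarrow> 'k set \<Rightarrow> 'k ring" where
  "residue_field R P =
     \<lparr>carrier = residue_rep R P ` carrier R,
      monoid.mult = (\<lambda>x y. residue_rep R P (x \<otimes>\<^bsub>R\<^esub> y)), monoid.one = residue_rep R P \<one>\<^bsub>R\<^esub>,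
      ring.zero = residue_rep R P \<zero>\<^bsub>R\<^esub>, ring.add = (\<lambda>x y. residue_rep R P (x \<oplus>\<^bsub>R\<^esub> y))\<rparr>"

locale residue_setup =
  fixes R :: "'k ring" (structure) and P :: "'k set"
  assumes cring: "cring R" and maximal: "maximalideal P R"
begin

sublocale R: cring R by (rule cring)
sublocale P: maximalideal P R by (rule maximal)

abbreviation "rep \<equiv> residue_rep R P"
abbreviation "S \<equiv> residue_field R P"

lemma primeideal: "primeideal P R"
  by (rule R.maximalideal_prime[OF maximal])

lemma rep_mem: "x \<in> carrier R \<Longrightarrow> rep x \<in> P +> x"
  unfolding residue_rep_def by (rule someI, rule P.a_rcos_self)

lemma rep_closed: "x \<in> carrier R \<Longrightarrow> rep x \<in> carrier R"
  using rep_mem R.a_r_coset_subset_G[of P x] P.a_subset by auto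

lemma rep_coset: "x \<in> carrier R \<Longrightarrow> P +> rep x = P +> x"
  using R.a_repr_independence[OF rep_mem _ P.a_subgroup] by simp

lemma rep_diff: "x \<in> carrier R \<Longrightarrow> rep x \<ominus> x \<in> P"
  using R.quotient_eq_iff_same_a_r_cos[OF P.is_ideal] rep_coset rep_closed by blast

lemma rep_cong:
  assumes "x \<in> carrier R" "y \<in> carrier R" "x \<ominus> y \<in> P"
  shows "rep x = rep y"
  using R.quotient_eq_iff_same_a_r_cos[OF P.is_ideal assms(1,2)] assms(3) unfolding residue_rep_def by simp

lemma rep_rep: "x \<in> carrier R \<Longrightarrow> rep (rep x) = rep x"
  by (intro rep_cong rep_diff rep_closed)

lemma mult_diff:
  assumes "a \<in> carrier R" "b \<in> carrier R" "c \<in> carrier R" "a \<ominus> b \<in> P"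
  shows "a \<otimes> c \<ominus> b \<otimes> c \<in> P"
proof -
  have "a \<otimes> c \<ominus> b \<otimes> c = (a \<ominus> b) \<otimes> c"
    using assms by (simp add: a_minus_def R.l_distr R.l_minus)
  then show ?thesis using P.I_r_closed[OF assms(4,3)] by simp
qed

lemma rep_mult_left: "x \<in> carrier R \<Longrightarrow> y \<in> carrier R \<Longrightarrow> rep (rep x \<otimes> y) = rep (x \<otimes> y)"
  by (intro rep_cong mult_diff rep_diff rep_closed R.m_closed)

lemma rep_mult_right: "x \<in> carrier R \<Longrightarrow> y \<in> carrier R \<Longrightarrow> rep (x \<otimes> rep y) = rep (x \<otimes> y)"
  using rep_mult_left[of y x] rep_closed by (simp add: R.m_comm)

lemma rep_add_left:
  assumes x: "x \<in> carrier R" and y: "y \<in> carrier R"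
  shows "rep (rep x \<oplus> y) = rep (x \<oplus> y)"
proof (rule rep_cong)
  have "(rep x \<oplus> y) \<ominus> (x \<oplus> y) = rep x \<ominus> x"
    using x y rep_closed[OF x] by (simp add: a_minus_def R.minus_add R.a_assoc R.a_lcomm[of y] R.r_neg)
  then show "(rep x \<oplus> y) \<ominus> (x \<oplus> y) \<in> P" using rep_diff[OF x] by simp
qed (use x y rep_closed in auto)

lemma rep_add_right: "x \<in> carrier R \<Longrightarrow> y \<in> carrier R \<Longrightarrow> rep (x \<oplus> rep y) = rep (x \<oplus> y)"
  using rep_add_left[of y x] rep_closed by (simp add: R.a_comm)

lemma S_sel: "carrier S = rep ` carrier R" "x \<otimes>\<^bsub>S\<^esub> y = rep (x \<otimes> y)" "\<one>\<^bsub>S\<^esub> = rep \<one>"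
    "\<zero>\<^bsub>S\<^esub> = rep \<zero>" "x \<oplus>\<^bsub>S\<^esub> y = rep (x \<oplus> y)"
  by (simp_all add: residue_field_def)

lemma rep_in_S: "x \<in> carrier R \<Longrightarrow> rep x \<in> carrier S" unfolding S_sel by blast

lemma S_R: "s \<in> carrier S \<Longrightarrow> s \<in> carrier R" unfolding S_sel using rep_closed by blast

lemma rep_S: "s \<in> carrier S \<Longrightarrow> rep s = s" unfolding S_sel using rep_rep by blast

lemma one_S: "\<one>\<^bsub>S\<^esub> \<in> carrier S" unfolding S_sel(3) by (intro rep_in_S R.one_closed)

lemma one_act: "r \<in> carrier R \<Longrightarrow> \<one>\<^bsub>S\<^esub> \<otimes>\<^bsub>S\<^esub> r = rep r"
  by (simp add: S_sel rep_mult_left)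

lemma S_cring: "cring S"
proof (rule cringI)
  show "abelian_group S"
  proof (rule abelian_groupI)
    fix x assume "x \<in> carrier S"
    then obtain a where a: "a \<in> carrier R" "x = rep a" unfolding S_sel by blast
    show "\<zero>\<^bsub>S\<^esub> \<oplus>\<^bsub>S\<^esub> x = x" using a by (simp add: S_sel rep_add_left rep_add_right rep_closed)
    show "\<exists>y\<in>carrier S. y \<oplus>\<^bsub>S\<^esub> x = \<zero>\<^bsub>S\<^esub>"
      using a by (intro bexI[of _ "rep (\<ominus> a)"])
        (simp_all add: S_sel rep_add_left rep_add_right rep_closed R.l_neg)
    fix y assume "y \<in> carrier S"
    then obtain b where b: "b \<in> carrier R" "y = rep b" unfolding S_sel by blast
    show "x \<oplus>\<^bsub>S\<^esub> y \<in> carrier S" "x \<oplus>\<^bsub>S\<^esub> y = y \<oplus>\<^bsub>S\<^esub> x"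
      using a b by (simp_all add: S_sel rep_closed R.a_comm)
    fix z assume "z \<in> carrier S"
    then obtain c where c: "c \<in> carrier R" "z = rep c" unfolding S_sel by blast
    show "x \<oplus>\<^bsub>S\<^esub> y \<oplus>\<^bsub>S\<^esub> z = x \<oplus>\<^bsub>S\<^esub> (y \<oplus>\<^bsub>S\<^esub> z)"
      using a b c by (simp add: S_sel rep_add_left rep_add_right rep_closed R.a_assoc)
  qed (simp add: S_sel)
  show "comm_monoid S"
  proof (rule comm_monoidI)
    fix x assume "x \<in> carrier S"
    then obtain a where a: "a \<in> carrier R" "x = rep a" unfolding S_sel by blast
    show "\<one>\<^bsub>S\<^esub> \<otimes>\<^bsub>S\<^esub> x = x" using a by (simp add: S_sel rep_mult_left rep_mult_right rep_closed)
    fix y assume "y \<in> carrier S"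
    then obtain b where b: "b \<in> carrier R" "y = rep b" unfolding S_sel by blast
    show "x \<otimes>\<^bsub>S\<^esub> y \<in> carrier S" "x \<otimes>\<^bsub>S\<^esub> y = y \<otimes>\<^bsub>S\<^esub> x"
      using a b by (simp_all add: S_sel rep_closed R.m_comm)
    fix z assume "z \<in> carrier S"
    then obtain c where c: "c \<in> carrier R" "z = rep c" unfolding S_sel by blast
    show "x \<otimes>\<^bsub>S\<^esub> y \<otimes>\<^bsub>S\<^esub> z = x \<otimes>\<^bsub>S\<^esub> (y \<otimes>\<^bsub>S\<^esub> z)"
      using a b c by (simp add: S_sel rep_mult_left rep_mult_right rep_closed R.m_assoc)
  qed (simp add: S_sel)
  fix x y z assume "x \<in> carrier S" "y \<in> carrier S" "z \<in> carrier S"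
  then have "x \<in> carrier R" "y \<in> carrier R" "z \<in> carrier R" using S_R by auto
  then show "(x \<oplus>\<^bsub>S\<^esub> y) \<otimes>\<^bsub>S\<^esub> z = x \<otimes>\<^bsub>S\<^esub> z \<oplus>\<^bsub>S\<^esub> y \<otimes>\<^bsub>S\<^esub> z"
    by (simp add: S_sel rep_mult_left rep_add_left rep_add_right rep_closed R.l_distr)
qed

lemma inverse_mod:
  assumes s: "s \<in> carrier R" "s \<notin> P"
  shows "\<exists>t\<in>carrier R. t \<otimes> s \<ominus> \<one> \<in> P"
proof -
  interpret Q: field "R Quot P" by (rule P.quotient_is_field[OF cring])
  have c: "P +> x \<in> carrier (R Quot P)" if "x \<in> carrier R" for x
    using that P.a_subset by (auto simp: FactRing_def intro!: R.a_rcosetsI)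
  have "P +> s \<noteq> P" using P.rcos_const_imp_mem[OF s(1)] s(2) by blast
  then have "P +> s \<noteq> \<zero>\<^bsub>R Quot P\<^esub>" by (simp add: FactRing_def)
  then have "P +> s \<in> Units (R Quot P)" using Q.field_Units c[OF s(1)] by blast
  then obtain U where U: "U \<in> carrier (R Quot P)" "U \<otimes>\<^bsub>R Quot P\<^esub> (P +> s) = \<one>\<^bsub>R Quot P\<^esub>"
    unfolding Units_def by blast
  obtain t where t: "t \<in> carrier R" "U = P +> t"
    using U(1) by (auto simp: FactRing_def A_RCOSETS_def')
  have "P +> (t \<otimes> s) = P +> \<one>"
    using U(2) t s by (simp add: FactRing_def P.rcoset_mult_add)
  then show ?thesis using R.quotient_eq_iff_same_a_r_cos[OF P.is_ideal] t s by blast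
qed

lemma S_field: "field S"
proof (rule cring.cring_fieldI2[OF S_cring])
  show "\<zero>\<^bsub>S\<^esub> \<noteq> \<one>\<^bsub>S\<^esub>"
  proof
    assume "\<zero>\<^bsub>S\<^esub> = \<one>\<^bsub>S\<^esub>"
    then have "P +> \<one> = P +> \<zero>"
      unfolding S_sel using rep_coset by (metis R.one_closed R.zero_closed)
    then have "\<one> \<ominus> \<zero> \<in> P" using R.quotient_eq_iff_same_a_r_cos[OF P.is_ideal] by simp
    then show False using P.one_imp_carrier P.I_notcarr by (simp add: a_minus_def)
  qed
  fix a assume a: "a \<in> carrier S" "a \<noteq> \<zero>\<^bsub>S\<^esub>"
  have "a \<notin> P"
  proof
    assume "a \<in> P"
    moreover have "a \<ominus> \<zero> = a" using S_R[OF a(1)] by (simp add: a_minus_def)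
    ultimately have "a \<ominus> \<zero> \<in> P" by metis
    then have "rep a = rep \<zero>" by (rule rep_cong[OF S_R[OF a(1)] R.zero_closed])
    then have "a = \<zero>\<^bsub>S\<^esub>" unfolding rep_S[OF a(1)] S_sel(4) .
    then show False using a(2) by contradiction
  qed
  then obtain t where t: "t \<in> carrier R" "t \<otimes> a \<ominus> \<one> \<in> P"
    using inverse_mod S_R a by blast
  have "a \<otimes>\<^bsub>S\<^esub> rep t = \<one>\<^bsub>S\<^esub>"
    using t S_R[OF a(1)] by (simp add: S_sel rep_mult_right R.m_comm rep_cong)
  then show "\<exists>b\<in>carrier S. a \<otimes>\<^bsub>S\<^esub> b = \<one>\<^bsub>S\<^esub>" using rep_in_S t by blast
qed

lemma scalar_change: "scalar_change R S"
proof (rule scalar_change.intro[OF cring S_cring])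
  show "(\<lambda>r. \<one>\<^bsub>S\<^esub> \<otimes>\<^bsub>S\<^esub> r) \<in> ring_hom R S"
  proof (rule ring_hom_memI)
    fix x assume x: "x \<in> carrier R"
    show "\<one>\<^bsub>S\<^esub> \<otimes>\<^bsub>S\<^esub> x \<in> carrier S" using x by (simp add: one_act rep_in_S)
    fix y assume y: "y \<in> carrier R"
    show "\<one>\<^bsub>S\<^esub> \<otimes>\<^bsub>S\<^esub> (x \<otimes> y) = (\<one>\<^bsub>S\<^esub> \<otimes>\<^bsub>S\<^esub> x) \<otimes>\<^bsub>S\<^esub> (\<one>\<^bsub>S\<^esub> \<otimes>\<^bsub>S\<^esub> y)"
      using x y by (simp add: one_act) (simp add: S_sel rep_mult_left rep_mult_right rep_closed)
    show "\<one>\<^bsub>S\<^esub> \<otimes>\<^bsub>S\<^esub> (x \<oplus> y) = (\<one>\<^bsub>S\<^esub> \<otimes>\<^bsub>S\<^esub> x) \<oplus>\<^bsub>S\<^esub> (\<one>\<^bsub>S\<^esub> \<otimes>\<^bsub>S\<^esub> y)"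
      using x y by (simp add: one_act) (simp add: S_sel rep_add_left rep_add_right rep_closed)
  next
    show "\<one>\<^bsub>S\<^esub> \<otimes>\<^bsub>S\<^esub> \<one> = \<one>\<^bsub>S\<^esub>" by (simp add: one_act) (simp add: S_sel)
  qed
  show "s \<otimes>\<^bsub>S\<^esub> (\<one>\<^bsub>S\<^esub> \<otimes>\<^bsub>S\<^esub> r) = s \<otimes>\<^bsub>S\<^esub> r" if "s \<in> carrier S" "r \<in> carrier R" for s r
    using that S_R by (simp add: one_act) (simp add: S_sel rep_mult_right)
  show "\<exists>u\<in>carrier S. \<exists>a\<in>carrier R. \<exists>b\<in>carrier R. s = u \<otimes>\<^bsub>S\<^esub> a \<and> t = u \<otimes>\<^bsub>S\<^esub> b"
    if "s \<in> carrier S" "t \<in> carrier S" for s t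
    using that S_R rep_S one_act one_S by metis
qed

text \<open>The evaluation \<open>s \<otimes> m \<mapsto> s m\<close> uses representatives and is
  additive on the free group; it respects the tensor relations only modulo the product of
  \<open>P\<close> and \<open>M\<close>, because sums and products of representatives are correct
  only modulo \<open>P\<close>.\<close>

lemma tensor_eq_imp:
  assumes M: "module R M" and gs: "set gs \<subseteq> carrier M" "carrier M \<subseteq> span_list R M gs"
    and mn: "m \<in> carrier M" "n \<in> carrier M"
    and rel: "frag_of (\<one>\<^bsub>S\<^esub>, m) - frag_of (\<one>\<^bsub>S\<^esub>, n) \<in> tensor_rels R S M"
  shows "m \<ominus>\<^bsub>M\<^esub> n \<in> span_list (R\<lparr>carrier := P\<rparr>) M gs"
proof -
  interpret M: module R M by fact
  interpret sc: scalar_change R S by (rule scalar_change)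
  interpret S: cring S by (rule S_cring)
  let ?W = "span_list (R\<lparr>carrier := P\<rparr>) M gs"
  note W = M.submoduleE[OF M.span_list_ideal_submodule[OF P.is_ideal gs(1)]]
  have W0: "\<zero>\<^bsub>M\<^esub> \<in> ?W"
    using subgroup.one_closed[OF submodule.axioms(1)[OF M.span_list_ideal_submodule[OF P.is_ideal gs(1)]]] by simp
  have PW: "p \<odot>\<^bsub>M\<^esub> x \<in> ?W" if "p \<in> P" "x \<in> carrier M" for p x
    using M.ideal_span_smult[OF P.is_ideal gs(1) that(1)] gs(2) that(2) by blast
  let ?D = "carrier S \<times> carrier M"
  have "(\<lambda>(s, m). s \<odot>\<^bsub>M\<^esub> m) ` ?D \<subseteq> carrier (add_monoid M)" using S_R by auto
  from comm_group.free_Abelian_group_universal[OF M.M.a_comm_group this]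
  obtain h where hh: "h \<in> hom (free_Abelian_group ?D) (add_monoid M)"
    and "\<And>x. x \<in> ?D \<Longrightarrow> h (frag_of x) = (\<lambda>(s, m). s \<odot>\<^bsub>M\<^esub> m) x" by metis
  then have hf: "\<And>s m. s \<in> carrier S \<Longrightarrow> m \<in> carrier M \<Longrightarrow> h (frag_of (s, m)) = s \<odot>\<^bsub>M\<^esub> m" by simp
  interpret h: group_hom "free_Abelian_group ?D" "add_monoid M" h
    using hh M.M.a_group by (simp add: group_hom_def group_hom_axioms_def)
  have hadd: "h (x + y) = h x \<oplus>\<^bsub>M\<^esub> h y"
    if "Poly_Mapping.keys x \<subseteq> ?D" "Poly_Mapping.keys y \<subseteq> ?D" for x y
    using h.hom_mult[of x y] that by simp
  have hneg: "h (- x) = \<ominus>\<^bsub>M\<^esub> h x" if "Poly_Mapping.keys x \<subseteq> ?D" for x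
    using h.hom_inv[of x] that by (simp add: a_inv_def)
  have hdiff: "h (x - y) = h x \<ominus>\<^bsub>M\<^esub> h y"
    if "Poly_Mapping.keys x \<subseteq> ?D" "Poly_Mapping.keys y \<subseteq> ?D" for x y
    using hadd[of x "- y"] hneg[of y] that by (simp add: a_minus_def)
  have h3: "h (frag_of x - frag_of y - frag_of z) = h (frag_of x) \<ominus>\<^bsub>M\<^esub> h (frag_of y) \<ominus>\<^bsub>M\<^esub> h (frag_of z)"
    if in_D: "x \<in> ?D" "y \<in> ?D" "z \<in> ?D" for x y z
  proof -
    have "Poly_Mapping.keys (frag_of x - frag_of y) \<subseteq> ?D" using frag_relator_closed2[OF in_D(1,2)] by simp
    then show ?thesis using in_D by (simp add: hdiff)
  qed
  define Z where "Z = {x. Poly_Mapping.keys x \<subseteq> ?D \<and> h x \<in> ?W}"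
  have "frag_of (\<one>\<^bsub>S\<^esub>, m) - frag_of (\<one>\<^bsub>S\<^esub>, n) \<in> Z"
  proof (rule tensor_rels_subset[where h = "\<lambda>x. x" and T' = Z, OF _ _ _ _ M _ sc.scalar_closed _ _ _ rel])
    show "0 \<in> Z" unfolding Z_def using W0 h.hom_one by simp
    show "x + y \<in> Z" if "x \<in> Z" "y \<in> Z" for x y
      using that keys_add[of x y] W(5) unfolding Z_def by (auto simp: hadd)
    show "- x \<in> Z" if "x \<in> Z" for x
      using that W(3) unfolding Z_def by (simp add: hneg)
  next
    fix s t m assume s: "s \<in> carrier S" and t: "t \<in> carrier S" and m: "m \<in> carrier M"
    have st: "s \<in> carrier R" "t \<in> carrier R" "s \<oplus>\<^bsub>S\<^esub> t \<in> carrier S" using s t S_R by auto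
    have "h (frag_of (s \<oplus>\<^bsub>S\<^esub> t, m) - frag_of (s, m) - frag_of (t, m))
        = ((s \<oplus>\<^bsub>S\<^esub> t) \<ominus> (s \<oplus> t)) \<odot>\<^bsub>M\<^esub> m"
      using s t m st S_R[OF st(3)]
      by (simp add: h3 hf a_minus_def R.minus_add M.smult_l_distr M.smult_l_minus M.M.a_assoc)
    also have "\<dots> \<in> ?W"
      using PW[OF _ m] rep_diff[of "s \<oplus> t"] st unfolding S_sel by simp
    finally show "frag_of (s \<oplus>\<^bsub>S\<^esub> t, m) - frag_of (s, m) - frag_of (t, m) \<in> Z"
      using frag_relator_closed[of "(s \<oplus>\<^bsub>S\<^esub> t, m)" ?D "(s, m)" "(t, m)"] s t st m unfolding Z_def by simp
  next
    fix s m n assume s: "s \<in> carrier S" and m: "m \<in> carrier M" and n: "n \<in> carrier M"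
    have "h (frag_of (s, m \<oplus>\<^bsub>M\<^esub> n) - frag_of (s, m) - frag_of (s, n)) = \<zero>\<^bsub>M\<^esub>"
      using s m n S_R[OF s]
      by (simp add: h3 hf a_minus_def M.smult_r_distr M.M.a_assoc M.M.a_lcomm[of "s \<odot>\<^bsub>M\<^esub> n"] M.M.r_neg)
    then show "frag_of (s, m \<oplus>\<^bsub>M\<^esub> n) - frag_of (s, m) - frag_of (s, n) \<in> Z"
      using frag_relator_closed[of "(s, m \<oplus>\<^bsub>M\<^esub> n)" ?D "(s, m)" "(s, n)"] s m n W0 unfolding Z_def by simp
  next
    fix s r m assume s: "s \<in> carrier S" and r: "r \<in> carrier R" and m: "m \<in> carrier M"
    have sr: "s \<in> carrier R" "s \<otimes>\<^bsub>S\<^esub> r \<in> carrier S" using s S_R r sc.scalar_closed by auto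
    have "h (frag_of (s \<otimes>\<^bsub>S\<^esub> r, m) - frag_of (s, r \<odot>\<^bsub>M\<^esub> m)) = ((s \<otimes>\<^bsub>S\<^esub> r) \<ominus> s \<otimes> r) \<odot>\<^bsub>M\<^esub> m"
      using s r m sr S_R[OF sr(2)]
      by (simp add: hdiff hf a_minus_def M.smult_l_distr M.smult_l_minus M.smult_assoc1)
    also have "\<dots> \<in> ?W" using PW[OF _ m] rep_diff[of "s \<otimes> r"] sr r unfolding S_sel by simp
    finally show "frag_of (s \<otimes>\<^bsub>S\<^esub> r, m) - frag_of (s, r \<odot>\<^bsub>M\<^esub> m) \<in> Z"
      using frag_relator_closed2[of "(s \<otimes>\<^bsub>S\<^esub> r, m)" ?D "(s, r \<odot>\<^bsub>M\<^esub> m)"] s r m sr unfolding Z_def by simp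
  qed simp_all
  then have "h (frag_of (\<one>\<^bsub>S\<^esub>, m) - frag_of (\<one>\<^bsub>S\<^esub>, n)) \<in> ?W" unfolding Z_def by blast
  then have *: "\<one>\<^bsub>S\<^esub> \<odot>\<^bsub>M\<^esub> m \<ominus>\<^bsub>M\<^esub> \<one>\<^bsub>S\<^esub> \<odot>\<^bsub>M\<^esub> n \<in> ?W" using mn by (simp add: hdiff hf)
  \<comment> \<open>The unit of the residue field is merely a representative of \<open>1\<close>, so
    evaluation gives a multiple of \<open>m - n\<close> by it; the correction again lies in the
    product of \<open>P\<close> and \<open>M\<close>.\<close>
  have mnc: "m \<ominus>\<^bsub>M\<^esub> n \<in> carrier M" "\<one>\<^bsub>S\<^esub> \<in> carrier R" using mn S_R one_S by auto
  have "m \<ominus>\<^bsub>M\<^esub> n = \<one>\<^bsub>S\<^esub> \<odot>\<^bsub>M\<^esub> (m \<ominus>\<^bsub>M\<^esub> n) \<oplus>\<^bsub>M\<^esub> \<ominus>\<^bsub>M\<^esub> ((\<one>\<^bsub>S\<^esub> \<ominus> \<one>) \<odot>\<^bsub>M\<^esub> (m \<ominus>\<^bsub>M\<^esub> n))"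
  proof -
    have "\<ominus>\<^bsub>M\<^esub> ((\<one>\<^bsub>S\<^esub> \<ominus> \<one>) \<odot>\<^bsub>M\<^esub> d) = \<ominus>\<^bsub>M\<^esub> (\<one>\<^bsub>S\<^esub> \<odot>\<^bsub>M\<^esub> d) \<oplus>\<^bsub>M\<^esub> d" if "d \<in> carrier M" for d
      using that mnc(2) by (simp add: a_minus_def M.smult_l_distr M.smult_l_minus M.M.minus_add)
    then show ?thesis using mnc by (simp add: M.M.r_neg2)
  qed
  also have "\<dots> \<in> ?W"
  proof -
    have "\<one>\<^bsub>S\<^esub> \<odot>\<^bsub>M\<^esub> (m \<ominus>\<^bsub>M\<^esub> n) \<in> ?W"
      using * mn mnc(2) by (simp add: a_minus_def M.smult_r_distr M.smult_r_minus)
    moreover have "(\<one>\<^bsub>S\<^esub> \<ominus> \<one>) \<odot>\<^bsub>M\<^esub> (m \<ominus>\<^bsub>M\<^esub> n) \<in> ?W"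
      using PW[OF _ mnc(1)] rep_diff[of "\<one>"] unfolding S_sel by simp
    ultimately show ?thesis using W(3,5) by blast
  qed
  finally show ?thesis .
qed

text \<open>The tensor of the Hom module with the residue field is a quotient of it, so an inverse
  pair lifts to \<open>f\<close> and \<open>g\<close> whose composites are the identity modulo
  \<open>P\<close>. Nakayama makes these composites invertible up to scalars outside
  \<open>P\<close>.\<close>

lemma isomorphic_iff_loc_iso:
  fixes C :: "('k, 'o, 'm) rcat"
  assumes "R_category R C" and fin: "hom_finite R C" and A: "A \<in> Ob C" and B: "B \<in> Ob C"
  shows "isomorphic (add_ext R S C) (ext_ob R S C A) (ext_ob R S C B) \<longleftrightarrow> loc_iso R C P A B"
proof -
  interpret category_base_change R S C
    by (rule category_base_change.intro[OF assms(1) scalar_change])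
  have rep1: "\<exists>m\<in>mor A B. U = pt A B \<one>\<^bsub>S\<^esub> m"
    if Ob: "A \<in> Ob C" "B \<in> Ob C" and U: "U \<in> carrier (Hom D A B)" for U A B
  proof -
    obtain s m where s: "s \<in> carrier S" "m \<in> mor A B" "U = pt A B s m" using pt_exists[OF Ob U] by blast
    have "U = pt A B \<one>\<^bsub>S\<^esub> (s \<odot>\<^bsub>Hom C A B\<^esub> m)"
      using pt_smult[OF Ob one_S S_R[OF s(1)] s(2)] one_act[OF S_R[OF s(1)]] rep_S[OF s(1)] s(3) by simp
    then show ?thesis using mor_smult[OF Ob s(2) S_R[OF s(1)]] by blast
  qed
  \<comment> \<open>If \<open>x\<close> is the identity modulo \<open>P\<close>, composing with
    \<open>x\<close> on either side is congruent to the identity map of the endomorphism module.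
    Nakayama is applied to both maps, so the two inverses and their scalars are a priori
    unrelated.\<close>
  have units: "(\<exists>s\<in>carrier R - P. \<exists>v\<in>mor A A. Comp C A A A x v = s \<odot>\<^bsub>Hom C A A\<^esub> Ident C A) \<and>
      (\<exists>s\<in>carrier R - P. \<exists>v\<in>mor A A. Comp C A A A v x = s \<odot>\<^bsub>Hom C A A\<^esub> Ident C A)"
    if Ob [simp]: "A \<in> Ob C" and x [simp]: "x \<in> mor A A" and eq: "pt A A (\<one>\<^bsub>S\<^esub> \<otimes>\<^bsub>S\<^esub> \<one>\<^bsub>S\<^esub>) x = pt A A \<one>\<^bsub>S\<^esub> (Ident C A)" for A x
  proof -
    interpret M: module R "Hom C A A" by (rule Hom_module[OF Ob Ob])
    let ?M = "Hom C A A"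
    obtain gs where gs: "set gs \<subseteq> mor A A" "mor A A \<subseteq> span_list R ?M gs"
      using fin lincombs_spanned[OF M.module_axioms] Ob unfolding hom_finite_def by metis
    have "pt A A \<one>\<^bsub>S\<^esub> (Ident C A) = pt A A \<one>\<^bsub>S\<^esub> x" using eq by simp
    then have w: "Ident C A \<ominus>\<^bsub>?M\<^esub> x \<in> span_list (R\<lparr>carrier := P\<rparr>) ?M gs"
      unfolding pt_eq_iff[OF Ob Ob] by (intro tensor_eq_imp M.module_axioms gs Ident_closed Ob x)
    have "z \<ominus>\<^bsub>?M\<^esub> Comp C A A A x z \<in> span_list (R\<lparr>carrier := P\<rparr>) ?M gs" if z: "z \<in> mor A A" for z
    proof -
      have "Comp C A A A (Ident C A \<ominus>\<^bsub>?M\<^esub> x) z \<in> span_list (R\<lparr>carrier := P\<rparr>) ?M gs"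
        by (rule M.ideal_span_linear_image[OF P.is_ideal gs, where f = "\<lambda>w. Comp C A A A w z", OF _ _ _ gs(1) w])
          (use z in \<open>simp_all add: Comp_closed Comp_add_left Comp_smult_left\<close>)
      then show ?thesis using z by (simp add: a_minus_def Comp_simps)
    qed
    then have 1: "\<exists>s\<in>carrier R - P. \<exists>v\<in>mor A A. Comp C A A A x v = s \<odot>\<^bsub>?M\<^esub> Ident C A"
      by (intro M.nakayama_endomorphism[OF primeideal gs])
        (simp_all add: Comp_closed Comp_add_right Comp_smult_right Ident_closed)
    have "z \<ominus>\<^bsub>?M\<^esub> Comp C A A A z x \<in> span_list (R\<lparr>carrier := P\<rparr>) ?M gs" if z: "z \<in> mor A A" for z
    proof -
      have "Comp C A A A z (Ident C A \<ominus>\<^bsub>?M\<^esub> x) \<in> span_list (R\<lparr>carrier := P\<rparr>) ?M gs"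
        by (rule M.ideal_span_linear_image[OF P.is_ideal gs, where f = "\<lambda>w. Comp C A A A z w", OF _ _ _ gs(1) w])
          (use z in \<open>simp_all add: Comp_closed Comp_add_right Comp_smult_right\<close>)
      then show ?thesis using z by (simp add: a_minus_def Comp_simps)
    qed
    then have "\<exists>s\<in>carrier R - P. \<exists>v\<in>mor A A. Comp C A A A v x = s \<odot>\<^bsub>?M\<^esub> Ident C A"
      by (intro M.nakayama_endomorphism[OF primeideal gs])
        (simp_all add: Comp_closed Comp_add_left Comp_smult_left Ident_closed)
    with 1 show ?thesis by blast
  qed
  show ?thesis unfolding ext_isomorphic_iff[OF A B]
  proof
    assume "isomorphic D A B"
    then obtain F G where FG: "F \<in> carrier (Hom D A B)" "G \<in> carrier (Hom D B A)"
      "Comp D A B A G F = Ident D A" "Comp D B A B F G = Ident D B"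
      unfolding isomorphic_def inverse_pair_def by blast
    obtain f where f: "f \<in> mor A B" "F = pt A B \<one>\<^bsub>S\<^esub> f" using rep1[OF A B FG(1)] by blast
    obtain g where g: "g \<in> mor B A" "G = pt B A \<one>\<^bsub>S\<^esub> g" using rep1[OF B A FG(2)] by blast
    have gf: "Comp C A B A g f \<in> mor A A" "Comp C B A B f g \<in> mor B B"
      using A B f g by (simp_all add: Comp_closed)
    have eq: "pt A A (\<one>\<^bsub>S\<^esub> \<otimes>\<^bsub>S\<^esub> \<one>\<^bsub>S\<^esub>) (Comp C A B A g f) = pt A A \<one>\<^bsub>S\<^esub> (Ident C A)"
      "pt B B (\<one>\<^bsub>S\<^esub> \<otimes>\<^bsub>S\<^esub> \<one>\<^bsub>S\<^esub>) (Comp C B A B f g) = pt B B \<one>\<^bsub>S\<^esub> (Ident C B)"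
      using FG(3,4) by (simp_all only: f(2) g(2) D_Ident pt_Comp[OF A B A one_S g(1) one_S f(1)]
          pt_Comp[OF B A B one_S f(1) one_S g(1)])
    obtain s v where v: "s \<in> carrier R - P" "v \<in> mor A A"
      "Comp C A A A v (Comp C A B A g f) = s \<odot>\<^bsub>Hom C A A\<^esub> Ident C A" using units[OF A gf(1) eq(1)] by blast
    obtain t w where w: "t \<in> carrier R - P" "w \<in> mor B B"
      "Comp C B B B (Comp C B A B f g) w = t \<odot>\<^bsub>Hom C B B\<^esub> Ident C B" using units[OF B gf(2) eq(2)] by blast
    have R: "s \<in> carrier R" "t \<in> carrier R" using v w by auto
    note [simp] = A B f(1) g(1) v(2) w(2) R Comp_closed Ident_closed mor_smult
    \<comment> \<open>\<open>?l\<close> and \<open>?r\<close> invert \<open>f\<close> on the left up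
      to \<open>s\<close> and on the right up to \<open>t\<close>. The usual comparison of one-sided
      inverses gives \<open>t ?l = s ?r\<close>, a two-sided inverse up to
      \<open>t s\<close>.\<close>
    let ?l = "Comp C B A A v g" and ?r = "Comp C B B A g w"
    have lf: "Comp C A B A ?l f = s \<odot>\<^bsub>Hom C A A\<^esub> Ident C A" using v(3) by (simp add: Comp_assoc_right)
    have fr: "Comp C B A B f ?r = t \<odot>\<^bsub>Hom C B B\<^esub> Ident C B" using w(3) by (simp add: Comp_assoc_right)
    have "s \<odot>\<^bsub>Hom C B A\<^esub> ?r = Comp C B A A (Comp C A B A ?l f) ?r"
      unfolding lf by (simp add: Comp_smult_left Ident_left)
    also have "\<dots> = Comp C B B A ?l (Comp C B A B f ?r)" by (rule Comp_assoc_right) simp_all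
    also have "\<dots> = t \<odot>\<^bsub>Hom C B A\<^esub> ?l" unfolding fr by (simp add: Comp_smult_right Ident_right)
    finally have lr: "t \<odot>\<^bsub>Hom C B A\<^esub> ?l = s \<odot>\<^bsub>Hom C B A\<^esub> ?r" by simp
    interpret MA: module R "Hom C A A" by (rule Hom_module[OF A A])
    interpret MB: module R "Hom C B B" by (rule Hom_module[OF B B])
    have "Comp C A B A (t \<odot>\<^bsub>Hom C B A\<^esub> ?l) f = (t \<otimes> s) \<odot>\<^bsub>Hom C A A\<^esub> Ident C A"
      using lf by (simp add: Comp_smult_left MA.smult_assoc1)
    moreover have "Comp C B A B f (t \<odot>\<^bsub>Hom C B A\<^esub> ?l) = (t \<otimes> s) \<odot>\<^bsub>Hom C B B\<^esub> Ident C B"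
      unfolding lr using fr by (simp add: Comp_smult_right R.m_comm[of t s] MB.smult_assoc1)
    moreover have "t \<otimes> s \<in> carrier R - P"
      using v(1) w(1) primeideal.I_prime[OF primeideal] by blast
    moreover have "t \<odot>\<^bsub>Hom C B A\<^esub> ?l \<in> mor B A" by simp
    ultimately show "loc_iso R C P A B" unfolding loc_iso_def using f(1) by blast
  next
    assume "loc_iso R C P A B"
    then obtain f g s where fg: "f \<in> mor A B" "g \<in> mor B A" and s: "s \<in> carrier R" "s \<notin> P"
      and e: "Comp C A B A g f = s \<odot>\<^bsub>Hom C A A\<^esub> Ident C A" "Comp C B A B f g = s \<odot>\<^bsub>Hom C B B\<^esub> Ident C B"
      unfolding loc_iso_def by blast
    \<comment> \<open>\<open>s\<close> is a unit modulo \<open>P\<close>, and its inverse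
      \<open>t\<close> takes the place of the denominator.\<close>
    obtain t where t: "t \<in> carrier R" "t \<otimes> s \<ominus> \<one> \<in> P" using inverse_mod[OF s] by blast
    have i: "rep t \<in> carrier S" "rep t \<otimes>\<^bsub>S\<^esub> s = \<one>\<^bsub>S\<^esub>"
      using t s by (auto simp: rep_in_S S_sel(2,3) rep_mult_left intro!: rep_cong)
    have "Comp D A B A (pt B A (rep t) g) (pt A B \<one>\<^bsub>S\<^esub> f) = Ident D A"
      using A B fg i one_S pt_smult[OF A A i(1) s(1) Ident_closed[OF A]] by (simp add: pt_Comp e D_Ident)
    moreover have "Comp D B A B (pt A B \<one>\<^bsub>S\<^esub> f) (pt B A (rep t) g) = Ident D B"
      using A B fg i one_S pt_smult[OF B B i(1) s(1) Ident_closed[OF B]] by (simp add: pt_Comp e D_Ident)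
    ultimately show "isomorphic D A B"
      unfolding isomorphic_def inverse_pair_def
      using pt_closed[OF A B one_S fg(1)] pt_closed[OF B A i(1) fg(2)] by blast
  qed
qed

end

section \<open>Genera and multiplicities\<close>

text \<open>This makes rational isomorphism the case \<open>P = 0\<close> of the criterion for
  localizations.\<close>

lemma localization_zero:
  assumes frac: "fraction_field R K"
  shows "localization R K {\<zero>\<^bsub>R\<^esub>} = K"
proof -
  interpret K: field K using frac unfolding fraction_field_def by blast
  have sub: "subring (carrier R) K" and R: "R = K\<lparr>carrier := carrier R\<rparr>"
    using frac unfolding fraction_field_def by blast+
  have z: "\<zero>\<^bsub>R\<^esub> = \<zero>\<^bsub>K\<^esub>" by (subst R) simp
  have "{a \<otimes>\<^bsub>K\<^esub> inv\<^bsub>K\<^esub> b | a b. a \<in> carrier R \<and> b \<in> carrier R - {\<zero>\<^bsub>R\<^esub>}} = carrier K"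
  proof
    show "{a \<otimes>\<^bsub>K\<^esub> inv\<^bsub>K\<^esub> b | a b. a \<in> carrier R \<and> b \<in> carrier R - {\<zero>\<^bsub>R\<^esub>}} \<subseteq> carrier K"
      using subringE(1)[OF sub] K.field_Units z by (auto intro!: K.m_closed K.Units_inv_closed)
    show "carrier K \<subseteq> {a \<otimes>\<^bsub>K\<^esub> inv\<^bsub>K\<^esub> b | a b. a \<in> carrier R \<and> b \<in> carrier R - {\<zero>\<^bsub>R\<^esub>}}"
      using frac unfolding fraction_field_def by blast
  qed
  then show ?thesis unfolding localization_def by simp
qed

locale genus_setup = R_category R C for R :: "'k ring" and C :: "('k, 'o, 'm) rcat" +
  fixes K :: "'k ring"
  assumes frac: "fraction_field R K" and dedekind: "dedekind_domain R K"
    and finite_hom: "hom_finite R C" and additive: "additive C"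
    and indecomposables_lift: "indecomposable (add_ext R K C) W \<Longrightarrow>
      \<exists>S\<in>Ob C. isomorphic (add_ext R K C) (ext_ob R K C S) W"
begin

lemma noetherian: "noetherian_domain R"
  and prime_maximal: "primeideal P R \<Longrightarrow> P \<noteq> {\<zero>\<^bsub>R\<^esub>} \<Longrightarrow> maximalideal P R"
  using dedekind unfolding dedekind_domain_def by blast+

sublocale R: noetherian_domain R by (rule noetherian)

abbreviation "maxspec \<equiv> {P. maximalideal P R}"

text \<open>The value is a formal sum of objects of the residue category. As residue fields are
  carried by representatives, its type is the same for all \<open>P\<close>.\<close>

definition mu :: "'k set \<Rightarrow> 'o \<Rightarrow> 'o list \<times> ('k \<times> 'm \<Rightarrow>\<^sub>0 int) set matrix \<Rightarrow>\<^sub>0 int" where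
  "mu P A = multiplicities (add_ext R (residue_field R P) C) (ext_ob R (residue_field R P) C A)"

definition mu_Q :: "'o \<Rightarrow> 'o list \<times> ('k \<times> 'm \<Rightarrow>\<^sub>0 int) set matrix \<Rightarrow>\<^sub>0 int" where
  "mu_Q A = multiplicities (add_ext R K C) (ext_ob R K C A)"

lemma residue: "P \<in> maxspec \<Longrightarrow> residue_setup R P"
  by (intro residue_setup.intro R.is_cring) simp

lemma localization: "primeideal P R \<Longrightarrow> localization_setup R K P"
  by (intro localization_setup.intro frac)

lemma zero_prime: "primeideal {\<zero>\<^bsub>R\<^esub>} R"
  by (rule R.zeroprimeideal)

lemma K_field: "field K" using frac unfolding fraction_field_def by blast

lemma change_K: "category_base_change R K C"
  using localization_setup.scalar_change[OF localization[OF zero_prime]]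
  unfolding localization_zero[OF frac] by (intro category_base_change.intro R_category_axioms)

lemma change_residue: "P \<in> maxspec \<Longrightarrow> category_base_change R (residue_field R P) C"
  by (intro category_base_change.intro R_category_axioms residue_setup.scalar_change residue)

lemma krull_schmidt_K: "krull_schmidt K (add_ext R K C)"
  by (rule category_base_change.ext_krull_schmidt[OF change_K K_field finite_hom])

lemma krull_schmidt_residue: "P \<in> maxspec \<Longrightarrow> krull_schmidt (residue_field R P) (add_ext R (residue_field R P) C)"
  by (intro category_base_change.ext_krull_schmidt change_residue residue_setup.S_field residue finite_hom)

lemma mu_add: "P \<in> maxspec \<Longrightarrow> direct_sum C T A B \<Longrightarrow> mu P T = mu P A + mu P B"
  unfolding mu_def
  by (intro krull_schmidt.multiplicities_direct_sum[OF krull_schmidt_residue]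
      category_base_change.ext_direct_sum change_residue)

lemma mu_Q_add: "direct_sum C T A B \<Longrightarrow> mu_Q T = mu_Q A + mu_Q B"
  unfolding mu_Q_def
  by (intro krull_schmidt.multiplicities_direct_sum[OF krull_schmidt_K]
      category_base_change.ext_direct_sum change_K)

lemma mu_eq_iff:
  assumes "P \<in> maxspec" "A \<in> Ob C" "B \<in> Ob C"
  shows "mu P A = mu P B \<longleftrightarrow> loc_iso R C P A B"
  unfolding mu_def
  using krull_schmidt.multiplicities_eq_iff[OF krull_schmidt_residue]
    category_base_change.ext_Ob[OF change_residue]
    residue_setup.isomorphic_iff_loc_iso[OF residue R_category_axioms finite_hom] assms by simp

lemma mu_Q_eq_iff:
  assumes "A \<in> Ob C" "B \<in> Ob C"
  shows "mu_Q A = mu_Q B \<longleftrightarrow> loc_iso R C {\<zero>\<^bsub>R\<^esub>} A B"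
  unfolding mu_Q_def
  using krull_schmidt.multiplicities_eq_iff[OF krull_schmidt_K] category_base_change.ext_Ob[OF change_K]
    localization_setup.isomorphic_iff_loc_iso[OF localization[OF zero_prime] R_category_axioms] assms
  unfolding localization_zero[OF frac] by simp

text \<open>A rational isomorphism with cleared denominators is an isomorphism at every
  \<open>P\<close> that avoids its scalar \<open>s\<close>, and a nonzero \<open>s\<close> lies in
  only finitely many maximal ideals.\<close>

lemma almost_all_equal:
  assumes "A \<in> Ob C" "B \<in> Ob C" "mu_Q A = mu_Q B"
  shows "finite {P \<in> maxspec. mu P A \<noteq> mu P B}"
proof -
  obtain f g s where fgs: "f \<in> mor A B" "g \<in> mor B A" "s \<in> carrier R" "s \<noteq> \<zero>\<^bsub>R\<^esub>"
    "Comp C A B A g f = s \<odot>\<^bsub>Hom C A A\<^esub> Ident C A" "Comp C B A B f g = s \<odot>\<^bsub>Hom C B B\<^esub> Ident C B"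
    using assms mu_Q_eq_iff unfolding loc_iso_def by blast
  have "mu P A = mu P B" if "P \<in> maxspec" "s \<notin> P" for P
    using mu_eq_iff[OF that(1) assms(1,2)] fgs that(2) unfolding loc_iso_def by blast
  then have "{P \<in> maxspec. mu P A \<noteq> mu P B} \<subseteq> {P. maximalideal P R \<and> s \<in> P}" by blast
  then show ?thesis
    using finite_maximalideals_containing[OF noetherian prime_maximal fgs(3,4)] finite_subset by blast
qed

text \<open>Genera are defined by localizations and \<open>mu\<close> by residue fields; both are
  translated into \<open>loc_iso\<close>.\<close>

lemma genus_iff:
  assumes "A \<in> Ob C"
  shows "B \<in> genus R K C A \<longleftrightarrow> B \<in> Ob C \<and> (\<forall>P\<in>maxspec. mu P B = mu P A)"
proof (cases "B \<in> Ob C")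
  case True
  have "isomorphic (add_ext R (localization R K P) C)
      (ext_ob R (localization R K P) C B) (ext_ob R (localization R K P) C A) \<longleftrightarrow> mu P B = mu P A"
    if P: "P \<in> maxspec" for P
    using localization_setup.isomorphic_iff_loc_iso[OF localization R_category_axioms True assms]
      R.maximalideal_prime P mu_eq_iff[OF P True assms] by simp
  then show ?thesis using True unfolding genus_def by simp
qed (simp add: genus_def)

lemma genus_eq_iff:
  assumes "A \<in> Ob C" "B \<in> Ob C"
  shows "genus R K C A = genus R K C B \<longleftrightarrow> (\<forall>P\<in>maxspec. mu P A = mu P B)"
proof
  assume "genus R K C A = genus R K C B"
  moreover have "A \<in> genus R K C A" using genus_iff assms by simp
  ultimately show "\<forall>P\<in>maxspec. mu P A = mu P B" using genus_iff[OF assms(2)] by blast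
next
  assume "\<forall>P\<in>maxspec. mu P A = mu P B"
  then show "genus R K C A = genus R K C B" using genus_iff[OF assms(1)] genus_iff[OF assms(2)] by auto
qed

text \<open>A scalar outside some maximal ideal is nonzero, so a local isomorphism at a single
  \<open>P\<close> is already a rational one. Some maximal ideal exists, the zero ideal if
  \<open>R\<close> is a field.\<close>

lemma genus_mu_Q:
  assumes "A \<in> Ob C" "B \<in> Ob C" "genus R K C A = genus R K C B"
  shows "mu_Q A = mu_Q B"
proof -
  obtain P where P: "P \<in> maxspec" using R.maximalideal_exists by auto
  then have "loc_iso R C P A B" using assms genus_eq_iff mu_eq_iff by blast
  moreover have "\<zero>\<^bsub>R\<^esub> \<in> P" using R.ideal_zero_mem maximalideal.axioms(1) P by blast
  ultimately have "loc_iso R C {\<zero>\<^bsub>R\<^esub>} A B" unfolding loc_iso_def by blast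
  then show ?thesis using mu_Q_eq_iff assms by blast
qed

section \<open>Rational models and a finitely supported invariant\<close>

lemma zero_sum:
  assumes "zero_object C Z"
  shows "direct_sum C Z Z Z"
proof -
  have "Z \<in> Ob C" "Ident C Z = \<zero>\<^bsub>Hom C Z Z\<^esub>" using assms unfolding zero_object_def by auto
  then have "biproduct C Z Z Z \<zero>\<^bsub>Hom C Z Z\<^esub> \<zero>\<^bsub>Hom C Z Z\<^esub> \<zero>\<^bsub>Hom C Z Z\<^esub> \<zero>\<^bsub>Hom C Z Z\<^esub>"
    unfolding biproduct_def by (simp add: Comp_simps)
  then show ?thesis unfolding direct_sum_iff_biproduct by blast
qed

text \<open>The object is chosen before the additive function: the same \<open>B\<close> must serve
  for \<open>mu_Q\<close> and for every \<open>mu P\<close>.\<close>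

lemma sum_object:
  assumes "set Ls \<subseteq> Ob C"
  shows "\<exists>B\<in>Ob C. \<forall>\<nu> :: 'o \<Rightarrow> 'x \<Rightarrow>\<^sub>0 int.
    (\<forall>T A B. direct_sum C T A B \<longrightarrow> \<nu> T = \<nu> A + \<nu> B) \<longrightarrow> \<nu> B = (\<Sum>L\<leftarrow>Ls. \<nu> L)"
  using assms
proof (induction Ls)
  case Nil
  obtain Z where Z: "zero_object C Z" using additive unfolding additive_def by blast
  show ?case
  proof (intro bexI[of _ Z] allI impI)
    fix \<nu> :: "'o \<Rightarrow> 'x \<Rightarrow>\<^sub>0 int" assume "\<forall>T A B. direct_sum C T A B \<longrightarrow> \<nu> T = \<nu> A + \<nu> B"
    then have "\<nu> Z = \<nu> Z + \<nu> Z" using zero_sum[OF Z] by blast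
    then show "\<nu> Z = (\<Sum>L\<leftarrow>[]. \<nu> L)" by simp
  qed (use Z in \<open>simp add: zero_object_def\<close>)
next
  case (Cons L Ls)
  then obtain B where B: "B \<in> Ob C" "\<forall>\<nu> :: 'o \<Rightarrow> 'x \<Rightarrow>\<^sub>0 int.
    (\<forall>T A B. direct_sum C T A B \<longrightarrow> \<nu> T = \<nu> A + \<nu> B) \<longrightarrow> \<nu> B = (\<Sum>L\<leftarrow>Ls. \<nu> L)" by auto
  obtain T where T: "direct_sum C T L B" using additive Cons.prems B(1) unfolding additive_def
    by (metis list.set_intros(1) subsetD)
  show ?case
  proof (intro bexI[of _ T] allI impI)
    fix \<nu> :: "'o \<Rightarrow> 'x \<Rightarrow>\<^sub>0 int" assume \<nu>: "\<forall>T A B. direct_sum C T A B \<longrightarrow> \<nu> T = \<nu> A + \<nu> B"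
    then have "\<nu> T = \<nu> L + \<nu> B" using T by blast
    then show "\<nu> T = (\<Sum>L\<leftarrow>L # Ls. \<nu> L)" using B(2) \<nu> by simp
  qed (use direct_sum_Ob[OF T] in blast)
qed

text \<open>Arbitrary unless \<open>V\<close> represents an indecomposable of the rational category.\<close>

definition lift :: "'o list \<times> ('k \<times> 'm \<Rightarrow>\<^sub>0 int) set matrix \<Rightarrow> 'o" where
  "lift V = (SOME S. S \<in> Ob C \<and> mu_Q S = frag_of V)"

text \<open>Away from finitely many \<open>P\<close>, every object is locally isomorphic to the direct sum of lifts
  of its rational constituents; subtracting that sum makes the local multiplicities finitely
  supported in \<open>P\<close>.\<close>

lemma rational_model:
  assumes A: "A \<in> Ob C"
  shows "\<exists>B\<in>Ob C. mu_Q B = mu_Q A \<and> (\<forall>P\<in>maxspec. mu P B = frag_extend (\<lambda>V. mu P (lift V)) (mu_Q A))"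
proof -
  interpret Q: krull_schmidt K "add_ext R K C" by (rule krull_schmidt_K)
  have QA: "ext_ob R K C A \<in> Ob (add_ext R K C)" by (rule category_base_change.ext_Ob[OF change_K A])
  obtain Ws where Ws: "summands (add_ext R K C) (ext_ob R K C A) Ws"
    "\<forall>W\<in>set Ws. indecomposable (add_ext R K C) W" using Q.summands_exist[OF QA] by blast
  let ?V = "iso_rep (add_ext R K C)"
  \<comment> \<open>The object picked by \<open>lift\<close> may differ from the lift
    \<open>S\<close> at hand; its rational multiplicity is all that matters. Choosing it by the
    representative \<open>?V W\<close> makes it the same for isomorphic constituents, so that the
    model is linear in \<open>mu_Q A\<close>.\<close>
  have lift: "lift (?V W) \<in> Ob C \<and> mu_Q (lift (?V W)) = frag_of (?V W)" if W: "W \<in> set Ws" for W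
  proof -
    have ind: "indecomposable (add_ext R K C) W" using Ws(2) W by blast
    obtain S where S: "S \<in> Ob C" "isomorphic (add_ext R K C) (ext_ob R K C S) W"
      using indecomposables_lift[OF ind] by blast
    have "mu_Q S = multiplicities (add_ext R K C) W"
      using Q.multiplicities_eq_iff[OF category_base_change.ext_Ob[OF change_K S(1)], of W] S(2) ind
      unfolding mu_Q_def indecomposable_def by blast
    then have "S \<in> Ob C \<and> mu_Q S = frag_of (?V W)"
      using S(1) Q.multiplicities_indecomposable[OF ind] by simp
    then show ?thesis unfolding lift_def by (rule someI)
  qed
  let ?Ls = "map (\<lambda>W. lift (?V W)) Ws"
  have "set ?Ls \<subseteq> Ob C" using lift by auto
  from sum_object[OF this] obtain B where B: "B \<in> Ob C"
    "\<And>\<nu> :: 'o \<Rightarrow> 'o list \<times> ('k \<times> 'm \<Rightarrow>\<^sub>0 int) set matrix \<Rightarrow>\<^sub>0 int.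
      \<forall>T A B. direct_sum C T A B \<longrightarrow> \<nu> T = \<nu> A + \<nu> B \<Longrightarrow> \<nu> B = (\<Sum>L\<leftarrow>?Ls. \<nu> L)" by blast
  have muA: "mu_Q A = (\<Sum>W\<leftarrow>Ws. frag_of (?V W))"
    unfolding mu_Q_def by (rule Q.multiplicities_eq[OF Ws])
  have "mu_Q B = (\<Sum>W\<leftarrow>Ws. mu_Q (lift (?V W)))"
    using B(2)[of mu_Q] mu_Q_add by (simp add: comp_def)
  also have "\<dots> = mu_Q A" unfolding muA using lift by (intro arg_cong[of _ _ sum_list] map_cong) auto
  finally have 1: "mu_Q B = mu_Q A" .
  have 2: "mu P B = frag_extend (\<lambda>V. mu P (lift V)) (mu_Q A)" if P: "P \<in> maxspec" for P
  proof -
    have "mu P B = (\<Sum>W\<leftarrow>Ws. mu P (lift (?V W)))"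
      using B(2)[of "mu P"] mu_add[OF P] by (simp add: comp_def)
    also have "\<dots> = frag_extend (\<lambda>V. mu P (lift V)) (mu_Q A)"
      unfolding muA by (induction Ws) (simp_all add: frag_extend_add)
    finally show ?thesis .
  qed
  show ?thesis using B(1) 1 2 by blast
qed

text \<open>Both terms are additive in \<open>A\<close>, hence so is the difference; it vanishes
  wherever \<open>A\<close> has the local multiplicities of its rational model.\<close>

definition local_part :: "'k set \<Rightarrow> 'o \<Rightarrow> 'o list \<times> ('k \<times> 'm \<Rightarrow>\<^sub>0 int) set matrix \<Rightarrow>\<^sub>0 int" where
  "local_part P A = mu P A - frag_extend (\<lambda>V. mu P (lift V)) (mu_Q A)"

text \<open>The index \<open>None\<close> keeps the rational multiplicities, from which the
  subtracted term can be recomputed; so no \<open>mu P\<close> is lost. The use of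
  \<open>Abs_poly_mapping\<close> is justified by the finiteness in
  \<open>lookup_invariant\<close>.\<close>

definition invariant :: "'o \<Rightarrow> 'k set option \<times> 'o list \<times> ('k \<times> 'm \<Rightarrow>\<^sub>0 int) set matrix \<Rightarrow>\<^sub>0 int" where
  "invariant A = Abs_poly_mapping (\<lambda>(x, V). case x of None \<Rightarrow> poly_mapping.lookup (mu_Q A) V
     | Some P \<Rightarrow> if P \<in> maxspec then poly_mapping.lookup (local_part P A) V else 0)"

text \<open>Finite support: the local part is zero at \<open>P\<close> unless \<open>A\<close> and
  its rational model \<open>B\<close> differ there, and \<open>almost_all_equal\<close> bounds these
  \<open>P\<close>.\<close>

lemma lookup_invariant:
  assumes A: "A \<in> Ob C"
  shows "poly_mapping.lookup (invariant A) (None, V) = poly_mapping.lookup (mu_Q A) V"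
    and "poly_mapping.lookup (invariant A) (Some P, V) =
      (if P \<in> maxspec then poly_mapping.lookup (local_part P A) V else 0)"
proof -
  let ?f = "\<lambda>(x, V). case x of None \<Rightarrow> poly_mapping.lookup (mu_Q A) V
     | Some P \<Rightarrow> if P \<in> maxspec then poly_mapping.lookup (local_part P A) V else 0"
  obtain B where B: "B \<in> Ob C" "mu_Q B = mu_Q A"
    "\<forall>P\<in>maxspec. mu P B = frag_extend (\<lambda>V. mu P (lift V)) (mu_Q A)" using rational_model[OF A] by blast
  let ?N = "{P \<in> maxspec. mu P A \<noteq> mu P B}"
  have "finite ?N" using almost_all_equal[OF A B(1)] B(2) by simp
  then have fin: "finite ({None} \<times> Poly_Mapping.keys (mu_Q A) \<union> (\<Union>P\<in>?N. {Some P} \<times> Poly_Mapping.keys (local_part P A)))"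
    by auto
  have "{z. ?f z \<noteq> 0} \<subseteq> {None} \<times> Poly_Mapping.keys (mu_Q A) \<union> (\<Union>P\<in>?N. {Some P} \<times> Poly_Mapping.keys (local_part P A))"
  proof
    fix z assume z: "z \<in> {z. ?f z \<noteq> 0}"
    obtain x V where xV: "z = (x, V)" by (cases z)
    show "z \<in> {None} \<times> Poly_Mapping.keys (mu_Q A) \<union> (\<Union>P\<in>?N. {Some P} \<times> Poly_Mapping.keys (local_part P A))"
    proof (cases x)
      case None
      then show ?thesis using z xV by (simp add: in_keys_iff)
    next
      case (Some P)
      then have P: "P \<in> maxspec" "poly_mapping.lookup (local_part P A) V \<noteq> 0"
        using z xV by (auto split: if_splits)
      then have "mu P A \<noteq> mu P B" using B(3) unfolding local_part_def by auto
      then show ?thesis using P xV Some by (auto simp: in_keys_iff)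
    qed
  qed
  then have "finite {z. ?f z \<noteq> 0}" using fin by (rule finite_subset)
  then have "poly_mapping.lookup (invariant A) = ?f" unfolding invariant_def by (rule lookup_Abs_poly_mapping)
  then show "poly_mapping.lookup (invariant A) (None, V) = poly_mapping.lookup (mu_Q A) V"
    "poly_mapping.lookup (invariant A) (Some P, V) =
      (if P \<in> maxspec then poly_mapping.lookup (local_part P A) V else 0)" by simp_all
qed

lemma invariant_add:
  assumes "direct_sum C T A B"
  shows "invariant T = invariant A + invariant B"
proof (rule poly_mapping_eqI)
  fix z :: "'k set option \<times> 'o list \<times> ('k \<times> 'm \<Rightarrow>\<^sub>0 int) set matrix"
  obtain x V where z: "z = (x, V)" by (cases z)
  have O: "T \<in> Ob C" "A \<in> Ob C" "B \<in> Ob C" using direct_sum_Ob[OF assms] by auto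
  show "poly_mapping.lookup (invariant T) z = poly_mapping.lookup (invariant A + invariant B) z"
    by (cases x) (auto simp: z lookup_add lookup_invariant O mu_Q_add[OF assms] local_part_def
      mu_add[OF _ assms] frag_extend_add lookup_minus)
qed

text \<open>Equal rational multiplicities give equal corrections, so equality of local parts and
  equality of local multiplicities are the same; conversely a genus determines its rational
  multiplicities.\<close>

lemma invariant_eq_iff:
  assumes A: "A \<in> Ob C" and B: "B \<in> Ob C"
  shows "invariant A = invariant B \<longleftrightarrow> genus R K C A = genus R K C B"
proof
  assume eq: "invariant A = invariant B"
  have Q: "mu_Q A = mu_Q B"
    by (rule poly_mapping_eqI) (use lookup_invariant(1)[OF A] lookup_invariant(1)[OF B] eq in simp)
  have "local_part P A = local_part P B" if "P \<in> maxspec" for P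
    by (rule poly_mapping_eqI)
      (use lookup_invariant(2)[OF A, of P] lookup_invariant(2)[OF B, of P] eq that in simp)
  then have "mu P A = mu P B" if "P \<in> maxspec" for P using Q that unfolding local_part_def by fastforce
  then show "genus R K C A = genus R K C B" using genus_eq_iff[OF A B] by blast
next
  assume eq: "genus R K C A = genus R K C B"
  then have "mu_Q A = mu_Q B" "\<forall>P\<in>maxspec. local_part P A = local_part P B"
    using genus_mu_Q[OF A B] genus_eq_iff[OF A B] unfolding local_part_def by auto
  then show "invariant A = invariant B"
    unfolding invariant_def by (intro arg_cong[of _ _ Abs_poly_mapping] ext) (auto split: option.split)
qed

section \<open>The Grothendieck group of genera\<close>

abbreviation "G \<equiv> genus R K C"
abbreviation "FG \<equiv> free_Abelian_group (G ` Ob C)"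

lemma K0G_rels_diff: "x \<in> K0G_rels R K C \<Longrightarrow> y \<in> K0G_rels R K C \<Longrightarrow> x - y \<in> K0G_rels R K C"
proof -
  interpret N: subgroup "K0G_rels R K C" FG by (rule normal_imp_subgroup[OF K0G_rels_normal])
  assume x: "x \<in> K0G_rels R K C" and y: "y \<in> K0G_rels R K C"
  have "Poly_Mapping.keys y \<subseteq> G ` Ob C" using N.mem_carrier[OF y] by simp
  then show ?thesis using N.m_closed[OF x N.m_inv_closed[OF y]] by simp
qed

lemma K0G_rels_zero: "0 \<in> K0G_rels R K C"
  using subgroup.one_closed[OF normal_imp_subgroup[OF K0G_rels_normal, of R K C]] by simp

lemma K0G_rels_sum: "direct_sum C T A B \<Longrightarrow> frag_of (G T) - frag_of (G A) - frag_of (G B) \<in> K0G_rels R K C"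
  unfolding K0G_rels_def by (intro generate.incl) blast

text \<open>Direct sums exist in \<open>C\<close>, so formal combinations can be collected into one
  positive and one negative object. Injectivity on the group is thereby reduced to a statement about
  two objects.\<close>

lemma K0G_difference:
  assumes "Poly_Mapping.keys c \<subseteq> G ` Ob C"
  shows "\<exists>A\<in>Ob C. \<exists>B\<in>Ob C. c - (frag_of (G A) - frag_of (G B)) \<in> K0G_rels R K C"
proof -
  obtain Z where Z: "zero_object C Z" using additive unfolding additive_def by blast
  have ZO: "Z \<in> Ob C" using Z unfolding zero_object_def by blast
  \<comment> \<open>The relation for \<open>Z\<close> as a sum of \<open>Z\<close> and
    \<open>Z\<close> is minus the class of its genus.\<close>
  have gZ: "frag_of (G Z) \<in> K0G_rels R K C"
    using K0G_rels_diff[OF K0G_rels_zero K0G_rels_sum[OF zero_sum[OF Z]]] by simp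
  show ?thesis
  proof (rule free_Abelian_group_induct[OF assms])
    show "\<exists>A\<in>Ob C. \<exists>B\<in>Ob C. 0 - (frag_of (G A) - frag_of (G B)) \<in> K0G_rels R K C"
      using ZO K0G_rels_zero by (intro bexI[of _ Z]) auto
  next
    fix x y
    assume "\<exists>A\<in>Ob C. \<exists>B\<in>Ob C. x - (frag_of (G A) - frag_of (G B)) \<in> K0G_rels R K C"
      and "\<exists>A\<in>Ob C. \<exists>B\<in>Ob C. y - (frag_of (G A) - frag_of (G B)) \<in> K0G_rels R K C"
    then obtain A B A' B' where O: "A \<in> Ob C" "B \<in> Ob C" "A' \<in> Ob C" "B' \<in> Ob C"
      and x: "x - (frag_of (G A) - frag_of (G B)) \<in> K0G_rels R K C"
      and y: "y - (frag_of (G A') - frag_of (G B')) \<in> K0G_rels R K C" by blast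
    \<comment> \<open>\<open>(A - B) - (A' - B')\<close> is regrouped as
      \<open>(A + B') - (B + A')\<close>.\<close>
    obtain T U where T: "direct_sum C T A B'" and U: "direct_sum C U B A'"
      using additive O unfolding additive_def by blast
    have "x - y - (frag_of (G T) - frag_of (G U))
      = (x - (frag_of (G A) - frag_of (G B))) - (y - (frag_of (G A') - frag_of (G B')))
        - ((frag_of (G T) - frag_of (G A) - frag_of (G B')) - (frag_of (G U) - frag_of (G B) - frag_of (G A')))"
      by (simp add: algebra_simps)
    also have "\<dots> \<in> K0G_rels R K C" by (intro K0G_rels_diff x y K0G_rels_sum T U)
    finally show "\<exists>A\<in>Ob C. \<exists>B\<in>Ob C. x - y - (frag_of (G A) - frag_of (G B)) \<in> K0G_rels R K C"
      using direct_sum_Ob[OF T] direct_sum_Ob[OF U] by blast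
  next
    fix a assume "a \<in> G ` Ob C"
    then obtain A where "A \<in> Ob C" "a = G A" by blast
    then show "\<exists>A\<in>Ob C. \<exists>B\<in>Ob C. frag_of a - (frag_of (G A) - frag_of (G B)) \<in> K0G_rels R K C"
      using ZO gZ by (intro bexI[of _ A] bexI[of _ Z]) simp_all
  qed
qed

text \<open>Any object of the genus may be chosen, as \<open>invariant\<close> is constant on a
  genus.\<close>

definition genus_invariant where
  "genus_invariant = frag_extend (\<lambda>\<Gamma>. invariant (SOME A. A \<in> Ob C \<and> G A = \<Gamma>))"

lemma genus_invariant_of: "A \<in> Ob C \<Longrightarrow> genus_invariant (frag_of (G A)) = invariant A"
proof -
  assume A: "A \<in> Ob C"
  have "(SOME B. B \<in> Ob C \<and> G B = G A) \<in> Ob C \<and> G (SOME B. B \<in> Ob C \<and> G B = G A) = G A"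
    by (rule someI[of _ A]) (use A in simp)
  then show ?thesis using A invariant_eq_iff unfolding genus_invariant_def by simp
qed

lemma genus_invariant_diff: "genus_invariant (x - y) = genus_invariant x - genus_invariant y"
  and genus_invariant_add: "genus_invariant (x + y) = genus_invariant x + genus_invariant y"
  and genus_invariant_minus: "genus_invariant (- x) = - genus_invariant x"
  and genus_invariant_zero: "genus_invariant 0 = 0"
  unfolding genus_invariant_def by (simp_all add: frag_extend_diff frag_extend_add frag_extend_minus)

lemma genus_invariant_relator:
  assumes "direct_sum C T A B"
  shows "genus_invariant (frag_of (G T) - frag_of (G A) - frag_of (G B)) = 0"
  using direct_sum_Ob[OF assms] by (simp add: genus_invariant_diff genus_invariant_of invariant_add[OF assms])

lemma genus_invariant_rels:
  assumes "c \<in> K0G_rels R K C"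
  shows "genus_invariant c = 0"
  using assms unfolding K0G_rels_def
proof (induction rule: generate.induct)
  case one
  then show ?case by (simp add: genus_invariant_zero)
next
  case (incl c)
  then show ?case using genus_invariant_relator by blast
next
  case (inv c)
  then obtain T A B where c: "c = frag_of (G T) - frag_of (G A) - frag_of (G B)" "direct_sum C T A B" by blast
  have "c \<in> carrier FG"
    unfolding c(1) by (rule frag_relator_closed) (use direct_sum_Ob[OF c(2)] in auto)
  then have "inv\<^bsub>FG\<^esub> c = - c" by simp
  moreover have "genus_invariant c = 0" unfolding c(1) by (rule genus_invariant_relator[OF c(2)])
  ultimately show ?case by (simp only: genus_invariant_minus neg_equal_0_iff_equal)
next
  case (eng c d)
  then show ?case by (simp add: genus_invariant_add)
qed

text \<open>For a difference of two objects, a vanishing invariant means equal invariants and hence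
  equal genera, not merely equality after adding a common summand; so the difference of their
  generators is literally \<open>0\<close>.\<close>

lemma genus_invariant_kernel:
  assumes c: "Poly_Mapping.keys c \<subseteq> G ` Ob C" and z: "genus_invariant c = 0"
  shows "c \<in> K0G_rels R K C"
proof -
  obtain A B where AB: "A \<in> Ob C" "B \<in> Ob C" and d: "c - (frag_of (G A) - frag_of (G B)) \<in> K0G_rels R K C"
    using K0G_difference[OF c] by blast
  have "invariant A = invariant B"
    using genus_invariant_rels[OF d] z AB by (simp add: genus_invariant_diff genus_invariant_of)
  then show ?thesis using d invariant_eq_iff AB by simp
qed

lemma genus_hom_surj: "genus_hom R K C ` carrier (K0 C) = carrier (K0G R K C)"
proof
  show "genus_hom R K C ` carrier (K0 C) \<subseteq> carrier (K0G R K C)"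
    using genus_hom_hom[of R K C] unfolding hom_def by auto
  show "carrier (K0G R K C) \<subseteq> genus_hom R K C ` carrier (K0 C)"
  proof
    fix V assume "V \<in> carrier (K0G R K C)"
    then obtain c where c: "Poly_Mapping.keys c \<subseteq> G ` Ob C" "V = K0G_rels R K C #>\<^bsub>FG\<^esub> c"
      by (auto simp: K0G_def FactGroup_def RCOSETS_def)
    have "\<exists>d. Poly_Mapping.keys d \<subseteq> Ob C \<and> frag_extend (frag_of \<circ> G) d = c"
    proof (rule free_Abelian_group_induct[OF c(1)])
      show "\<exists>d. Poly_Mapping.keys d \<subseteq> Ob C \<and> frag_extend (frag_of \<circ> G) d = 0"
        by (intro exI[of _ 0]) simp
    next
      fix x y assume "\<exists>d. Poly_Mapping.keys d \<subseteq> Ob C \<and> frag_extend (frag_of \<circ> G) d = x"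
        "\<exists>d. Poly_Mapping.keys d \<subseteq> Ob C \<and> frag_extend (frag_of \<circ> G) d = y"
      then obtain d e where "Poly_Mapping.keys d \<subseteq> Ob C" "frag_extend (frag_of \<circ> G) d = x"
        "Poly_Mapping.keys e \<subseteq> Ob C" "frag_extend (frag_of \<circ> G) e = y" by blast
      then show "\<exists>d. Poly_Mapping.keys d \<subseteq> Ob C \<and> frag_extend (frag_of \<circ> G) d = x - y"
        using keys_diff[of d e] by (intro exI[of _ "d - e"]) (auto simp: frag_extend_diff)
    next
      fix a assume "a \<in> G ` Ob C"
      then obtain A where "A \<in> Ob C" "a = G A" by blast
      then show "\<exists>d. Poly_Mapping.keys d \<subseteq> Ob C \<and> frag_extend (frag_of \<circ> G) d = frag_of a"
        by (intro exI[of _ "frag_of A"]) simp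
    qed
    then obtain d where d: "Poly_Mapping.keys d \<subseteq> Ob C" "frag_extend (frag_of \<circ> G) d = c" by blast
    have "K0_rels C #>\<^bsub>free_Abelian_group (Ob C)\<^esub> d \<in> carrier (K0 C)"
      using d(1) by (auto simp: K0_def FactGroup_def RCOSETS_def)
    moreover have "genus_hom R K C (K0_rels C #>\<^bsub>free_Abelian_group (Ob C)\<^esub> d) = V"
      using d c(2) by (subst genus_hom_coset) simp_all
    ultimately show "V \<in> genus_hom R K C ` carrier (K0 C)" by blast
  qed
qed

lemma K0_splits:
  "K0 C \<cong> (K0 C)\<lparr>carrier := kernel (K0 C) (K0G R K C) (genus_hom R K C)\<rparr> \<times>\<times> K0G R K C"
proof -
  interpret N: normal "K0G_rels R K C" FG by (rule K0G_rels_normal)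
  interpret F: comm_group "free_Abelian_group (Ob C)" by (rule abelian_free_Abelian_group)
  interpret FG: comm_group FG by (rule abelian_free_Abelian_group)
  \<comment> \<open>\<open>genus_invariant\<close> vanishes on the relations, so evaluating it at
    any representative of the coset gives the same value.\<close>
  define psi where "psi U = genus_invariant (SOME c. c \<in> U)" for U
  have psi: "psi (K0G_rels R K C #>\<^bsub>FG\<^esub> c) = genus_invariant c" for c
  proof -
    have "0 + c \<in> K0G_rels R K C #>\<^bsub>FG\<^esub> c" using K0G_rels_zero unfolding r_coset_def by fastforce
    then have "(SOME d. d \<in> K0G_rels R K C #>\<^bsub>FG\<^esub> c) \<in> K0G_rels R K C #>\<^bsub>FG\<^esub> c" by (rule someI)
    then obtain n where "n \<in> K0G_rels R K C" "(SOME d. d \<in> K0G_rels R K C #>\<^bsub>FG\<^esub> c) = n + c"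
      unfolding r_coset_def by auto
    then show ?thesis unfolding psi_def by (simp add: genus_invariant_add genus_invariant_rels)
  qed
  have coset: "\<exists>c. Poly_Mapping.keys c \<subseteq> G ` Ob C \<and> U = K0G_rels R K C #>\<^bsub>FG\<^esub> c"
    if U: "U \<in> carrier (K0G R K C)" for U
  proof -
    from U obtain c where "c \<in> carrier FG" "U = K0G_rels R K C #>\<^bsub>FG\<^esub> c"
      by (auto simp: K0G_def FactGroup_def RCOSETS_def)
    then show ?thesis by auto
  qed
  show ?thesis
  proof (rule epi_to_free_subgroup_splits)
    show "comm_group (K0 C)"
      unfolding K0_def by (rule F.abelian_FactGroup[OF normal_imp_subgroup[OF K0_rels_normal]])
    show "comm_group (K0G R K C)"
      unfolding K0G_def by (rule FG.abelian_FactGroup[OF N.subgroup_axioms])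
    show "genus_hom R K C \<in> hom (K0 C) (K0G R K C)" by (rule genus_hom_hom)
    show "genus_hom R K C ` carrier (K0 C) = carrier (K0G R K C)" by (rule genus_hom_surj)
    show "psi (U \<otimes>\<^bsub>K0G R K C\<^esub> V) = psi U + psi V"
      if U: "U \<in> carrier (K0G R K C)" and V: "V \<in> carrier (K0G R K C)" for U V
    proof -
      obtain c where c: "Poly_Mapping.keys c \<subseteq> G ` Ob C" "U = K0G_rels R K C #>\<^bsub>FG\<^esub> c"
        using coset[OF U] by blast
      obtain d where d: "Poly_Mapping.keys d \<subseteq> G ` Ob C" "V = K0G_rels R K C #>\<^bsub>FG\<^esub> d"
        using coset[OF V] by blast
      have "U \<otimes>\<^bsub>K0G R K C\<^esub> V = K0G_rels R K C #>\<^bsub>FG\<^esub> (c + d)"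
      proof -
        have "c \<in> carrier FG" "d \<in> carrier FG" using c(1) d(1) by simp_all
        from N.rcos_sum[OF this] show ?thesis
          unfolding c(2) d(2) K0G_def FactGroup_def mult_free_Abelian_group by simp
      qed
      then show ?thesis unfolding c(2) d(2) by (simp only: psi genus_invariant_add)
    qed
    show "inj_on psi (carrier (K0G R K C))"
    proof (rule inj_onI)
      fix U V assume U: "U \<in> carrier (K0G R K C)" and V: "V \<in> carrier (K0G R K C)" and eq: "psi U = psi V"
      obtain c where c: "Poly_Mapping.keys c \<subseteq> G ` Ob C" "U = K0G_rels R K C #>\<^bsub>FG\<^esub> c"
        using coset[OF U] by blast
      obtain d where d: "Poly_Mapping.keys d \<subseteq> G ` Ob C" "V = K0G_rels R K C #>\<^bsub>FG\<^esub> d"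
        using coset[OF V] by blast
      have "genus_invariant (c - d) = 0"
        using eq unfolding c(2) d(2) psi by (simp add: genus_invariant_diff)
      then have "c - d \<in> K0G_rels R K C" using order_trans[OF keys_diff Un_least[OF c(1) d(1)]]
        by (intro genus_invariant_kernel)
      then have "(c - d) + d \<in> K0G_rels R K C #>\<^bsub>FG\<^esub> d" unfolding r_coset_def by fastforce
      then have "K0G_rels R K C #>\<^bsub>FG\<^esub> d = K0G_rels R K C #>\<^bsub>FG\<^esub> c"
        using d(1) by (intro group.repr_independence[OF group_free_Abelian_group] N.subgroup_axioms) simp_all
      then show "U = V" unfolding c(2) d(2) by (rule sym)
    qed
  qed
qed

end

theorem corollary4p6:
  fixes R K :: "'k ring" and C :: "('k, 'o, 'm) rcat"
  assumes "fraction_field R K" and "dedekind_domain R K"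
    and "R_category R C" and "hom_finite R C" and "fully_additive C"
    and "max_condition R K C"
  shows "K0 C \<cong> (K0 C)\<lparr>carrier := kernel (K0 C) (K0G R K C) (genus_hom R K C)\<rparr>
                 \<times>\<times> K0G R K C"
proof -
  have "genus_setup R C K"
  proof (intro genus_setup.intro genus_setup_axioms.intro assms(1-4))
    show "additive C" using assms(5) unfolding fully_additive_def by blast
    show "\<exists>S\<in>Ob C. isomorphic (add_ext R K C) (ext_ob R K C S) W"
      if "indecomposable (add_ext R K C) W" for W
      using assms(6) that unfolding max_condition_def isomorphic_def by blast
  qed
  then show ?thesis by (rule genus_setup.K0_splits)
qed

end
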